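(* For every $\epsilon>0$ there exists $c=c(\epsilon)>0$ such that $\mathbb P(\sigma^{\Lambda_N,+}_o\neq\sigma^{\Lambda_N,-}_o)\leq c^{-1}e^{-cN}$ for all integers $N\geq1$.
   Context: Let $\{h_v:v\in\mathbb Z^2\}$ be i.i.d. Gaussian with mean zero and variance $\epsilon^2>0$, with law $\mathbb P$. Write $u\sim v$ if $|u-v|_1=1$; for $A\subset\mathbb Z^2$, $\partial A=\{v\in\mathbb Z^2\setminus A: u\sim v\text{ for some }u\in A\}$. $\Lambda_N=\{v\in\mathbb Z^2:|v|_\infty\le N\}$, $o$ is the origin. For $\sigma\in\{-1,1\}^{\Lambda_N}$, $H^{\Lambda_N,\pm}(\sigma)=-\big(\sum_{u\sim v,\,u,v\in\Lambda_N}\sigma_u\sigma_v\pm\sum_{u\sim v,\,u\in\Lambda_N,v\in\partial\Lambda_N}\sigma_u+\sum_{u\in\Lambda_N}\sigma_uh_u\big)$ (each unordered pair counted once). $\sigma^{\Lambda_N,+}$ (resp. $\sigma^{\Lambda_N,-}$) denotes the ground state, i.e. the minimizer of $H^{\Lambda_N,+}$ (resp. $H^{\Lambda_N,-}$), which is unique with probability 1. *)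

theory Defs
  imports "HOL-Probability.Probability"
begin

type_synonym site = "int \<times> int"

definition adj :: "site \<Rightarrow> site \<Rightarrow> bool" where
  "adj u v \<longleftrightarrow> \<bar>fst u - fst v\<bar> + \<bar>snd u - snd v\<bar> = 1"

definition bdry :: "site set \<Rightarrow> site set" where
  "bdry A = {v. v \<notin> A \<and> (\<exists>u\<in>A. adj u v)}"

definition Lambda :: "nat \<Rightarrow> site set" where
  "Lambda N = {v. \<bar>fst v\<bar> \<le> int N \<and> \<bar>snd v\<bar> \<le> int N}"

definition configs :: "nat \<Rightarrow> (site \<Rightarrow> real) set" where
  "configs N = {\<sigma>. (\<forall>v\<in>Lambda N. \<sigma> v = 1 \<or> \<sigma> v = -1) \<and> (\<forall>v. v \<notin> Lambda N \<longrightarrow> \<sigma> v = 0)}"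

text \<open>Hamiltonian with boundary sign s (s = 1 for plus, s = -1 for minus); unordered
  nearest-neighbour pairs are counted once as two-element sets.\<close>
definition H :: "nat \<Rightarrow> real \<Rightarrow> (site \<Rightarrow> real) \<Rightarrow> (site \<Rightarrow> real) \<Rightarrow> real" where
  "H N s h \<sigma> = - ((\<Sum>e\<in>{e. \<exists>u v. e = {u, v} \<and> u \<in> Lambda N \<and> v \<in> Lambda N \<and> adj u v}.
                       \<Prod>u\<in>e. \<sigma> u)
              + s * (\<Sum>p\<in>{(u, v). u \<in> Lambda N \<and> v \<in> bdry (Lambda N) \<and> adj u v}. \<sigma> (fst p))
              + (\<Sum>u\<in>Lambda N. \<sigma> u * h u))"

definition is_ground_state :: "nat \<Rightarrow> real \<Rightarrow> (site \<Rightarrow> real) \<Rightarrow> (site \<Rightarrow> real) \<Rightarrow> bool" where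
  "is_ground_state N s h \<sigma> \<longleftrightarrow> \<sigma> \<in> configs N \<and> (\<forall>\<tau>\<in>configs N. H N s h \<sigma> \<le> H N s h \<tau>)"

definition field_law :: "real \<Rightarrow> (site \<Rightarrow> real) measure" where
  "field_law eps = PiM UNIV (\<lambda>_. density lborel (normal_density 0 eps))"

end

theory Submission
  imports Defs
begin

text \<open>
  Encode the plus ground state by its set of minus spins and the minus ground state by its set of plus
  spins.  The disagreement set of a box shrinks when the box grows, and by an isoperimetric argument
  each of its points is joined to the boundary inside the set.

  (1) Shift the field on \<open>V\<close> by \<open>s\<close>.  Comparing energies across a set \<open>Z\<close> around \<open>V\<close> bounds the integral
  over \<open>s\<close> of the number of disagreements in \<open>V\<close> by the size of the cut of the disagreement set along
  the boundary of \<open>Z\<close>, and for a Gaussian field this integral controls the expected number itself up to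
  the factor \<open>eps * sqrt (2 * pi / card V)\<close>.

  (2) Long thin tubes are not crossed by disagreement with probability close to one: otherwise
  crossings for the fields \<open>h\<close> and \<open>h + 1/q\<close> enclose every block, the number of frozen disagreements in a
  block becomes a local variable, the isoperimetric inequality makes these numbers grow geometrically
  outwards, and independence of distant blocks contradicts such growth.

  (3) Hence nearly straight disagreement paths are rare, and a Peierls argument over scales shows that
  paths across distance \<open>n\<close> have length at least \<open>K n\<close> for every constant \<open>K\<close>.

  (4) Long paths provide many disjoint cuts, so by (1) the one-point disagreement probability \<open>m n\<close>
  satisfies \<open>m (31 n) \<le> \<eta> m n\<close> for every \<open>\<eta> > 0\<close> and large \<open>n\<close>.  Thus \<open>n\<^sup>2 m n\<close> becomes arbitrarily small along
  a subsequence, and a final Peierls argument at a fixed scale gives exponential decay.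
\<close>

section \<open>Ground states as minimisers over sets\<close>

text \<open>Dimension two is critical for the Imry-Ma balance: shifting the field on a box of side n
  by 1/n, the order at which its average fluctuates, changes the energy by order n, and n is also
  the length of the boundary. Cutting along concentric boxes thus only bounds
  \<open>marginal (31 * n)\<close> by C / eps times \<open>marginal n\<close>, which is useless for
  small eps. The missing factor comes from the geometry of disagreement paths: if they need K n
  steps to cover distance n, about K n disjoint cuts by graph distance fit into one annulus instead
  of n. A fixed gain is iterated to make K large: \<open>tortuous_step\<close> multiplies K by a
  factor that does not depend on K. That gain needs straight runs to be rare in every direction,
  hence crossings of tilted rectangles and a continuum crossing theorem; and it needs a tube bound
  uniform in the scale q, hence the field shift 1/q, whose Cameron-Martin cost on a box of side of
  order q is bounded. Finally the Peierls argument takes a union over the (2n+1)^2 sites of a block,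
  so the one-point probability must beat n^(-2), not merely tend to 0.\<close>

declare split_paired_All [simp del] split_paired_Ex [simp del] split_paired_all [simp del]

section \<open>Edge boundaries and their submodularity\<close>

definition per :: "site set \<Rightarrow> real" where
  "per A = real (card {(u, v). adj u v \<and> u \<in> A \<and> v \<notin> A})"

definition ecount :: "site set \<Rightarrow> site set \<Rightarrow> real" where
  "ecount C T = real (card {(u, v). adj u v \<and> u \<in> C \<and> v \<in> T})"

text \<open>Ordered pairs, so every undirected edge occurs twice. This is the source of the factors
  2 in \<open>ecount_sum\<close> and \<open>per_sum\<close>, and it reduces perimeter inequalities
  to a case check on a single edge.\<close>

definition touching :: "site set \<Rightarrow> (site \<times> site) set" where
  "touching W = {(u, v). adj u v \<and> (u \<in> W \<or> v \<in> W)}"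

lemma adj_sym: "adj u v \<longleftrightarrow> adj v u"
  by (auto simp: adj_def abs_minus_commute)

lemma adj_irrefl: "\<not> adj u u"
  by (auto simp: adj_def)

lemma adj_iff:
  "adj u v \<longleftrightarrow> v \<in> {(fst u + 1, snd u), (fst u - 1, snd u), (fst u, snd u + 1), (fst u, snd u - 1)}"
  by (cases u; cases v) (auto simp: adj_def)

lemma finite_nbrs: "finite {v. adj u v}"
  by (rule finite_subset[of _ "{(fst u + 1, snd u), (fst u - 1, snd u), (fst u, snd u + 1), (fst u, snd u - 1)}"])
    (auto simp: adj_iff)

lemma card_nbrs_le: "card {v. adj u v} \<le> 4"
proof -
  have "{v. adj u v} = {(fst u + 1, snd u), (fst u - 1, snd u), (fst u, snd u + 1), (fst u, snd u - 1)}"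
    by (auto simp: adj_iff)
  then show ?thesis by (simp add: card_insert_le_m1 card_insert_if)
qed

lemma finite_touching: "finite W \<Longrightarrow> finite (touching W)"
proof -
  assume W: "finite W"
  have "touching W \<subseteq> (\<Union>u\<in>W. ({u} \<times> {v. adj u v}) \<union> ({v. adj u v} \<times> {u}))"
    by (auto simp: touching_def adj_sym)
  moreover have "finite (\<Union>u\<in>W. ({u} \<times> {v. adj u v}) \<union> ({v. adj u v} \<times> {u}))"
    using W finite_nbrs by auto
  ultimately show ?thesis by (rule finite_subset)
qed

lemma card_as_sum:
  assumes "finite S" "{p. Q p} \<subseteq> S"
  shows "real (card {p. Q p}) = (\<Sum>p\<in>S. of_bool (Q p))"
proof -
  have "(\<Sum>p\<in>S. of_bool (Q p)) = real (card {p \<in> S. Q p})"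
    using assms(1) by (simp add: Int_def)
  also have "{p \<in> S. Q p} = {p. Q p}" using assms(2) by auto
  finally show ?thesis by simp
qed

lemma sum_touching_swap:
  "(\<Sum>(u, v)\<in>touching W. f u v) = (\<Sum>(u, v)\<in>touching W. (f v u :: real))"
  by (rule sum.reindex_bij_witness[of _ "\<lambda>(u, v). (v, u)" "\<lambda>(u, v). (v, u)"])
    (auto simp: touching_def adj_sym)

lemma ecount_sum:
  assumes "finite W" "C \<subseteq> W"
  shows "2 * ecount C T = (\<Sum>(u, v)\<in>touching W. of_bool (u \<in> C \<and> v \<in> T) + of_bool (v \<in> C \<and> u \<in> T))"
proof -
  have "ecount C T = (\<Sum>p\<in>touching W. of_bool (case p of (u, v) \<Rightarrow> adj u v \<and> u \<in> C \<and> v \<in> T))"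
    unfolding ecount_def using assms
    by (intro card_as_sum finite_touching) (auto simp: touching_def)
  also have "\<dots> = (\<Sum>(u, v)\<in>touching W. of_bool (u \<in> C \<and> v \<in> T))"
    by (intro sum.cong) (auto simp: touching_def)
  finally have 1: "ecount C T = \<dots>" .
  show ?thesis
    using 1 sum_touching_swap[of "\<lambda>u v. of_bool (u \<in> C \<and> v \<in> T)" W]
    by (simp add: sum.distrib case_prod_unfold)
qed

lemma per_eq_ecount: "per A = ecount A (- A)"
  by (simp add: per_def ecount_def)

lemma per_sum:
  assumes "finite W" "A \<subseteq> W"
  shows "2 * per A = (\<Sum>(u, v)\<in>touching W. of_bool ((u \<in> A) \<noteq> (v \<in> A)))"
  unfolding per_eq_ecount ecount_sum[OF assms]
  by (intro sum.cong) (auto simp: of_bool_def)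

text \<open>Holds edge by edge: the only edges counted on the right and lost on the left join
  \<open>A - B\<close> to \<open>B - A\<close>.\<close>

lemma per_submodular:
  assumes "finite A" "finite B"
  shows "per (A \<union> B) + per (A \<inter> B) \<le> per A + per B"
proof -
  let ?W = "A \<union> B"
  have W: "finite ?W" using assms by auto
  have "2 * per (A \<union> B) + 2 * per (A \<inter> B) \<le> 2 * per A + 2 * per B"
    unfolding per_sum[OF W, of "A \<union> B", simplified] per_sum[OF W, of "A \<inter> B", OF le_infI1, simplified]
      per_sum[OF W, of A, simplified] per_sum[OF W, of B, simplified] sum.distrib[symmetric]
    by (rule sum_mono, clarify, rename_tac a b c d,
        case_tac "(a, b) \<in> A"; case_tac "(c, d) \<in> A"; case_tac "(a, b) \<in> B"; case_tac "(c, d) \<in> B") simp_all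
  then show ?thesis by simp
qed

text \<open>This is submodularity for \<open>A\<close> and the complement of \<open>B\<close>, whose
  edge boundary has the same size as that of \<open>B\<close>; the form with differences keeps all
  sets finite.\<close>

lemma per_posimodular:
  assumes "finite A" "finite B"
  shows "per (A - B) + per (B - A) \<le> per A + per B"
proof -
  let ?W = "A \<union> B"
  have W: "finite ?W" using assms by auto
  have "2 * per (A - B) + 2 * per (B - A) \<le> 2 * per A + 2 * per B"
    unfolding per_sum[OF W, of "A - B", OF le_supI1[OF Diff_subset]] per_sum[OF W, of "B - A", OF le_supI2[OF Diff_subset]]
      per_sum[OF W, of A, simplified] per_sum[OF W, of B, simplified] sum.distrib[symmetric]
    by (rule sum_mono, clarify, rename_tac a b c d,
        case_tac "(a, b) \<in> A"; case_tac "(c, d) \<in> A"; case_tac "(a, b) \<in> B"; case_tac "(c, d) \<in> B") simp_all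
  then show ?thesis by simp
qed

lemma per_Un_separated:
  assumes "finite A" "finite B" "\<And>u v. u \<in> A \<Longrightarrow> v \<in> B \<Longrightarrow> \<not> adj u v" "A \<inter> B = {}"
  shows "per (A \<union> B) = per A + per B"
proof -
  let ?W = "A \<union> B"
  have W: "finite ?W" using assms by auto
  have "2 * per (A \<union> B) = 2 * per A + 2 * per B"
    unfolding per_sum[OF W order_refl] per_sum[OF W, of A, simplified] per_sum[OF W, of B, simplified] sum.distrib[symmetric]
  proof (rule sum.cong[OF refl], goal_cases)
    case (1 p)
    obtain a c where p: "p = (a, c)" by (cases p)
    have "adj a c" "adj c a" using 1 by (auto simp: touching_def adj_sym p)
    then have "\<not> (a \<in> A \<and> c \<in> B)" "\<not> (c \<in> A \<and> a \<in> B)" "\<not> (a \<in> A \<and> a \<in> B)" "\<not> (c \<in> A \<and> c \<in> B)"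
      using assms(3,4) by blast+
    then show ?case unfolding p
      by (cases "a \<in> A"; cases "c \<in> A"; cases "a \<in> B"; cases "c \<in> B") simp_all
  qed
  then show ?thesis by simp
qed

lemma per_empty [simp]: "per {} = 0"
  by (simp add: per_def)

lemma per_Un_le:
  assumes "finite A" "finite B" "A \<inter> B = {}"
  shows "per (A \<union> B) \<le> per A + per B"
  using per_submodular[OF assms(1,2)] assms(3) by simp

section \<open>Minimisers: lattice structure, monotonicity, restriction to subdomains\<close>

definition energy :: "(site \<Rightarrow> real) \<Rightarrow> site set \<Rightarrow> real" where
  "energy h A = per A + sum h A"

definition is_min :: "site set \<Rightarrow> (site \<Rightarrow> real) \<Rightarrow> site set \<Rightarrow> bool" where
  "is_min U h A \<longleftrightarrow> A \<subseteq> U \<and> (\<forall>A'\<subseteq>U. energy h A \<le> energy h A')"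

lemma is_minD: "is_min U h A \<Longrightarrow> A' \<subseteq> U \<Longrightarrow> energy h A \<le> energy h A'"
  by (auto simp: is_min_def)

lemma is_min_sub: "is_min U h A \<Longrightarrow> A \<subseteq> U"
  by (auto simp: is_min_def)

lemma is_minI: "A \<subseteq> U \<Longrightarrow> is_min U h B \<Longrightarrow> energy h A \<le> energy h B \<Longrightarrow> is_min U h A"
  by (auto simp: is_min_def intro: order_trans)

text \<open>Ties are broken towards few minus spins here and towards many plus spins in
  \<open>plus_set\<close>. Leastness yields the disjointness \<open>minus_plus_disjoint\<close>;
  greatestness of the other set yields the strict inequality in
  \<open>isoperimetric\<close>.\<close>

definition minus_set :: "site set \<Rightarrow> (site \<Rightarrow> real) \<Rightarrow> site set" where
  "minus_set U h = \<Inter>{A. is_min U h A}"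

text \<open>A global spin flip turns minus boundary conditions into plus ones and \<open>h\<close>
  into \<open>- h\<close>, so the plus spins of that ground state minimise the same functional for
  the negated field.\<close>

definition plus_set :: "site set \<Rightarrow> (site \<Rightarrow> real) \<Rightarrow> site set" where
  "plus_set U h = \<Union>{A. is_min U (\<lambda>v. - h v) A}"

definition disagree :: "site set \<Rightarrow> (site \<Rightarrow> real) \<Rightarrow> site set" where
  "disagree U h = U - minus_set U h - plus_set U h"

lemma energy_submodular:
  assumes "finite A" "finite B"
  shows "energy h (A \<union> B) + energy h (A \<inter> B) \<le> energy h A + energy h B"
  using per_submodular[OF assms] sum.union_inter[OF assms, of h] by (simp add: energy_def)

lemma is_min_exists: assumes "finite U" shows "\<exists>A. is_min U h A"
proof -
  obtain A where "A \<in> Pow U" "\<And>A'. A' \<in> Pow U \<Longrightarrow> energy h A \<le> energy h A'"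
    using ex_is_arg_min_if_finite[of "Pow U" "energy h"] assms
    by (auto simp: is_arg_min_linorder)
  then show ?thesis by (auto simp: is_min_def)
qed

lemma is_min_lattice:
  assumes "finite U" "is_min U h A" "is_min U h B"
  shows "is_min U h (A \<inter> B)" "is_min U h (A \<union> B)"
proof -
  have sub: "A \<subseteq> U" "B \<subseteq> U" using assms by (auto simp: is_min_def)
  then have fin: "finite A" "finite B" using assms(1) finite_subset by auto
  have "energy h A \<le> energy h (A \<union> B)" "energy h B \<le> energy h (A \<inter> B)"
    "energy h A \<le> energy h (A \<inter> B)" "energy h B \<le> energy h (A \<union> B)"
    using sub by (auto intro!: is_minD[OF assms(2)] is_minD[OF assms(3)])
  with energy_submodular[OF fin, of h] have
    "energy h (A \<inter> B) = energy h A" "energy h (A \<union> B) = energy h A" by linarith+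
  with assms sub show "is_min U h (A \<inter> B)" "is_min U h (A \<union> B)"
    by (auto simp: is_min_def)
qed

lemma is_min_minus_set: assumes "finite U" shows "is_min U h (minus_set U h)"
proof -
  let ?F = "{A. is_min U h A}"
  have "?F \<subseteq> Pow U" by (auto simp: is_min_def)
  then have fin: "finite ?F" using assms by (meson finite_Pow_iff finite_subset)
  have ne: "?F \<noteq> {}" using is_min_exists[OF assms] by auto
  have "\<And>G. finite G \<Longrightarrow> G \<noteq> {} \<Longrightarrow> G \<subseteq> ?F \<Longrightarrow> is_min U h (\<Inter>G)"
  proof -
    fix G show "finite G \<Longrightarrow> G \<noteq> {} \<Longrightarrow> G \<subseteq> ?F \<Longrightarrow> is_min U h (\<Inter>G)"
      by (induction G rule: finite_ne_induct) (auto intro: is_min_lattice[OF assms])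
  qed
  then show ?thesis using fin ne by (simp add: minus_set_def)
qed

lemma is_min_plus_set: assumes "finite U" shows "is_min U (\<lambda>v. - h v) (plus_set U h)"
proof -
  let ?F = "{A. is_min U (\<lambda>v. - h v) A}"
  have "?F \<subseteq> Pow U" by (auto simp: is_min_def)
  then have fin: "finite ?F" using assms by (meson finite_Pow_iff finite_subset)
  have ne: "?F \<noteq> {}" using is_min_exists[OF assms] by auto
  have "\<And>G. finite G \<Longrightarrow> G \<noteq> {} \<Longrightarrow> G \<subseteq> ?F \<Longrightarrow> is_min U (\<lambda>v. - h v) (\<Union>G)"
  proof -
    fix G show "finite G \<Longrightarrow> G \<noteq> {} \<Longrightarrow> G \<subseteq> ?F \<Longrightarrow> is_min U (\<lambda>v. - h v) (\<Union>G)"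
      by (induction G rule: finite_ne_induct) (auto intro: is_min_lattice[OF assms])
  qed
  then show ?thesis using fin ne by (simp add: plus_set_def)
qed

lemma minus_set_least: "is_min U h A \<Longrightarrow> minus_set U h \<subseteq> A"
  by (auto simp: minus_set_def)

lemma plus_set_greatest: "is_min U (\<lambda>v. - h v) A \<Longrightarrow> A \<subseteq> plus_set U h"
  by (auto simp: plus_set_def)

lemma minus_set_subset: "finite U \<Longrightarrow> minus_set U h \<subseteq> U"
  using is_min_minus_set by (auto simp: is_min_def)

lemma plus_set_subset: "plus_set U h \<subseteq> U"
  by (auto simp: plus_set_def is_min_def)

text \<open>\<open>A \<inter> C\<close> competes with \<open>A\<close> in \<open>U\<close>, and
  \<open>A \<union> C\<close> competes with \<open>C\<close> in \<open>W\<close>. Submodularity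
  together with \<open>h' \<le> h\<close> on \<open>A - C\<close> leaves no room for a loss, so both
  competitors are minimisers. Enlarging the domain and lowering the field are handled at
  once.\<close>

lemma is_min_compare:
  assumes "finite W" "U \<subseteq> W" "is_min U h A" "is_min W h' C" "\<And>v. v \<in> U \<Longrightarrow> h' v \<le> h v"
  shows "is_min U h (A \<inter> C)" "is_min W h' (A \<union> C)"
proof -
  have sub: "A \<subseteq> U" "C \<subseteq> W" using assms by (auto simp: is_min_def)
  then have fin: "finite A" "finite C" using assms(1,2) by (meson finite_subset subset_trans)+
  have i: "energy h A \<le> energy h (A \<inter> C)" "energy h' C \<le> energy h' (A \<union> C)"
    using sub assms(2) by (auto intro!: is_minD[OF assms(3)] is_minD[OF assms(4)])
  have "sum h' (A - C) \<le> sum h (A - C)" using sub assms(5) by (intro sum_mono) auto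
  moreover have "sum h A = sum h (A \<inter> C) + sum h (A - C)"
    using fin by (metis sum.Int_Diff)
  moreover have "sum h' (A \<union> C) = sum h' C + sum h' (A - C)"
    using fin by (metis Un_Diff_cancel Un_commute finite_Diff sum.union_disjoint Diff_disjoint)
  ultimately have "energy h (A \<inter> C) + energy h' (A \<union> C) \<le> energy h A + energy h' C"
    using per_submodular[OF fin] by (simp add: energy_def)
  with i have "energy h (A \<inter> C) = energy h A" "energy h' (A \<union> C) = energy h' C" by linarith+
  then show "is_min U h (A \<inter> C)" "is_min W h' (A \<union> C)"
    using assms(2,3,4) by (auto simp: is_min_def)
qed

lemma minus_set_mono:
  assumes "finite W" "U \<subseteq> W" "\<And>v. v \<in> U \<Longrightarrow> h' v \<le> h v"
  shows "minus_set U h \<subseteq> minus_set W h'"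
proof -
  have "is_min U h (minus_set U h \<inter> minus_set W h')"
    by (rule is_min_compare(1)[OF assms(1,2) is_min_minus_set is_min_minus_set[OF assms(1)]])
      (use assms in \<open>auto intro: finite_subset\<close>)
  from minus_set_least[OF this] show ?thesis by blast
qed

lemma plus_set_mono:
  assumes "finite W" "U \<subseteq> W" "\<And>v. v \<in> U \<Longrightarrow> h v \<le> h' v"
  shows "plus_set U h \<subseteq> plus_set W h'"
proof -
  have "is_min W (\<lambda>v. - h' v) (plus_set U h \<union> plus_set W h')"
    by (rule is_min_compare(2)[OF assms(1,2) is_min_plus_set is_min_plus_set[OF assms(1)]])
      (use assms in \<open>auto intro: finite_subset\<close>)
  from plus_set_greatest[OF this] show ?thesis by blast
qed

lemma disagree_antimono:
  assumes "finite W" "U \<subseteq> W" "v \<in> U" "v \<in> disagree W h"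
  shows "v \<in> disagree U h"
  using assms minus_set_mono[of W U h h] plus_set_mono[of W U h h] by (auto simp: disagree_def)

text \<open>When \<open>A\<close> avoids the sites of \<open>W\<close> just outside
  \<open>U\<close>, no edge joins \<open>A \<inter> U\<close> to \<open>A - U\<close>, so the energy
  splits into two independent parts. The surroundings then act on \<open>U\<close> like its own
  boundary condition.\<close>

lemma is_min_restrict:
  assumes "finite W" "U \<subseteq> W" "is_min W h A"
    and sep: "\<And>u v. u \<in> U \<Longrightarrow> v \<in> W - U \<Longrightarrow> adj u v \<Longrightarrow> v \<notin> A"
  shows "is_min U h (A \<inter> U)"
  unfolding is_min_def
proof (intro conjI allI impI)
  fix C assume C: "C \<subseteq> U"
  have sub: "A \<subseteq> W" using assms by (auto simp: is_min_def)
  have fin: "finite (A \<inter> U)" "finite (A - U)" "finite C"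
    using sub C assms(1,2) by (meson finite_subset finite_Int finite_Diff subset_trans)+
  have "energy h A \<le> energy h (C \<union> (A - U))"
    using assms(2) sub C by (auto intro!: is_minD[OF assms(3)])
  also have "\<dots> \<le> energy h C + energy h (A - U)"
  proof -
    have "C \<inter> (A - U) = {}" using C by auto
    then show ?thesis using per_Un_le[OF fin(3,2)] fin by (simp add: energy_def sum.union_disjoint)
  qed
  finally have 1: "energy h A \<le> energy h C + energy h (A - U)" .
  have "per A = per (A \<inter> U) + per (A - U)"
  proof -
    have "(A \<inter> U) \<union> (A - U) = A" by blast
    moreover have "\<not> adj u v" if "u \<in> A \<inter> U" "v \<in> A - U" for u v
      using sep[of u v] that sub by auto
    ultimately show ?thesis using per_Un_separated[OF fin(1,2)] by auto
  qed
  moreover have "sum h A = sum h (A \<inter> U) + sum h (A - U)"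
    using sub(1) assms(1) by (metis finite_subset sum.Int_Diff)
  ultimately show "energy h (A \<inter> U) \<le> energy h C" using 1 by (simp add: energy_def)
qed auto


lemma is_min_glue:
  assumes "finite W" "U \<subseteq> W" "is_min W h A" "is_min U h C"
    and sep: "\<And>u v. u \<in> U \<Longrightarrow> v \<in> W - U \<Longrightarrow> adj u v \<Longrightarrow> v \<notin> A"
  shows "is_min W h (C \<union> (A - U))"
proof -
  have sub: "A \<subseteq> W" "C \<subseteq> U" using assms by (auto simp: is_min_def)
  have fin: "finite (A \<inter> U)" "finite (A - U)" "finite C"
    using sub assms(1,2) by (meson finite_subset finite_Int finite_Diff subset_trans)+
  have "energy h (C \<union> (A - U)) \<le> energy h C + energy h (A - U)"
  proof -
    have "C \<inter> (A - U) = {}" using sub by auto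
    then show ?thesis using per_Un_le[OF fin(3,2)] fin by (simp add: energy_def sum.union_disjoint)
  qed
  also have "\<dots> \<le> energy h (A \<inter> U) + energy h (A - U)"
    using is_minD[OF assms(4), of "A \<inter> U"] by simp
  also have "\<dots> = energy h A"
  proof -
    have "(A \<inter> U) \<union> (A - U) = A" by blast
    moreover have "\<not> adj u v" if "u \<in> A \<inter> U" "v \<in> A - U" for u v
      using sep[of u v] that sub by auto
    ultimately have "per A = per (A \<inter> U) + per (A - U)"
      using per_Un_separated[OF fin(1,2)] by auto
    moreover have "sum h A = sum h (A \<inter> U) + sum h (A - U)"
      using sub(1) assms(1) by (metis finite_subset sum.Int_Diff)
    ultimately show ?thesis by (simp add: energy_def)
  qed
  finally have 1: "energy h (C \<union> (A - U)) \<le> energy h A" .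
  show ?thesis using 1 sub assms(2) by (intro is_minI[OF _ assms(3)]) auto
qed

text \<open>One inclusion is monotonicity in the domain. For the other, the least minimiser is
  attacked by gluing \<open>minus_set U h\<close> into \<open>W\<close>; for the greatest one, in
  \<open>plus_set_restrict\<close>, the minimiser of \<open>W\<close> is restricted to
  \<open>U\<close> instead.\<close>

lemma minus_set_restrict:
  assumes "finite W" "U \<subseteq> W"
    and "\<And>u v. u \<in> U \<Longrightarrow> v \<in> W - U \<Longrightarrow> adj u v \<Longrightarrow> v \<notin> minus_set W h"
  shows "minus_set W h \<inter> U = minus_set U h"
proof
  have fU: "finite U" using assms finite_subset by blast
  show "minus_set U h \<subseteq> minus_set W h \<inter> U"
    using minus_set_mono[OF assms(1,2), of h h] minus_set_subset[OF fU] by auto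
  have "is_min W h (minus_set U h \<union> (minus_set W h - U))"
    by (rule is_min_glue[OF assms(1,2) is_min_minus_set[OF assms(1)] is_min_minus_set[OF fU]])
      (use assms(3) in blast)
  from minus_set_least[OF this]
  show "minus_set W h \<inter> U \<subseteq> minus_set U h" by blast
qed

lemma plus_set_restrict:
  assumes "finite W" "U \<subseteq> W"
    and "\<And>u v. u \<in> U \<Longrightarrow> v \<in> W - U \<Longrightarrow> adj u v \<Longrightarrow> v \<notin> plus_set W h"
  shows "plus_set W h \<inter> U = plus_set U h"
proof
  show "plus_set U h \<subseteq> plus_set W h \<inter> U"
    using plus_set_mono[OF assms(1,2), of h h] plus_set_subset by auto
  have "is_min U (\<lambda>v. - h v) (plus_set W h \<inter> U)"
    by (rule is_min_restrict[OF assms(1,2) is_min_plus_set[OF assms(1)]]) (use assms(3) in blast)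
  from plus_set_greatest[OF this]
  show "plus_set W h \<inter> U \<subseteq> plus_set U h" by blast
qed

text \<open>Deleting the overlap from both sets cancels the field terms and by posimodularity does
  not increase the total energy. So \<open>minus_set U h - plus_set U h\<close> is again a
  minimiser, and leastness leaves no overlap.\<close>

lemma minus_plus_disjoint:
  assumes "finite U" shows "minus_set U h \<inter> plus_set U h = {}"
proof -
  let ?X = "minus_set U h" and ?Y = "plus_set U h"
  have sub: "?X \<subseteq> U" "?Y \<subseteq> U" using assms minus_set_subset plus_set_subset by auto
  then have fin: "finite ?X" "finite ?Y" using assms by (auto intro: finite_subset)
  have "energy (\<lambda>v. - h v) ?Y \<le> energy (\<lambda>v. - h v) (?Y - ?X)"
    using sub by (intro is_minD[OF is_min_plus_set[OF assms, of h]]) auto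
  moreover have "sum h ?X = sum h (?X \<inter> ?Y) + sum h (?X - ?Y)" "sum h ?Y = sum h (?X \<inter> ?Y) + sum h (?Y - ?X)"
    using fin by (metis sum.Int_Diff, metis sum.Int_Diff Int_commute)
  ultimately have "energy h (?X - ?Y) \<le> energy h ?X"
    using per_posimodular[OF fin] by (simp add: energy_def sum_negf)
  then have "is_min U h (?X - ?Y)"
    using sub by (intro is_minI[OF _ is_min_minus_set[OF assms, of h]]) auto
  from minus_set_least[OF this] show ?thesis by blast
qed

text \<open>The comparison behind the Imry--Ma argument: turning \<open>C\<close> over in both ground states costs
  only the edges which leave \<open>C\<close> towards other sites of disagreement, since at all other boundary
  edges the two changes cancel.\<close>

lemma per_flip_both:
  assumes "finite X" "finite Y" "finite C" "C \<inter> X = {}" "C \<inter> Y = {}"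
  shows "per (X \<union> C) + per (Y \<union> C) \<le> per X + per Y + 2 * ecount C (- (C \<union> X \<union> Y))"
proof -
  let ?W = "X \<union> Y \<union> C"
  have W: "finite ?W" using assms by auto
  have s: "X \<union> C \<subseteq> ?W" "Y \<union> C \<subseteq> ?W" "X \<subseteq> ?W" "Y \<subseteq> ?W" "C \<subseteq> ?W" by auto
  have "2 * per (X \<union> C) + 2 * per (Y \<union> C) \<le> 2 * per X + 2 * per Y + 2 * (2 * ecount C (- (C \<union> X \<union> Y)))"
    unfolding per_sum[OF W s(1)] per_sum[OF W s(2)] per_sum[OF W s(3)] per_sum[OF W s(4)]
      ecount_sum[OF W s(5)] sum.distrib[symmetric] sum_distrib_left
  proof (rule sum_mono, clarify, goal_cases)
    case (1 a b c d)
    have "(x, y) \<in> C \<Longrightarrow> (x, y) \<notin> X \<and> (x, y) \<notin> Y" for x y using assms(4,5) by auto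
    then show ?case
      by (cases "(a, b) \<in> X"; cases "(c, d) \<in> X"; cases "(a, b) \<in> Y"; cases "(c, d) \<in> Y";
          cases "(a, b) \<in> C"; cases "(c, d) \<in> C") simp_all
  qed
  then show ?thesis by simp
qed

text \<open>Turning \<open>C\<close> over costs energy in both ground states. Adding the two costs,
  the field contributes \<open>- d * real (card C)\<close>, which the cut has to pay for. With
  \<open>d = 0\<close> this says that disagreement is connected to the outside; with
  \<open>d = 1 / q\<close> it forces exponential growth of sets that disagree for both
  fields.\<close>

lemma isoperimetric:
  assumes U: "finite U" and C: "C \<subseteq> U - minus_set U h - plus_set U h'" "C \<noteq> {}"
    and hh: "\<And>v. v \<in> C \<Longrightarrow> h' v = h v + d"
  shows "d * real (card C) < 2 * ecount C (- (C \<union> minus_set U h \<union> plus_set U h'))"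
proof -
  let ?X = "minus_set U h" and ?Y = "plus_set U h'"
  have sub: "?X \<subseteq> U" "?Y \<subseteq> U" "C \<subseteq> U" using U C minus_set_subset plus_set_subset by auto
  then have fin: "finite ?X" "finite ?Y" "finite C" using U by (auto intro: finite_subset)
  have disj: "C \<inter> ?X = {}" "C \<inter> ?Y = {}" using C by auto
  have 1: "energy h ?X \<le> energy h (?X \<union> C)"
    using sub by (intro is_minD[OF is_min_minus_set[OF U, of h]]) auto
  have 2: "energy (\<lambda>v. - h' v) ?Y < energy (\<lambda>v. - h' v) (?Y \<union> C)"
  proof (rule ccontr)
    assume "\<not> ?thesis"
    then have "is_min U (\<lambda>v. - h' v) (?Y \<union> C)"
      using sub by (intro is_minI[OF _ is_min_plus_set[OF U, of h']]) auto
    from plus_set_greatest[OF this] C show False by blast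
  qed
  have "sum h (?X \<union> C) = sum h ?X + sum h C" "sum h' (?Y \<union> C) = sum h' ?Y + sum h' C"
    using fin disj by (simp_all add: sum.union_disjoint Int_commute)
  moreover have "sum h' C = sum h C + d * real (card C)"
    using hh by (simp add: sum.distrib)
  ultimately have "d * real (card C) < per (?X \<union> C) + per (?Y \<union> C) - per ?X - per ?Y"
    using 1 2 by (simp add: energy_def sum_negf)
  with per_flip_both[OF fin disj] show ?thesis by simp
qed

text \<open>\<open>A\<close> stands for the minus spins of one configuration and \<open>B\<close>
  for the plus spins of the other; the new sets arise by exchanging the two configurations inside
  \<open>Z\<close>. Edges within \<open>Z\<close> or outside it keep their total cost, and across
  the boundary of \<open>Z\<close> only an edge with both ends in neither \<open>A\<close> nor
  \<open>B\<close> becomes more expensive, by 2.\<close>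

lemma per_swap:
  assumes "finite W" "A \<subseteq> W" "B \<subseteq> W" "Z \<subseteq> W" "A \<inter> B = {}"
  shows "per ((A - Z) \<union> (Z - B)) + per ((B - Z) \<union> (Z - A))
    \<le> per A + per B + 2 * ecount (Z - A - B) (- (A \<union> B \<union> Z))"
proof -
  have W: "finite W" by fact
  have s: "(A - Z) \<union> (Z - B) \<subseteq> W" "(B - Z) \<union> (Z - A) \<subseteq> W" "Z - A - B \<subseteq> W" using assms by auto
  have "2 * per ((A - Z) \<union> (Z - B)) + 2 * per ((B - Z) \<union> (Z - A))
    \<le> 2 * per A + 2 * per B + 2 * (2 * ecount (Z - A - B) (- (A \<union> B \<union> Z)))"
    unfolding per_sum[OF W s(1)] per_sum[OF W s(2)] per_sum[OF W assms(2)] per_sum[OF W assms(3)]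
      ecount_sum[OF W s(3)] sum.distrib[symmetric] sum_distrib_left
  proof (rule sum_mono, clarify, goal_cases)
    case (1 a b c d)
    have "(x, y) \<in> A \<Longrightarrow> (x, y) \<notin> B" for x y using assms(5) by auto
    then show ?case
      by (cases "(a, b) \<in> A"; cases "(c, d) \<in> A"; cases "(a, b) \<in> B"; cases "(c, d) \<in> B";
          cases "(a, b) \<in> Z"; cases "(c, d) \<in> Z") simp_all
  qed
  then show ?thesis by simp
qed

definition ground_energy :: "site set \<Rightarrow> (site \<Rightarrow> real) \<Rightarrow> real" where
  "ground_energy U h = energy h (minus_set U h)"

lemma ground_energy_le: "finite U \<Longrightarrow> A \<subseteq> U \<Longrightarrow> ground_energy U h \<le> energy h A"
  using is_min_minus_set[of U h] by (auto simp: ground_energy_def is_min_def)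

lemma ground_energy_is_min: "finite U \<Longrightarrow> is_min U h A \<Longrightarrow> energy h A = ground_energy U h"
  using is_min_minus_set[of U h] by (auto simp: ground_energy_def is_min_def intro: antisym)

definition shift_on :: "site set \<Rightarrow> real \<Rightarrow> (site \<Rightarrow> real) \<Rightarrow> site \<Rightarrow> real" where
  "shift_on V s h = (\<lambda>v. h v + s * of_bool (v \<in> V))"

lemma sum_shift_on:
  "finite A \<Longrightarrow> sum (shift_on V s h) A = sum h A + s * real (card (A \<inter> V))"
  by (simp add: shift_on_def sum.distrib sum_distrib_left[symmetric] Int_def)

text \<open>The minus set is taken at the larger shift and the plus set at the smaller one; after
  the exchange on \<open>Z\<close> each is tested against the other field. Because
  \<open>V \<subseteq> Z\<close>, the exchanged field terms differ by exactly
  \<open>(s2 - s1) * real (card V)\<close>.\<close>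

lemma swap_inequality:
  assumes W: "finite W" and V: "V \<subseteq> Z" "Z \<subseteq> W" and s: "s1 \<le> s2"
    and h1: "h1 = shift_on V s1 h" and h2: "h2 = shift_on V s2 h"
  shows "(s2 - s1) * real (card V) + ground_energy W h1 + ground_energy W (\<lambda>v. - h2 v)
    \<le> ground_energy W h2 + ground_energy W (\<lambda>v. - h1 v)
      + 2 * ecount (Z - minus_set W h2 - plus_set W h1) (- (minus_set W h2 \<union> plus_set W h1 \<union> Z))"
proof -
  define A where "A = minus_set W h2"
  define B where "B = plus_set W h1"
  have sub: "A \<subseteq> W" "B \<subseteq> W" using W minus_set_subset plus_set_subset by (auto simp: A_def B_def)
  have fin: "finite A" "finite B" "finite Z" "finite V" using sub W V by (meson finite_subset)+
  have le: "h1 v \<le> h2 v" for v using s by (auto simp: h1 h2 shift_on_def)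
  have "A \<subseteq> minus_set W h1" unfolding A_def by (rule minus_set_mono) (use W le in auto)
  then have disj: "A \<inter> B = {}" using minus_plus_disjoint[OF W, of h1] by (auto simp: B_def)
  define A' where "A' = (A - Z) \<union> (Z - B)"
  define B' where "B' = (B - Z) \<union> (Z - A)"
  have sub': "A' \<subseteq> W" "B' \<subseteq> W" using sub V by (auto simp: A'_def B'_def)
  have E: "ground_energy W h1 \<le> energy h1 A'" "ground_energy W (\<lambda>v. - h2 v) \<le> energy (\<lambda>v. - h2 v) B'"
    "energy h2 A = ground_energy W h2" "energy (\<lambda>v. - h1 v) B = ground_energy W (\<lambda>v. - h1 v)"
    using ground_energy_le[OF W] sub' ground_energy_is_min[OF W] is_min_minus_set[OF W] is_min_plus_set[OF W]
    by (auto simp: A_def B_def)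
  have o: "h1 v = h2 v" if "v \<notin> Z" for v using that V by (auto simp: h1 h2 shift_on_def)
  have "sum h1 A' = sum h1 (A - Z) + sum h1 (Z - B)" "sum h2 B' = sum h2 (B - Z) + sum h2 (Z - A)"
    unfolding A'_def B'_def using fin by (auto intro!: sum.union_disjoint)
  moreover have "sum h1 (A - Z) = sum h2 (A - Z)" "sum h1 (B - Z) = sum h2 (B - Z)"
    using o by (auto intro: sum.cong)
  moreover have "sum h1 Z = sum h1 (Z \<inter> B) + sum h1 (Z - B)" "sum h2 Z = sum h2 (Z \<inter> A) + sum h2 (Z - A)"
    "sum h2 A = sum h2 (A \<inter> Z) + sum h2 (A - Z)" "sum h1 B = sum h1 (B \<inter> Z) + sum h1 (B - Z)"
    using fin by (simp_all only: sum.Int_Diff)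
  moreover have "sum h2 Z = sum h1 Z + (s2 - s1) * real (card V)"
    using fin V(1) by (simp add: h1 h2 sum_shift_on Int_absorb1 algebra_simps)
  ultimately have "sum h1 A' - sum h2 B' = sum h2 A - sum h1 B - (s2 - s1) * real (card V)"
    by (simp add: Int_commute)
  then show ?thesis
    using E per_swap[OF W sub V(2) disj] unfolding energy_def A_def[symmetric] B_def[symmetric]
      A'_def[symmetric] B'_def[symmetric] by (simp add: sum_negf)
qed

text \<open>Envelope estimates: the minimiser at one shift is a competitor at the other. Both ground
  energies are concave in the shift, with slopes given by the numbers of minus, respectively
  (negated) plus, spins in \<open>V\<close>.\<close>

lemma ground_energy_shift:
  assumes W: "finite W" and V: "V \<subseteq> W" and s: "s \<le> t"
  shows "(t - s) * real (card (minus_set W (shift_on V t h) \<inter> V))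
      \<le> ground_energy W (shift_on V t h) - ground_energy W (shift_on V s h)"
    and "(t - s) * real (card (plus_set W (shift_on V s h) \<inter> V))
      \<le> ground_energy W (\<lambda>v. - shift_on V s h v) - ground_energy W (\<lambda>v. - shift_on V t h v)"
    and "ground_energy W (shift_on V t h) - ground_energy W (shift_on V s h)
      \<le> (t - s) * real (card (minus_set W (shift_on V s h) \<inter> V))"
    and "ground_energy W (\<lambda>v. - shift_on V s h v) - ground_energy W (\<lambda>v. - shift_on V t h v)
      \<le> (t - s) * real (card (plus_set W (shift_on V t h) \<inter> V))"
proof -
  have e1: "energy (shift_on V a h) A = energy (shift_on V b h) A + (a - b) * real (card (A \<inter> V))"
    if "A \<subseteq> W" for a b A
    using finite_subset[OF that W] by (simp add: energy_def sum_shift_on algebra_simps)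
  have e2: "energy (\<lambda>v. - shift_on V a h v) A = energy (\<lambda>v. - shift_on V b h v) A - (a - b) * real (card (A \<inter> V))"
    if "A \<subseteq> W" for a b A
    using finite_subset[OF that W] by (simp add: energy_def sum_negf sum_shift_on algebra_simps)
  have m: "energy (shift_on V a h) (minus_set W (shift_on V a h)) = ground_energy W (shift_on V a h)"
    "energy (\<lambda>v. - shift_on V a h v) (plus_set W (shift_on V a h)) = ground_energy W (\<lambda>v. - shift_on V a h v)" for a
    by (simp_all add: ground_energy_def ground_energy_is_min[OF W is_min_plus_set[OF W], unfolded ground_energy_def])
  note l = ground_energy_le[OF W]
  note sx = minus_set_subset[OF W] and sy = plus_set_subset
  show "(t - s) * real (card (minus_set W (shift_on V t h) \<inter> V))
      \<le> ground_energy W (shift_on V t h) - ground_energy W (shift_on V s h)"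
    using l[OF sx, of "shift_on V s h" "shift_on V t h"] e1[OF sx, of t "shift_on V t h" s] m(1)[of t] by (simp add: algebra_simps)
  show "ground_energy W (shift_on V t h) - ground_energy W (shift_on V s h)
      \<le> (t - s) * real (card (minus_set W (shift_on V s h) \<inter> V))"
    using l[OF sx, of "shift_on V t h" "shift_on V s h"] e1[OF sx, of t "shift_on V s h" s] m(1)[of s] by (simp add: algebra_simps)
  show "(t - s) * real (card (plus_set W (shift_on V s h) \<inter> V))
      \<le> ground_energy W (\<lambda>v. - shift_on V s h v) - ground_energy W (\<lambda>v. - shift_on V t h v)"
    using l[OF sy, of "\<lambda>v. - shift_on V t h v" "shift_on V s h"] e2[OF sy, of t "shift_on V s h" s] m(2)[of s] by (simp add: algebra_simps)
  show "ground_energy W (\<lambda>v. - shift_on V s h v) - ground_energy W (\<lambda>v. - shift_on V t h v)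
      \<le> (t - s) * real (card (plus_set W (shift_on V t h) \<inter> V))"
    using l[OF sy, of "\<lambda>v. - shift_on V s h v" "shift_on V t h"] e2[OF sy, of t "shift_on V t h" s] m(2)[of t] by (simp add: algebra_simps)
qed

section \<open>Locality, lattice symmetries and walks of disagreement\<close>

lemma is_min_cong:
  assumes "\<And>v. v \<in> U \<Longrightarrow> h v = h' v" shows "is_min U h A \<longleftrightarrow> is_min U h' A"
proof -
  have "energy h B = energy h' B" if "B \<subseteq> U" for B
    using assms that by (auto simp: energy_def intro!: sum.cong)
  then show ?thesis by (auto simp: is_min_def)
qed

lemma sets_cong:
  assumes "\<And>v. v \<in> U \<Longrightarrow> h v = h' v"
  shows "minus_set U h = minus_set U h'" "plus_set U h = plus_set U h'" "disagree U h = disagree U h'"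
proof -
  show 1: "minus_set U h = minus_set U h'" unfolding minus_set_def using assms
    by (intro arg_cong[of _ _ "\<lambda>F. \<Inter>F"] Collect_cong is_min_cong)
  show 2: "plus_set U h = plus_set U h'"
    unfolding plus_set_def using assms by (intro arg_cong[of _ _ "\<lambda>F. \<Union>F"] Collect_cong is_min_cong) auto
  show "disagree U h = disagree U h'" by (simp add: disagree_def 1 2)
qed

definition lattice_iso :: "(site \<Rightarrow> site) \<Rightarrow> bool" where
  "lattice_iso T \<longleftrightarrow> bij T \<and> (\<forall>u v. adj (T u) (T v) \<longleftrightarrow> adj u v)"

lemma is_min_iso:
  assumes T: "lattice_iso T" shows "is_min (T ` U) h (T ` A) \<longleftrightarrow> is_min U (h \<circ> T) A"
proof -
  have b: "bij T" "inj T" using T by (auto simp: lattice_iso_def bij_def)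
  have p: "per (T ` B) = per B" for B
  proof -
    have "{(u, v). adj u v \<and> u \<in> T ` B \<and> v \<notin> T ` B} = map_prod T T ` {(u, v). adj u v \<and> u \<in> B \<and> v \<notin> B}"
      (is "?L = ?R")
    proof
      show "?R \<subseteq> ?L"
      proof
        fix p assume "p \<in> ?R"
        then obtain a c where "p = (T a, T c)" "adj a c" "a \<in> B" "c \<notin> B" by auto
        then show "p \<in> ?L" using T[unfolded lattice_iso_def, THEN conjunct2, rule_format, of a c] b by (simp add: inj_image_mem_iff)
      qed
      show "?L \<subseteq> ?R"
      proof
        fix p assume "p \<in> ?L"
        then obtain u v where p: "p = (u, v)" "adj u v" "u \<in> T ` B" "v \<notin> T ` B" by blast
        obtain v' where v: "v = T v'" using surjD[OF bij_is_surj[OF b(1)]] by blast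
        obtain u' where u: "u = T u'" "u' \<in> B" using p by auto
        have "adj u' v'" "v' \<notin> B" using p u v T[unfolded lattice_iso_def, THEN conjunct2, rule_format, of u' v'] by auto
        then show "p \<in> ?R" using u by (intro rev_image_eqI[of "(u', v')"]) (auto simp: p v)
      qed
    qed
    moreover have "inj (map_prod T T)" using b by (simp add: prod.inj_map)
    ultimately show ?thesis
      unfolding per_def by (simp only: card_image[OF inj_on_subset[OF _ subset_UNIV]])
  qed
  have "energy h (T ` B) = energy (h \<circ> T) B" for B
    unfolding energy_def p using b by (simp add: sum.reindex inj_on_subset[of T UNIV])
  moreover have "T ` A \<subseteq> T ` U \<longleftrightarrow> A \<subseteq> U" using b by (simp add: inj_image_subset_iff)
  ultimately show ?thesis
    unfolding is_min_def all_subset_image by simp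
qed

lemma sets_iso:
  assumes T: "lattice_iso T"
  shows "minus_set (T ` U) h = T ` minus_set U (h \<circ> T)" "plus_set (T ` U) h = T ` plus_set U (h \<circ> T)"
    "disagree (T ` U) h = T ` disagree U (h \<circ> T)"
proof -
  have b: "bij T" "inj T" "surj T" using T by (auto simp: lattice_iso_def bij_def)
  have c: "{A. is_min (T ` U) g A} = (`) T ` {A. is_min U (g \<circ> T) A}" for g
  proof (intro set_eqI iffI)
    fix A assume "A \<in> {A. is_min (T ` U) g A}"
    moreover have "A = T ` (T -` A)" using b by (simp add: surj_image_vimage_eq)
    ultimately have "is_min U (g \<circ> T) (T -` A)" using is_min_iso[OF T] by (metis mem_Collect_eq)
    with \<open>A = T ` (T -` A)\<close> show "A \<in> (`) T ` {A. is_min U (g \<circ> T) A}" by blast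
  qed (use is_min_iso[OF T] in auto)
  show 1: "minus_set (T ` U) h = T ` minus_set U (h \<circ> T)"
    unfolding minus_set_def c using bij_image_INT[OF b(1), of "\<lambda>A. A"] by simp
  show 2: "plus_set (T ` U) h = T ` plus_set U (h \<circ> T)"
    unfolding plus_set_def c using c[of "\<lambda>v. - h v"] by (auto simp: comp_def)
  show "disagree (T ` U) h = T ` disagree U (h \<circ> T)"
    unfolding disagree_def 1 2 using b by (simp add: image_set_diff)
qed

definition walk :: "site set \<Rightarrow> (nat \<Rightarrow> site) \<Rightarrow> nat \<Rightarrow> bool" where
  "walk S g k \<longleftrightarrow> (\<forall>i\<le>k. g i \<in> S) \<and> (\<forall>i<k. adj (g i) (g (Suc i)))"

lemma walk_extend:
  assumes "walk S g k" "adj (g k) v" "v \<in> S"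
  shows "walk S (g(Suc k := v)) (Suc k)"
  using assms by (auto simp: walk_def le_Suc_eq less_Suc_eq)

text \<open>Let \<open>C\<close> be the component of \<open>z\<close> in the disagreement set. If no
  site of \<open>C\<close> had a neighbour outside \<open>W\<close>, no edge of \<open>C\<close>
  would count in \<open>isoperimetric\<close>, which for \<open>d = 0\<close> would read 0 <
  0.\<close>

lemma disagree_reaches_boundary:
  assumes W: "finite W" and o: "z \<in> disagree W h"
  shows "\<exists>g k v. walk (disagree W h) g k \<and> g 0 = z \<and> v \<notin> W \<and> adj (g k) v"
proof (rule ccontr)
  assume no: "\<not> ?thesis"
  define C where "C = {v. \<exists>g k. walk (disagree W h) g k \<and> g 0 = z \<and> g k = v}"
  have "walk (disagree W h) (\<lambda>_. z) 0" using o by (simp add: walk_def)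
  then have zC: "z \<in> C" unfolding C_def by (intro CollectI exI[of _ "\<lambda>_. z"] exI[of _ 0]) simp
  have CD: "C \<subseteq> disagree W h" by (auto simp: C_def walk_def)
  have "{(u, v). adj u v \<and> u \<in> C \<and> v \<in> - (C \<union> minus_set W h \<union> plus_set W h)} = {}"
  proof (rule ccontr)
    assume "\<not> ?thesis"
    then obtain u v where uv: "adj u v" "u \<in> C" "v \<notin> C" "v \<notin> minus_set W h" "v \<notin> plus_set W h" by blast
    from uv obtain g k where g: "walk (disagree W h) g k" "g 0 = z" "g k = u" by (auto simp: C_def)
    have "v \<in> W" using no g uv by blast
    then have "v \<in> disagree W h" using uv by (auto simp: disagree_def)
    then have "walk (disagree W h) (g(Suc k := v)) (Suc k)" using g uv by (intro walk_extend) auto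
    then have "v \<in> C" unfolding C_def using g
      by (intro CollectI exI[of _ "g(Suc k := v)"] exI[of _ "Suc k"]) auto
    with uv show False by simp
  qed
  then have "ecount C (- (C \<union> minus_set W h \<union> plus_set W h)) = 0" by (simp only: ecount_def card.empty of_nat_0)
  moreover have "0 * real (card C) < 2 * ecount C (- (C \<union> minus_set W h \<union> plus_set W h))"
    by (rule isoperimetric[OF W]) (use CD zC in \<open>auto simp: disagree_def\<close>)
  ultimately show False by simp
qed

lemma card_disagree_Int:
  assumes "finite W" "V \<subseteq> W"
  shows "real (card (disagree W h \<inter> V)) = real (card V) - real (card (minus_set W h \<inter> V)) - real (card (plus_set W h \<inter> V))"
proof -
  have fV: "finite V" using assms by (meson finite_subset)
  let ?X = "minus_set W h \<inter> V" and ?Y = "plus_set W h \<inter> V"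
  have "V = (disagree W h \<inter> V) \<union> (?X \<union> ?Y)" using assms by (auto simp: disagree_def)
  moreover have "(disagree W h \<inter> V) \<inter> (?X \<union> ?Y) = {}" by (auto simp: disagree_def)
  ultimately have "card V = card (disagree W h \<inter> V) + card (?X \<union> ?Y)"
    using fV by (metis card_Un_disjoint finite_Un)
  moreover have "card (?X \<union> ?Y) = card ?X + card ?Y"
    using fV minus_plus_disjoint[OF assms(1), of h] by (intro card_Un_disjoint) auto
  ultimately show ?thesis by simp
qed

section \<open>Integration over the shift of the field\<close>

lemma step_bound:
  fixes \<psi> c :: "real \<Rightarrow> real"
  assumes ab: "a < b" and N: "0 < N" and d: "d = (b - a) / real N"
    and \<psi>: "\<And>s. 0 \<le> \<psi> s" and le: "\<And>t s. t \<le> s \<Longrightarrow> s \<le> t + d \<Longrightarrow> \<psi> s \<le> c t"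
  shows "(\<integral>\<^sup>+ s. ennreal (\<psi> s) * indicator {a..<b} s \<partial>lborel) \<le> ennreal (\<Sum>i<N. c (a + real i * d) * d)"
proof -
  have d0: "d > 0" using ab N by (simp add: d)
  have c0: "0 \<le> c t" for t using le[of t t] \<psi>[of t] d0 by simp
  let ?t = "\<lambda>i::nat. a + real i * d"
  have "ennreal (\<psi> s) * indicator {a..<b} s \<le> (\<Sum>i<N. ennreal (c (?t i)) * indicator {?t i..<?t (Suc i)} s)" for s
  proof (cases "s \<in> {a..<b}")
    case True
    define i where "i = nat \<lfloor>(s - a) / d\<rfloor>"
    have q0: "0 \<le> (s - a) / d" using True d0 by simp
    have "(s - a) / d < real N" using True d0 ab N by (simp add: d field_simps)
    then have iN: "i < N" using q0 by (simp add: i_def) linarith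
    have ri: "real i = of_int \<lfloor>(s - a) / d\<rfloor>" using q0 by (simp add: i_def)
    have "real i \<le> (s - a) / d" "(s - a) / d < real i + 1" unfolding ri by linarith+
    then have s: "?t i \<le> s" "s < ?t (Suc i)" using d0 by (simp_all add: field_simps)
    have "\<psi> s \<le> c (?t i)" using s by (intro le) (simp_all add: algebra_simps)
    then have "ennreal (\<psi> s) * indicator {a..<b} s \<le> ennreal (c (?t i)) * indicator {?t i..<?t (Suc i)} s"
      using True s by (simp add: ennreal_leI)
    also have "\<dots> \<le> (\<Sum>i<N. ennreal (c (?t i)) * indicator {?t i..<?t (Suc i)} s)"
      using iN by (intro member_le_sum) auto
    finally show ?thesis .
  qed simp
  then have "(\<integral>\<^sup>+ s. ennreal (\<psi> s) * indicator {a..<b} s \<partial>lborel)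
      \<le> (\<integral>\<^sup>+ s. (\<Sum>i<N. ennreal (c (?t i)) * indicator {?t i..<?t (Suc i)} s) \<partial>lborel)"
    by (intro nn_integral_mono)
  also have "\<dots> = (\<Sum>i<N. ennreal (c (?t i)) * ennreal d)"
    using d0 by (subst nn_integral_sum) (auto simp: nn_integral_cmult_indicator algebra_simps)
  also have "\<dots> = ennreal (\<Sum>i<N. c (?t i) * d)"
    using c0 d0 by (simp add: ennreal_mult'' sum_ennreal[symmetric])
  finally show ?thesis .
qed

lemma shift_sets_mono:
  assumes "finite W" "s \<le> t"
  shows "minus_set W (shift_on V t h) \<subseteq> minus_set W (shift_on V s h)"
    and "plus_set W (shift_on V s h) \<subseteq> plus_set W (shift_on V t h)"
  using assms by (intro minus_set_mono plus_set_mono; simp add: shift_on_def)+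

text \<open>Integrating the swap inequality over the shift bounds the total disagreement
  along a whole line of fields by the number of edges in a single cut.\<close>

lemma disagreement_integral:
  assumes W: "finite W" and V: "V \<subseteq> W"
    and cut: "\<And>s1 s2. s1 \<le> s2 \<Longrightarrow> \<exists>Z. V \<subseteq> Z \<and> Z \<subseteq> W \<and>
      ecount (Z - minus_set W (shift_on V s2 h) - plus_set W (shift_on V s1 h))
        (- (minus_set W (shift_on V s2 h) \<union> plus_set W (shift_on V s1 h) \<union> Z)) \<le> \<kappa>"
  shows "(\<integral>\<^sup>+ s. ennreal (real (card (disagree W (shift_on V s h) \<inter> V))) \<partial>lborel) \<le> ennreal (2 * \<kappa>)"
proof -
  have fV: "finite V" using W V by (meson finite_subset)
  define x where "x s = real (card (minus_set W (shift_on V s h) \<inter> V))" for s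
  define y where "y s = real (card (plus_set W (shift_on V s h) \<inter> V))" for s
  define \<psi> where "\<psi> s = real (card (disagree W (shift_on V s h) \<inter> V))" for s
  define n where "n = real (card V)"
  define Ep where "Ep s = ground_energy W (shift_on V s h)" for s
  define Em where "Em s = ground_energy W (\<lambda>v. - shift_on V s h v)" for s
  have \<psi>: "\<psi> s = n - x s - y s" for s
    by (simp add: \<psi>_def x_def y_def n_def card_disagree_Int[OF W V])
  have xm: "x t \<le> x s" and ym: "y s \<le> y t" if "s \<le> t" for s t
    using shift_sets_mono[OF W that, of V h] fV by (auto simp: x_def y_def intro!: card_mono)
  have bd: "0 \<le> x s" "x s \<le> n" "0 \<le> y s" "y s \<le> n" for s
    using fV by (auto simp: x_def y_def n_def intro!: card_mono)
  have E1: "Ep t - Ep s \<le> (t - s) * x s" and E2: "Em s - Em t \<le> (t - s) * y t" if "s \<le> t" for s t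
    using ground_energy_shift(3,4)[OF W V that, of h] by (simp_all add: Ep_def Em_def x_def y_def)
  have sw: "(t - s) * n + Ep s + Em t \<le> Ep t + Em s + 2 * \<kappa>" if st: "s \<le> t" for s t
  proof -
    obtain Z where Z: "V \<subseteq> Z" "Z \<subseteq> W" "ecount (Z - minus_set W (shift_on V t h) - plus_set W (shift_on V s h))
        (- (minus_set W (shift_on V t h) \<union> plus_set W (shift_on V s h) \<union> Z)) \<le> \<kappa>" using cut[OF st] by blast
    show ?thesis using swap_inequality[OF W Z(1,2) st refl refl, of h] Z(3)
      by (simp add: n_def Ep_def Em_def)
  qed
  have k0: "0 \<le> \<kappa>" using sw[of 0 0] by simp
  have fin: "(\<integral>\<^sup>+ s. ennreal (\<psi> s) * indicator {a..<b} s \<partial>lborel) \<le> ennreal (2 * \<kappa> + 2 * n * ((b - a) / real N))"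
    if ab: "a < b" and N: "0 < N" for a b and N :: nat
  proof -
    define d where "d = (b - a) / real N"
    have d0: "d > 0" using ab N by (simp add: d_def)
    let ?t = "\<lambda>i::nat. a + real i * d"
    \<comment> \<open>\<open>x\<close> decreases and \<open>y\<close> increases in the shift, so
      taking them at opposite ends of a step dominates \<psi> on the whole step.\<close>
    define c where "c t = n - x (t + d) - y t" for t
    have "(\<integral>\<^sup>+ s. ennreal (\<psi> s) * indicator {a..<b} s \<partial>lborel) \<le> ennreal (\<Sum>i<N. c (?t i) * d)"
    proof (rule step_bound[OF ab N d_def])
      show "0 \<le> \<psi> s" for s by (simp add: \<psi>_def)
      show "\<psi> s \<le> c t" if "t \<le> s" "s \<le> t + d" for s t
        using xm[OF that(2)] ym[OF that(1)] by (simp add: \<psi> c_def)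
    qed
    also have "(\<Sum>i<N. c (?t i) * d) \<le> 2 * \<kappa> + 2 * n * d"
    proof -
      have st: "?t i + d = ?t (Suc i)" for i by (simp add: algebra_simps)
      \<comment> \<open>\<open>c\<close> uses \<open>x\<close> at the right end and \<open>y\<close>
        at the left end, while \<open>E1\<close> and \<open>E2\<close> control the opposite choices.
        The two corrections telescope to at most \<open>n * d\<close> each, and the energy
        differences telescope to the end points, where \<open>sw\<close> applies.\<close>
      have "(\<Sum>i<N. c (?t i) * d) = (\<Sum>i<N. n * d - x (?t i) * d - y (?t (Suc i)) * d + (x (?t i) - x (?t (Suc i))) * d + (y (?t (Suc i)) - y (?t i)) * d)"
        by (intro sum.cong) (simp_all add: c_def st algebra_simps)
      also have "\<dots> \<le> (\<Sum>i<N. n * d + (Ep (?t i) - Ep (?t (Suc i))) + (Em (?t (Suc i)) - Em (?t i)) + (x (?t i) - x (?t (Suc i))) * d + (y (?t (Suc i)) - y (?t i)) * d)"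
      proof (rule sum_mono)
        fix i
        have 1: "?t i \<le> ?t (Suc i)" "?t (Suc i) - ?t i = d" using d0 by (simp_all add: algebra_simps)
        show "n * d - x (?t i) * d - y (?t (Suc i)) * d + (x (?t i) - x (?t (Suc i))) * d + (y (?t (Suc i)) - y (?t i)) * d
          \<le> n * d + (Ep (?t i) - Ep (?t (Suc i))) + (Em (?t (Suc i)) - Em (?t i)) + (x (?t i) - x (?t (Suc i))) * d + (y (?t (Suc i)) - y (?t i)) * d"
          using E1[OF 1(1)] E2[OF 1(1)] unfolding 1(2) by (simp add: mult.commute)
      qed
      also have "\<dots> = real N * (n * d) + (Ep (?t 0) - Ep (?t N)) + (Em (?t N) - Em (?t 0)) + (x (?t 0) - x (?t N)) * d + (y (?t N) - y (?t 0)) * d"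
      proof -
        have t1: "(\<Sum>i<N. f (?t i) - f (?t (Suc i))) = f (?t 0) - f (?t N)" for f :: "real \<Rightarrow> real"
          by (rule sum_lessThan_telescope')
        have t2: "(\<Sum>i<N. f (?t (Suc i)) - f (?t i)) = f (?t N) - f (?t 0)" for f :: "real \<Rightarrow> real"
          by (rule sum_lessThan_telescope)
        show ?thesis by (simp only: sum.distrib sum_distrib_right[symmetric] t1 t2 sum_constant card_lessThan)
      qed
      also have "\<dots> \<le> 2 * \<kappa> + 2 * n * d"
      proof -
        have e: "?t 0 = a" "?t N = b" using N by (simp_all add: d_def)
        have 1: "(x a - x b) * d \<le> n * d" "(y b - y a) * d \<le> n * d"
          using bd[of a] bd[of b] d0 by (intro mult_right_mono; linarith)+
        have "real N * d = b - a" using N by (simp add: d_def)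
        then have 2: "real N * (n * d) = (b - a) * n" by (metis mult.assoc mult.commute)
        show ?thesis unfolding e 2 using 1 sw[OF less_imp_le[OF ab]] by linarith
      qed
      finally show ?thesis .
    qed
    finally show ?thesis by (simp add: d_def ennreal_leI)
  qed
  \<comment> \<open>On a fixed window the mesh tends to 0 and removes the discretisation error. The
    result does not depend on the window since \<kappa> bounds the cut for every pair of shifts, so
    the window can then exhaust the line.\<close>
  have fin2: "(\<integral>\<^sup>+ s. ennreal (\<psi> s) * indicator {- real k..<real k} s \<partial>lborel) \<le> ennreal (2 * \<kappa>)" for k :: nat
  proof (cases "k = 0")
    case False
    have "(\<lambda>N. ennreal (2 * \<kappa> + 2 * n * ((real k - - real k) / real (Suc N)))) \<longlonglongrightarrow> ennreal (2 * \<kappa> + 2 * n * 0)"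
      by (intro tendsto_ennrealI tendsto_intros LIMSEQ_Suc lim_const_over_n)
    then have "(\<integral>\<^sup>+ s. ennreal (\<psi> s) * indicator {- real k..<real k} s \<partial>lborel) \<le> ennreal (2 * \<kappa> + 2 * n * 0)"
    proof (rule LIMSEQ_le_const)
      show "\<exists>N0. \<forall>N\<ge>N0. (\<integral>\<^sup>+ s. ennreal (\<psi> s) * indicator {- real k..<real k} s \<partial>lborel)
          \<le> ennreal (2 * \<kappa> + 2 * n * ((real k - - real k) / real (Suc N)))"
        using False by (intro exI[of _ 0] allI impI fin) auto
    qed
    then show ?thesis by simp
  qed simp
  have mx: "(\<lambda>s. - x s) \<in> borel_measurable borel" "y \<in> borel_measurable borel"
    using xm ym by (intro borel_measurable_mono; simp add: mono_def)+
  have "\<psi> = (\<lambda>s. n + (- x s) - y s)" using \<psi> by auto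
  then have m: "\<psi> \<in> borel_measurable borel" using mx by simp
  have "(\<integral>\<^sup>+ s. ennreal (\<psi> s) \<partial>lborel) = (\<integral>\<^sup>+ s. (SUP k::nat. ennreal (\<psi> s) * indicator {- real k..<real k} s) \<partial>lborel)"
  proof (rule nn_integral_cong)
    fix s :: real
    obtain k :: nat where k: "\<bar>s\<bar> < real k" using reals_Archimedean2 by blast
    have "ennreal (\<psi> s) * indicator {- real k..<real k} s \<le> (SUP k::nat. ennreal (\<psi> s) * indicator {- real k..<real k} s)"
      by (rule SUP_upper) simp
    moreover have "s \<in> {- real k..<real k}" using k by auto
    ultimately have "ennreal (\<psi> s) \<le> (SUP k::nat. ennreal (\<psi> s) * indicator {- real k..<real k} s)"
      by simp
    moreover have "(SUP k::nat. ennreal (\<psi> s) * indicator {- real k..<real k} s) \<le> ennreal (\<psi> s)"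
      by (intro SUP_least) (auto simp: indicator_def)
    ultimately show "ennreal (\<psi> s) = (SUP k::nat. ennreal (\<psi> s) * indicator {- real k..<real k} s)" by (rule antisym)
  qed
  also have "\<dots> = (SUP k::nat. \<integral>\<^sup>+ s. ennreal (\<psi> s) * indicator {- real k..<real k} s \<partial>lborel)"
  proof (rule nn_integral_monotone_convergence_SUP)
    show "incseq (\<lambda>k s. ennreal (\<psi> s) * indicator {- real k..<real k} s)"
      by (auto simp: incseq_def le_fun_def indicator_def)
    show "(\<lambda>s. ennreal (\<psi> s) * indicator {- real k..<real k} s) \<in> borel_measurable lborel" for k :: nat
      using m by simp
  qed
  also have "\<dots> \<le> ennreal (2 * \<kappa>)" using fin2 by (intro SUP_least)
  finally show ?thesis by (simp add: \<psi>_def)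
qed

section \<open>Gaussian fields and local events\<close>

definition gauss :: "real \<Rightarrow> real measure" where
  "gauss eps = density lborel (normal_density 0 eps)"

lemma sets_gauss [simp, measurable_cong]: "sets (gauss eps) = sets borel"
  by (simp add: gauss_def)

lemma space_gauss [simp]: "space (gauss eps) = UNIV"
  by (simp add: gauss_def)

locale gaussian_field =
  fixes eps :: real
  assumes eps_pos: "eps > 0"
begin

abbreviation \<mu> where "\<mu> \<equiv> field_law eps"
abbreviation \<mu>f where "\<mu>f K \<equiv> PiM K (\<lambda>_. gauss eps)"

lemma \<mu>_eq: "\<mu> = PiM UNIV (\<lambda>_. gauss eps)"
  by (simp add: field_law_def gauss_def)

sublocale G: prob_space "gauss eps"
  unfolding gauss_def using eps_pos by (rule prob_space_normal_density)

sublocale PP: product_prob_space "\<lambda>_::site. gauss eps" UNIV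
  by unfold_locales

sublocale P: prob_space \<mu>
  unfolding \<mu>_eq by (rule PP.prob_space_axioms)

lemma space_\<mu> [simp]: "space \<mu> = UNIV"
  by (simp add: \<mu>_eq space_PiM)

definition pr :: "((site \<Rightarrow> real) \<Rightarrow> bool) \<Rightarrow> real" where
  "pr E = measure \<mu> {h. E h}"

definition ev :: "((site \<Rightarrow> real) \<Rightarrow> bool) \<Rightarrow> bool" where
  "ev E \<longleftrightarrow> {h. E h} \<in> sets \<mu>"

text \<open>Recording a finite set of relevant sites with each event turns independence into
  disjointness of these sets, see \<open>pr_indep\<close>.\<close>

definition local_ev :: "site set \<Rightarrow> ((site \<Rightarrow> real) \<Rightarrow> bool) \<Rightarrow> bool" where
  "local_ev K E \<longleftrightarrow> finite K \<and> (\<forall>h. E h = E (restrict h K)) \<and> {h \<in> space (\<mu>f K). E h} \<in> sets (\<mu>f K)"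

lemma local_evD: "local_ev K E \<Longrightarrow> (\<And>v. v \<in> K \<Longrightarrow> h v = h' v) \<Longrightarrow> E h = E h'"
  unfolding local_ev_def by (metis restrict_ext)

lemma local_ev_finite: "local_ev K E \<Longrightarrow> finite K"
  by (auto simp: local_ev_def)

lemma measurable_restrict_\<mu>: "(\<lambda>h. restrict h K) \<in> measurable \<mu> (\<mu>f K)"
  unfolding \<mu>_eq by (rule measurable_restrict_subset) auto

lemma local_ev_ev: assumes "local_ev K E" shows "ev E"
proof -
  have "(\<lambda>h. restrict h K) -` {h \<in> space (\<mu>f K). E h} \<inter> space \<mu> \<in> sets \<mu>"
    using assms measurable_restrict_\<mu> by (intro measurable_sets) (auto simp: local_ev_def)
  also have "(\<lambda>h. restrict h K) -` {h \<in> space (\<mu>f K). E h} \<inter> space \<mu> = {h. E h}"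
    using assms by (auto simp: local_ev_def space_PiM)
  finally show ?thesis by (simp add: ev_def)
qed

lemma pr_local: assumes "local_ev K E" shows "ennreal (pr E) = emeasure (\<mu>f K) {h \<in> space (\<mu>f K). E h}"
proof -
  have "emeasure (\<mu>f K) {h \<in> space (\<mu>f K). E h} = emeasure (distr \<mu> (\<mu>f K) (\<lambda>h. restrict h K)) {h \<in> space (\<mu>f K). E h}"
    using PP.distr_PiM_restrict_finite[of K] assms by (simp add: \<mu>_eq local_ev_def)
  also have "\<dots> = emeasure \<mu> ((\<lambda>h. restrict h K) -` {h \<in> space (\<mu>f K). E h} \<inter> space \<mu>)"
    using assms measurable_restrict_\<mu> by (intro emeasure_distr) (auto simp: local_ev_def)
  also have "(\<lambda>h. restrict h K) -` {h \<in> space (\<mu>f K). E h} \<inter> space \<mu> = {h. E h}"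
    using assms by (auto simp: local_ev_def space_PiM)
  finally show ?thesis by (simp add: pr_def P.emeasure_eq_measure)
qed

lemma local_ev_mono: assumes "local_ev K E" "K \<subseteq> K'" "finite K'" shows "local_ev K' E"
proof -
  have "(\<lambda>h. restrict h K) -` {h \<in> space (\<mu>f K). E h} \<inter> space (\<mu>f K') \<in> sets (\<mu>f K')"
    using assms by (intro measurable_sets[OF measurable_restrict_subset]) (auto simp: local_ev_def)
  also have "(\<lambda>h. restrict h K) -` {h \<in> space (\<mu>f K). E h} \<inter> space (\<mu>f K') = {h \<in> space (\<mu>f K'). E h}"
    using assms by (auto simp: local_ev_def space_PiM)
  finally have 1: "{h \<in> space (\<mu>f K'). E h} \<in> sets (\<mu>f K')" .
  have "E h = E (restrict h K')" for h
    using assms(2) by (intro local_evD[OF assms(1)]) auto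
  with 1 show ?thesis using assms(3) by (auto simp: local_ev_def)
qed

text \<open>\<open>Q\<close> is an arbitrary property of the set of indices whose events occur, so
  this covers every Boolean combination of finitely many events. Measurability of events about
  ground states and about lattice paths is reduced to it without looking at their form.\<close>

lemma local_ev_combine:
  assumes I: "finite I" and K: "finite K" and A: "\<And>i. i \<in> I \<Longrightarrow> local_ev K (A i)"
  shows "local_ev K (\<lambda>h. Q {i \<in> I. A i h})"
  unfolding local_ev_def
proof (intro conjI allI K)
  fix h show "Q {i \<in> I. A i h} = Q {i \<in> I. A i (restrict h K)}"
    using A by (intro arg_cong[of _ _ Q] Collect_cong) (auto simp: local_ev_def)
next
  have m: "{h \<in> space (\<mu>f K). A i h} \<in> sets (\<mu>f K)" if "i \<in> I" for i using A[OF that] by (simp add: local_ev_def)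
  have "{h \<in> space (\<mu>f K). Q {i \<in> I. A i h}} = (\<Union>T\<in>{T \<in> Pow I. Q T}. {h \<in> space (\<mu>f K). \<forall>i\<in>I. A i h \<longleftrightarrow> i \<in> T})"
    (is "?L = ?R")
  proof (intro set_eqI iffI)
    fix h assume "h \<in> ?L"
    then show "h \<in> ?R" by (intro UN_I[of "{i \<in> I. A i h}"]) auto
  next
    fix h assume "h \<in> ?R"
    then obtain T where T: "T \<subseteq> I" "Q T" "h \<in> space (\<mu>f K)" "\<forall>i\<in>I. A i h \<longleftrightarrow> i \<in> T" by auto
    then have "{i \<in> I. A i h} = T" by auto
    with T show "h \<in> ?L" by simp
  qed
  also have "\<dots> \<in> sets (\<mu>f K)"
  proof (intro sets.finite_UN)
    show "finite {T \<in> Pow I. Q T}" using I by simp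
    fix T assume "T \<in> {T \<in> Pow I. Q T}"
    have "{h \<in> space (\<mu>f K). A i h \<longleftrightarrow> i \<in> T} \<in> sets (\<mu>f K)" if "i \<in> I" for i
    proof (cases "i \<in> T")
      case False
      have "space (\<mu>f K) - {h \<in> space (\<mu>f K). A i h} \<in> sets (\<mu>f K)" using m[OF that] by simp
      also have "space (\<mu>f K) - {h \<in> space (\<mu>f K). A i h} = {h \<in> space (\<mu>f K). A i h \<longleftrightarrow> i \<in> T}" using False by auto
      finally show ?thesis .
    qed (use m[OF that] in simp)
    then show "{h \<in> space (\<mu>f K). \<forall>i\<in>I. A i h \<longleftrightarrow> i \<in> T} \<in> sets (\<mu>f K)"
      using I by (intro sets.sets_Collect_finite_All) auto
  qed
  finally show "{h \<in> space (\<mu>f K). Q {i \<in> I. A i h}} \<in> sets (\<mu>f K)" .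
qed

lemma local_ev_not: assumes "local_ev K E" shows "local_ev K (\<lambda>h. \<not> E h)"
proof -
  have "local_ev K (\<lambda>h. (\<lambda>T. T = {}) {i \<in> {()}. E h})"
    using assms by (intro local_ev_combine) (auto simp: local_ev_def)
  moreover have "({i \<in> {()}. E h} = {}) = (\<not> E h)" for h by blast
  ultimately show ?thesis by (simp only:)
qed

lemma local_ev_conj: assumes "local_ev K E" "local_ev K F" shows "local_ev K (\<lambda>h. E h \<and> F h)"
proof -
  have "local_ev K (\<lambda>h. (\<lambda>T. T = {True, False}) {i \<in> {True, False}. if i then E h else F h})"
  proof (rule local_ev_combine)
    show "local_ev K (\<lambda>h. if i then E h else F h)" for i using assms by (cases i) auto
  qed (use assms in \<open>auto simp: local_ev_def\<close>)
  moreover have "({i \<in> {True, False}. if i then E h else F h} = {True, False}) = (E h \<and> F h)" for h by auto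
  ultimately show ?thesis by simp
qed

lemma local_ev_Ball: assumes "finite I" "finite K" "\<And>i. i \<in> I \<Longrightarrow> local_ev K (E i)" shows "local_ev K (\<lambda>h. \<forall>i\<in>I. E i h)"
proof -
  have "local_ev K (\<lambda>h. (\<lambda>T. T = I) {i \<in> I. E i h})" using assms by (intro local_ev_combine)
  moreover have "({i \<in> I. E i h} = I) = (\<forall>i\<in>I. E i h)" for h by auto
  ultimately show ?thesis by simp
qed

lemma local_ev_Bex: assumes "finite I" "finite K" "\<And>i. i \<in> I \<Longrightarrow> local_ev K (E i)" shows "local_ev K (\<lambda>h. \<exists>i\<in>I. E i h)"
proof -
  have "local_ev K (\<lambda>h. (\<lambda>T. T \<noteq> {}) {i \<in> I. E i h})" using assms by (intro local_ev_combine)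
  moreover have "({i \<in> I. E i h} \<noteq> {}) = (\<exists>i\<in>I. E i h)" for h by auto
  ultimately show ?thesis by simp
qed

lemma local_ev_is_min:
  assumes U: "finite U" and A: "A \<subseteq> U" and s: "s = 1 \<or> s = -1"
  shows "local_ev U (\<lambda>h. is_min U (\<lambda>v. s * h v) A)"
  unfolding local_ev_def
proof (intro conjI allI U)
  show "is_min U (\<lambda>v. s * h v) A = is_min U (\<lambda>v. s * restrict h U v) A" for h
    by (rule is_min_cong) simp
  have e: "(\<lambda>h. energy (\<lambda>v. s * h v) B) \<in> borel_measurable (\<mu>f U)" if "B \<subseteq> U" for B
  proof -
    have "(\<lambda>h. h v) \<in> borel_measurable (\<mu>f U)" if "v \<in> B" for v
      using measurable_component_singleton[of v U "\<lambda>_. gauss eps"] that \<open>B \<subseteq> U\<close>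
      by (auto simp: measurable_cong_sets[OF refl sets_gauss])
    then show ?thesis unfolding energy_def by (intro borel_measurable_add borel_measurable_const borel_measurable_sum borel_measurable_times)
  qed
  have "{h \<in> space (\<mu>f U). is_min U (\<lambda>v. s * h v) A}
      = {h \<in> space (\<mu>f U). \<forall>B\<in>Pow U. energy (\<lambda>v. s * h v) A \<le> energy (\<lambda>v. s * h v) B}"
    using A by (auto simp: is_min_def)
  also have "\<dots> \<in> sets (\<mu>f U)"
    using U A e by (intro sets.sets_Collect_finite_All borel_measurable_le) auto
  finally show "{h \<in> space (\<mu>f U). is_min U (\<lambda>v. s * h v) A} \<in> sets (\<mu>f U)" .
qed

lemma local_ev_sets:
  assumes U: "finite U"
  shows "local_ev U (\<lambda>h. Q (minus_set U h) (plus_set U h))"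
proof -
  \<comment> \<open>An index is a candidate set with a sign: 1 for minimisers of the field, -1 for
    minimisers of its negative. The indices that occur determine both \<open>minus_set\<close> and
    \<open>plus_set\<close>.\<close>
  let ?I = "Pow U \<times> {1, -1 :: real}"
  have "local_ev U (\<lambda>h. (\<lambda>T. Q (\<Inter>{A. (A, 1) \<in> T}) (\<Union>{A. (A, -1) \<in> T})) {i \<in> ?I. is_min U (\<lambda>v. snd i * h v) (fst i)})"
    using U by (intro local_ev_combine local_ev_is_min) auto
  moreover have "{A. (A, 1) \<in> {i \<in> ?I. is_min U (\<lambda>v. snd i * h v) (fst i)}} = {A. is_min U h A}"
    "{A. (A, -1) \<in> {i \<in> ?I. is_min U (\<lambda>v. snd i * h v) (fst i)}} = {A. is_min U (\<lambda>v. - h v) A}" for h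
    by (auto simp: is_min_def)
  ultimately show ?thesis unfolding minus_set_def plus_set_def by (simp only:)
qed

lemma local_ev_disagree: "finite U \<Longrightarrow> local_ev U (\<lambda>h. Q (disagree U h))"
  unfolding disagree_def by (rule local_ev_sets[where Q = "\<lambda>X Y. Q (U - X - Y)"])

lemma pr_indep:
  assumes 1: "local_ev K E" and 2: "local_ev K' F" and d: "K \<inter> K' = {}"
  shows "pr (\<lambda>h. E h \<and> F h) = pr E * pr F"
proof -
  have fin: "finite K" "finite K'" using 1 2 by (auto dest: local_ev_finite)
  have 3: "local_ev (K \<union> K') (\<lambda>h. E h \<and> F h)"
    using 1 2 fin by (intro local_ev_conj local_ev_mono[OF 1] local_ev_mono[OF 2]) auto
  interpret J: prob_space "\<mu>f K'" by (rule prob_space_PiM) (rule G.prob_space_axioms)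
  let ?S = "{h \<in> space (\<mu>f (K \<union> K')). E h \<and> F h}"
  have "ennreal (pr (\<lambda>h. E h \<and> F h)) = emeasure (\<mu>f (K \<union> K')) ?S" by (rule pr_local[OF 3])
  also have "\<dots> = emeasure (distr (\<mu>f K \<Otimes>\<^sub>M \<mu>f K') (\<mu>f (K \<union> K')) (merge K K')) ?S"
    using PP.distr_merge[OF d fin] by simp
  also have "\<dots> = emeasure (\<mu>f K \<Otimes>\<^sub>M \<mu>f K') (merge K K' -` ?S \<inter> space (\<mu>f K \<Otimes>\<^sub>M \<mu>f K'))"
    using 3 by (intro emeasure_distr measurable_merge) (auto simp: local_ev_def)
  also have "merge K K' -` ?S \<inter> space (\<mu>f K \<Otimes>\<^sub>M \<mu>f K') = {h \<in> space (\<mu>f K). E h} \<times> {h \<in> space (\<mu>f K'). F h}"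
  proof -
    have "E (merge K K' (x, y)) = E x" "F (merge K K' (x, y)) = F y" for x y
      using d by (intro local_evD[OF 1] local_evD[OF 2]; auto simp: merge_def)+
    moreover have "merge K K' (x, y) \<in> space (\<mu>f (K \<union> K'))" if "x \<in> space (\<mu>f K)" "y \<in> space (\<mu>f K')" for x y
      using that by (auto simp: space_PiM)
    ultimately show ?thesis unfolding space_pair_measure by blast
  qed
  also have "emeasure (\<mu>f K \<Otimes>\<^sub>M \<mu>f K') \<dots> = ennreal (pr E) * ennreal (pr F)"
    using 1 2 unfolding pr_local[OF 1] pr_local[OF 2]
    by (intro J.emeasure_pair_measure_Times) (auto simp: local_ev_def)
  finally have "ennreal (pr (\<lambda>h. E h \<and> F h)) = ennreal (pr E * pr F)"
    by (simp add: ennreal_mult'' pr_def)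
  then show ?thesis by (simp add: pr_def)
qed

lemma pr_indep_Ball:
  assumes "finite I" "\<And>i. i \<in> I \<Longrightarrow> local_ev (K i) (E i)" "disjoint_family_on K I"
  shows "pr (\<lambda>h. \<forall>i\<in>I. E i h) = (\<Prod>i\<in>I. pr (E i))"
  using assms
proof (induction I rule: finite_induct)
  case empty
  then show ?case by (simp add: pr_def P.prob_space[simplified])
next
  case (insert i I)
  have fin: "finite (K j)" if "j \<in> insert i I" for j using insert.prems(1)[OF that] by (rule local_ev_finite)
  have l: "local_ev (\<Union>j\<in>I. K j) (\<lambda>h. \<forall>j\<in>I. E j h)"
  proof (rule local_ev_Ball)
    show fU: "finite (\<Union>j\<in>I. K j)" using insert.hyps(1) fin by blast
    fix j assume j: "j \<in> I"
    show "local_ev (\<Union>j\<in>I. K j) (E j)"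
      by (rule local_ev_mono[OF insert.prems(1) _ fU]) (use j in blast)+
  qed (rule insert.hyps(1))
  have d: "K i \<inter> (\<Union>j\<in>I. K j) = {}" using insert.prems(2) insert.hyps by (auto simp: disjoint_family_on_def)
  have "pr (\<lambda>h. \<forall>j\<in>insert i I. E j h) = pr (\<lambda>h. E i h \<and> (\<forall>j\<in>I. E j h))" by simp
  also have "\<dots> = pr (E i) * pr (\<lambda>h. \<forall>j\<in>I. E j h)"
    by (rule pr_indep[OF insert.prems(1)[OF insertI1] l d])
  also have "pr (\<lambda>h. \<forall>j\<in>I. E j h) = (\<Prod>j\<in>I. pr (E j))"
    by (rule insert.IH[OF insert.prems(1)[OF insertI2] disjoint_family_on_mono[OF subset_insertI insert.prems(2)]])
  finally show ?case using insert.hyps by simp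
qed

lemma pr_nonneg [simp]: "0 \<le> pr E" and pr_le_1 [simp]: "pr E \<le> 1"
  by (simp_all add: pr_def)

text \<open>A set outside the sigma-algebra has \<open>measure\<close> 0 by default, so the
  inequality holds for arbitrary \<open>E\<close> below a measurable \<open>F\<close>.\<close>

lemma pr_mono: "ev F \<Longrightarrow> (\<And>h. E h \<Longrightarrow> F h) \<Longrightarrow> pr E \<le> pr F"
  unfolding pr_def ev_def by (intro P.finite_measure_mono) auto

lemma pr_Bex_le: "finite I \<Longrightarrow> (\<And>i. i \<in> I \<Longrightarrow> ev (E i)) \<Longrightarrow> pr (\<lambda>h. \<exists>i\<in>I. E i h) \<le> (\<Sum>i\<in>I. pr (E i))"
  unfolding pr_def ev_def
  using P.finite_measure_subadditive_finite[of I "\<lambda>i. {h. E i h}"] by (auto simp: Collect_bex_eq image_subset_iff)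

lemma ev_Bex: "finite I \<Longrightarrow> (\<And>i. i \<in> I \<Longrightarrow> ev (E i)) \<Longrightarrow> ev (\<lambda>h. \<exists>i\<in>I. E i h)"
  unfolding ev_def by (auto simp: Collect_bex_eq)

lemma pr_not: "ev E \<Longrightarrow> pr (\<lambda>h. \<not> E h) = 1 - pr E"
  unfolding pr_def ev_def using P.prob_compl[of "{h. E h}"] by (simp add: Collect_neg_eq Compl_eq_Diff_UNIV)

lemma ev_disj: "ev E \<Longrightarrow> ev F \<Longrightarrow> ev (\<lambda>h. E h \<or> F h)"
  unfolding ev_def by (simp add: Collect_disj_eq)

lemma pr_disj_le: "ev E \<Longrightarrow> ev F \<Longrightarrow> pr (\<lambda>h. E h \<or> F h) \<le> pr E + pr F"
  unfolding pr_def ev_def Collect_disj_eq by (rule measure_Un_le)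

text \<open>An i.i.d. family keeps its law under injective relabelling of the sites; this is the
  source of invariance under translations and quarter turns.\<close>

lemma pr_reindex:
  assumes T: "inj T" and E: "ev E"
  shows "pr (\<lambda>h. E (h \<circ> T)) = pr E" "ev (\<lambda>h. E (h \<circ> T))"
proof -
  have m: "(\<lambda>h. h \<circ> T) \<in> measurable \<mu> \<mu>"
    unfolding \<mu>_eq comp_def by (rule measurable_PiM_single') (auto simp: space_PiM)
  have d: "distr \<mu> \<mu> (\<lambda>h. h \<circ> T) = \<mu>"
    using distr_PiM_reindex[of UNIV "\<lambda>_. gauss eps" T UNIV] T G.prob_space_axioms by (simp add: \<mu>_eq comp_def restrict_UNIV)
  have s: "(\<lambda>h. h \<circ> T) -` {h. E h} \<inter> space \<mu> = {h. E (h \<circ> T)}" by auto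
  show "ev (\<lambda>h. E (h \<circ> T))" using measurable_sets[OF m] E s unfolding ev_def by metis
  have "measure \<mu> {h. E h} = measure (distr \<mu> \<mu> (\<lambda>h. h \<circ> T)) {h. E h}" by (simp add: d)
  also have "\<dots> = measure \<mu> {h. E (h \<circ> T)}" using E m s by (simp add: measure_distr ev_def)
  finally show "pr (\<lambda>h. E (h \<circ> T)) = pr E" by (simp add: pr_def)
qed


section \<open>Cameron-Martin shifts of the Gaussian field\<close>

definition local_fun :: "site set \<Rightarrow> ((site \<Rightarrow> real) \<Rightarrow> ennreal) \<Rightarrow> bool" where
  "local_fun K g \<longleftrightarrow> finite K \<and> (\<forall>h. g h = g (restrict h K)) \<and> g \<in> borel_measurable (\<mu>f K)"

lemma local_fun_finite: "local_fun K g \<Longrightarrow> finite K"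
  and local_fun_meas: "local_fun K g \<Longrightarrow> g \<in> borel_measurable (\<mu>f K)"
  by (auto simp: local_fun_def)

lemma local_fun_cong: "local_fun K g \<Longrightarrow> (\<And>v. v \<in> K \<Longrightarrow> h v = h' v) \<Longrightarrow> g h = g h'"
  unfolding local_fun_def by (metis restrict_ext)

lemma local_funI:
  assumes "finite K" "\<And>h. g h = g (restrict h K)" "g \<in> borel_measurable (\<mu>f K)"
  shows "local_fun K g"
  using assms unfolding local_fun_def by blast

lemma local_fun_measurable: assumes "local_fun K g" shows "g \<in> borel_measurable \<mu>"
proof -
  have "(\<lambda>h. g (restrict h K)) \<in> borel_measurable \<mu>"
    by (rule measurable_compose[OF measurable_restrict_\<mu> local_fun_meas[OF assms]])
  moreover have "(\<lambda>h. g (restrict h K)) = g" by (rule ext, rule local_fun_cong[OF assms]) simp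
  ultimately show ?thesis by simp
qed

lemma nn_integral_local: assumes "local_fun K g" shows "integral\<^sup>N \<mu> g = integral\<^sup>N (\<mu>f K) g"
proof -
  have "integral\<^sup>N (\<mu>f K) g = integral\<^sup>N (distr \<mu> (\<mu>f K) (\<lambda>h. restrict h K)) g"
    using PP.distr_PiM_restrict_finite[of K] local_fun_finite[OF assms] by (simp add: \<mu>_eq)
  also have "\<dots> = (\<integral>\<^sup>+ h. g (restrict h K) \<partial>\<mu>)"
    by (rule nn_integral_distr[OF measurable_restrict_\<mu>]) (simp add: local_fun_meas[OF assms])
  also have "\<dots> = integral\<^sup>N \<mu> g" by (intro nn_integral_cong local_fun_cong[OF assms]) simp
  finally show ?thesis by simp
qed

lemma gauss_shift:
  assumes [measurable]: "f \<in> borel_measurable borel"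
  shows "(\<integral>\<^sup>+ y. f (y + s) \<partial>gauss eps) = (\<integral>\<^sup>+ y. f y * ennreal (exp ((s * y - s\<^sup>2 / 2) / eps\<^sup>2)) \<partial>gauss eps)"
proof -
  have n: "normal_density 0 eps y * exp ((s * y - s\<^sup>2 / 2) / eps\<^sup>2) = normal_density 0 eps (y - s)" for y
  proof -
    have "- (y - 0)\<^sup>2 / (2 * eps\<^sup>2) + (s * y - s\<^sup>2 / 2) / eps\<^sup>2 = - (y - s - 0)\<^sup>2 / (2 * eps\<^sup>2)"
      using eps_pos by (simp add: field_simps power2_eq_square)
    then show ?thesis by (simp only: normal_density_def mult.assoc exp_add[symmetric])
  qed
  have "(\<integral>\<^sup>+ y. f y * ennreal (exp ((s * y - s\<^sup>2 / 2) / eps\<^sup>2)) \<partial>gauss eps)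
      = (\<integral>\<^sup>+ y. ennreal (normal_density 0 eps y) * (f y * ennreal (exp ((s * y - s\<^sup>2 / 2) / eps\<^sup>2))) \<partial>lborel)"
    unfolding gauss_def by (subst nn_integral_density) auto
  also have "\<dots> = (\<integral>\<^sup>+ y. ennreal (normal_density 0 eps (y - s)) * f y \<partial>lborel)"
  proof (rule nn_integral_cong)
    fix y
    have "ennreal (normal_density 0 eps y) * (f y * ennreal (exp ((s * y - s\<^sup>2 / 2) / eps\<^sup>2)))
      = ennreal (normal_density 0 eps y * exp ((s * y - s\<^sup>2 / 2) / eps\<^sup>2)) * f y"
      by (simp add: ennreal_mult'' mult.assoc mult.commute mult.left_commute)
    then show "ennreal (normal_density 0 eps y) * (f y * ennreal (exp ((s * y - s\<^sup>2 / 2) / eps\<^sup>2)))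
      = ennreal (normal_density 0 eps (y - s)) * f y" by (simp add: n)
  qed
  also have "\<dots> = (\<integral>\<^sup>+ y. ennreal (normal_density 0 eps y) * f (y + s) \<partial>lborel)"
    by (subst nn_integral_real_affine[where c = 1 and t = s]) (auto simp: add.commute)
  also have "\<dots> = (\<integral>\<^sup>+ y. f (y + s) \<partial>gauss eps)"
    unfolding gauss_def by (subst nn_integral_density) auto
  finally show ?thesis by simp
qed

text \<open>The one-site identity \<open>gauss_shift\<close> is applied to one coordinate at a time:
  integrating out the new site first leaves a function of the remaining sites, to which the
  induction hypothesis applies.\<close>

lemma cameron_martin_finite:
  fixes K :: "site set"
  assumes "finite K" "g \<in> borel_measurable (\<mu>f K)"
  shows "(\<integral>\<^sup>+ x. g (\<lambda>v\<in>K. x v + t v) \<partial>\<mu>f K)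
    = (\<integral>\<^sup>+ x. g x * (\<Prod>v\<in>K. ennreal (exp ((t v * x v - (t v)\<^sup>2 / 2) / eps\<^sup>2))) \<partial>\<mu>f K)"
  using assms
proof (induction K arbitrary: g rule: finite_induct)
  case empty
  have "(\<integral>\<^sup>+ x. g (\<lambda>v\<in>{}. x v + t v) \<partial>\<mu>f {}) = (\<integral>\<^sup>+ x. g x \<partial>\<mu>f {})"
    by (intro nn_integral_cong) (auto simp: space_PiM intro!: arg_cong[of _ _ g])
  then show ?case by (simp only: prod.empty mult_1_right)
next
  case (insert i K)
  note [measurable] = insert.prems
  let ?r = "\<lambda>v y. ennreal (exp ((t v * y - (t v)\<^sup>2 / 2) / eps\<^sup>2))"
  let ?sh = "\<lambda>x. (\<lambda>v\<in>K. x v + t v)"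
  have sp: "?sh x \<in> space (\<mu>f K)" for x by (auto simp: space_PiM)
  have comp: "(\<lambda>x. x v) \<in> borel_measurable (\<mu>f J)" if "v \<in> J" for v and J :: "site set"
    using measurable_component_singleton[of v J "\<lambda>_. gauss eps"] that
    by (auto simp: measurable_cong_sets[OF refl sets_gauss])
  have upd: "(\<lambda>y. g (x(i := y))) \<in> borel_measurable borel" if "x \<in> space (\<mu>f K)" for x
  proof -
    have "(\<lambda>y. x(i := y)) \<in> measurable (gauss eps) (\<mu>f (insert i K))"
      using that insert.hyps by (intro measurable_component_update) auto
    from measurable_compose[OF this insert.prems] show ?thesis by (simp only: measurable_cong_sets[OF sets_gauss refl])
  qed
  define \<Phi> where "\<Phi> z = (\<integral>\<^sup>+ y. g (z(i := y)) * ?r i y \<partial>gauss eps)" for z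
  have m2: "(\<lambda>(z, y). g (z(i := y)) * ?r i y) \<in> borel_measurable (\<mu>f K \<Otimes>\<^sub>M gauss eps)"
  proof -
    have "(\<lambda>p. g ((\<lambda>(f, y). f(i := y)) p)) \<in> borel_measurable (\<mu>f K \<Otimes>\<^sub>M gauss eps)"
      by (rule measurable_compose[OF measurable_add_dim insert.prems])
    then show ?thesis by (simp add: case_prod_unfold) measurable
  qed
  have \<Phi>m: "\<Phi> \<in> borel_measurable (\<mu>f K)"
    unfolding \<Phi>_def using m2 by (rule G.borel_measurable_nn_integral)
  have shm: "(\<lambda>x. \<lambda>v\<in>insert i K. x v + t v) \<in> measurable (\<mu>f (insert i K)) (\<mu>f (insert i K))"
    by (rule measurable_restrict) (use comp in \<open>simp add: measurable_cong_sets[OF refl sets_gauss]\<close>)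
  have "(\<integral>\<^sup>+ x. g (\<lambda>v\<in>insert i K. x v + t v) \<partial>\<mu>f (insert i K))
      = (\<integral>\<^sup>+ x. (\<integral>\<^sup>+ y. g (\<lambda>v\<in>insert i K. (x(i := y)) v + t v) \<partial>gauss eps) \<partial>\<mu>f K)"
    using measurable_compose[OF shm insert.prems] insert.hyps
    by (intro PP.product_nn_integral_insert[where f = "\<lambda>x. g (\<lambda>v\<in>insert i K. x v + t v)"]) auto
  also have "\<dots> = (\<integral>\<^sup>+ x. \<Phi> (?sh x) \<partial>\<mu>f K)"
  proof (rule nn_integral_cong)
    fix x
    have e: "(\<lambda>v\<in>insert i K. (x(i := y)) v + t v) = (?sh x)(i := y + t i)" for y
      using insert.hyps by (auto simp: restrict_def)
    have "(\<integral>\<^sup>+ y. g ((?sh x)(i := y + t i)) \<partial>gauss eps) = \<Phi> (?sh x)"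
      unfolding \<Phi>_def by (rule gauss_shift[OF upd[OF sp]])
    then show "(\<integral>\<^sup>+ y. g (\<lambda>v\<in>insert i K. (x(i := y)) v + t v) \<partial>gauss eps) = \<Phi> (?sh x)" unfolding e .
  qed
  also have "\<dots> = (\<integral>\<^sup>+ x. \<Phi> x * (\<Prod>v\<in>K. ?r v (x v)) \<partial>\<mu>f K)"
    by (rule insert.IH[OF \<Phi>m])
  also have "\<dots> = (\<integral>\<^sup>+ x. (\<integral>\<^sup>+ y. g (x(i := y)) * (\<Prod>v\<in>insert i K. ?r v ((x(i := y)) v)) \<partial>gauss eps) \<partial>\<mu>f K)"
  proof (rule nn_integral_cong)
    fix x assume x: "x \<in> space (\<mu>f K)"
    have "g (x(i := y)) * (\<Prod>v\<in>insert i K. ?r v ((x(i := y)) v)) = g (x(i := y)) * ?r i y * (\<Prod>v\<in>K. ?r v (x v))" for y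
    proof -
      have "(\<Prod>v\<in>K. ?r v ((x(i := y)) v)) = (\<Prod>v\<in>K. ?r v (x v))"
        using insert.hyps by (intro prod.cong) auto
      then show ?thesis using insert.hyps by (simp add: mult.assoc)
    qed
    moreover have "(\<lambda>y. g (x(i := y)) * ?r i y) \<in> borel_measurable (gauss eps)"
      using upd[OF x] by (simp cong: measurable_cong_sets)
    ultimately show "\<Phi> x * (\<Prod>v\<in>K. ?r v (x v))
      = (\<integral>\<^sup>+ y. g (x(i := y)) * (\<Prod>v\<in>insert i K. ?r v ((x(i := y)) v)) \<partial>gauss eps)"
      unfolding \<Phi>_def by (simp only: nn_integral_multc)
  qed
  also have "\<dots> = (\<integral>\<^sup>+ x. g x * (\<Prod>v\<in>insert i K. ?r v (x v)) \<partial>\<mu>f (insert i K))"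
  proof (rule PP.product_nn_integral_insert[symmetric])
    have "(\<lambda>x. \<Prod>v\<in>insert i K. ?r v (x v)) \<in> borel_measurable (\<mu>f (insert i K))"
    proof (rule borel_measurable_prod_ennreal)
      fix v assume "v \<in> insert i K"
      note [measurable] = comp[OF this]
      show "(\<lambda>x. ?r v (x v)) \<in> borel_measurable (\<mu>f (insert i K))" by measurable
    qed
    then show "(\<lambda>x. g x * (\<Prod>v\<in>insert i K. ?r v (x v))) \<in> borel_measurable (\<mu>f (insert i K))"
      using insert.prems by (intro borel_measurable_times_ennreal)
  qed (use insert.hyps in auto)
  finally show ?case .
qed

text \<open>The density, relative to the law of \<open>h\<close>, of the law of
  \<open>shift_on V s h\<close>.\<close>

definition rho :: "site set \<Rightarrow> real \<Rightarrow> (site \<Rightarrow> real) \<Rightarrow> real" where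
  "rho V s h = exp ((s * sum h V - real (card V) * s\<^sup>2 / 2) / eps\<^sup>2)"

lemma comp_\<mu>f: "v \<in> K \<Longrightarrow> (\<lambda>x. x v) \<in> borel_measurable (\<mu>f K)"
  using measurable_component_singleton[of v K "\<lambda>_. gauss eps"]
  by (auto simp: measurable_cong_sets[OF refl sets_gauss])

lemma local_fun_sum:
  assumes "finite K" "V \<subseteq> K" "f \<in> borel_measurable borel"
  shows "local_fun K (\<lambda>h. ennreal (f (sum h V)))"
proof -
  have "(\<lambda>h. sum h V) \<in> borel_measurable (\<mu>f K)"
    using assms by (intro borel_measurable_sum comp_\<mu>f) auto
  then have "(\<lambda>h. ennreal (f (sum h V))) \<in> borel_measurable (\<mu>f K)"
    using assms(3) by measurable
  moreover have "ennreal (f (sum h V)) = ennreal (f (sum (restrict h K) V))" for h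
    using assms by (intro arg_cong[of _ _ "\<lambda>u. ennreal (f u)"] sum.cong) auto
  ultimately show ?thesis using assms(1) by (intro local_funI)
qed

lemma local_fun_mult:
  assumes "local_fun K f" "local_fun K g"
  shows "local_fun K (\<lambda>h. f h * g h)"
proof (rule local_funI)
  show "f h * g h = f (restrict h K) * g (restrict h K)" for h
    by (intro arg_cong2[of _ _ _ _ "(*)"] local_fun_cong[OF assms(1)] local_fun_cong[OF assms(2)]) auto
qed (use assms local_fun_meas local_fun_finite in auto)

lemma measurable_shift_\<mu>f:
  "(\<lambda>x. \<lambda>v\<in>K. x v + s * of_bool (v \<in> V)) \<in> measurable (\<mu>f K) (\<mu>f K)"
  by (rule measurable_restrict) (use comp_\<mu>f in \<open>simp add: measurable_cong_sets[OF refl sets_gauss]\<close>)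

lemma local_fun_shift: assumes "local_fun K g" shows "local_fun K (\<lambda>h. g (shift_on V s h))"
proof (rule local_funI)
  have e: "(\<lambda>h. g (shift_on V s h)) = (\<lambda>h. g (\<lambda>v\<in>K. h v + s * of_bool (v \<in> V)))"
    by (rule ext, rule local_fun_cong[OF assms]) (simp add: shift_on_def)
  show "(\<lambda>h. g (shift_on V s h)) \<in> borel_measurable (\<mu>f K)"
    unfolding e by (rule measurable_compose[OF measurable_shift_\<mu>f local_fun_meas[OF assms]])
  show "g (shift_on V s h) = g (shift_on V s (restrict h K))" for h
    by (rule local_fun_cong[OF assms]) (simp add: shift_on_def)
qed (rule local_fun_finite[OF assms])

lemma cameron_martin:
  assumes g: "local_fun K g" and V: "V \<subseteq> K"
  shows "(\<integral>\<^sup>+ h. g (shift_on V s h) \<partial>\<mu>) = (\<integral>\<^sup>+ h. g h * ennreal (rho V s h) \<partial>\<mu>)"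
proof -
  have K: "finite K" using g by (rule local_fun_finite)
  let ?t = "\<lambda>v. s * of_bool (v \<in> V) :: real"
  have r: "(\<Prod>v\<in>K. ennreal (exp ((?t v * x v - (?t v)\<^sup>2 / 2) / eps\<^sup>2))) = ennreal (rho V s x)" for x
  proof -
    have "(\<Prod>v\<in>K. ennreal (exp ((?t v * x v - (?t v)\<^sup>2 / 2) / eps\<^sup>2))) = ennreal (exp (\<Sum>v\<in>K. (?t v * x v - (?t v)\<^sup>2 / 2) / eps\<^sup>2))"
      using K by (simp add: prod_ennreal exp_sum)
    also have "(\<Sum>v\<in>K. (?t v * x v - (?t v)\<^sup>2 / 2) / eps\<^sup>2) = (\<Sum>v\<in>V. (s * x v - s\<^sup>2 / 2) / eps\<^sup>2)"
      using K V by (intro sum.mono_neutral_cong_right) auto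
    also have "\<dots> = (s * sum x V - real (card V) * s\<^sup>2 / 2) / eps\<^sup>2"
      by (simp add: sum_divide_distrib[symmetric] sum_subtractf sum_distrib_left)
    finally show ?thesis by (simp add: rho_def)
  qed
  have "(\<integral>\<^sup>+ h. g (shift_on V s h) \<partial>\<mu>) = (\<integral>\<^sup>+ h. g (shift_on V s h) \<partial>\<mu>f K)"
    by (rule nn_integral_local[OF local_fun_shift[OF g]])
  also have "\<dots> = (\<integral>\<^sup>+ x. g (\<lambda>v\<in>K. x v + ?t v) \<partial>\<mu>f K)"
  proof (rule nn_integral_cong)
    fix x
    show "g (shift_on V s x) = g (\<lambda>v\<in>K. x v + ?t v)"
      by (rule local_fun_cong[OF g]) (simp add: shift_on_def)
  qed
  also have "\<dots> = (\<integral>\<^sup>+ x. g x * ennreal (rho V s x) \<partial>\<mu>f K)"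
    by (subst cameron_martin_finite[OF K local_fun_meas[OF g]]) (simp add: r)
  also have "\<dots> = (\<integral>\<^sup>+ h. g h * ennreal (rho V s h) \<partial>\<mu>)"
    using g K V unfolding rho_def
    by (intro nn_integral_local[symmetric] local_fun_mult
        local_fun_sum[where f = "\<lambda>u. exp ((s * u - real (card V) * s\<^sup>2 / 2) / eps\<^sup>2)"]) auto
  finally show ?thesis .
qed

lemma local_fun_rho: "finite K \<Longrightarrow> V \<subseteq> K \<Longrightarrow> local_fun K (\<lambda>h. ennreal (rho V s h))"
  unfolding rho_def by (intro local_fun_sum[where f = "\<lambda>u. exp ((s * u - real (card V) * s\<^sup>2 / 2) / eps\<^sup>2)"]) auto

lemma nn_integral_rho: "finite V \<Longrightarrow> (\<integral>\<^sup>+ h. ennreal (rho V s h) \<partial>\<mu>) = 1"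
  using cameron_martin[of V "\<lambda>_. 1" V s] by (simp add: local_fun_def P.emeasure_space_1[simplified])

lemma nn_integral_rho_sq:
  assumes V: "finite V"
  shows "(\<integral>\<^sup>+ h. ennreal ((rho V s h)\<^sup>2) \<partial>\<mu>) = ennreal (exp (real (card V) * s\<^sup>2 / eps\<^sup>2))"
proof -
  have "rho V s (shift_on V s h) = exp (real (card V) * s\<^sup>2 / eps\<^sup>2) * rho V s h" for h
    using V eps_pos by (simp add: rho_def sum_shift_on exp_add[symmetric] field_simps power2_eq_square)
  then have "(\<integral>\<^sup>+ h. ennreal (rho V s (shift_on V s h)) \<partial>\<mu>) = ennreal (exp (real (card V) * s\<^sup>2 / eps\<^sup>2)) * (\<integral>\<^sup>+ h. ennreal (rho V s h) \<partial>\<mu>)"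
    using local_fun_measurable[OF local_fun_rho[OF V order_refl, of s]]
    by (simp add: ennreal_mult' nn_integral_cmult)
  moreover have "(\<integral>\<^sup>+ h. ennreal (rho V s (shift_on V s h)) \<partial>\<mu>) = (\<integral>\<^sup>+ h. ennreal ((rho V s h)\<^sup>2) \<partial>\<mu>)"
    using cameron_martin[OF local_fun_rho[OF V order_refl, of s] order_refl, of s]
    by (simp add: power2_eq_square ennreal_mult'' rho_def)
  ultimately show ?thesis using V by (simp add: nn_integral_rho)
qed

lemma local_ev_fun: "local_ev K E \<Longrightarrow> local_fun K (\<lambda>h. indicator {h. E h} h)"
proof (rule local_funI)
  assume E: "local_ev K E"
  show "indicator {h. E h} h = (indicator {h. E h} (restrict h K) :: ennreal)" for h
    using local_evD[OF E, of h "restrict h K"] by (simp add: indicator_def)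
  have "{h \<in> space (\<mu>f K). E h} \<in> sets (\<mu>f K)" using E by (simp only: local_ev_def)
  then have "indicator {h \<in> space (\<mu>f K). E h} \<in> borel_measurable (\<mu>f K)" by simp
  then show "(\<lambda>h. indicator {h. E h} h :: ennreal) \<in> borel_measurable (\<mu>f K)"
    by (rule measurable_cong[THEN iffD1, rotated]) (simp add: indicator_def)
qed (rule local_ev_finite)

lemma local_ev_shift: assumes "local_ev K E" shows "local_ev K (\<lambda>h. E (shift_on V s h))"
proof -
  have e: "E (shift_on V s h) = E (\<lambda>v\<in>K. h v + s * of_bool (v \<in> V))" for h
    by (rule local_evD[OF assms]) (simp add: shift_on_def)
  have "(\<lambda>x. \<lambda>v\<in>K. x v + s * of_bool (v \<in> V)) -` {h \<in> space (\<mu>f K). E h} \<inter> space (\<mu>f K) \<in> sets (\<mu>f K)"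
    using assms unfolding local_ev_def by (intro measurable_sets[OF measurable_shift_\<mu>f]) blast
  also have "(\<lambda>x. \<lambda>v\<in>K. x v + s * of_bool (v \<in> V)) -` {h \<in> space (\<mu>f K). E h} \<inter> space (\<mu>f K)
      = {h \<in> space (\<mu>f K). E (shift_on V s h)}"
    unfolding e by (auto simp: space_PiM)
  finally have "{h \<in> space (\<mu>f K). E (shift_on V s h)} \<in> sets (\<mu>f K)" .
  moreover have "E (shift_on V s h) = E (shift_on V s (restrict h K))" for h
    by (rule local_evD[OF assms]) (simp add: shift_on_def)
  ultimately show ?thesis using local_ev_finite[OF assms] unfolding local_ev_def by blast
qed

lemma nn_integral_indicator_pr: "ev E \<Longrightarrow> (\<integral>\<^sup>+ h. indicator {h. E h} h \<partial>\<mu>) = ennreal (pr E)"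
  by (simp add: ev_def pr_def P.emeasure_eq_measure)

text \<open>Truncation of the density: \<open>rho V s h\<close> is at most R + rho^2 / R, and its
  second moment is the exponential. An unlikely event stays unlikely after a shift as long as
  \<open>real (card V) * s\<^sup>2\<close> is bounded, for example s = 1/q on a box of side of order
  q.\<close>

lemma pr_shift_le:
  assumes E: "local_ev K E" and V: "V \<subseteq> K" and R: "R > 0"
  shows "pr (\<lambda>h. E (shift_on V s h)) \<le> R * pr E + exp (real (card V) * s\<^sup>2 / eps\<^sup>2) / R"
proof -
  have K: "finite K" "finite V" using local_ev_finite[OF E] V by (auto intro: finite_subset)
  let ?I = "\<lambda>h. indicator {h. E h} h :: ennreal"
  have m: "?I \<in> borel_measurable \<mu>" using local_fun_measurable[OF local_ev_fun[OF E]] .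
  have mr: "(\<lambda>h. ennreal ((rho V s h)\<^sup>2)) \<in> borel_measurable \<mu>"
    using local_fun_measurable[OF local_fun_mult[OF local_fun_rho[OF K(1) V, of s] local_fun_rho[OF K(1) V, of s]]]
    by (simp add: power2_eq_square ennreal_mult'' rho_def)
  have "ennreal (pr (\<lambda>h. E (shift_on V s h))) = (\<integral>\<^sup>+ h. indicator {h. E (shift_on V s h)} h \<partial>\<mu>)"
    by (rule nn_integral_indicator_pr[symmetric, OF local_ev_ev[OF local_ev_shift[OF E]]])
  also have "\<dots> = (\<integral>\<^sup>+ h. ?I (shift_on V s h) \<partial>\<mu>)" by (simp add: indicator_def)
  also have "\<dots> = (\<integral>\<^sup>+ h. ?I h * ennreal (rho V s h) \<partial>\<mu>)" by (rule cameron_martin[OF local_ev_fun[OF E] V])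
  also have "\<dots> \<le> (\<integral>\<^sup>+ h. ennreal R * ?I h + ennreal (1 / R) * ennreal ((rho V s h)\<^sup>2) \<partial>\<mu>)"
  proof (rule nn_integral_mono)
    fix h
    have r0: "0 \<le> rho V s h" by (simp add: rho_def)
    have "rho V s h \<le> R + 1 / R * (rho V s h)\<^sup>2"
    proof (cases "rho V s h \<le> R")
      case True then show ?thesis using R by (simp add: add_increasing2)
    next
      case False
      then have "rho V s h * R \<le> rho V s h * rho V s h" using r0 by (intro mult_left_mono) auto
      then have "rho V s h \<le> 1 / R * (rho V s h)\<^sup>2" using R by (simp add: field_simps power2_eq_square)
      then show ?thesis using R by linarith
    qed
    then have "ennreal (rho V s h) \<le> ennreal R + ennreal (1 / R) * ennreal ((rho V s h)\<^sup>2)"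
      using R by (simp add: ennreal_mult''[symmetric] ennreal_plus[symmetric] ennreal_leI del: ennreal_plus)
    then show "?I h * ennreal (rho V s h) \<le> ennreal R * ?I h + ennreal (1 / R) * ennreal ((rho V s h)\<^sup>2)"
      by (auto simp: indicator_def)
  qed
  also have "\<dots> = ennreal R * (\<integral>\<^sup>+ h. ?I h \<partial>\<mu>) + ennreal (1 / R) * (\<integral>\<^sup>+ h. ennreal ((rho V s h)\<^sup>2) \<partial>\<mu>)"
    using m mr by (subst nn_integral_add) (auto simp: nn_integral_cmult)
  also have "\<dots> = ennreal (R * pr E + exp (real (card V) * s\<^sup>2 / eps\<^sup>2) / R)"
    unfolding nn_integral_indicator_pr[OF local_ev_ev[OF E]] nn_integral_rho_sq[OF K(2)]
    using R by (simp add: ennreal_mult''[symmetric] ennreal_plus[symmetric] del: ennreal_plus)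
  finally show ?thesis using R by (subst (asm) ennreal_le_iff) auto
qed

lemma measurable_shift_pair: "(\<lambda>(h, s). shift_on V s h) \<in> measurable (\<mu> \<Otimes>\<^sub>M lborel) \<mu>"
proof -
  have "(\<lambda>p. fst p v + snd p * of_bool (v \<in> V)) \<in> borel_measurable (\<mu> \<Otimes>\<^sub>M lborel)" for v :: site
  proof -
    have "(\<lambda>h. h v) \<in> borel_measurable \<mu>" using comp_\<mu>f[of v UNIV] by (simp add: \<mu>_eq)
    from measurable_compose[OF measurable_fst this] have "(\<lambda>p. fst p v) \<in> borel_measurable (\<mu> \<Otimes>\<^sub>M lborel)" .
    moreover have "(\<lambda>p. snd p) \<in> borel_measurable (\<mu> \<Otimes>\<^sub>M lborel)"
      using measurable_snd[of \<mu> lborel] by (simp add: measurable_lborel1)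
    ultimately show ?thesis by (intro borel_measurable_add borel_measurable_times borel_measurable_const)
  qed
  then show ?thesis unfolding \<mu>_eq[symmetric] shift_on_def case_prod_unfold
    by (subst (2) \<mu>_eq) (rule measurable_PiM_single', auto simp: measurable_cong_sets[OF refl sets_gauss])
qed

text \<open>The average of the field over \<open>V\<close> has a density bounded by the reciprocal of the
  constant on the left, so integrating along the line \<open>h + s 1\<^sub>V\<close> costs only that constant.\<close>

lemma line_average:
  assumes g: "local_fun K g" and V: "V \<subseteq> K" "V \<noteq> {}"
  shows "ennreal (eps * sqrt (2 * pi / real (card V))) * integral\<^sup>N \<mu> g
    \<le> (\<integral>\<^sup>+ h. (\<integral>\<^sup>+ s. g (shift_on V s h) \<partial>lborel) \<partial>\<mu>)"
proof -
  have K: "finite K" "finite V" using local_fun_finite[OF g] V by (auto intro: finite_subset)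
  define n where "n = real (card V)"
  have n0: "n > 0" using K V by (simp add: n_def card_gt_0_iff)
  \<comment> \<open>An unnormalised Gaussian with the variance eps^2 / n of the average
    \<open>m h\<close>: it is at most 1, and its integral over the line is the constant
    \<open>?c\<close>.\<close>
  define \<phi> where "\<phi> u = exp (- n * u\<^sup>2 / (2 * eps\<^sup>2))" for u
  define m where "m h = sum h V / n" for h :: "site \<Rightarrow> real"
  let ?c = "eps * sqrt (2 * pi / n)"
  have gm: "g \<in> borel_measurable \<mu>" by (rule local_fun_measurable[OF g])
  have mm: "m \<in> borel_measurable \<mu>"
    unfolding m_def using comp_\<mu>f[of _ UNIV] by (auto simp: \<mu>_eq intro!: borel_measurable_sum borel_measurable_divide)
  have sig: "(eps / sqrt n)\<^sup>2 = eps\<^sup>2 / n" using n0 by (simp add: power_divide)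
  have c: "(\<integral>\<^sup>+ s. ennreal (\<phi> (u - s)) \<partial>lborel) = ennreal ?c" for u
  proof -
    have e: "\<phi> (u - s) = ?c * normal_density u (eps / sqrt n) s" for s
    proof -
      have "sqrt (2 * pi * (eps\<^sup>2 / n)) = ?c"
        using eps_pos by (simp add: real_sqrt_mult real_sqrt_divide)
      moreover have "- n * (u - s)\<^sup>2 / (2 * eps\<^sup>2) = - (s - u)\<^sup>2 / (2 * (eps\<^sup>2 / n))"
        using n0 eps_pos by (simp add: field_simps power2_eq_square)
      moreover have "?c \<noteq> 0" using eps_pos n0 by simp
      ultimately show ?thesis unfolding \<phi>_def normal_density_def sig by simp
    qed
    interpret N: prob_space "density lborel (normal_density u (eps / sqrt n))"
      using eps_pos n0 by (intro prob_space_normal_density) simp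
    have "(\<integral>\<^sup>+ s. ennreal (normal_density u (eps / sqrt n) s) \<partial>lborel) = 1"
      using N.emeasure_space_1 by (simp add: emeasure_density)
    then show ?thesis unfolding e using eps_pos n0
      by (simp add: ennreal_mult'' nn_integral_cmult normal_density_nonneg)
  qed
  interpret PS: pair_sigma_finite \<mu> lborel ..
  have "ennreal ?c * integral\<^sup>N \<mu> g = (\<integral>\<^sup>+ h. (\<integral>\<^sup>+ s. g h * ennreal (\<phi> (m h - s)) \<partial>lborel) \<partial>\<mu>)"
  proof -
    have "(\<integral>\<^sup>+ s. g h * ennreal (\<phi> (m h - s)) \<partial>lborel) = g h * ennreal ?c" for h
      using c[of "m h"] by (subst nn_integral_cmult) (auto simp: \<phi>_def)
    then show ?thesis using gm by (simp add: nn_integral_multc mult.commute)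
  qed
  also have "\<dots> = (\<integral>\<^sup>+ s. (\<integral>\<^sup>+ h. g h * ennreal (\<phi> (m h - s)) \<partial>\<mu>) \<partial>lborel)"
    by (rule PS.Fubini'[symmetric]) (use gm mm in \<open>simp add: \<phi>_def case_prod_unfold\<close>)
  also have "\<dots> \<le> (\<integral>\<^sup>+ s. (\<integral>\<^sup>+ h. g (shift_on V s h) \<partial>\<mu>) \<partial>lborel)"
  proof (rule nn_integral_mono)
    fix s
    have lf: "local_fun K (\<lambda>h. g h * ennreal (\<phi> (m h)))"
      unfolding m_def using g K V by (intro local_fun_mult local_fun_sum[where f = "\<lambda>u. \<phi> (u / n)"]) (auto simp: \<phi>_def)
    \<comment> \<open>Completing the square: translating \<phi> is the same as multiplying it by the
      Cameron-Martin density, so the weight can be traded for a shift of the field.\<close>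
    have "\<phi> (m h - s) = \<phi> (m h) * rho V s h" for h
    proof -
      have "- n * (m h - s)\<^sup>2 / (2 * eps\<^sup>2) = - n * (m h)\<^sup>2 / (2 * eps\<^sup>2) + (s * sum h V - n * s\<^sup>2 / 2) / eps\<^sup>2"
        using n0 eps_pos by (simp add: m_def field_simps power2_eq_square)
      then show ?thesis by (simp add: \<phi>_def rho_def n_def[symmetric] exp_add[symmetric])
    qed
    then have "(\<integral>\<^sup>+ h. g h * ennreal (\<phi> (m h - s)) \<partial>\<mu>) = (\<integral>\<^sup>+ h. (g h * ennreal (\<phi> (m h))) * ennreal (rho V s h) \<partial>\<mu>)"
      by (intro nn_integral_cong) (simp add: \<phi>_def ennreal_mult' mult.assoc)
    also have "\<dots> = (\<integral>\<^sup>+ h. g (shift_on V s h) * ennreal (\<phi> (m (shift_on V s h))) \<partial>\<mu>)"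
      using cameron_martin[OF lf V(1), of s] by simp
    also have "\<dots> \<le> (\<integral>\<^sup>+ h. g (shift_on V s h) * 1 \<partial>\<mu>)"
      by (intro nn_integral_mono mult_left_mono) (use n0 in \<open>auto simp: \<phi>_def ennreal_le_1\<close>)
    finally show "(\<integral>\<^sup>+ h. g h * ennreal (\<phi> (m h - s)) \<partial>\<mu>) \<le> (\<integral>\<^sup>+ h. g (shift_on V s h) \<partial>\<mu>)" by simp
  qed
  also have "\<dots> = (\<integral>\<^sup>+ h. (\<integral>\<^sup>+ s. g (shift_on V s h) \<partial>lborel) \<partial>\<mu>)"
    by (rule PS.Fubini') (use measurable_compose[OF measurable_shift_pair gm] in \<open>simp add: case_prod_unfold\<close>)
  finally show ?thesis by (simp add: n_def)
qed

end

section \<open>Crossing lattice paths\<close>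

definition pos :: "site \<Rightarrow> real \<times> real" where
  "pos p = (real_of_int (fst p), real_of_int (snd p))"

definition perp :: "real \<times> real \<Rightarrow> real \<times> real" where
  "perp e = (- snd e, fst e)"

lemma inner_pair: "(x :: real \<times> real) \<bullet> y = fst x * fst y + snd x * snd y"
  by (cases x; cases y) (simp add: inner_prod_def)

text \<open>Rounding down gives each point of an edge a canonical endpoint. Applied to two edges
  through the same point, it shows that they share a vertex; thus curves that meet come from lattice
  paths that meet.\<close>

lemma floor_mem_edge:
  assumes "p = p' \<or> adj p p'" "w \<in> closed_segment (pos p) (pos p')"
  shows "(\<lfloor>fst w\<rfloor>, \<lfloor>snd w\<rfloor>) \<in> {p, p'}"
proof -
  obtain t where t: "0 \<le> t" "t \<le> 1" "w = (1 - t) *\<^sub>R pos p + t *\<^sub>R pos p'"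
    using assms(2) by (auto simp: closed_segment_def)
  obtain x y where p: "p = (x, y)" by (cases p)
  have w: "fst w = (1 - t) * real_of_int (fst p) + t * real_of_int (fst p')"
    "snd w = (1 - t) * real_of_int (snd p) + t * real_of_int (snd p')"
    by (simp_all add: t(3) pos_def)
  have A: "\<lfloor>(1 - t) * real_of_int z + t * real_of_int z\<rfloor> = z" for z
    by (simp add: algebra_simps)
  have B: "\<lfloor>(1 - t) * real_of_int z + t * real_of_int (z + 1)\<rfloor> = (if t = 1 then z + 1 else z)" for z
    using t by (auto simp: algebra_simps floor_eq_iff)
  have C: "\<lfloor>(1 - t) * real_of_int z + t * real_of_int (z - 1)\<rfloor> = (if t = 0 then z else z - 1)" for z
    using t by (auto simp: algebra_simps floor_eq_iff)
  from assms(1) consider "p' = p" | "p' = (x + 1, y)" | "p' = (x - 1, y)" | "p' = (x, y + 1)" | "p' = (x, y - 1)"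
    by (auto simp: adj_iff p)
  then show ?thesis
    by cases (auto simp: w p A B C simp del: of_int_add of_int_diff)
qed

lemma polygonal_path:
  fixes f :: "nat \<Rightarrow> 'a::real_normed_vector"
  shows "\<exists>\<gamma>. path \<gamma> \<and> pathstart \<gamma> = f 0 \<and> pathfinish \<gamma> = f k \<and>
    path_image \<gamma> \<subseteq> {z. \<exists>i\<le>k. \<exists>j\<le>k. (j = i \<or> j = Suc i) \<and> z \<in> closed_segment (f i) (f j)}"
proof (induction k)
  case 0
  show ?case by (rule exI[of _ "\<lambda>_. f 0"]) (auto simp: path_def pathstart_def pathfinish_def path_image_def)
next
  case (Suc k)
  then obtain \<gamma> where g: "path \<gamma>" "pathstart \<gamma> = f 0" "pathfinish \<gamma> = f k"
    "path_image \<gamma> \<subseteq> {z. \<exists>i\<le>k. \<exists>j\<le>k. (j = i \<or> j = Suc i) \<and> z \<in> closed_segment (f i) (f j)}" by blast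
  let ?g = "\<gamma> +++ linepath (f k) (f (Suc k))"
  have "path_image ?g = path_image \<gamma> \<union> closed_segment (f k) (f (Suc k))"
    using g by (simp add: path_image_join)
  moreover have "path_image \<gamma> \<subseteq> {z. \<exists>i\<le>Suc k. \<exists>j\<le>Suc k. (j = i \<or> j = Suc i) \<and> z \<in> closed_segment (f i) (f j)}"
  proof
    fix z assume "z \<in> path_image \<gamma>"
    with g(4) obtain i j where "i \<le> k" "j \<le> k" "j = i \<or> j = Suc i" "z \<in> closed_segment (f i) (f j)" by blast
    then show "z \<in> {z. \<exists>i\<le>Suc k. \<exists>j\<le>Suc k. (j = i \<or> j = Suc i) \<and> z \<in> closed_segment (f i) (f j)}"
      by (intro CollectI exI[of _ i] conjI exI[of _ j]) auto
  qed
  moreover have "closed_segment (f k) (f (Suc k)) \<subseteq> {z. \<exists>i\<le>Suc k. \<exists>j\<le>Suc k. (j = i \<or> j = Suc i) \<and> z \<in> closed_segment (f i) (f j)}"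
    by (intro subsetI CollectI exI[of _ k] conjI exI[of _ "Suc k"]) auto
  ultimately show ?case using g by (intro exI[of _ ?g]) simp
qed

lemma segment_component:
  fixes x y z :: "real^'n"
  assumes "z \<in> closed_segment x y"
  shows "l \<le> x $ k \<Longrightarrow> l \<le> y $ k \<Longrightarrow> l \<le> z $ k" "x $ k \<le> l \<Longrightarrow> y $ k \<le> l \<Longrightarrow> z $ k \<le> l"
    "l < x $ k \<Longrightarrow> l < y $ k \<Longrightarrow> l < z $ k" "x $ k < l \<Longrightarrow> y $ k < l \<Longrightarrow> z $ k < l"
proof -
  obtain t where t: "0 \<le> t" "t \<le> 1" "z = (1 - t) *\<^sub>R x + t *\<^sub>R y"
    using assms by (auto simp: closed_segment_def)
  have z: "z $ k = (1 - t) * x $ k + t * y $ k" by (simp add: t(3))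
  have n: "- (z $ k) = (1 - t) * (- (x $ k)) + t * (- (y $ k))" by (simp add: z)
  show "x $ k \<le> l \<Longrightarrow> y $ k \<le> l \<Longrightarrow> z $ k \<le> l"
    unfolding z using t by (intro convex_bound_le) auto
  show "x $ k < l \<Longrightarrow> y $ k < l \<Longrightarrow> z $ k < l"
    unfolding z using t by (intro convex_bound_lt) auto
  show "l \<le> x $ k \<Longrightarrow> l \<le> y $ k \<Longrightarrow> l \<le> z $ k"
    using convex_bound_le[of "- (x $ k)" "- l" "- (y $ k)" "1 - t" t] t n by auto
  show "l < x $ k \<Longrightarrow> l < y $ k \<Longrightarrow> l < z $ k"
    using convex_bound_lt[of "- (x $ k)" "- l" "- (y $ k)" "1 - t" t] t n by auto
qed

text \<open>The path \<open>p\<close> traverses a strip lengthwise while \<open>q\<close> traverses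
  it across. The Fashoda theorem needs curves joining opposite sides of one box, so both polygons
  are prolonged to a large box; the bounds on \<open>u\<close> and \<open>v\<close> keep the
  prolongations from producing a spurious meeting point.\<close>

lemma lattice_paths_cross:
  fixes e :: "real \<times> real" and A v0 v1 :: real
  defines "u \<equiv> \<lambda>p. pos p \<bullet> e" and "v \<equiv> \<lambda>p. pos p \<bullet> perp e"
  assumes e: "norm e = 1"
    and p: "\<And>i. i < k \<Longrightarrow> adj (p i) (p (Suc i))" and q: "\<And>j. j < m \<Longrightarrow> adj (q j) (q (Suc j))"
    and pu: "u (p 0) \<le> - A" "A \<le> u (p k)" and pv: "\<And>i. i \<le> k \<Longrightarrow> v0 \<le> v (p i) \<and> v (p i) \<le> v1"
    and qv: "v (q 0) < v0" "v1 < v (q m)" and qu: "\<And>j. j \<le> m \<Longrightarrow> \<bar>u (q j)\<bar> < A"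
  shows "\<exists>i\<le>k. \<exists>j\<le>m. p i = q j"
proof -
  \<comment> \<open>Rotated coordinates along \<open>e\<close> and \<open>perp e\<close>; an
    axis-parallel box in these coordinates is what \<open>fashoda\<close> refers to.\<close>
  define \<Phi> :: "real \<times> real \<Rightarrow> real^2" where "\<Phi> w = vector [w \<bullet> e, w \<bullet> perp e]" for w
  have \<Phi>c: "\<Phi> w $ 1 = w \<bullet> e" "\<Phi> w $ 2 = w \<bullet> perp e" for w by (simp_all add: \<Phi>_def)
  have lin: "linear \<Phi>"
    by (rule linearI) (simp_all add: vec_eq_iff forall_2 \<Phi>c inner_add_left)
  have ee: "(fst e)\<^sup>2 + (snd e)\<^sup>2 = 1"
    using e by (cases e) (simp add: norm_Pair)
  have inj: "inj \<Phi>"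
  proof (subst linear_injective_0[OF lin], intro allI impI)
    fix w assume "\<Phi> w = 0"
    then have 1: "w \<bullet> e = 0" "w \<bullet> perp e = 0" using \<Phi>c[of w] by simp_all
    have "fst w = (w \<bullet> e) * fst e - (w \<bullet> perp e) * snd e" "snd w = (w \<bullet> e) * snd e + (w \<bullet> perp e) * fst e"
      using ee by (simp_all add: inner_pair perp_def) algebra+
    then show "w = 0" using 1 by (simp add: prod_eq_iff)
  qed
  define f where "f i = \<Phi> (pos (p i))" for i
  define g where "g j = \<Phi> (pos (q j))" for j
  have f1: "f i $ 1 = u (p i)" "f i $ 2 = v (p i)" and g1: "g j $ 1 = u (q j)" "g j $ 2 = v (q j)" for i j
    by (simp_all add: f_def g_def \<Phi>c u_def v_def)
  obtain M where M: "\<And>z. z \<in> f ` {..k} \<union> g ` {..m} \<Longrightarrow> norm z \<le> M" and M0: "0 \<le> M"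
  proof -
    have "bounded (f ` {..k} \<union> g ` {..m})" by (intro finite_imp_bounded) auto
    then obtain M where M: "\<forall>z\<in>f ` {..k} \<union> g ` {..m}. norm z \<le> M" unfolding bounded_iff by blast
    show ?thesis
    proof (rule that[of "max M 0"])
      fix z assume "z \<in> f ` {..k} \<union> g ` {..m}"
      with M have "norm z \<le> M" by blast
      then show "norm z \<le> max M 0" by simp
    qed simp
  qed
  have cb: "z \<in> cbox (vector [-M, -M]) (vector [M, M]) \<longleftrightarrow> -M \<le> z $ 1 \<and> z $ 1 \<le> M \<and> -M \<le> z $ 2 \<and> z $ 2 \<le> M" for z :: "real^2"
    by (auto simp: mem_box_cart forall_2)
  have inb: "f i \<in> cbox (vector [-M, -M]) (vector [M, M])" if "i \<le> k" for i
    using M[of "f i"] that component_le_norm_cart[of "f i" 1] component_le_norm_cart[of "f i" 2] by (auto simp: cb)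
  have ing: "g j \<in> cbox (vector [-M, -M]) (vector [M, M])" if "j \<le> m" for j
    using M[of "g j"] that component_le_norm_cart[of "g j" 1] component_le_norm_cart[of "g j" 2] by (auto simp: cb)
  obtain F where F: "path F" "pathstart F = f 0" "pathfinish F = f k"
    "path_image F \<subseteq> {z. \<exists>i\<le>k. \<exists>j\<le>k. (j = i \<or> j = Suc i) \<and> z \<in> closed_segment (f i) (f j)}"
    using polygonal_path[of f k] by blast
  obtain G where G: "path G" "pathstart G = g 0" "pathfinish G = g m"
    "path_image G \<subseteq> {z. \<exists>i\<le>m. \<exists>j\<le>m. (j = i \<or> j = Suc i) \<and> z \<in> closed_segment (g i) (g j)}"
    using polygonal_path[of g m] by blast
  \<comment> \<open>The points where the prolongations reach the sides of the box: \<open>a\<close>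
    left, \<open>b\<close> right, \<open>c\<close> bottom, \<open>d\<close> top.\<close>
  define a :: "real^2" where "a = vector [-M, v (p 0)]"
  define b :: "real^2" where "b = vector [M, v (p k)]"
  define c :: "real^2" where "c = vector [u (q 0), -M]"
  define d :: "real^2" where "d = vector [u (q m), M]"
  have abcd: "a $ 1 = -M" "a $ 2 = v (p 0)" "b $ 1 = M" "b $ 2 = v (p k)"
    "c $ 1 = u (q 0)" "c $ 2 = -M" "d $ 1 = u (q m)" "d $ 2 = M"
    by (simp_all add: a_def b_def c_def d_def)
  let ?F = "linepath a (f 0) +++ (F +++ linepath (f k) b)"
  let ?G = "linepath c (g 0) +++ (G +++ linepath (g m) d)"
  have iF: "path_image ?F = closed_segment a (f 0) \<union> (path_image F \<union> closed_segment (f k) b)"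
    using F by (simp add: path_image_join)
  have iG: "path_image ?G = closed_segment c (g 0) \<union> (path_image G \<union> closed_segment (g m) d)"
    using G by (simp add: path_image_join)
  have conv: "closed_segment x y \<subseteq> cbox (vector [-M, -M]) (vector [M, M])"
    if "x \<in> cbox (vector [-M, -M]) (vector [M, M])" "y \<in> cbox (vector [-M, -M]) (vector [M, M])" for x y :: "real^2"
    using that by (intro closed_segment_subset) (auto simp: convex_box)
  have inabcd: "a \<in> cbox (vector [-M, -M]) (vector [M, M])" "b \<in> cbox (vector [-M, -M]) (vector [M, M])"
    "c \<in> cbox (vector [-M, -M]) (vector [M, M])" "d \<in> cbox (vector [-M, -M]) (vector [M, M])"
    using inb[of 0] inb[of k] ing[of 0] ing[of m] M0 by (auto simp: cb abcd f1 g1)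
  have sF: "path_image ?F \<subseteq> cbox (vector [-M, -M]) (vector [M, M])"
  proof -
    have "path_image F \<subseteq> cbox (vector [-M, -M]) (vector [M, M])"
    proof
      fix z assume "z \<in> path_image F"
      with F(4) obtain i j where "i \<le> k" "j \<le> k" "z \<in> closed_segment (f i) (f j)" by blast
      with conv[OF inb[of i] inb[of j]] show "z \<in> cbox (vector [-M, -M]) (vector [M, M])" by auto
    qed
    then show ?thesis unfolding iF by (intro Un_least conv inb inabcd) auto
  qed
  have sG: "path_image ?G \<subseteq> cbox (vector [-M, -M]) (vector [M, M])"
  proof -
    have "path_image G \<subseteq> cbox (vector [-M, -M]) (vector [M, M])"
    proof
      fix z assume "z \<in> path_image G"
      with G(4) obtain i j where "i \<le> m" "j \<le> m" "z \<in> closed_segment (g i) (g j)" by blast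
      with conv[OF ing[of i] ing[of j]] show "z \<in> cbox (vector [-M, -M]) (vector [M, M])" by auto
    qed
    then show ?thesis unfolding iG by (intro Un_least conv ing inabcd) auto
  qed
  have pF: "path ?F" using F by (intro path_join_imp) simp_all
  have pG: "path ?G" using G by (intro path_join_imp) simp_all
  have ends: "pathstart ?F $ 1 = (vector [-M, -M] :: real^2) $ 1" "pathfinish ?F $ 1 = (vector [M, M] :: real^2) $ 1"
    "pathstart ?G $ 2 = (vector [-M, -M] :: real^2) $ 2" "pathfinish ?G $ 2 = (vector [M, M] :: real^2) $ 2"
    by (simp_all add: abcd)
  obtain z where z: "z \<in> path_image ?F" "z \<in> path_image ?G"
    by (rule fashoda[OF pF pG sF sG ends])
  have zF: "z \<in> path_image F \<or> z $ 1 \<le> - A \<or> A \<le> z $ 1"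
    using z(1) unfolding iF
  proof (elim UnE)
    assume *: "z \<in> closed_segment a (f 0)"
    have "z $ 1 \<le> - A"
      using pu inb[of 0] by (intro segment_component(2)[OF *]) (simp_all add: abcd f1 cb)
    then show ?thesis by simp
  next
    assume *: "z \<in> closed_segment (f k) b"
    have "A \<le> z $ 1"
      using pu inb[of k] by (intro segment_component(1)[OF *]) (simp_all add: abcd f1 cb)
    then show ?thesis by simp
  qed simp
  have zFv: "z \<in> path_image F \<Longrightarrow> v0 \<le> z $ 2 \<and> z $ 2 \<le> v1"
  proof -
    assume "z \<in> path_image F"
    with F(4) obtain i j where ij: "i \<le> k" "j \<le> k" and *: "z \<in> closed_segment (f i) (f j)" by blast
    show ?thesis using pv[OF ij(1)] pv[OF ij(2)] segment_component(1)[OF *, where k = 2 and l = v0]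
        segment_component(2)[OF *, where k = 2 and l = v1] by (simp add: f1)
  qed
  have q2: "\<bar>u (q 0)\<bar> < A" "\<bar>u (q m)\<bar> < A" using qu by auto
  have zG: "\<bar>z $ 1\<bar> < A \<and> (z \<in> path_image G \<or> z $ 2 < v0 \<or> v1 < z $ 2)"
    using z(2) unfolding iG
  proof (elim UnE)
    assume *: "z \<in> closed_segment c (g 0)"
    have "z $ 1 < A" using q2 by (intro segment_component(4)[OF *]) (auto simp: abcd g1)
    moreover have "- A < z $ 1" using q2 by (intro segment_component(3)[OF *]) (auto simp: abcd g1)
    moreover have "z $ 2 < v0" using qv ing[of 0] by (intro segment_component(4)[OF *]) (auto simp: abcd g1 cb)
    ultimately show ?thesis by auto
  next
    assume *: "z \<in> closed_segment (g m) d"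
    have "z $ 1 < A" using q2 by (intro segment_component(4)[OF *]) (auto simp: abcd g1)
    moreover have "- A < z $ 1" using q2 by (intro segment_component(3)[OF *]) (auto simp: abcd g1)
    moreover have "v1 < z $ 2" using qv ing[of m] by (intro segment_component(3)[OF *]) (auto simp: abcd g1 cb)
    ultimately show ?thesis by auto
  next
    assume zz: "z \<in> path_image G"
    with G(4) obtain i j where ij: "i \<le> m" "j \<le> m" and *: "z \<in> closed_segment (g i) (g j)" by blast
    have "z $ 1 < A" using qu[OF ij(1)] qu[OF ij(2)] by (intro segment_component(4)[OF *]) (auto simp: g1)
    moreover have "- A < z $ 1" using qu[OF ij(1)] qu[OF ij(2)] by (intro segment_component(3)[OF *]) (auto simp: g1)
    ultimately show ?thesis using zz by auto
  qed
  \<comment> \<open>On the prolongations of \<open>p\<close> the first coordinate has modulus at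
    least \<open>A\<close>, which never happens along \<open>?G\<close>. So \<open>z\<close> lies on
    the polygon of \<open>p\<close>, its second coordinate is between \<open>v0\<close> and
    \<open>v1\<close>, and this excludes the prolongations of \<open>q\<close>.\<close>
  from zF zG have zF': "z \<in> path_image F" by auto
  with zFv zG have zG': "z \<in> path_image G" by auto
  from zF' F(4) obtain i j where ij: "i \<le> k" "j \<le> k" "j = i \<or> j = Suc i" and s1: "z \<in> closed_segment (f i) (f j)" by blast
  from zG' G(4) obtain i' j' where ij': "i' \<le> m" "j' \<le> m" "j' = i' \<or> j' = Suc i'" and s2: "z \<in> closed_segment (g i') (g j')" by blast
  from s1 obtain w where w: "z = \<Phi> w" "w \<in> closed_segment (pos (p i)) (pos (p j))"
    unfolding f_def closed_segment_linear_image[OF lin] by blast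
  from s2 obtain w' where w': "z = \<Phi> w'" "w' \<in> closed_segment (pos (q i')) (pos (q j'))"
    unfolding g_def closed_segment_linear_image[OF lin] by blast
  have "w' = w" using w(1) w'(1) inj by (simp add: inj_def)
  have 1: "p i = p j \<or> adj (p i) (p j)" using ij p by (auto simp: Suc_le_eq)
  have 2: "q i' = q j' \<or> adj (q i') (q j')" using ij' q by (auto simp: Suc_le_eq)
  have "(\<lfloor>fst w\<rfloor>, \<lfloor>snd w\<rfloor>) \<in> {p i, p j}" by (rule floor_mem_edge[OF 1 w(2)])
  moreover have "(\<lfloor>fst w\<rfloor>, \<lfloor>snd w\<rfloor>) \<in> {q i', q j'}" using floor_mem_edge[OF 2 w'(2)] \<open>w' = w\<close> by simp
  ultimately show ?thesis using ij(1,2) ij'(1,2) by (metis empty_iff insert_iff)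
qed

section \<open>Chains of cells\<close>

abbreviation dst :: "site \<Rightarrow> site \<Rightarrow> real" where
  "dst p q \<equiv> dist (pos p) (pos q)"

lemma dst_adj: "adj p q \<Longrightarrow> dst p q = 1"
  by (auto simp: adj_iff pos_def dist_prod_def dist_real_def)

lemma dst_coord: "real_of_int \<bar>fst p - fst q\<bar> \<le> dst p q" "real_of_int \<bar>snd p - snd q\<bar> \<le> dst p q"
proof -
  have "dist (fst (pos p)) (fst (pos q)) \<le> dst p q" "dist (snd (pos p)) (snd (pos q)) \<le> dst p q"
    by (rule dist_fst_le, rule dist_snd_le)
  then show "real_of_int \<bar>fst p - fst q\<bar> \<le> dst p q" "real_of_int \<bar>snd p - snd q\<bar> \<le> dst p q"
    by (simp_all add: pos_def dist_real_def)
qed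

lemma dst_le_of_coord:
  assumes "\<bar>fst p - fst q\<bar> \<le> a" "\<bar>snd p - snd q\<bar> \<le> b"
  shows "dst p q \<le> real_of_int a + real_of_int b"
proof -
  have "dst p q \<le> dist (fst (pos p)) (fst (pos q)) + dist (snd (pos p)) (snd (pos q))"
    unfolding dist_prod_def by (intro sqrt_sum_squares_le_sum) auto
  also have "\<dots> \<le> real_of_int a + real_of_int b"
    using assms by (auto simp: pos_def dist_real_def)
  finally show ?thesis .
qed

text \<open>Cut the path greedily at the first time it is at distance \<open>l\<close> from the last
  cut. Each piece takes at least \<open>c\<close> steps and advances by at most
  \<open>l + 1\<close>, the 1 being the overshoot of a step; the final incomplete piece accounts for
  the subtracted \<open>l\<close>.\<close>

lemma length_lower_bound:
  fixes g :: "nat \<Rightarrow> site" and l c :: real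
  assumes l: "l > 0" and c: "c \<ge> 0" and ab: "a \<le> b"
    and adj: "\<And>i. a \<le> i \<Longrightarrow> i < b \<Longrightarrow> adj (g i) (g (Suc i))"
    and good: "\<And>i j. a \<le> i \<Longrightarrow> i \<le> j \<Longrightarrow> j \<le> b \<Longrightarrow> l \<le> dst (g i) (g j) \<Longrightarrow> c \<le> real (j - i)"
  shows "c * (dst (g a) (g b) - l) \<le> (l + 1) * real (b - a)"
  using ab adj good
proof (induction "b - a" arbitrary: a rule: less_induct)
  case less
  show ?case
  proof (cases "l \<le> dst (g a) (g b)")
    case False
    then have "c * (dst (g a) (g b) - l) \<le> 0" using c by (intro mult_nonneg_nonpos) auto
    also have "0 \<le> (l + 1) * real (b - a)" using l by simp
    finally show ?thesis .
  next
    case True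
    define i where "i = (LEAST i. a \<le> i \<and> l \<le> dst (g a) (g i))"
    have i: "a \<le> i" "l \<le> dst (g a) (g i)" and ib: "i \<le> b"
      using LeastI[of "\<lambda>i. a \<le> i \<and> l \<le> dst (g a) (g i)" b] Least_le[of "\<lambda>i. a \<le> i \<and> l \<le> dst (g a) (g i)" b]
        True less.prems(1) by (auto simp: i_def)
    have "i \<noteq> a" using i l by auto
    then have ai: "a < i" using i by simp
    then obtain i' where i': "i = Suc i'" "a \<le> i'" by (cases i) auto
    have "\<not> (a \<le> i' \<and> l \<le> dst (g a) (g i'))"
      using not_less_Least[of i' "\<lambda>i. a \<le> i \<and> l \<le> dst (g a) (g i)"] i' by (simp add: i_def[symmetric])
    then have "dst (g a) (g i') < l" using i' by simp
    moreover have "dst (g i') (g i) = 1" using less.prems(2)[of i'] i' ib by (auto intro: dst_adj)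
    ultimately have d1: "dst (g a) (g i) \<le> l + 1"
      using dist_triangle[of "pos (g a)" "pos (g i)" "pos (g i')"] by linarith
    have ci: "c \<le> real (i - a)" using less.prems(3)[of a i] i ib by simp
    have IH: "c * (dst (g i) (g b) - l) \<le> (l + 1) * real (b - i)"
      by (rule less.hyps) (use ai ib less.prems i in \<open>auto intro: order_trans\<close>)
    have "dst (g a) (g b) \<le> (l + 1) + dst (g i) (g b)"
      using d1 dist_triangle[of "pos (g a)" "pos (g b)" "pos (g i)"] by linarith
    then have "c * (dst (g a) (g b) - l) \<le> c * ((l + 1) + (dst (g i) (g b) - l))"
      using c by (intro mult_left_mono) auto
    also have "\<dots> = (l + 1) * c + c * (dst (g i) (g b) - l)" by (simp add: algebra_simps)
    also have "\<dots> \<le> (l + 1) * real (i - a) + (l + 1) * real (b - i)"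
      using ci IH l by (intro add_mono mult_left_mono) auto
    also have "\<dots> = (l + 1) * real (b - a)" using i ib by (simp add: algebra_simps of_nat_diff)
    finally show ?thesis .
  qed
qed

text \<open>Cutting just after the last visit to the ball, rather than at the first exit, ensures
  that the path never again comes within \<open>R\<close> of an earlier cut point. This global
  separation is what makes the cells of \<open>cell_chain\<close> distinct.\<close>

lemma last_exit_decomposition:
  fixes g :: "nat \<Rightarrow> site" and R :: real
  assumes R: "R \<ge> 0" and adj: "\<And>i. i < k \<Longrightarrow> adj (g i) (g (Suc i))" and s: "s \<le> k"
  shows "\<exists>J t. t 0 = s \<and> (\<forall>j\<le>J. t j \<le> k) \<and> (\<forall>j<J. t j < t (Suc j)) \<and>
    (\<forall>j<J. dst (g (t j)) (g (t (Suc j))) \<le> R + 1) \<and>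
    (\<forall>j<J. \<forall>i. t (Suc j) \<le> i \<longrightarrow> i \<le> k \<longrightarrow> R < dst (g (t j)) (g i)) \<and>
    dst (g (t J)) (g k) \<le> R"
  using s
proof (induction "k - s" arbitrary: s rule: less_induct)
  case less
  show ?case
  proof (cases "dst (g s) (g k) \<le> R")
    case True
    then show ?thesis using less.prems by (intro exI[of _ 0] exI[of _ "\<lambda>_. s"]) auto
  next
    case False
    let ?I = "{i. s \<le> i \<and> i \<le> k \<and> dst (g s) (g i) \<le> R}"
    have fin: "finite ?I" by (rule finite_subset[of _ "{..k}"]) auto
    have sI: "s \<in> ?I" using R less.prems by simp
    define i0 where "i0 = Max ?I"
    have i0: "i0 \<in> ?I" unfolding i0_def using fin sI by (intro Max_in) auto
    have mx: "i \<le> i0" if "i \<in> ?I" for i unfolding i0_def using fin that by (rule Max_ge)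
    have "i0 \<noteq> k" using i0 False by auto
    then have i0k: "i0 < k" using i0 by auto
    have far: "R < dst (g s) (g i)" if "Suc i0 \<le> i" "i \<le> k" for i
    proof (rule ccontr)
      assume "\<not> ?thesis"
      then have "i \<in> ?I" using that i0 by auto
      from mx[OF this] that show False by simp
    qed
    have "dst (g i0) (g (Suc i0)) = 1" using adj i0k by (intro dst_adj) auto
    then have near: "dst (g s) (g (Suc i0)) \<le> R + 1"
      using i0 dist_triangle[of "pos (g s)" "pos (g (Suc i0))" "pos (g i0)"] by simp
    have "k - Suc i0 < k - s" "Suc i0 \<le> k" using i0 i0k by auto
    from less.hyps[OF this] obtain J t where t: "t 0 = Suc i0" "\<forall>j\<le>J. t j \<le> k" "\<forall>j<J. t j < t (Suc j)"
      "\<forall>j<J. dst (g (t j)) (g (t (Suc j))) \<le> R + 1"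
      "\<forall>j<J. \<forall>i. t (Suc j) \<le> i \<longrightarrow> i \<le> k \<longrightarrow> R < dst (g (t j)) (g i)"
      "dst (g (t J)) (g k) \<le> R" by blast
    let ?t = "case_nat s t"
    have "\<forall>j\<le>Suc J. ?t j \<le> k" using t(2) less.prems by (auto split: nat.split)
    moreover have "\<forall>j<Suc J. ?t j < ?t (Suc j)" using t(1,3) i0 by (auto split: nat.split)
    moreover have "\<forall>j<Suc J. dst (g (?t j)) (g (?t (Suc j))) \<le> R + 1" using t(1,4) near by (auto split: nat.split)
    moreover have "\<forall>j<Suc J. \<forall>i. ?t (Suc j) \<le> i \<longrightarrow> i \<le> k \<longrightarrow> R < dst (g (?t j)) (g i)"
      using t(1,5) far by (auto split: nat.split)
    ultimately show ?thesis using t(6) by (intro exI[of _ "Suc J"] exI[of _ ?t]) auto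
  qed
qed

definition cell :: "nat \<Rightarrow> site \<Rightarrow> site" where
  "cell r p = (fst p div int r, snd p div int r)"

definition sdist :: "site \<Rightarrow> site \<Rightarrow> int" where
  "sdist z z' = max \<bar>fst z - fst z'\<bar> \<bar>snd z - snd z'\<bar>"

lemma div_close:
  fixes x y :: int assumes "r > 0" "\<bar>x - y\<bar> \<le> 3 * r" shows "\<bar>x div r - y div r\<bar> \<le> 3"
proof -
  have "r * (x div r) = x - x mod r" "r * (y div r) = y - y mod r" by (simp_all add: minus_mod_eq_mult_div)
  then have e: "r * (x div r - y div r) = (x - y) - (x mod r - y mod r)" by (simp add: algebra_simps)
  have "0 \<le> x mod r" "x mod r < r" "0 \<le> y mod r" "y mod r < r" using assms by auto
  then have "\<bar>r * (x div r - y div r)\<bar> < 4 * r" unfolding e using assms(2) by linarith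
  then have "r * \<bar>x div r - y div r\<bar> < r * 4" using assms by (simp add: abs_mult)
  then have "\<bar>x div r - y div r\<bar> < 4" using assms by (simp only: mult_less_cancel_left_pos)
  then show ?thesis by simp
qed

lemma div_same:
  fixes x y :: int assumes "r > 0" "x div r = y div r" shows "\<bar>x - y\<bar> < r"
proof -
  have "r * (x div r) = x - x mod r" "r * (y div r) = y - y mod r" by (simp_all add: minus_mod_eq_mult_div)
  then have e: "x - y = x mod r - y mod r" using assms(2) by simp
  have "0 \<le> x mod r" "x mod r < r" "0 \<le> y mod r" "y mod r < r" using assms by auto
  then show ?thesis unfolding e by linarith
qed

text \<open>With radius 2r, two sites of one cell of side r are closer than the radius, so different
  cut points lie in different cells; a jump of at most 2r + 1 <= 3r moves each cell coordinate by at
  most 3.\<close>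

lemma cell_chain:
  fixes g :: "nat \<Rightarrow> site" and r :: nat
  assumes r: "r \<ge> 1" and adj: "\<And>i. i < k \<Longrightarrow> adj (g i) (g (Suc i))"
  obtains J t where "t 0 = 0" "\<And>j. j \<le> J \<Longrightarrow> t j \<le> k" "\<And>j. j < J \<Longrightarrow> t j < t (Suc j)"
    "\<And>j. j < J \<Longrightarrow> 2 * real r < dst (g (t j)) (g (t (Suc j)))"
    "\<And>j. j < J \<Longrightarrow> sdist (cell r (g (t j))) (cell r (g (t (Suc j)))) \<le> 3"
    "inj_on (\<lambda>j. cell r (g (t j))) {..<J}"
    "dst (g 0) (g k) \<le> real (Suc J) * (2 * real r + 1)"
proof -
  let ?R = "2 * real r"
  obtain J t where t: "t 0 = 0" "\<forall>j\<le>J. t j \<le> k" "\<forall>j<J. t j < t (Suc j)"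
    "\<forall>j<J. dst (g (t j)) (g (t (Suc j))) \<le> ?R + 1"
    "\<forall>j<J. \<forall>i. t (Suc j) \<le> i \<longrightarrow> i \<le> k \<longrightarrow> ?R < dst (g (t j)) (g i)"
    "dst (g (t J)) (g k) \<le> ?R"
    using last_exit_decomposition[of ?R k g 0] adj by auto
  have mono: "t i \<le> t j" if "i \<le> j" "j \<le> J" for i j
    using that
  proof (induction j rule: dec_induct)
    case (step n)
    then have "t n \<le> t (Suc n)" using t(3) by (auto intro: less_imp_le)
    with step show ?case by auto
  qed simp
  have sep: "?R < dst (g (t i)) (g (t j))" if "i < j" "j < J" for i j
    using t(2) t(5)[rule_format, of i "t j"] mono[of "Suc i" j] that by auto
  have inj: "inj_on (\<lambda>j. cell r (g (t j))) {..<J}"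
  proof (rule linorder_inj_onI')
    fix i j assume ij: "i \<in> {..<J}" "j \<in> {..<J}" "i < j"
    show "cell r (g (t i)) \<noteq> cell r (g (t j))"
    proof
      assume "cell r (g (t i)) = cell r (g (t j))"
      then have "\<bar>fst (g (t i)) - fst (g (t j))\<bar> < int r" "\<bar>snd (g (t i)) - snd (g (t j))\<bar> < int r"
        using r by (auto simp: cell_def intro!: div_same)
      then have "\<bar>fst (g (t i)) - fst (g (t j))\<bar> \<le> int r - 1" "\<bar>snd (g (t i)) - snd (g (t j))\<bar> \<le> int r - 1"
        by simp_all
      then have "dst (g (t i)) (g (t j)) \<le> real_of_int (int r - 1) + real_of_int (int r - 1)"
        by (rule dst_le_of_coord)
      with sep[of i j] ij show False by auto
    qed
  qed
  have close: "sdist (cell r (g (t j))) (cell r (g (t (Suc j)))) \<le> 3" if "j < J" for j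
  proof -
    have d: "dst (g (t j)) (g (t (Suc j))) \<le> 3 * real r" using t(4)[rule_format, OF that] r by linarith
    have "real_of_int \<bar>fst (g (t j)) - fst (g (t (Suc j)))\<bar> \<le> real_of_int (3 * int r)"
      "real_of_int \<bar>snd (g (t j)) - snd (g (t (Suc j)))\<bar> \<le> real_of_int (3 * int r)"
      using order_trans[OF dst_coord(1) d] order_trans[OF dst_coord(2) d] by simp_all
    then have "\<bar>fst (g (t j)) - fst (g (t (Suc j)))\<bar> \<le> 3 * int r" "\<bar>snd (g (t j)) - snd (g (t (Suc j)))\<bar> \<le> 3 * int r"
      by (simp_all only: of_int_le_iff)
    then show ?thesis using r by (auto simp: sdist_def cell_def intro!: div_close)
  qed
  have len: "dst (g 0) (g (t j)) \<le> real j * (?R + 1)" if "j \<le> J" for j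
    using that
  proof (induction j)
    case (Suc j)
    then have "dst (g 0) (g (t j)) \<le> real j * (?R + 1)" "dst (g (t j)) (g (t (Suc j))) \<le> ?R + 1" using t(4) by auto
    then show ?case using dist_triangle[of "pos (g 0)" "pos (g (t (Suc j)))" "pos (g (t j))"]
      by (simp add: algebra_simps)
  qed (simp add: t(1))
  have tot: "dst (g 0) (g k) \<le> real (Suc J) * (?R + 1)"
    using len[of J] t(6) dist_triangle[of "pos (g 0)" "pos (g k)" "pos (g (t J))"] by (simp add: algebra_simps)
  have cross: "?R < dst (g (t j)) (g (t (Suc j)))" if "j < J" for j
    using t(2) t(5)[rule_format, OF that, of "t (Suc j)"] that by auto
  show ?thesis using that[of t J] t(1,2,3) cross close inj tot by blast
qed

text \<open>Chains are stored in reverse, with the latest cell at the head. Each extension has at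
  most 7 * 7 = 49 choices.\<close>

fun rchains :: "site set \<Rightarrow> nat \<Rightarrow> site list set" where
  "rchains S 0 = {[]}"
| "rchains S (Suc n) = (if n = 0 then (\<lambda>z. [z]) ` S
     else (\<Union>zs\<in>rchains S n. (\<lambda>z. z # zs) ` {z. sdist (hd zs) z \<le> 3}))"

lemma sdist_ball: "{z. sdist y z \<le> 3} \<subseteq> {fst y - 3..fst y + 3} \<times> {snd y - 3..snd y + 3}"
  by (auto simp: sdist_def)

lemma card_sdist_ball: "finite {z. sdist y z \<le> 3}" "card {z. sdist y z \<le> 3} \<le> 49"
proof -
  show "finite {z. sdist y z \<le> 3}" by (rule finite_subset[OF sdist_ball]) auto
  have "card {z. sdist y z \<le> 3} \<le> card ({fst y - 3..fst y + 3} \<times> {snd y - 3..snd y + 3})"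
    by (intro card_mono sdist_ball) auto
  then show "card {z. sdist y z \<le> 3} \<le> 49" by (simp add: card_cartesian_product)
qed

lemma rchains_finite_card:
  assumes S: "finite S"
  shows "finite (rchains S n) \<and> card (rchains S n) \<le> (if n = 0 then 1 else card S * 49 ^ n)"
proof (induction n)
  case (Suc n)
  show ?case
  proof (cases "n = 0")
    case True
    have "card ((\<lambda>z. [z]) ` S) \<le> card S" using S by (rule card_image_le)
    also have "\<dots> \<le> card S * 49" by simp
    finally show ?thesis using True S by simp
  next
    case False
    have f: "finite (rchains S n)" and c: "card (rchains S n) \<le> card S * 49 ^ n" using Suc False by auto
    have "card (\<Union>zs\<in>rchains S n. (\<lambda>z. z # zs) ` {z. sdist (hd zs) z \<le> 3}) \<le> (\<Sum>zs\<in>rchains S n. card ((\<lambda>z. z # zs) ` {z. sdist (hd zs) z \<le> 3}))"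
      by (rule card_UN_le[OF f])
    also have "\<dots> \<le> (\<Sum>zs\<in>rchains S n. 49)"
    proof (rule sum_mono)
      fix zs
      have "card ((\<lambda>z. z # zs) ` {z. sdist (hd zs) z \<le> 3}) \<le> card {z. sdist (hd zs) z \<le> 3}"
        by (rule card_image_le[OF card_sdist_ball(1)])
      then show "card ((\<lambda>z. z # zs) ` {z. sdist (hd zs) z \<le> 3}) \<le> 49" using card_sdist_ball(2)[of "hd zs"] by simp
    qed
    also have "\<dots> \<le> card S * 49 ^ Suc n" using c by simp
    finally show ?thesis using False f card_sdist_ball(1) by auto
  qed
qed simp

lemma chain_in_rchains:
  assumes "n \<ge> 1" "z 0 \<in> S" "\<And>j. Suc j < n \<Longrightarrow> sdist (z j) (z (Suc j)) \<le> 3"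
  shows "map z (rev [0..<n]) \<in> rchains S n"
  using assms
proof (induction n rule: nat_induct_at_least)
  case (Suc n)
  then have "map z (rev [0..<n]) \<in> rchains S n" by auto
  moreover have "hd (map z (rev [0..<n])) = z (n - 1)" using Suc by (cases n) auto
  moreover have "sdist (z (n - 1)) (z n) \<le> 3" using Suc.prems(2)[of "n - 1"] Suc.hyps by auto
  ultimately have "map z (rev [0..<Suc n]) \<in> (\<lambda>y. y # map z (rev [0..<n])) ` {y. sdist (hd (map z (rev [0..<n]))) y \<le> 3}"
    and "map z (rev [0..<n]) \<in> rchains S n" by auto
  then show ?case using Suc.hyps by (simp only: rchains.simps) auto
qed auto

context gaussian_field
begin

text \<open>Sort the bad cells by their coordinates modulo \<open>k\<close>: one of the k^2 classes
  holds at least n / (2 k^2) of them, and distinct cells of one class are at least \<open>k\<close>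
  apart, hence independent. The factor 2 per cell pays for the choice of the subset.\<close>

lemma chain_probability:
  fixes z :: "nat \<Rightarrow> site" and Kz :: "site \<Rightarrow> site set"
  assumes loc: "\<And>y. local_ev (Kz y) (E y)" and k: "k \<ge> 1"
    and sep: "\<And>y y'. sdist y y' \<ge> int k \<Longrightarrow> Kz y \<inter> Kz y' = {}"
    and pE: "\<And>y. pr (E y) \<le> \<tau>" and \<tau>: "0 < \<tau>" "\<tau> \<le> 1" and inj: "inj_on z {..<n}"
  shows "pr (\<lambda>h. n \<le> 2 * card {j. j < n \<and> E (z j) h}) \<le> (2 * \<tau> powr (1 / (2 * real k ^ 2))) ^ n"
proof -
  define \<F> where "\<F> = {T \<in> Pow {..<n}. real n / (2 * real k ^ 2) \<le> real (card T) \<and>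
      disjoint_family_on (\<lambda>j. Kz (z j)) T}"
  have fF: "finite \<F>" by (simp add: \<F>_def)
  have cF: "card \<F> \<le> 2 ^ n"
  proof -
    have "card \<F> \<le> card (Pow {..<n})" by (intro card_mono) (auto simp: \<F>_def)
    then show ?thesis by (simp add: card_Pow)
  qed
  let ?K = "\<Union>j<n. Kz (z j)"
  have fK: "finite ?K" using local_ev_finite[OF loc] by blast
  have le: "local_ev ?K (\<lambda>h. \<forall>j\<in>T. E (z j) h)" if "T \<in> \<F>" for T
  proof (rule local_ev_Ball[OF _ fK])
    show "finite T" using that by (auto simp: \<F>_def intro: finite_subset)
    fix j assume "j \<in> T"
    then show "local_ev ?K (E (z j))" using that by (intro local_ev_mono[OF loc _ fK]) (auto simp: \<F>_def)
  qed
  have pT: "pr (\<lambda>h. \<forall>j\<in>T. E (z j) h) \<le> (\<tau> powr (1 / (2 * real k ^ 2))) ^ n" if T: "T \<in> \<F>" for T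
  proof -
    have fT: "finite T" using T by (auto simp: \<F>_def intro: finite_subset)
    have "pr (\<lambda>h. \<forall>j\<in>T. E (z j) h) = (\<Prod>j\<in>T. pr (E (z j)))"
      by (rule pr_indep_Ball[OF fT loc]) (use T in \<open>simp add: \<F>_def\<close>)
    also have "\<dots> \<le> (\<Prod>j\<in>T. \<tau>)" using pE by (intro prod_mono) auto
    also have "\<dots> = \<tau> powr real (card T)" using \<tau> by (simp add: powr_realpow)
    also have "\<dots> \<le> \<tau> powr (real n / (2 * real k ^ 2))" using \<tau> T by (intro powr_mono') (auto simp: \<F>_def)
    also have "\<dots> = (\<tau> powr (1 / (2 * real k ^ 2))) ^ n"
      using \<tau> by (simp add: powr_realpow[symmetric] powr_powr)
    finally show ?thesis .
  qed
  have cover: "\<exists>T\<in>\<F>. \<forall>j\<in>T. E (z j) h" if H: "n \<le> 2 * card {j. j < n \<and> E (z j) h}" for h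
  proof -
    let ?T = "{j. j < n \<and> E (z j) h}"
    have fT: "finite ?T" by auto
    let ?B = "{0..<int k} \<times> {0..<int k}"
    let ?f = "\<lambda>j. (fst (z j) mod int k, snd (z j) mod int k)"
    have "\<exists>c\<in>?B. real n / (2 * real k ^ 2) \<le> real (card {j \<in> ?T. ?f j = c})"
    proof (rule ccontr)
      assume "\<not> ?thesis"
      then have lt: "real (card {j \<in> ?T. ?f j = c}) < real n / (2 * real k ^ 2)" if "c \<in> ?B" for c
        using that by (meson not_le)
      have sub: "?T \<subseteq> (\<Union>c\<in>?B. {j \<in> ?T. ?f j = c})" using k by auto
      have "card ?T \<le> card (\<Union>c\<in>?B. {j \<in> ?T. ?f j = c})"
        by (rule card_mono[OF _ sub]) (rule finite_subset[of _ "{..<n}"], auto)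
      also have "\<dots> \<le> (\<Sum>c\<in>?B. card {j \<in> ?T. ?f j = c})" by (rule card_UN_le) simp
      finally have "real (card ?T) \<le> real (\<Sum>c\<in>?B. card {j \<in> ?T. ?f j = c})" by (simp only: of_nat_le_iff)
      then have "real (card ?T) \<le> (\<Sum>c\<in>?B. real (card {j \<in> ?T. ?f j = c}))" by (simp only: of_nat_sum)
      also have "\<dots> < (\<Sum>c\<in>?B. real n / (2 * real k ^ 2))"
        using k lt by (intro sum_strict_mono) auto
      also have "\<dots> = real n / 2" using k by (simp add: power2_eq_square card_cartesian_product)
      finally show False using H by simp
    qed
    then obtain c where c: "real n / (2 * real k ^ 2) \<le> real (card {j \<in> ?T. ?f j = c})" by blast
    let ?T' = "{j \<in> ?T. ?f j = c}"
    have "disjoint_family_on (\<lambda>j. Kz (z j)) ?T'"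
      unfolding disjoint_family_on_def
    proof (intro ballI impI sep)
      fix i j assume ij: "i \<in> ?T'" "j \<in> ?T'" "i \<noteq> j"
      then have "z i \<noteq> z j" using inj by (auto simp: inj_on_def)
      then have "fst (z i) \<noteq> fst (z j) \<or> snd (z i) \<noteq> snd (z j)" by (simp add: prod_eq_iff)
      moreover have "fst (z i) mod int k = fst (z j) mod int k" "snd (z i) mod int k = snd (z j) mod int k"
        using ij by auto
      then have "int k dvd fst (z i) - fst (z j)" "int k dvd snd (z i) - snd (z j)"
        by (simp_all only: mod_eq_dvd_iff)
      moreover note this
      ultimately show "int k \<le> sdist (z i) (z j)"
        unfolding sdist_def using dvd_imp_le_int[of "fst (z i) - fst (z j)" "int k"]
          dvd_imp_le_int[of "snd (z i) - snd (z j)" "int k"] by auto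
    qed
    with c have "?T' \<in> \<F>" unfolding \<F>_def by (intro CollectI conjI PowI) auto
    moreover have "\<forall>j\<in>?T'. E (z j) h" by simp
    ultimately show ?thesis by (rule rev_bexI)
  qed
  have "pr (\<lambda>h. n \<le> 2 * card {j. j < n \<and> E (z j) h}) \<le> pr (\<lambda>h. \<exists>T\<in>\<F>. \<forall>j\<in>T. E (z j) h)"
    by (intro pr_mono ev_Bex fF local_ev_ev[OF le] cover)
  also have "\<dots> \<le> (\<Sum>T\<in>\<F>. pr (\<lambda>h. \<forall>j\<in>T. E (z j) h))"
    by (intro pr_Bex_le fF local_ev_ev[OF le])
  also have "\<dots> \<le> (\<Sum>T\<in>\<F>. (\<tau> powr (1 / (2 * real k ^ 2))) ^ n)" by (intro sum_mono pT)
  also have "\<dots> = real (card \<F>) * (\<tau> powr (1 / (2 * real k ^ 2))) ^ n" by simp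
  also have "\<dots> \<le> 2 ^ n * (\<tau> powr (1 / (2 * real k ^ 2))) ^ n"
    using cF by (intro mult_right_mono) (auto simp: of_nat_le_iff[of _ "2 ^ n", symmetric] simp del: of_nat_le_iff)
  finally show ?thesis by (simp add: power_mult_distrib)
qed

text \<open>The union is over 49^n chains per starting cell, each with a subset factor 2^n, so 98
  must be beaten. Returning one event \<open>F\<close> that serves all chains keeps the enumeration
  by lists out of the applications.\<close>

lemma peierls:
  fixes Kz :: "site \<Rightarrow> site set"
  assumes loc: "\<And>y. local_ev (Kz y) (E y)" and k: "k \<ge> 1"
    and sep: "\<And>y y'. sdist y y' \<ge> int k \<Longrightarrow> Kz y \<inter> Kz y' = {}"
    and pE: "\<And>y. pr (E y) \<le> \<tau>" and \<tau>: "0 < \<tau>" "\<tau> \<le> 1"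
    and small: "98 * \<tau> powr (1 / (2 * real k ^ 2)) \<le> 1 / 2"
    and S: "finite S" and n: "n \<ge> 1"
  shows "\<exists>F. ev F \<and> pr F \<le> real (card S) * (1 / 2) ^ n \<and>
    (\<forall>h z. z 0 \<in> S \<longrightarrow> (\<forall>j. Suc j < n \<longrightarrow> sdist (z j) (z (Suc j)) \<le> 3) \<longrightarrow> inj_on z {..<n} \<longrightarrow>
       n \<le> 2 * card {j. j < n \<and> E (z j) h} \<longrightarrow> F h)"
proof -
  let ?C = "{zs \<in> rchains S n. length zs = n \<and> distinct zs}"
  have fC: "finite ?C" using rchains_finite_card[OF S] by simp
  have cC: "card ?C \<le> card S * 49 ^ n"
  proof -
    have "card ?C \<le> card (rchains S n)" using rchains_finite_card[OF S, of n] by (intro card_mono) auto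
    then show ?thesis using rchains_finite_card[OF S, of n] n by auto
  qed
  let ?\<theta> = "\<tau> powr (1 / (2 * real k ^ 2))"
  let ?G = "\<lambda>zs h. n \<le> 2 * card {j. j < n \<and> E (zs ! (n - 1 - j)) h}"
  have inj: "inj_on (\<lambda>j. zs ! (n - 1 - j)) {..<n}" if "zs \<in> ?C" for zs
    using that by (auto simp: inj_on_def nth_eq_iff_index_eq)
  have evG: "ev (?G zs)" for zs
  proof -
    let ?K = "\<Union>j<n. Kz (zs ! (n - 1 - j))"
    have fK: "finite ?K" using local_ev_finite[OF loc] by blast
    have "local_ev ?K (\<lambda>h. (\<lambda>T. n \<le> 2 * card T) {j \<in> {..<n}. E (zs ! (n - 1 - j)) h})"
      by (intro local_ev_combine fK local_ev_mono[OF loc _ fK]) auto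
    then show ?thesis using local_ev_ev by (auto simp: conj_commute)
  qed
  let ?F = "\<lambda>h. \<exists>zs\<in>?C. ?G zs h"
  have "pr ?F \<le> (\<Sum>zs\<in>?C. pr (?G zs))" by (intro pr_Bex_le fC evG)
  also have "\<dots> \<le> (\<Sum>zs\<in>?C. (2 * ?\<theta>) ^ n)"
    by (intro sum_mono chain_probability[OF loc k sep pE \<tau> inj]) auto
  also have "\<dots> = real (card ?C) * (2 * ?\<theta>) ^ n" by simp
  also have "\<dots> \<le> real (card S * 49 ^ n) * (2 * ?\<theta>) ^ n"
    using cC by (intro mult_right_mono) (simp_all only: of_nat_le_iff, simp)
  also have "\<dots> = real (card S) * (98 * ?\<theta>) ^ n"
  proof -
    have "(98 :: real) ^ n = 49 ^ n * 2 ^ n" using power_mult_distrib[of "49 :: real" 2 n] by simp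
    then show ?thesis by (simp add: power_mult_distrib)
  qed
  also have "\<dots> \<le> real (card S) * (1 / 2) ^ n"
    using small by (intro mult_left_mono power_mono) auto
  finally have 1: "pr ?F \<le> real (card S) * (1 / 2) ^ n" .
  have 2: "?F h" if "z 0 \<in> S" "\<forall>j. Suc j < n \<longrightarrow> sdist (z j) (z (Suc j)) \<le> 3" "inj_on z {..<n}"
    "n \<le> 2 * card {j. j < n \<and> E (z j) h}" for h z
  proof
    let ?zs = "map z (rev [0..<n])"
    show "?zs \<in> ?C" using chain_in_rchains[OF n, of z S] that(1,2,3) by (auto simp: distinct_map inj_on_def)
    have "?zs ! (n - 1 - j) = z j" if "j < n" for j using that by (simp add: rev_nth)
    then have "{j. j < n \<and> E (?zs ! (n - 1 - j)) h} = {j. j < n \<and> E (z j) h}" by auto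
    then show "?G ?zs h" using that(4) by simp
  qed
  have 3: "ev ?F" by (intro ev_Bex fC evG)
  show ?thesis by (intro exI[of _ ?F] conjI 1 3 allI impI) (rule 2)
qed

end

text \<open>Separation 21 suits boxes of radius 10r around cells of side r, see
  \<open>Lam_snap_disjoint\<close>. Then 2 * 21^2 = 882, and 98 / 196 = 1 / 2.\<close>

lemma peierls_constant: "\<exists>\<tau>>0. \<tau> \<le> 1 \<and> 98 * \<tau> powr (1 / (2 * real 21 ^ 2)) \<le> 1 / 2"
proof (intro exI[of _ "(1 / 196) powr 882"] conjI)
  show "(0::real) < (1 / 196) powr 882" by simp
  show "(1 / 196 :: real) powr 882 \<le> 1" using powr_mono'[of 0 882 "1 / 196 :: real"] by simp
  have "1 / (2 * real 21 ^ 2) = (1 / 882 :: real)" by simp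
  then have "((1 / 196 :: real) powr 882) powr (1 / (2 * real 21 ^ 2)) = 1 / 196" unfolding powr_powr by (simp only:) simp
  then show "98 * ((1 / 196) powr 882) powr (1 / (2 * real 21 ^ 2)) \<le> 1 / 2" by simp
qed


section \<open>Tubes\<close>

definition Lam :: "nat \<Rightarrow> site \<Rightarrow> site set" where
  "Lam n x = {v. sdist v x \<le> int n}"

lemma Lam_eq: "Lam n x = {fst x - int n..fst x + int n} \<times> {snd x - int n..snd x + int n}"
  by (auto simp: Lam_def sdist_def)

lemma finite_Lam [simp]: "finite (Lam n x)"
  by (simp add: Lam_eq)

lemma card_Lam: "card (Lam n x) = (2 * n + 1)\<^sup>2"
  by (simp add: Lam_eq card_cartesian_product power2_eq_square nat_add_distrib nat_mult_distrib)

lemma sdist_sym: "sdist a b = sdist b a"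
  by (simp add: sdist_def abs_minus_commute)

lemma sdist_triangle: "sdist a c \<le> sdist a b + sdist b c"
  unfolding sdist_def by linarith

lemma sdist_le_dst: "real_of_int (sdist p q) \<le> dst p q"
  using dst_coord[of p q] by (simp add: sdist_def max_def)

text \<open>3/2 serves as a rational upper bound for the square root of 2.\<close>

lemma dst_le_sdist: "dst p q \<le> 3 / 2 * real_of_int (sdist p q)"
proof -
  let ?s = "real_of_int (sdist p q)"
  have s: "\<bar>real_of_int (fst p - fst q)\<bar> \<le> ?s" "\<bar>real_of_int (snd p - snd q)\<bar> \<le> ?s" "0 \<le> ?s"
    by (simp_all add: sdist_def)
  have "dst p q = sqrt ((real_of_int (fst p - fst q))\<^sup>2 + (real_of_int (snd p - snd q))\<^sup>2)"
    by (simp add: dist_prod_def pos_def dist_real_def)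
  also have "\<dots> \<le> sqrt (?s\<^sup>2 + ?s\<^sup>2)"
    using s by (intro real_sqrt_le_mono add_mono) (simp_all add: abs_le_square_iff[symmetric])
  also have "\<dots> \<le> sqrt ((3 / 2 * ?s)\<^sup>2)"
    by (intro real_sqrt_le_mono) (simp add: power2_eq_square)
  also have "\<dots> = 3 / 2 * ?s" using s by simp
  finally show ?thesis .
qed

lemma Lam_mono: assumes "sdist x y + int m \<le> int n" shows "Lam m x \<subseteq> Lam n y"
proof
  fix v assume "v \<in> Lam m x"
  then show "v \<in> Lam n y" using sdist_triangle[of v y x] assms by (simp add: Lam_def)
qed

lemma pos_add: "pos (p + q) = pos p + pos q" and pos_diff: "pos (p - q) = pos p - pos q"
  by (simp_all add: pos_def)

lemma perp_linear: "perp (a + b) = perp a + perp b" "perp (a - b) = perp a - perp b" "perp (r *\<^sub>R a) = r *\<^sub>R perp a"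
  by (simp_all add: perp_def)

lemma perp_inner: "perp a \<bullet> perp b = a \<bullet> b"
  by (simp add: inner_pair perp_def)

lemma perp_perp: "perp (perp a) = - a"
  by (simp add: perp_def prod_eq_iff)

lemma perp_pow_inner: "(perp ^^ m) a \<bullet> (perp ^^ m) b = a \<bullet> b"
  by (induction m) (simp_all add: perp_inner)

lemma perp_pow_diff: "(perp ^^ m) (a - b) = (perp ^^ m) a - (perp ^^ m) b"
  by (induction m) (simp_all add: perp_linear)

lemma perp_pow_norm: "norm ((perp ^^ m) a) = norm a"
  by (simp add: norm_eq_sqrt_inner perp_pow_inner)

definition rotS :: "site \<Rightarrow> site" where
  "rotS p = (- snd p, fst p)"

lemma pos_rotS1: "pos (rotS p) = perp (pos p)"
  by (simp add: pos_def rotS_def perp_def)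

lemma pos_rotS: "pos ((rotS ^^ m) p) = (perp ^^ m) (pos p)"
  by (induction m) (simp_all add: pos_rotS1)

lemma adj_rotS: "adj (rotS u) (rotS v) \<longleftrightarrow> adj u v"
  by (auto simp: adj_def rotS_def)

lemma lattice_iso_rotS: "lattice_iso rotS"
  unfolding lattice_iso_def using adj_rotS
  by (auto simp: rotS_def prod_eq_iff intro!: o_bij[of "\<lambda>p. (snd p, - fst p)"])

lemma lattice_iso_add: "lattice_iso (\<lambda>p. p + x)"
  unfolding lattice_iso_def
  by (auto simp: adj_def prod_eq_iff intro!: o_bij[of "\<lambda>p. p - x"])

lemma lattice_iso_comp: "lattice_iso S \<Longrightarrow> lattice_iso T \<Longrightarrow> lattice_iso (S \<circ> T)"
  unfolding lattice_iso_def by (auto intro: bij_comp)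

lemma lattice_iso_rotS_pow: "lattice_iso (rotS ^^ m)"
proof (induction m)
  case 0
  show ?case by (auto simp: lattice_iso_def bij_def)
next
  case (Suc m)
  show ?case unfolding funpow.simps by (rule lattice_iso_comp[OF lattice_iso_rotS Suc])
qed

text \<open>Quarter turns about \<open>c\<close> followed by the translation from \<open>c\<close>
  to \<open>x\<close>. Since a general rotation does not preserve the lattice, a tube in direction
  \<open>e\<close> is compared only with tubes in the four directions obtained by quarter
  turns.\<close>

definition move :: "nat \<Rightarrow> site \<Rightarrow> site \<Rightarrow> site \<Rightarrow> site" where
  "move m c x p = (rotS ^^ m) (p - c) + x"

lemma lattice_iso_move: "lattice_iso (move m c x)"
proof -
  have "lattice_iso ((\<lambda>p. p + x) \<circ> ((rotS ^^ m) \<circ> (\<lambda>p. p + (- c))))"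
    by (intro lattice_iso_comp lattice_iso_add lattice_iso_rotS_pow)
  also have "(\<lambda>p. p + x) \<circ> ((rotS ^^ m) \<circ> (\<lambda>p. p + (- c))) = move m c x"
    by (auto simp: move_def)
  finally show ?thesis .
qed

lemma pos_move: "pos (move m c x p) - pos (move m c x p') = (perp ^^ m) (pos p - pos p')"
  by (simp add: move_def pos_add pos_rotS pos_diff perp_pow_diff)

lemma sdist_rotS: "sdist ((rotS ^^ m) p) ((rotS ^^ m) q) = sdist p q"
proof -
  have "sdist (rotS a) (rotS b) = sdist a b" for a b
    by (simp add: sdist_def rotS_def max.commute abs_minus_commute)
  then show ?thesis by (induction m) simp_all
qed

lemma move_self: "move m c x c = x"
proof -
  have "(rotS ^^ m) 0 = 0" by (induction m) (auto simp: rotS_def zero_prod_def)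
  then show ?thesis by (simp add: move_def)
qed

lemma sdist_move: "sdist (move m c x p) (move m c x q) = sdist p q"
proof -
  have "sdist (move m c x p) (move m c x q) = sdist ((rotS ^^ m) (p - c)) ((rotS ^^ m) (q - c))"
    by (simp add: move_def sdist_def)
  also have "\<dots> = sdist p q" unfolding sdist_rotS by (simp add: sdist_def)
  finally show ?thesis .
qed

lemma move_Lam: "move m c x ` Lam n c = Lam n x"
proof -
  have b: "bij (move m c x)" using lattice_iso_move by (simp add: lattice_iso_def)
  show ?thesis
  proof (intro set_eqI iffI)
    fix v assume "v \<in> move m c x ` Lam n c"
    then obtain p where p: "v = move m c x p" "p \<in> Lam n c" by blast
    then show "v \<in> Lam n x" using sdist_move[of m c x p c] by (simp add: Lam_def move_self)
  next
    fix v assume v: "v \<in> Lam n x"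
    obtain p where p: "v = move m c x p" using surjD[OF bij_is_surj[OF b]] by blast
    have "p \<in> Lam n c" using v sdist_move[of m c x p c] by (simp add: Lam_def move_self p)
    then show "v \<in> move m c x ` Lam n c" using p by blast
  qed
qed

text \<open>\<open>crosses e q c S\<close>: the set \<open>S\<close> contains a lattice path that crosses, in the long direction \<open>e\<close>,
  the rectangle of length \<open>16 q\<close> and width \<open>4 q\<close> centred at \<open>c\<close>.\<close>

definition crosses :: "real \<times> real \<Rightarrow> nat \<Rightarrow> site \<Rightarrow> site set \<Rightarrow> bool" where
  "crosses e q c S \<longleftrightarrow> (\<exists>g k. walk S g k \<and> (pos (g 0) - pos c) \<bullet> e \<le> - 8 * real q \<and> 8 * real q \<le> (pos (g k) - pos c) \<bullet> e \<and>
     (\<forall>i\<le>k. \<bar>(pos (g i) - pos c) \<bullet> perp e\<bar> \<le> 2 * real q \<and> \<bar>(pos (g i) - pos c) \<bullet> e\<bar> \<le> 8 * real q + 1))"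

text \<open>A crossing has coordinates of size at most 8q + 1 and 2q relative to \<open>c\<close>,
  so only sites within 10q + 1 of \<open>c\<close> matter.\<close>

lemma crosses_mono: "crosses e q c S \<Longrightarrow> (\<And>v. v \<in> S \<Longrightarrow> dst v c \<le> 10 * real q + 1 \<Longrightarrow> v \<in> S') \<Longrightarrow> norm e = 1 \<Longrightarrow> crosses e q c S'"
proof -
  assume a: "crosses e q c S" and S: "\<And>v. v \<in> S \<Longrightarrow> dst v c \<le> 10 * real q + 1 \<Longrightarrow> v \<in> S'" and e: "norm e = 1"
  from a obtain g k where g: "walk S g k" "(pos (g 0) - pos c) \<bullet> e \<le> - 8 * real q" "8 * real q \<le> (pos (g k) - pos c) \<bullet> e"
    "\<And>i. i \<le> k \<Longrightarrow> \<bar>(pos (g i) - pos c) \<bullet> perp e\<bar> \<le> 2 * real q \<and> \<bar>(pos (g i) - pos c) \<bullet> e\<bar> \<le> 8 * real q + 1"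
    unfolding crosses_def by blast
  have "g i \<in> S'" if "i \<le> k" for i
  proof (rule S)
    show "g i \<in> S" using g(1) that by (simp add: walk_def)
    let ?w = "pos (g i) - pos c"
    have ee: "fst e * fst e + snd e * snd e = 1"
      using e by (cases e) (simp add: norm_Pair power2_eq_square)
    have w: "?w = (?w \<bullet> e) *\<^sub>R e + (?w \<bullet> perp e) *\<^sub>R perp e"
    proof -
      obtain a b where ab: "?w = (a, b)" by (cases ?w)
      have "a = (a * fst e + b * snd e) * fst e + (b * fst e - a * snd e) * (- snd e)"
        "b = (a * fst e + b * snd e) * snd e + (b * fst e - a * snd e) * fst e"
        using ee by algebra+
      then show ?thesis unfolding ab by (cases e) (simp add: inner_pair perp_def)
    qed
    have "norm ?w \<le> \<bar>?w \<bullet> e\<bar> * norm e + \<bar>?w \<bullet> perp e\<bar> * norm (perp e)"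
      by (subst w) (metis norm_scaleR norm_triangle_ineq)
    moreover have "norm (perp e) = 1" using perp_pow_norm[of 1 e] e by simp
    ultimately show "dst (g i) c \<le> 10 * real q + 1"
      using g(4)[OF that] e by (simp add: dist_norm)
  qed
  then have "walk S' g k" using g(1) by (simp add: walk_def)
  then show ?thesis unfolding crosses_def using g(2-4) by blast
qed

lemma crosses_move:
  assumes "crosses e q c S"
  shows "crosses ((perp ^^ m) e) q (move m c x c) (move m c x ` S)"
proof -
  from assms obtain g k where g: "walk S g k" "(pos (g 0) - pos c) \<bullet> e \<le> - 8 * real q" "8 * real q \<le> (pos (g k) - pos c) \<bullet> e"
    "\<And>i. i \<le> k \<Longrightarrow> \<bar>(pos (g i) - pos c) \<bullet> perp e\<bar> \<le> 2 * real q \<and> \<bar>(pos (g i) - pos c) \<bullet> e\<bar> \<le> 8 * real q + 1"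
    unfolding crosses_def by blast
  let ?g = "\<lambda>i. move m c x (g i)"
  have adjm: "adj (move m c x u) (move m c x v) = adj u v" for u v
    using lattice_iso_move[of m c x] unfolding lattice_iso_def by blast
  have w: "walk (move m c x ` S) ?g k" using g(1) by (simp add: walk_def adjm)
  have u: "(pos (?g i) - pos (move m c x c)) \<bullet> (perp ^^ m) e = (pos (g i) - pos c) \<bullet> e"
    "(pos (?g i) - pos (move m c x c)) \<bullet> perp ((perp ^^ m) e) = (pos (g i) - pos c) \<bullet> perp e" for i
    unfolding pos_move funpow_swap1[symmetric] by (simp_all add: perp_pow_inner funpow_swap1)
  show ?thesis unfolding crosses_def
    by (rule exI[of _ ?g], rule exI[of _ k]) (use w g(2-4) in \<open>simp add: u\<close>)
qed

text \<open>The disagreement is computed in a box around the tube itself, so the event is local; its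
  radius is a large multiple \<open>L\<close> of the width so that every box used in the argument by
  contradiction fits inside.\<close>

definition tube :: "real \<times> real \<Rightarrow> nat \<Rightarrow> nat \<Rightarrow> site \<Rightarrow> (site \<Rightarrow> real) \<Rightarrow> bool" where
  "tube e q L c h \<longleftrightarrow> crosses e q c (disagree (Lam (L * q) c) h)"

lemma tube_move:
  assumes "tube e q L c (h \<circ> move m c x)"
  shows "tube ((perp ^^ m) e) q L x h"
  using crosses_move[OF assms[unfolded tube_def], of m x] sets_iso(3)[OF lattice_iso_move[of m c x], of "Lam (L * q) c" h]
  by (simp add: tube_def move_Lam move_self)

text \<open>With the centre moved by 4q, the tube occupies perpendicular coordinates from 2q to 6q.
  Its half-length 8q exceeds 6q, so the four tubes obtained by quarter turns overlap at the corners
  and enclose the middle. Rounding to a lattice site displaces the centre by at most 1.\<close>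

definition ringc :: "real \<times> real \<Rightarrow> nat \<Rightarrow> site" where
  "ringc e q = (round (4 * real q * fst (perp e)), round (4 * real q * snd (perp e)))"

lemma ringc_err:
  assumes "norm e = 1"
  shows "\<bar>pos (ringc e q) \<bullet> e\<bar> \<le> 1" "\<bar>pos (ringc e q) \<bullet> perp e - 4 * real q\<bar> \<le> 1" "norm (pos (ringc e q)) \<le> 4 * real q + 1"
proof -
  let ?r = "pos (ringc e q) - (4 * real q) *\<^sub>R perp e"
  have pn: "norm (perp e) = 1" using perp_pow_norm[of 1 e] assms by simp
  have "\<bar>fst ?r\<bar> \<le> 1 / 2" "\<bar>snd ?r\<bar> \<le> 1 / 2"
    unfolding ringc_def pos_def
    by (simp_all only: fst_conv snd_conv fst_diff snd_diff fst_scaleR snd_scaleR real_scaleR_def of_int_round_abs_le)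
  then have n: "norm ?r \<le> 1"
  proof -
    have "norm ?r \<le> \<bar>fst ?r\<bar> + \<bar>snd ?r\<bar>"
      using norm_Pair_le[of "fst ?r" "snd ?r"] by (simp only: prod.collapse real_norm_def)
    then show ?thesis using \<open>\<bar>fst ?r\<bar> \<le> 1 / 2\<close> \<open>\<bar>snd ?r\<bar> \<le> 1 / 2\<close> by linarith
  qed
  have "\<bar>?r \<bullet> e\<bar> \<le> 1" "\<bar>?r \<bullet> perp e\<bar> \<le> 1"
    using Cauchy_Schwarz_ineq2[of ?r e] Cauchy_Schwarz_ineq2[of ?r "perp e"] n assms pn by simp_all
  moreover have "perp e \<bullet> e = 0" "perp e \<bullet> perp e = 1"
    using pn by (simp_all add: inner_pair perp_def norm_eq_1[symmetric])  (simp add: norm_eq_1 inner_pair perp_def)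
  ultimately show "\<bar>pos (ringc e q) \<bullet> e\<bar> \<le> 1" "\<bar>pos (ringc e q) \<bullet> perp e - 4 * real q\<bar> \<le> 1"
    by (simp_all add: inner_diff_left)
  have "norm (pos (ringc e q)) \<le> norm ?r + norm ((4 * real q) *\<^sub>R perp e)"
    using norm_triangle_ineq[of ?r "(4 * real q) *\<^sub>R perp e"] by simp
  then show "norm (pos (ringc e q)) \<le> 4 * real q + 1" using n pn by simp
qed

definition ringcm :: "real \<times> real \<Rightarrow> nat \<Rightarrow> site \<Rightarrow> nat \<Rightarrow> site" where
  "ringcm e q x m = (rotS ^^ m) (ringc e q) + x"

lemma ring_tube_coords:
  assumes e: "norm e = 1"
  shows "\<bar>(pos p - pos x) \<bullet> (perp ^^ m) e - (pos p - pos (ringcm e q x m)) \<bullet> (perp ^^ m) e\<bar> \<le> 1"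
    "\<bar>(pos p - pos x) \<bullet> perp ((perp ^^ m) e) - (pos p - pos (ringcm e q x m)) \<bullet> perp ((perp ^^ m) e) - 4 * real q\<bar> \<le> 1"
proof -
  have 1: "pos (ringcm e q x m) - pos x = (perp ^^ m) (pos (ringc e q))"
    by (simp add: ringcm_def pos_add pos_rotS)
  have 2: "(pos p - pos x) \<bullet> w - (pos p - pos (ringcm e q x m)) \<bullet> w = (perp ^^ m) (pos (ringc e q)) \<bullet> w" for w
    unfolding 1[symmetric] by (simp add: inner_diff_left)
  have 3: "perp ((perp ^^ m) e) = (perp ^^ m) (perp e)" by (simp add: funpow_swap1)
  show "\<bar>(pos p - pos x) \<bullet> (perp ^^ m) e - (pos p - pos (ringcm e q x m)) \<bullet> (perp ^^ m) e\<bar> \<le> 1"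
    unfolding 2 perp_pow_inner by (rule ringc_err(1)[OF e])
  show "\<bar>(pos p - pos x) \<bullet> perp ((perp ^^ m) e) - (pos p - pos (ringcm e q x m)) \<bullet> perp ((perp ^^ m) e) - 4 * real q\<bar> \<le> 1"
    unfolding 2 unfolding 3 perp_pow_inner by (rule ringc_err(2)[OF e])
qed

lemma sdist_ringcm: assumes "norm e = 1" shows "sdist (ringcm e q x m) x \<le> 4 * int q + 1"
proof -
  have "dst (ringcm e q x m) x = norm ((perp ^^ m) (pos (ringc e q)))"
    by (simp add: dist_norm ringcm_def pos_add pos_rotS)
  then have "dst (ringcm e q x m) x \<le> 4 * real q + 1" using ringc_err(3)[OF assms] by (simp add: perp_pow_norm)
  then have "real_of_int (sdist (ringcm e q x m) x) \<le> real_of_int (4 * int q + 1)"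
    using sdist_le_dst[of "ringcm e q x m" x] by simp
  then show ?thesis by (simp only: of_int_le_iff)
qed

lemma crossing_path_around:
  assumes "crosses ((perp ^^ m) e) q (ringcm e q x m) S" "norm e = 1"
  obtains g k where "walk S g k" "(pos (g 0) - pos x) \<bullet> (perp ^^ m) e \<le> - (8 * real q - 1)"
    "8 * real q - 1 \<le> (pos (g k) - pos x) \<bullet> (perp ^^ m) e"
    "\<And>i. i \<le> k \<Longrightarrow> 2 * real q - 1 \<le> (pos (g i) - pos x) \<bullet> perp ((perp ^^ m) e)"
    "\<And>i. i \<le> k \<Longrightarrow> (pos (g i) - pos x) \<bullet> perp ((perp ^^ m) e) \<le> 6 * real q + 1"
proof -
  let ?e = "(perp ^^ m) e" and ?c = "ringcm e q x m"
  from assms(1) obtain g k where g: "walk S g k" "(pos (g 0) - pos ?c) \<bullet> ?e \<le> - 8 * real q" "8 * real q \<le> (pos (g k) - pos ?c) \<bullet> ?e"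
    "\<And>i. i \<le> k \<Longrightarrow> \<bar>(pos (g i) - pos ?c) \<bullet> perp ?e\<bar> \<le> 2 * real q \<and> \<bar>(pos (g i) - pos ?c) \<bullet> ?e\<bar> \<le> 8 * real q + 1"
    unfolding crosses_def by blast
  show ?thesis
  proof (rule that[of g k])
    show "walk S g k" by fact
    show "(pos (g 0) - pos x) \<bullet> ?e \<le> - (8 * real q - 1)" using ring_tube_coords(1)[OF assms(2), of "g 0" x m q] g(2) by linarith
    show "8 * real q - 1 \<le> (pos (g k) - pos x) \<bullet> ?e" using ring_tube_coords(1)[OF assms(2), of "g k" x m q] g(3) by linarith
    fix i assume i: "i \<le> k"
    show "2 * real q - 1 \<le> (pos (g i) - pos x) \<bullet> perp ?e" using ring_tube_coords(2)[OF assms(2), of "g i" x m q] g(4)[OF i] by linarith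
    show "(pos (g i) - pos x) \<bullet> perp ?e \<le> 6 * real q + 1" using ring_tube_coords(2)[OF assms(2), of "g i" x m q] g(4)[OF i] by linarith
  qed
qed

lemma adj_diff: "adj (u - x) (v - x) = adj u v"
  by (simp add: adj_def)

lemma paths_meet:
  assumes e: "norm e = 1" and p: "\<And>i. i < k \<Longrightarrow> adj (p i) (p (Suc i))" and q: "\<And>j. j < m \<Longrightarrow> adj (q j) (q (Suc j))"
    and pu: "(pos (p 0) - pos x) \<bullet> e \<le> - A" "A \<le> (pos (p k) - pos x) \<bullet> e"
    and pv: "\<And>i. i \<le> k \<Longrightarrow> v0 \<le> (pos (p i) - pos x) \<bullet> perp e" "\<And>i. i \<le> k \<Longrightarrow> (pos (p i) - pos x) \<bullet> perp e \<le> v1"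
    and qv: "(pos (q 0) - pos x) \<bullet> perp e < v0" "v1 < (pos (q m) - pos x) \<bullet> perp e"
    and qu: "\<And>j. j \<le> m \<Longrightarrow> \<bar>(pos (q j) - pos x) \<bullet> e\<bar> < A"
  shows "\<exists>i\<le>k. \<exists>j\<le>m. p i = q j"
proof -
  have "\<exists>i\<le>k. \<exists>j\<le>m. p i - x = q j - x"
    by (rule lattice_paths_cross[OF e, of k "\<lambda>i. p i - x" m "\<lambda>j. q j - x" A v0 v1])
      (use p q pu pv qv qu in \<open>simp_all add: adj_diff pos_diff\<close>)
  then show ?thesis by simp
qed

lemma Lam_of_coords:
  assumes e: "norm e = 1" and q: "q \<ge> 4"
    and b: "\<bar>(pos p - pos x) \<bullet> e\<bar> \<le> 6 * real q + 1" "\<bar>(pos p - pos x) \<bullet> perp e\<bar> \<le> 6 * real q + 1"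
  shows "p \<in> Lam (12 * q) x"
proof -
  let ?w = "pos p - pos x"
  have "norm ?w ^ 2 = (?w \<bullet> e)\<^sup>2 + (?w \<bullet> perp e)\<^sup>2"
  proof -
    obtain a b where ab: "?w = (a, b)" by (cases ?w)
    obtain c d where e': "e = (c, d)" by (cases e)
    have "c\<^sup>2 + d\<^sup>2 = 1" using e by (simp add: e' norm_Pair)
    then have "a\<^sup>2 + b\<^sup>2 = (a * c + b * d)\<^sup>2 + (a * - d + b * c)\<^sup>2" by algebra
    then show ?thesis unfolding ab e' by (simp add: norm_Pair inner_pair perp_def)
  qed
  also have "\<dots> \<le> (6 * real q + 1)\<^sup>2 + (6 * real q + 1)\<^sup>2"
    using b by (intro add_mono) (auto simp: abs_le_square_iff[symmetric])
  also have "\<dots> \<le> (12 * real q)\<^sup>2"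
  proof -
    have "(6 * real q + 1)\<^sup>2 \<le> (7 * real q)\<^sup>2" using q by (intro power_mono) auto
    moreover have "(7 * real q)\<^sup>2 = 49 * (real q)\<^sup>2" "(12 * real q)\<^sup>2 = 144 * (real q)\<^sup>2" by (simp_all add: power_mult_distrib)
    moreover have "0 \<le> (real q)\<^sup>2" by simp
    ultimately show ?thesis by linarith
  qed
  finally have "norm ?w \<le> 12 * real q" by (rule power2_le_imp_le) simp
  then have "real_of_int (sdist p x) \<le> real_of_int (12 * int q)" using sdist_le_dst[of p x] by (simp add: dist_norm)
  then show "p \<in> Lam (12 * q) x" by (simp only: of_int_le_iff Lam_def mem_Collect_eq of_nat_mult of_nat_numeral)
qed

text \<open>\<open>U\<close> is what can be reached from the inner box without touching the four
  crossings. A walk out of the ring first leaves through one side; up to that moment its lateral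
  coordinate is below the half-length of the tube on that side, so it must meet the crossing
  there.\<close>

lemma ring_separates:
  assumes e: "norm e = 1" and q: "q \<ge> 4"
    and ring: "\<And>m. m < 4 \<Longrightarrow> crosses ((perp ^^ m) e) q (ringcm e q x m) S"
  shows "\<exists>U. Lam q x \<subseteq> U \<and> U \<subseteq> Lam (12 * q) x \<and> (\<forall>u\<in>U. \<forall>v. v \<notin> U \<longrightarrow> adj u v \<longrightarrow> v \<in> S)"
proof -
  let ?e = "\<lambda>m. (perp ^^ m) e"
  have ne: "norm (?e m) = 1" for m using e by (simp add: perp_pow_norm)
  define Q where "Q m g k \<longleftrightarrow> walk S g k \<and> (pos (g 0) - pos x) \<bullet> ?e m \<le> - (8 * real q - 1) \<and>
    8 * real q - 1 \<le> (pos (g k) - pos x) \<bullet> ?e m \<and>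
    (\<forall>i\<le>k. 2 * real q - 1 \<le> (pos (g i) - pos x) \<bullet> perp (?e m)) \<and>
    (\<forall>i\<le>k. (pos (g i) - pos x) \<bullet> perp (?e m) \<le> 6 * real q + 1)" for m g k
  have ex: "\<exists>gk. Q m (fst gk) (snd gk)" if m: "m < 4" for m
    by (rule crossing_path_around[OF ring[OF m] e]) (auto simp: Q_def intro!: exI[of _ "(_, _)"])
  define G where "G m = fst (SOME gk. Q m (fst gk) (snd gk))" for m
  define K where "K m = snd (SOME gk. Q m (fst gk) (snd gk))" for m
  have Q: "Q m (G m) (K m)" if "m < 4" for m
    unfolding G_def K_def using someI_ex[OF ex[OF that]] .
  have GK: "\<And>m. m < 4 \<Longrightarrow> walk S (G m) (K m)"
    "\<And>m. m < 4 \<Longrightarrow> (pos (G m 0) - pos x) \<bullet> ?e m \<le> - (8 * real q - 1)"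
    "\<And>m. m < 4 \<Longrightarrow> 8 * real q - 1 \<le> (pos (G m (K m)) - pos x) \<bullet> ?e m"
    "\<And>m i. m < 4 \<Longrightarrow> i \<le> K m \<Longrightarrow> 2 * real q - 1 \<le> (pos (G m i) - pos x) \<bullet> perp (?e m)"
    "\<And>m i. m < 4 \<Longrightarrow> i \<le> K m \<Longrightarrow> (pos (G m i) - pos x) \<bullet> perp (?e m) \<le> 6 * real q + 1"
    using Q unfolding Q_def by blast+
  define P where "P = (\<Union>m<4. G m ` {..K m})"
  have PS: "P \<subseteq> S" using GK(1) by (auto simp: P_def walk_def)
  have small: "\<bar>(pos p - pos x) \<bullet> w\<bar> < 2 * real q - 1" if "p \<in> Lam q x" "norm w = 1" for p w
  proof -
    have "sdist p x \<le> int q" using that by (simp add: Lam_def)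
    then have "dst p x \<le> 3 / 2 * real q" using dst_le_sdist[of p x] by linarith
    then have "\<bar>(pos p - pos x) \<bullet> w\<bar> \<le> 3 / 2 * real q"
      using Cauchy_Schwarz_ineq2[of "pos p - pos x" w] that by (simp add: dist_norm)
    also have "\<dots> < 2 * real q - 1" using q by simp
    finally show ?thesis .
  qed
  have np: "norm (perp (?e m)) = 1" for m using ne[of m] perp_pow_norm[of 1 "?e m"] by simp
  have QP: "Lam q x \<inter> P = {}"
  proof (rule ccontr)
    assume "\<not> ?thesis"
    then obtain m i where mi: "m < 4" "i \<le> K m" "G m i \<in> Lam q x" by (auto simp: P_def)
    from GK(4)[OF mi(1,2)] small[OF mi(3) np[of m]] show False by linarith
  qed
  define U where "U = {v. \<exists>g k. walk (- P) g k \<and> g 0 \<in> Lam q x \<and> g k = v}"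
  have QU: "Lam q x \<subseteq> U"
  proof
    fix v assume v: "v \<in> Lam q x"
    then have "walk (- P) (\<lambda>_. v) 0" using QP by (auto simp: walk_def)
    then show "v \<in> U" unfolding U_def using v by (intro CollectI exI[of _ "\<lambda>_. v"] exI[of _ 0]) simp
  qed
  have bdU: "v \<in> P" if uv: "u \<in> U" "v \<notin> U" "adj u v" for u v
  proof (rule ccontr)
    assume v: "v \<notin> P"
    from uv obtain g k where g: "walk (- P) g k" "g 0 \<in> Lam q x" "g k = u" by (auto simp: U_def)
    have "walk (- P) (g(Suc k := v)) (Suc k)" using g uv v by (intro walk_extend) auto
    then have "v \<in> U" unfolding U_def using g by (intro CollectI exI[of _ "g(Suc k := v)"] exI[of _ "Suc k"]) auto
    with uv show False by simp
  qed
  \<comment> \<open>Beyond one of the four sides: the vectors \<open>perp (?e m)\<close> are the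
    outward normals. At the first far site the lateral coordinate is at most 6q + 2, one step more
    than before, and this is below 8q - 1.\<close>
  define far where "far p \<longleftrightarrow> (\<exists>m<4. 6 * real q + 1 < (pos p - pos x) \<bullet> perp (?e m))" for p
  have e4: "perp (?e 0) = perp e" "perp (?e (Suc 0)) = - e" "perp (?e 2) = - perp e" "perp (?e 3) = e"
    by (simp_all add: perp_perp eval_nat_numeral) (simp_all add: perp_def)
  have near: "\<bar>(pos p - pos x) \<bullet> ?e m\<bar> \<le> 6 * real q + 1" if "\<not> far p" "m < 4" for p m
  proof -
    have l: "(pos p - pos x) \<bullet> perp (?e m) \<le> 6 * real q + 1" if "m < 4" for m using \<open>\<not> far p\<close> that by (force simp: far_def)
    have b: "\<bar>(pos p - pos x) \<bullet> e\<bar> \<le> 6 * real q + 1" "\<bar>(pos p - pos x) \<bullet> perp e\<bar> \<le> 6 * real q + 1"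
      using l[of 0] l[of "Suc 0"] l[of 2] l[of 3] unfolding e4 by (auto simp: abs_le_iff)
    have "m = 0 \<or> m = Suc 0 \<or> m = 2 \<or> m = 3" using that(2) by auto
    moreover have "?e 0 = e" "?e (Suc 0) = perp e" "?e 2 = - e" "?e 3 = - perp e"
      by (simp_all add: perp_perp eval_nat_numeral) (simp_all add: perp_def)
    ultimately show ?thesis using b by auto
  qed
  have nofar: "\<not> far v" if "v \<in> U" for v
  proof
    assume fv: "far v"
    from that obtain g k where g: "walk (- P) g k" "g 0 \<in> Lam q x" "g k = v" by (auto simp: U_def)
    define k0 where "k0 = (LEAST i. far (g i))"
    have k0: "far (g k0)" "k0 \<le> k" using LeastI[of "\<lambda>i. far (g i)" k] Least_le[of "\<lambda>i. far (g i)" k] fv g(3) by (auto simp: k0_def)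
    have before: "\<not> far (g i)" if "i < k0" for i using not_less_Least[of i "\<lambda>i. far (g i)"] that by (simp add: k0_def)
    from k0(1) obtain m where m: "m < 4" "6 * real q + 1 < (pos (g k0) - pos x) \<bullet> perp (?e m)" by (auto simp: far_def)
    have "k0 \<noteq> 0"
    proof
      assume "k0 = 0"
      then show False using m small[OF g(2) np[of m]] by auto
    qed
    have lt: "\<bar>(pos (g i) - pos x) \<bullet> ?e m\<bar> < 8 * real q - 1" if "i \<le> k0" for i
    proof (cases "i = k0")
      case False
      then have "\<bar>(pos (g i) - pos x) \<bullet> ?e m\<bar> \<le> 6 * real q + 1" using that before near[OF _ m(1)] by simp
      then show ?thesis using q by linarith
    next
      case True
      obtain k1 where k1: "k0 = Suc k1" using \<open>k0 \<noteq> 0\<close> by (cases k0) auto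
      have a: "adj (g k1) (g k0)" using g(1) k0(2) k1 by (auto simp: walk_def)
      have "\<bar>(pos (g k0) - pos (g k1)) \<bullet> ?e m\<bar> \<le> 1"
        using Cauchy_Schwarz_ineq2[of "pos (g k0) - pos (g k1)" "?e m"] dst_adj[OF a] ne[of m]
        by (simp add: dist_norm norm_minus_commute)
      moreover have "\<bar>(pos (g k1) - pos x) \<bullet> ?e m\<bar> \<le> 6 * real q + 1" using before near[OF _ m(1)] k1 by simp
      moreover have "(pos (g k0) - pos x) \<bullet> ?e m = (pos (g k0) - pos (g k1)) \<bullet> ?e m + (pos (g k1) - pos x) \<bullet> ?e m"
        by (simp add: inner_diff_left)
      ultimately show ?thesis unfolding True using q by linarith
    qed
    have "\<exists>i\<le>K m. \<exists>j\<le>k0. G m i = g j"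
    proof (rule paths_meet[OF ne[of m], where A = "8 * real q - 1" and x = x and ?v0.0 = "2 * real q - 1" and ?v1.0 = "6 * real q + 1"])
      show "adj (G m i) (G m (Suc i))" if "i < K m" for i using GK(1)[OF m(1)] that by (simp add: walk_def)
      show "adj (g j) (g (Suc j))" if "j < k0" for j using g(1) that k0(2) by (simp add: walk_def)
      show "(pos (g 0) - pos x) \<bullet> perp (?e m) < 2 * real q - 1" using small[OF g(2) np[of m]] by linarith
    qed (use GK(2-5)[OF m(1)] m(2) lt in auto)
    then obtain i j where "i \<le> K m" "j \<le> k0" "G m i = g j" by blast
    then have "g j \<in> P" using m(1) by (force simp: P_def)
    then show False using g(1) \<open>j \<le> k0\<close> k0(2) by (auto simp: walk_def)
  qed
  have UL: "U \<subseteq> Lam (12 * q) x"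
  proof
    fix p assume "p \<in> U"
    then have nf: "\<not> far p" by (rule nofar)
    have b: "\<bar>(pos p - pos x) \<bullet> e\<bar> \<le> 6 * real q + 1" "\<bar>(pos p - pos x) \<bullet> perp e\<bar> \<le> 6 * real q + 1"
      using near[OF nf, of 0] near[OF nf, of "Suc 0"] by simp_all
    show "p \<in> Lam (12 * q) x" by (rule Lam_of_coords[OF e q b])
  qed
  show ?thesis using QU UL bdU PS by (intro exI[of _ U] conjI) blast+
qed

section \<open>Frozen disagreement: locality and growth\<close>

lemma ecount_le:
  assumes "finite C'" "\<And>u v. u \<in> C \<Longrightarrow> v \<in> T \<Longrightarrow> adj u v \<Longrightarrow> v \<in> C'"
  shows "ecount C T \<le> 4 * real (card C')"
proof -
  have "{(u, v). adj u v \<and> u \<in> C \<and> v \<in> T} \<subseteq> (\<Union>v\<in>C'. (\<lambda>u. (u, v)) ` {u. adj v u})"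
  proof
    fix p assume "p \<in> {(u, v). adj u v \<and> u \<in> C \<and> v \<in> T}"
    then obtain u v where p: "p = (u, v)" "adj u v" "u \<in> C" "v \<in> T" by blast
    then have "v \<in> C'" "adj v u" using assms(2)[of u v] by (simp_all add: adj_sym)
    then show "p \<in> (\<Union>v\<in>C'. (\<lambda>u. (u, v)) ` {u. adj v u})" using p(1) by blast
  qed
  moreover have fin: "finite (\<Union>v\<in>C'. (\<lambda>u. (u, v)) ` {u. adj v u})" using assms(1) finite_nbrs by blast
  ultimately have "card {(u, v). adj u v \<and> u \<in> C \<and> v \<in> T} \<le> card (\<Union>v\<in>C'. (\<lambda>u. (u, v)) ` {u. adj v u})"
    by (rule card_mono[rotated])
  also have "\<dots> \<le> (\<Sum>v\<in>C'. card ((\<lambda>u. (u, v)) ` {u. adj v u}))" by (rule card_UN_le[OF assms(1)])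
  also have "\<dots> \<le> (\<Sum>v\<in>C'. 4)"
    by (intro sum_mono order_trans[OF card_image_le card_nbrs_le] finite_nbrs)
  finally show ?thesis unfolding ecount_def using of_nat_mono[of "card {(u, v). adj u v \<and> u \<in> C \<and> v \<in> T}" "card C' * 4"] by simp
qed

lemma adj_sdist: "adj u v \<Longrightarrow> sdist u v \<le> 1"
  by (auto simp: adj_def sdist_def)

text \<open>A disagreeing site carries the boundary spin of either ground state. So the outer
  boundary of \<open>U\<close> decouples \<open>U\<close> from its surroundings for both, and the
  sets for \<open>U\<close>, \<open>Lam (12 * q) x\<close> and \<open>W\<close>, nested by
  monotonicity, coincide in the inner box. This makes the disagreement in a block a local
  quantity.\<close>

lemma inner_agreement:
  assumes W: "finite W" and sub: "Lam (12 * q) x \<subseteq> W" and e: "norm e = 1" and q: "q \<ge> 4"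
    and ring: "\<And>m. m < 4 \<Longrightarrow> crosses ((perp ^^ m) e) q (ringcm e q x m) (disagree W h)"
  shows "minus_set W h \<inter> Lam q x = minus_set (Lam (12 * q) x) h \<inter> Lam q x"
    and "plus_set W h \<inter> Lam q x = plus_set (Lam (12 * q) x) h \<inter> Lam q x"
proof -
  obtain U where U: "Lam q x \<subseteq> U" "U \<subseteq> Lam (12 * q) x" "\<And>u v. u \<in> U \<Longrightarrow> v \<notin> U \<Longrightarrow> adj u v \<Longrightarrow> v \<in> disagree W h"
    using ring_separates[OF e q ring] by blast
  have UW: "U \<subseteq> W" using U(2) sub by blast
  have "minus_set W h \<inter> U = minus_set U h"
  proof (rule minus_set_restrict[OF W UW])
    fix u v assume "u \<in> U" "v \<in> W - U" "adj u v"
    then have "v \<in> disagree W h" using U(3) by blast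
    then show "v \<notin> minus_set W h" by (simp add: disagree_def)
  qed
  moreover have "minus_set U h \<subseteq> minus_set (Lam (12 * q) x) h" "minus_set (Lam (12 * q) x) h \<subseteq> minus_set W h"
    by (rule minus_set_mono; use U(2) sub W in simp)+
  ultimately show "minus_set W h \<inter> Lam q x = minus_set (Lam (12 * q) x) h \<inter> Lam q x" using U(1) by blast
  have "plus_set W h \<inter> U = plus_set U h"
  proof (rule plus_set_restrict[OF W UW])
    fix u v assume "u \<in> U" "v \<in> W - U" "adj u v"
    then have "v \<in> disagree W h" using U(3) by blast
    then show "v \<notin> plus_set W h" by (simp add: disagree_def)
  qed
  moreover have "plus_set U h \<subseteq> plus_set (Lam (12 * q) x) h" "plus_set (Lam (12 * q) x) h \<subseteq> plus_set W h"
    by (rule plus_set_mono; use U(2) sub W in simp)+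
  ultimately show "plus_set W h \<inter> Lam q x = plus_set (Lam (12 * q) x) h \<inter> Lam q x" using U(1) by blast
qed

text \<open>A site of \<open>B\<close> disagrees for \<open>h\<close> and for
  \<open>h + 1/q\<close>. In \<open>isoperimetric\<close> with \<open>d = 1 / q\<close>, the cut
  edges of \<open>B \<inter> Lam r y\<close> end at sites of \<open>B\<close> in the next layer,
  each of which receives at most 4 of them; hence the constant 8q.\<close>

lemma growth_step:
  assumes W: "finite W" and q: "q \<ge> 1" and sub: "Lam (Suc r) y \<subseteq> W"
    and hh: "\<And>v. v \<in> W \<Longrightarrow> h' v = h v + 1 / real q"
    and B: "B = W - minus_set W h - plus_set W h'"
  shows "(1 + 1 / (8 * real q)) * real (card (B \<inter> Lam r y)) \<le> real (card (B \<inter> Lam (Suc r) y))"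
proof -
  let ?C = "B \<inter> Lam r y" and ?C' = "B \<inter> Lam (Suc r) y - B \<inter> Lam r y"
  have fin: "finite ?C" "finite ?C'" "finite (B \<inter> Lam (Suc r) y)" by auto
  have rr: "Lam r y \<subseteq> Lam (Suc r) y" by (auto simp: Lam_def)
  have c: "real (card (B \<inter> Lam (Suc r) y)) = real (card ?C) + real (card ?C')"
  proof -
    have "card (B \<inter> Lam (Suc r) y) = card ?C + card ?C'"
      using fin rr by (subst card_Un_disjoint[symmetric]) (auto intro!: arg_cong[of _ _ card])
    then show ?thesis by simp
  qed
  have "real (card ?C) \<le> 8 * real q * real (card ?C')"
  proof (cases "?C = {}")
    case False
    have "1 / real q * real (card ?C) < 2 * ecount ?C (- (?C \<union> minus_set W h \<union> plus_set W h'))"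
      by (rule isoperimetric[OF W _ False]) (use B hh in auto)
    also have "ecount ?C (- (?C \<union> minus_set W h \<union> plus_set W h')) \<le> 4 * real (card ?C')"
    proof (rule ecount_le[OF fin(2)])
      fix u v assume u: "u \<in> ?C" and v: "v \<in> - (?C \<union> minus_set W h \<union> plus_set W h')" and a: "adj u v"
      have "sdist v y \<le> sdist u v + sdist u y" using sdist_triangle[of v y u] by (simp add: sdist_sym)
      then have "v \<in> Lam (Suc r) y" using u adj_sdist[OF a] by (simp add: Lam_def)
      then show "v \<in> ?C'" using v sub B by auto
    qed
    finally show ?thesis using q by (simp add: field_simps)
  qed simp
  then show ?thesis unfolding c using q by (simp add: field_simps)
qed

text \<open>By Bernoulli's inequality \<open>8 * q\<close> layers double the count.\<close>

lemma growth:
  assumes W: "finite W" and q: "q \<ge> 1" and sub: "Lam (r + 8 * q * j) y \<subseteq> W"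
    and hh: "\<And>v. v \<in> W \<Longrightarrow> h' v = h v + 1 / real q"
    and B: "B = W - minus_set W h - plus_set W h'"
  shows "2 ^ j * real (card (B \<inter> Lam r y)) \<le> real (card (B \<inter> Lam (r + 8 * q * j) y))"
proof -
  let ?a = "1 + 1 / (8 * real q)"
  have a0: "0 \<le> ?a" by simp
  have "?a ^ n * real (card (B \<inter> Lam r y)) \<le> real (card (B \<inter> Lam (r + n) y))" if "n \<le> 8 * q * j" for n
    using that
  proof (induction n)
    case (Suc n)
    have "int (Suc (r + n)) \<le> int (r + 8 * q * j)" using Suc.prems by (simp only: of_nat_le_iff)
    then have "Lam (Suc (r + n)) y \<subseteq> Lam (r + 8 * q * j) y"
      by (intro Lam_mono) (simp only: sdist_def diff_self abs_0 max.idem add_0)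
    then have s: "Lam (Suc (r + n)) y \<subseteq> W" using sub by blast
    have "?a ^ Suc n * real (card (B \<inter> Lam r y)) = ?a * (?a ^ n * real (card (B \<inter> Lam r y)))" by simp
    also have "\<dots> \<le> ?a * real (card (B \<inter> Lam (r + n) y))" using Suc a0 by (intro mult_left_mono) auto
    also have "\<dots> \<le> real (card (B \<inter> Lam (Suc (r + n)) y))" by (rule growth_step[OF W q s hh B])
    finally show ?case by simp
  qed simp
  from this[OF order_refl] have 1: "?a ^ (8 * q * j) * real (card (B \<inter> Lam r y)) \<le> real (card (B \<inter> Lam (r + 8 * q * j) y))" .
  have "1 + real (8 * q) * (1 / (8 * real q)) \<le> ?a ^ (8 * q)" by (rule Bernoulli_inequality, rule order_trans[of _ 0]) auto
  then have "2 \<le> ?a ^ (8 * q)" using q by simp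
  then have "2 ^ j \<le> (?a ^ (8 * q)) ^ j" by (intro power_mono) auto
  then have "2 ^ j \<le> ?a ^ (8 * q * j)" by (simp add: power_mult)
  then have "2 ^ j * real (card (B \<inter> Lam r y)) \<le> ?a ^ (8 * q * j) * real (card (B \<inter> Lam r y))"
    by (intro mult_right_mono) auto
  with 1 show ?thesis by linarith
qed

text \<open>The blocks \<open>Lam q (ctr q i)\<close> have side 2q + 1 and tile the lattice.\<close>

definition ctr :: "nat \<Rightarrow> site \<Rightarrow> site" where
  "ctr q i = (int (2 * q + 1) * fst i, int (2 * q + 1) * snd i)"

lemma div_block:
  fixes x q M :: int
  assumes "q \<ge> 0" "\<bar>x\<bar> \<le> (2 * q + 1) * M + q"
  shows "\<bar>x - (2 * q + 1) * ((x + q) div (2 * q + 1))\<bar> \<le> q" "\<bar>(x + q) div (2 * q + 1)\<bar> \<le> M"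
proof -
  let ?d = "2 * q + 1" and ?y = "(x + q) div (2 * q + 1)"
  have d: "?d > 0" using assms by simp
  have "?d * ?y = (x + q) - (x + q) mod ?d" by (simp add: minus_mod_eq_mult_div)
  moreover have m: "0 \<le> (x + q) mod ?d" "(x + q) mod ?d < ?d" using pos_mod_sign[OF d] pos_mod_bound[OF d] by blast+
  ultimately show 1: "\<bar>x - ?d * ?y\<bar> \<le> q" by linarith
  have "?d * ?y < ?d * (M + 1)" "?d * (- M - 1) < ?d * ?y"
    using 1 assms by (simp_all add: algebra_simps abs_le_iff)
  then have "?y < M + 1" "- M - 1 < ?y" using d by (simp_all only: mult_less_cancel_left_pos)
  then show "\<bar>?y\<bar> \<le> M" by linarith
qed

lemma blocks_cover:
  assumes "sdist v 0 \<le> int (2 * q + 1) * int M + int q"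
  shows "\<exists>i\<in>Lam M 0. v \<in> Lam q (ctr q i)"
proof -
  let ?i = "((fst v + int q) div (2 * int q + 1), (snd v + int q) div (2 * int q + 1))"
  have b: "\<bar>fst v\<bar> \<le> (2 * int q + 1) * int M + int q" "\<bar>snd v\<bar> \<le> (2 * int q + 1) * int M + int q"
    using assms by (simp_all add: sdist_def algebra_simps)
  show ?thesis
    by (rule bexI[of _ ?i]) (use div_block[OF _ b(1)] div_block[OF _ b(2)] in \<open>simp_all add: Lam_def sdist_def ctr_def add.commute[of 1 "2 * int q"]\<close>)
qed

lemma sdist_ctr: "sdist (ctr q i) (ctr q i') = int (2 * q + 1) * sdist i i'"
proof -
  have "\<bar>int (2 * q + 1) * a - int (2 * q + 1) * b\<bar> = int (2 * q + 1) * \<bar>a - b\<bar>" for a b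
    by (simp add: abs_mult right_diff_distrib[symmetric] del: of_nat_add of_nat_mult of_nat_Suc)
  then show ?thesis unfolding sdist_def ctr_def by (simp add: max_mult_distrib_left del: of_nat_add of_nat_mult of_nat_Suc)
qed

lemma ctr_0: "ctr q 0 = 0"
  by (simp add: ctr_def zero_prod_def)

text \<open>From a block of maximal count, growth produces 2^j times that count within the region of
  (2M + 1)^2 blocks, none of which exceeds the maximum; so all counts vanish. Yet around the origin
  a crossing for \<open>h\<close> and a perpendicular one for \<open>h'\<close> meet, and the
  meeting site disagrees for both fields.\<close>

lemma ring_contradiction:
  fixes q M j :: nat and W :: "site set" and h h' :: "site \<Rightarrow> real"
  defines "W \<equiv> Lam ((2 * q + 1) * (M + 8)) 0"
  assumes e: "norm e = 1" and q: "q \<ge> 4" and jM: "4 * j \<le> M" and M: "M \<ge> 6" and pow: "(2 * M + 1)\<^sup>2 < 2 ^ j"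
    and hh: "\<And>v. v \<in> W \<Longrightarrow> h' v = h v + 1 / real q"
    and r1: "\<And>i m. i \<in> Lam M 0 \<Longrightarrow> m < 4 \<Longrightarrow> crosses ((perp ^^ m) e) q (ringcm e q (ctr q i) m) (disagree W h)"
    and r2: "\<And>i m. i \<in> Lam M 0 \<Longrightarrow> m < 4 \<Longrightarrow> crosses ((perp ^^ m) e) q (ringcm e q (ctr q i) m) (disagree W h')"
    and Z: "\<And>i. Z i = card (Lam q (ctr q i) - minus_set (Lam (12 * q) (ctr q i)) h - plus_set (Lam (12 * q) (ctr q i)) h')"
    and x: "x \<in> Lam (M - 4 * j) 0" and mx: "\<And>y. y \<in> Lam M 0 \<Longrightarrow> Z y \<le> Z x"
  shows False
proof -
  have W: "finite W" by (simp add: W_def)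
  define B where "B = W - minus_set W h - plus_set W h'"
  have blockW: "Lam (12 * q) (ctr q i) \<subseteq> W" if "i \<in> Lam M 0" for i
  proof -
    have "sdist i 0 \<le> int M" using that by (simp add: Lam_def)
    then have "int (2 * q + 1) * sdist i 0 \<le> int (2 * q + 1) * int M" by (intro mult_left_mono) auto
    then have "sdist (ctr q i) 0 \<le> int (2 * q + 1) * int M" using sdist_ctr[of q i 0] by (simp add: ctr_0)
    then show ?thesis unfolding W_def by (intro Lam_mono) (simp add: algebra_simps)
  qed
  have N: "card (B \<inter> Lam q (ctr q i)) = Z i" if i: "i \<in> Lam M 0" for i
  proof -
    have "Lam q (ctr q i) \<subseteq> W" using blockW[OF i] Lam_mono[of "ctr q i" "ctr q i" q "12 * q"] by (auto simp: sdist_def)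
    then have "B \<inter> Lam q (ctr q i) = Lam q (ctr q i) - (minus_set W h \<inter> Lam q (ctr q i)) - (plus_set W h' \<inter> Lam q (ctr q i))"
      unfolding B_def by blast
    also have "\<dots> = Lam q (ctr q i) - minus_set (Lam (12 * q) (ctr q i)) h - plus_set (Lam (12 * q) (ctr q i)) h'"
      unfolding inner_agreement(1)[OF W blockW[OF i] e q r1[OF i], simplified]
        inner_agreement(2)[OF W blockW[OF i] e q r2[OF i], simplified] by blast
    finally show ?thesis by (simp add: Z)
  qed
  have xM: "x \<in> Lam M 0" using x by (auto simp: Lam_def)
  have sx: "sdist (ctr q x) 0 \<le> int (2 * q + 1) * int (M - 4 * j)"
  proof -
    have "sdist x 0 \<le> int (M - 4 * j)" using x by (simp add: Lam_def)
    then have "int (2 * q + 1) * sdist x 0 \<le> int (2 * q + 1) * int (M - 4 * j)" by (intro mult_left_mono) auto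
    then show ?thesis using sdist_ctr[of q x 0] by (simp add: ctr_0)
  qed
  \<comment> \<open>8qj layers fit into 4j blocks of side 2q + 1, which is why the maximum has to
    sit 4j blocks away from the edge.\<close>
  have bound: "int (2 * q + 1) * int (M - 4 * j) + int (q + 8 * q * j) \<le> int (2 * q + 1) * int M + int q"
  proof -
    have "int (M - 4 * j) = int M - 4 * int j" using jM by (simp add: of_nat_diff)
    then show ?thesis by (simp add: algebra_simps)
  qed
  have sub: "Lam (q + 8 * q * j) (ctr q x) \<subseteq> (\<Union>i\<in>Lam M 0. Lam q (ctr q i))"
  proof
    fix v assume "v \<in> Lam (q + 8 * q * j) (ctr q x)"
    then have "sdist v (ctr q x) \<le> int (q + 8 * q * j)" by (simp add: Lam_def)
    then have "sdist v 0 \<le> int (2 * q + 1) * int M + int q"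
      using sdist_triangle[of v 0 "ctr q x"] sx bound by linarith
    then show "v \<in> (\<Union>i\<in>Lam M 0. Lam q (ctr q i))" using blocks_cover[of v q M] by blast
  qed
  have qsub: "Lam q (ctr q i) \<subseteq> Lam (12 * q) (ctr q i)" for i by (auto simp: Lam_def)
  have subW: "Lam (q + 8 * q * j) (ctr q x) \<subseteq> W" using sub blockW qsub by blast
  have "2 ^ j * real (card (B \<inter> Lam q (ctr q x))) \<le> real (card (B \<inter> Lam (q + 8 * q * j) (ctr q x)))"
    by (rule growth[OF W _ subW hh B_def]) (use q in auto)
  also have "card (B \<inter> Lam (q + 8 * q * j) (ctr q x)) \<le> card (\<Union>i\<in>Lam M 0. B \<inter> Lam q (ctr q i))"
    by (intro card_mono) (use sub in auto)
  also have "\<dots> \<le> (\<Sum>i\<in>Lam M 0. card (B \<inter> Lam q (ctr q i)))" by (intro card_UN_le) simp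
  also have "\<dots> \<le> (\<Sum>i\<in>(Lam M 0 :: site set). Z x)" using N mx by (intro sum_mono) simp
  also have "\<dots> = (2 * M + 1)\<^sup>2 * Z x" by (simp add: card_Lam)
  finally have "2 ^ j * real (Z x) \<le> real ((2 * M + 1)\<^sup>2 * Z x)" using N[OF xM] by (simp del: of_nat_mult of_nat_power)
  then have "2 ^ j * real (Z x) \<le> real ((2 * M + 1)\<^sup>2) * real (Z x)" by (simp only: of_nat_mult)
  moreover have "real ((2 * M + 1)\<^sup>2) < 2 ^ j" using pow by (metis of_nat_less_iff of_nat_numeral of_nat_power)
  ultimately have "Z x = 0" by (metis less_le_not_le linorder_neqE_nat mult_le_cancel_right not_less_zero of_nat_0_less_iff not_le)
  then have Z0: "B \<inter> Lam q (ctr q i) = {}" if "i \<in> Lam M 0" for i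
    using mx[OF that] N[OF that] by simp
  have z0: "0 \<in> Lam M 0" by (simp add: Lam_def sdist_def)
  \<comment> \<open>Two consecutive tubes of the ring around the origin, one taken for
    \<open>h\<close> and the other for \<open>h'\<close>; they overlap at a corner of the
    ring.\<close>
  obtain g k where g: "walk (disagree W h) g k" "(pos (g 0) - pos 0) \<bullet> (perp ^^ 0) e \<le> - (8 * real q - 1)"
    "8 * real q - 1 \<le> (pos (g k) - pos 0) \<bullet> (perp ^^ 0) e"
    "\<And>i. i \<le> k \<Longrightarrow> 2 * real q - 1 \<le> (pos (g i) - pos 0) \<bullet> perp ((perp ^^ 0) e)"
    "\<And>i. i \<le> k \<Longrightarrow> (pos (g i) - pos 0) \<bullet> perp ((perp ^^ 0) e) \<le> 6 * real q + 1"
    using crossing_path_around[OF r1[OF z0, of 0, unfolded ctr_0] e] by auto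
  obtain f n where f: "walk (disagree W h') f n" "(pos (f 0) - pos 0) \<bullet> (perp ^^ Suc 0) e \<le> - (8 * real q - 1)"
    "8 * real q - 1 \<le> (pos (f n) - pos 0) \<bullet> (perp ^^ Suc 0) e"
    "\<And>i. i \<le> n \<Longrightarrow> 2 * real q - 1 \<le> (pos (f i) - pos 0) \<bullet> perp ((perp ^^ Suc 0) e)"
    "\<And>i. i \<le> n \<Longrightarrow> (pos (f i) - pos 0) \<bullet> perp ((perp ^^ Suc 0) e) \<le> 6 * real q + 1"
    using crossing_path_around[OF r2[OF z0, of "Suc 0", unfolded ctr_0] e] by auto
  note g' = g(2-5)[unfolded funpow_0]
  have f': "(pos (f 0) - pos 0) \<bullet> perp e \<le> - (8 * real q - 1)" "8 * real q - 1 \<le> (pos (f n) - pos 0) \<bullet> perp e"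
    "\<And>i. i \<le> n \<Longrightarrow> 2 * real q - 1 \<le> - ((pos (f i) - pos 0) \<bullet> e)"
    "\<And>i. i \<le> n \<Longrightarrow> - ((pos (f i) - pos 0) \<bullet> e) \<le> 6 * real q + 1"
    using f(2-5) by (simp_all add: perp_perp)
  have "\<exists>i\<le>k. \<exists>l\<le>n. g i = f l"
  proof (rule paths_meet[OF e, where A = "8 * real q - 1" and x = 0 and ?v0.0 = "2 * real q - 1" and ?v1.0 = "6 * real q + 1"])
    show "adj (g i) (g (Suc i))" if "i < k" for i using g(1) that by (simp add: walk_def)
    show "adj (f i) (f (Suc i))" if "i < n" for i using f(1) that by (simp add: walk_def)
    show "(pos (f 0) - pos 0) \<bullet> perp e < 2 * real q - 1" using f'(1) q by simp
    show "6 * real q + 1 < (pos (f n) - pos 0) \<bullet> perp e" using f'(2) q by simp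
    show "\<bar>(pos (f l) - pos 0) \<bullet> e\<bar> < 8 * real q - 1" if "l \<le> n" for l
      using f'(3)[OF that] f'(4)[OF that] q by (simp add: abs_less_iff)
  qed (use g' in auto)
  then obtain i l where il: "i \<le> k" "l \<le> n" "g i = f l" by blast
  \<comment> \<open>Disagreement for \<open>h\<close> excludes \<open>minus_set W h\<close>,
    disagreement for \<open>h'\<close> excludes \<open>plus_set W h'\<close>; together this is
    membership in \<open>B\<close>.\<close>
  have d: "g i \<in> disagree W h" "g i \<in> disagree W h'" using g(1) f(1) il by (auto simp: walk_def)
  then have gB: "g i \<in> B" by (auto simp: B_def disagree_def)
  have "g i \<in> Lam (12 * q) 0"
  proof (rule Lam_of_coords[OF e q])
    show "\<bar>(pos (g i) - pos 0) \<bullet> e\<bar> \<le> 6 * real q + 1"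
      unfolding il(3) using f'(3)[OF il(2)] f'(4)[OF il(2)] q by (simp add: abs_le_iff)
    show "\<bar>(pos (g i) - pos 0) \<bullet> perp e\<bar> \<le> 6 * real q + 1"
      using g'(3)[OF il(1)] g'(4)[OF il(1)] q by (simp add: abs_le_iff)
  qed
  then have "sdist (g i) 0 \<le> int (12 * q)" by (simp add: Lam_def)
  also have "int (12 * q) \<le> int (2 * q + 1) * int M + int q"
  proof -
    have "int (2 * q + 1) * 6 \<le> int (2 * q + 1) * int M" using M by (intro mult_left_mono) auto
    then show ?thesis by simp
  qed
  finally obtain y where "y \<in> Lam M 0" "g i \<in> Lam q (ctr q y)" using blocks_cover by blast
  with Z0[of y] gB show False by blast
qed

context gaussian_field
begin

section \<open>Tubes are not crossed with probability close to one\<close>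

lemma local_ev_tube: "local_ev (Lam (L * q) c) (tube e q L c)"
  unfolding tube_def by (rule local_ev_disagree) simp

lemma local_ev_two_sets:
  assumes U: "finite U" and V: "U \<subseteq> V"
  shows "local_ev U (\<lambda>h. Q (minus_set U h) (plus_set U (\<lambda>v. h v + s)))"
proof -
  have eq: "plus_set U (\<lambda>v. h v + s) = plus_set U (shift_on V s h)" for h
    using V by (intro sets_cong) (auto simp: shift_on_def)
  let ?I = "{AC \<in> Pow U \<times> Pow U. Q (fst AC) (snd AC)}"
  have "local_ev U (\<lambda>h. \<exists>AC\<in>?I. minus_set U h = fst AC \<and> plus_set U (shift_on V s h) = snd AC)"
  proof (rule local_ev_Bex)
    show "finite ?I" "finite U" using U by auto
    fix AC
    show "local_ev U (\<lambda>h. minus_set U h = fst AC \<and> plus_set U (shift_on V s h) = snd AC)"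
      by (intro local_ev_conj local_ev_sets[OF U, of "\<lambda>X Y. X = fst AC"]
          local_ev_shift[OF local_ev_sets[OF U, of "\<lambda>X Y. Y = snd AC"]])
  qed
  moreover have "(\<exists>AC\<in>?I. minus_set U h = fst AC \<and> plus_set U (shift_on V s h) = snd AC) = Q (minus_set U h) (plus_set U (\<lambda>v. h v + s))" for h
  proof
    assume "Q (minus_set U h) (plus_set U (\<lambda>v. h v + s))"
    then show "\<exists>AC\<in>?I. minus_set U h = fst AC \<and> plus_set U (shift_on V s h) = snd AC"
      using minus_set_subset[OF U, of h] plus_set_subset[of U "shift_on V s h"]
      by (intro bexI[of _ "(minus_set U h, plus_set U (shift_on V s h))"]) (simp_all add: eq)
  next
    assume "\<exists>AC\<in>?I. minus_set U h = fst AC \<and> plus_set U (shift_on V s h) = snd AC"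
    then show "Q (minus_set U h) (plus_set U (\<lambda>v. h v + s))" by (auto simp: eq)
  qed
  ultimately show ?thesis by simp
qed

text \<open>The count is taken in the box of radius 12q so that it is local by definition. On the
  event that rings surround the block for both fields, \<open>inner_agreement\<close> identifies it
  with the count in the large box.\<close>

definition frozen_count :: "nat \<Rightarrow> site \<Rightarrow> (site \<Rightarrow> real) \<Rightarrow> nat" where
  "frozen_count q x h = card (Lam q x - minus_set (Lam (12 * q) x) h - plus_set (Lam (12 * q) x) (\<lambda>v. h v + 1 / real q))"

lemma local_ev_frozen_count: "local_ev (Lam (12 * q) x) (\<lambda>h. t < frozen_count q x h)"
  unfolding frozen_count_def by (rule local_ev_two_sets[where Q = "\<lambda>X Y. t < card (Lam q x - X - Y)", OF _ order_refl]) simp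

lemma frozen_count_translate: "frozen_count q x h = frozen_count q 0 (h \<circ> move 0 0 x)"
proof -
  let ?T = "move 0 0 x"
  have iso: "lattice_iso ?T" by (rule lattice_iso_move)
  then have inj: "inj ?T" by (simp add: lattice_iso_def bij_def)
  have L: "Lam n x = ?T ` Lam n 0" for n using move_Lam[of 0 0 x n] by simp
  have "(\<lambda>v. h v + 1 / real q) \<circ> ?T = (\<lambda>v. (h \<circ> ?T) v + 1 / real q)" by auto
  then have "Lam q x - minus_set (Lam (12 * q) x) h - plus_set (Lam (12 * q) x) (\<lambda>v. h v + 1 / real q)
    = ?T ` (Lam q 0 - minus_set (Lam (12 * q) 0) (h \<circ> ?T) - plus_set (Lam (12 * q) 0) (\<lambda>v. (h \<circ> ?T) v + 1 / real q))"
    unfolding L sets_iso[OF iso] using inj by (simp add: image_set_diff)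
  then show ?thesis unfolding frozen_count_def using inj by (simp add: card_image inj_on_subset[OF inj subset_UNIV])
qed

lemma pr_frozen_count: "pr (\<lambda>h. t < frozen_count q x h) = pr (\<lambda>h. t < frozen_count q 0 h)"
proof -
  have "inj (move 0 0 x)" using lattice_iso_move[of 0 0 x] by (simp add: lattice_iso_def bij_def)
  from pr_reindex(1)[OF this local_ev_ev[OF local_ev_frozen_count[of q 0 t]]] show ?thesis by (simp add: frozen_count_translate[symmetric])
qed

lemma exp_neg_3: "exp (- 3 :: real) \<le> 1 / 8"
proof -
  have "(2::real) \<le> exp 1" using exp_ge_add_one_self[of "1::real"] by simp
  then have "(2::real) ^ 3 \<le> exp 1 ^ 3" by (intro power_mono) auto
  also have "exp 1 ^ 3 = exp (3 * 1 :: real)" by (metis exp_of_nat_mult of_nat_numeral)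
  finally have "8 \<le> exp (3::real)" by simp
  then show ?thesis by (simp add: exp_minus field_simps)
qed

theorem tube_bound: "\<exists>L \<delta>. L \<ge> 30 \<and> 0 < \<delta> \<and> \<delta> < 1 \<and> (\<forall>q e c. q \<ge> 4 \<longrightarrow> norm e = 1 \<longrightarrow> pr (tube e q L c) \<le> 1 - \<delta>)"
proof -
  \<comment> \<open>Growth needs 2^j > (2M + 1)^2. The collar of 4j blocks has of order T j blocks,
    to be outnumbered by the (2T + 1)^2 independent blocks inside; this is why \<open>T\<close> is
    so large. \<open>L\<close> makes each tube's box contain the whole region of blocks.\<close>
  define j :: nat where "j = 50"
  define T :: nat where "T = 1000000"
  define M where "M = 13 * T + 4 * j"
  define L where "L = 6 * M + 30"
  define nI where "nI = real ((2 * M + 1)\<^sup>2)"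
  \<comment> \<open>Bounds \<open>real (card V) * (1 / real q)\<^sup>2 / eps\<^sup>2\<close>
    uniformly in \<open>q\<close>. Then \<open>R\<close> and \<delta> are chosen so that the events
    of the shifted and unshifted tubes contribute 1/8 from the truncation error and 1/8 from
    \<delta>.\<close>
  define \<kappa> where "\<kappa> = (5 * real L)\<^sup>2 / eps\<^sup>2"
  define R where "R = 32 * nI * exp \<kappa>"
  define \<delta> where "\<delta> = 1 / (32 * nI * (R + 1))"
  define b where "b = (2 * T + 1)\<^sup>2"
  \<comment> \<open>\<open>b\<close> independent trials of probability above \<open>p\<close> all
    fail with probability at most exp(-3) <= 1/8, while \<open>p\<close> times the number of collar
    blocks is still at most 1/8.\<close>
  define p where "p = 3 / real b"
  have jM: "4 * j \<le> M" "M \<ge> 6" by (simp_all add: M_def T_def)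
  have pow: "(2 * M + 1)\<^sup>2 < 2 ^ j" by (simp add: M_def T_def j_def)
  have MJ: "M - 4 * j = 13 * T" by (simp add: M_def)
  have p01: "0 < p" "p < 1" by (simp_all add: p_def b_def T_def)
  have ap: "(real ((2 * M + 1)\<^sup>2) - real ((2 * (13 * T) + 1)\<^sup>2)) * p \<le> 1 / 8"
    by (simp add: M_def p_def b_def T_def j_def)
  have nI1: "nI \<ge> 1" by (simp add: nI_def)
  have R0: "R > 0" using nI1 by (simp add: R_def)
  have \<delta>0: "\<delta> > 0" using nI1 R0 by (simp add: \<delta>_def)
  have \<delta>1: "\<delta> < 1"
  proof -
    have "1 < 32 * nI * (R + 1)" using nI1 R0 by (smt (verit) mult_le_cancel_left1 mult_less_cancel_left1)
    then show ?thesis by (simp add: \<delta>_def)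
  qed
  have "pr (tube e q L c) \<le> 1 - \<delta>" if q: "q \<ge> 4" and e: "norm e = 1" for q e c
  proof (rule ccontr)
    assume "\<not> ?thesis"
    then have hyp: "pr (tube e q L c) > 1 - \<delta>" by simp
    define V where "V = Lam (2 * L * q) 0"
    define W where "W = Lam ((2 * q + 1) * (M + 8)) 0"
    define sh where "sh h = shift_on V (1 / real q) h" for h
    have q3: "2 * q + 1 \<le> 3 * q" using q by simp
    define A where "A im h \<longleftrightarrow> \<not> tube ((perp ^^ snd im) e) q L (ringcm e q (ctr q (fst im)) (snd im)) h" for im h
    define Im where "Im = (Lam M 0 :: site set) \<times> {..<4::nat}"
    have fIm: "finite Im" by (simp add: Im_def)
    have cIm: "real (card Im) = 4 * nI" by (simp add: Im_def card_cartesian_product card_Lam nI_def)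
    have rc: "sdist (ringcm e q (ctr q i) m) 0 + int ((2 * q + 1) * (M + 8)) \<le> int (L * q)" if "i \<in> Lam M 0" for i m
    proof -
      have "sdist i 0 \<le> int M" using that by (simp add: Lam_def)
      then have "int (2 * q + 1) * sdist i 0 \<le> int (2 * q + 1) * int M" by (intro mult_left_mono) auto
      then have 1: "sdist (ctr q i) 0 \<le> int (2 * q + 1) * int M" using sdist_ctr[of q i 0] by (simp add: ctr_0)
      have 2: "sdist (ringcm e q (ctr q i) m) (ctr q i) \<le> 4 * int q + 1" by (rule sdist_ringcm[OF e])
      have "(2 * q + 1) * M + (4 * q + 1) + (2 * q + 1) * (M + 8) \<le> (3 * q) * M + 5 * q + (3 * q) * (M + 8)"
        using q q3 by (intro add_mono mult_right_mono) auto
      also have "\<dots> \<le> L * q" by (simp add: L_def algebra_simps)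
      finally have "int ((2 * q + 1) * M + (4 * q + 1) + (2 * q + 1) * (M + 8)) \<le> int (L * q)" by (simp only: of_nat_le_iff)
      then show ?thesis using 1 2 sdist_triangle[of "ringcm e q (ctr q i) m" 0 "ctr q i"] by (simp add: algebra_simps)
    qed
    have locA: "local_ev V (A im)" if "im \<in> Im" for im
    proof -
      have "Lam (L * q) (ringcm e q (ctr q (fst im)) (snd im)) \<subseteq> V"
      proof -
        have "fst im \<in> Lam M 0" using that by (simp add: Im_def mem_Times_iff)
        from rc[OF this, of "snd im"] have "sdist (ringcm e q (ctr q (fst im)) (snd im)) 0 \<le> int (L * q)"
          using of_nat_0_le_iff[of "(2 * q + 1) * (M + 8)", where ?'a = int] by linarith
        then show ?thesis unfolding V_def by (intro Lam_mono) simp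
      qed
      then show ?thesis unfolding A_def V_def
        by (intro local_ev_not local_ev_mono[OF local_ev_tube]) (auto simp: V_def)
    qed
    have pA: "pr (A im) \<le> \<delta>" for im
    proof -
      let ?x = "ringcm e q (ctr q (fst im)) (snd im)"
      have inj: "inj (move (snd im) c ?x)" using lattice_iso_move by (simp add: lattice_iso_def bij_def)
      have et: "ev (tube e q L c)" "ev (tube ((perp ^^ snd im) e) q L ?x)" by (rule local_ev_ev[OF local_ev_tube])+
      have "pr (tube e q L c) = pr (\<lambda>h. tube e q L c (h \<circ> move (snd im) c ?x))" by (rule pr_reindex(1)[OF inj et(1), symmetric])
      also have "\<dots> \<le> pr (tube ((perp ^^ snd im) e) q L ?x)" by (intro pr_mono et(2) tube_move)
      finally show ?thesis unfolding A_def using hyp pr_not[OF et(2)] by simp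
    qed
    have pA': "pr (\<lambda>h. A im (sh h)) \<le> R * \<delta> + exp \<kappa> / R" if "im \<in> Im" for im
    proof -
      have "pr (\<lambda>h. A im (sh h)) \<le> R * pr (A im) + exp (real (card V) * (1 / real q)\<^sup>2 / eps\<^sup>2) / R"
        unfolding sh_def by (rule pr_shift_le[OF locA[OF that] order_refl R0])
      also have "\<dots> \<le> R * \<delta> + exp \<kappa> / R"
      proof -
        have "4 * L * q + 1 \<le> 5 * L * q" using q by (simp add: L_def algebra_simps)
        then have "(4 * L * q + 1)\<^sup>2 \<le> (5 * L * q)\<^sup>2" by (rule power_mono) simp
        then have "card V \<le> (5 * L * q)\<^sup>2" by (simp add: V_def card_Lam)
        then have "real (card V) \<le> real ((5 * L * q)\<^sup>2)" by (simp only: of_nat_le_iff)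
        then have "real (card V) \<le> (5 * real L * real q)\<^sup>2" by simp
        then have "real (card V) * (1 / real q)\<^sup>2 \<le> (5 * real L * real q)\<^sup>2 * (1 / real q)\<^sup>2" by (intro mult_right_mono) auto
        also have "\<dots> = (5 * real L)\<^sup>2" using q by (simp add: power_mult_distrib power_divide)
        finally have "real (card V) * (1 / real q)\<^sup>2 / eps\<^sup>2 \<le> \<kappa>" unfolding \<kappa>_def by (intro divide_right_mono) auto
        then show ?thesis using R0 pA[of im] by (intro add_mono mult_left_mono divide_right_mono) auto
      qed
      finally show ?thesis .
    qed
    define F where "F t = pr (\<lambda>h. t < frozen_count q 0 h)" for t
    have exF: "\<exists>t. F t \<le> p"
    proof (rule exI[of _ "card (Lam q 0)"])
      have "\<not> card (Lam q 0) < frozen_count q 0 h" for h unfolding frozen_count_def by (simp add: not_less) (rule card_mono, auto)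
      then show "F (card (Lam q 0)) \<le> p" using p01 by (simp add: F_def pr_def)
    qed
    define t where "t = (LEAST t. F t \<le> p)"
    have Ft: "F t \<le> p" unfolding t_def by (rule LeastI_ex[OF exF])
    have Ft': "F (t - 1) > p" if "t > 0"
      using not_less_Least[of "t - 1" "\<lambda>t. F t \<le> p"] that by (simp add: t_def)
    define I0 where "I0 = (Lam (M - 4 * j) 0 :: site set)"
    \<comment> \<open>At spacing 13 the centres are at least 13 (2q + 1) > 24q apart, so the boxes
      of radius 12q that determine the counts are disjoint.\<close>
    define Sp where "Sp = (\<lambda>a. (13 * fst a, 13 * snd a)) ` (Lam T 0 :: site set)"
    define E1 where "E1 h \<longleftrightarrow> (\<exists>i\<in>Lam M 0 - I0. t < frozen_count q (ctr q i) h)" for h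
    define E2 where "E2 h \<longleftrightarrow> t > 0 \<and> (\<forall>i\<in>Sp. \<not> t - 1 < frozen_count q (ctr q i) h)" for h
    have I0M: "I0 \<subseteq> Lam M 0" unfolding I0_def by (auto simp: Lam_def)
    have fS: "finite Sp" by (simp add: Sp_def)
    have injS: "inj (\<lambda>a::site. (13 * fst a, 13 * snd a))" by (auto simp: inj_def prod_eq_iff)
    have cS: "card Sp = b" unfolding Sp_def b_def by (simp add: card_image inj_on_subset[OF injS] card_Lam)
    have SI: "Sp \<subseteq> I0" unfolding Sp_def I0_def MJ by (auto simp: Lam_def sdist_def)
    have evZ: "ev (\<lambda>h. u < frozen_count q x h)" for u x by (rule local_ev_ev[OF local_ev_frozen_count])
    have eF: "pr (\<lambda>h. u < frozen_count q (ctr q i) h) = F u" for u i unfolding F_def by (rule pr_frozen_count)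
    have pE1: "pr E1 \<le> 1 / 8"
    proof -
      have "pr E1 \<le> (\<Sum>i\<in>Lam M 0 - I0. pr (\<lambda>h. t < frozen_count q (ctr q i) h))"
        unfolding E1_def[abs_def] by (intro pr_Bex_le evZ) simp
      also have "\<dots> = real (card (Lam M 0 - I0)) * F t" by (simp add: eF)
      also have "\<dots> \<le> real (card (Lam M 0 - I0)) * p" using Ft by (intro mult_left_mono) auto
      also have "real (card (Lam M 0 - I0)) = real ((2 * M + 1)\<^sup>2) - real ((2 * (13 * T) + 1)\<^sup>2)"
        using I0M card_mono[OF finite_Lam I0M] by (subst card_Diff_subset) (auto simp: I0_def card_Lam MJ of_nat_diff)
      finally show ?thesis using ap by linarith
    qed
    have evE2: "ev E2" and pE2: "pr E2 \<le> 1 / 8"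
    proof -
      have loc: "local_ev (Lam (12 * q) (ctr q i)) (\<lambda>h. \<not> t - 1 < frozen_count q (ctr q i) h)" for i
        by (intro local_ev_not local_ev_frozen_count)
      let ?K = "\<Union>i\<in>Sp. Lam (12 * q) (ctr q i)"
      have fK: "finite ?K" using fS by auto
      have "local_ev ?K (\<lambda>h. \<forall>i\<in>Sp. \<not> t - 1 < frozen_count q (ctr q i) h)"
        by (rule local_ev_Ball[OF fS fK]) (rule local_ev_mono[OF loc _ fK], blast)
      then have ev1: "ev (\<lambda>h. \<forall>i\<in>Sp. \<not> t - 1 < frozen_count q (ctr q i) h)" by (rule local_ev_ev)
      have E2t: "E2 = (\<lambda>h. \<forall>i\<in>Sp. \<not> t - 1 < frozen_count q (ctr q i) h)" if "t > 0"
        using that by (simp add: E2_def fun_eq_iff)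
      have E2f: "E2 = (\<lambda>h. False)" if "\<not> t > 0" using that by (simp add: E2_def fun_eq_iff)
      show "ev E2"
      proof (cases "t > 0")
        case True
        then show ?thesis unfolding E2t[OF True] using ev1 by simp
      next
        case False
        then show ?thesis unfolding E2f[OF False] by (simp add: ev_def)
      qed
      show "pr E2 \<le> 1 / 8"
      proof (cases "t > 0")
        case True
        have "pr E2 = pr (\<lambda>h. \<forall>i\<in>Sp. \<not> t - 1 < frozen_count q (ctr q i) h)" by (simp only: E2t[OF True])
        also have "\<dots> = (\<Prod>i\<in>Sp. pr (\<lambda>h. \<not> t - 1 < frozen_count q (ctr q i) h))"
        proof (rule pr_indep_Ball[OF fS loc])
          show "disjoint_family_on (\<lambda>i. Lam (12 * q) (ctr q i)) Sp"
            unfolding disjoint_family_on_def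
          proof (intro ballI impI)
            fix i i' assume ii: "i \<in> Sp" "i' \<in> Sp" "i \<noteq> i'"
            then obtain a a' where a: "i = (13 * fst a, 13 * snd a)" "i' = (13 * fst a', 13 * snd a')" by (auto simp: Sp_def)
            have "sdist a a' \<ge> 1" using ii a by (cases a; cases a') (auto simp: sdist_def)
            moreover have "sdist i i' = 13 * sdist a a'" unfolding a by (simp add: sdist_def max_def abs_if)
            ultimately have "13 \<le> sdist i i'" by simp
            then have "int (2 * q + 1) * 13 \<le> sdist (ctr q i) (ctr q i')"
              unfolding sdist_ctr by (intro mult_left_mono) auto
            then have far: "24 * int q < sdist (ctr q i) (ctr q i')" by simp
            show "Lam (12 * q) (ctr q i) \<inter> Lam (12 * q) (ctr q i') = {}"
            proof (rule ccontr)
              assume "\<not> ?thesis"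
              then obtain v where "sdist v (ctr q i) \<le> int (12 * q)" "sdist v (ctr q i') \<le> int (12 * q)" by (auto simp: Lam_def)
              then show False using far sdist_triangle[of "ctr q i" "ctr q i'" v] by (simp add: sdist_sym)
            qed
          qed
        qed
        also have "\<dots> = (\<Prod>i\<in>Sp. 1 - F (t - 1))" by (simp only: pr_not[OF evZ] eF)
        also have "\<dots> = (1 - F (t - 1)) ^ b" using cS by simp
        also have "\<dots> \<le> (1 - p) ^ b" using Ft'[OF True] by (intro power_mono) (auto simp: F_def)
        also have "\<dots> \<le> exp (- p) ^ b" using p01 exp_ge_add_one_self[of "- p"] by (intro power_mono) auto
        also have "\<dots> = exp (real b * (- p))" by (rule exp_of_nat_mult[symmetric])
        also have "real b * (- p) = - 3" by (simp add: p_def b_def)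
        finally show ?thesis using exp_neg_3 by linarith
      next
        case False
        then show ?thesis unfolding E2f[OF False] by (simp add: pr_def)
      qed
    qed
    have evE1: "ev E1" unfolding E1_def[abs_def] by (intro ev_Bex evZ) simp
    have all: "(\<exists>im\<in>Im. A im h) \<or> (\<exists>im\<in>Im. A im (sh h)) \<or> E1 h \<or> E2 h" for h
    proof (rule ccontr)
      assume no: "\<not> ?thesis"
      have WL: "W \<subseteq> Lam (L * q) (ringcm e q (ctr q i) m)" if "i \<in> Lam M 0" for i m
        unfolding W_def using rc[OF that, of m] by (intro Lam_mono) (simp add: sdist_sym)
      have tr: "crosses ((perp ^^ m) e) q (ringcm e q (ctr q i) m) (disagree W g)"
        if "tube ((perp ^^ m) e) q L (ringcm e q (ctr q i) m) g" "i \<in> Lam M 0" for g i m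
      proof (rule crosses_mono[OF that(1)[unfolded tube_def]])
        show "norm ((perp ^^ m) e) = 1" using e by (simp add: perp_pow_norm)
        fix v assume v: "v \<in> disagree (Lam (L * q) (ringcm e q (ctr q i) m)) g" "dst v (ringcm e q (ctr q i) m) \<le> 10 * real q + 1"
        have "real_of_int (sdist v (ringcm e q (ctr q i) m)) \<le> real_of_int (10 * int q + 1)"
          using sdist_le_dst v(2) by (rule order_trans[THEN order_trans]) simp
        then have "sdist v (ringcm e q (ctr q i) m) \<le> 10 * int q + 1" by (simp only: of_int_le_iff)
        moreover have "sdist (ringcm e q (ctr q i) m) (ctr q i) \<le> 4 * int q + 1" by (rule sdist_ringcm[OF e])
        moreover have "sdist (ctr q i) 0 \<le> int (2 * q + 1) * int M"
        proof -
          have "sdist i 0 \<le> int M" using that(2) by (simp add: Lam_def)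
          then have "int (2 * q + 1) * sdist i 0 \<le> int (2 * q + 1) * int M" by (intro mult_left_mono) auto
          then show ?thesis using sdist_ctr[of q i 0] by (simp add: ctr_0)
        qed
        ultimately have "sdist v 0 \<le> int ((2 * q + 1) * (M + 8))"
          using sdist_triangle[of v 0 "ringcm e q (ctr q i) m"] sdist_triangle[of "ringcm e q (ctr q i) m" 0 "ctr q i"] q
          by (simp add: algebra_simps)
        then have "v \<in> W" by (simp add: W_def Lam_def)
        then show "v \<in> disagree W g" using v(1) by (intro disagree_antimono[OF _ WL[OF that(2)]]) auto
      qed
      have r1: "crosses ((perp ^^ m) e) q (ringcm e q (ctr q i) m) (disagree W h)" if "i \<in> Lam M 0" "m < 4" for i m
      proof (rule tr[OF _ that(1)])
        have "(i, m) \<in> Im" using that by (simp add: Im_def)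
        then show "tube ((perp ^^ m) e) q L (ringcm e q (ctr q i) m) h" using no by (force simp: A_def)
      qed
      have r2: "crosses ((perp ^^ m) e) q (ringcm e q (ctr q i) m) (disagree W (sh h))" if "i \<in> Lam M 0" "m < 4" for i m
      proof (rule tr[OF _ that(1)])
        have "(i, m) \<in> Im" using that by (simp add: Im_def)
        then show "tube ((perp ^^ m) e) q L (ringcm e q (ctr q i) m) (sh h)" using no by (force simp: A_def)
      qed
      have WV: "W \<subseteq> V"
      proof -
        have "int ((2 * q + 1) * (M + 8)) \<le> int (2 * L * q)"
        proof -
          have "0 \<in> Lam M 0" by (simp add: Lam_def sdist_def)
          then have "sdist (ringcm e q (ctr q 0) 0) 0 + int ((2 * q + 1) * (M + 8)) \<le> int (L * q)" by (rule rc)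
          moreover have "0 \<le> sdist (ringcm e q (ctr q 0) 0) 0" by (simp add: sdist_def)
          moreover have "int (L * q) \<le> int (2 * L * q)" by simp
          ultimately show ?thesis by linarith
        qed
        then show ?thesis unfolding W_def V_def by (intro Lam_mono) (simp add: sdist_def)
      qed
      have hh: "sh h v = h v + 1 / real q" if "v \<in> W" for v using WV that by (auto simp: sh_def shift_on_def)
      obtain x where x: "x \<in> I0" "\<And>y. y \<in> I0 \<Longrightarrow> frozen_count q (ctr q y) h \<le> frozen_count q (ctr q x) h"
      proof -
        have "finite I0" by (simp add: I0_def)
        have "0 \<in> I0" by (simp add: I0_def Lam_def sdist_def)
        then have "I0 \<noteq> {}" by blast
        let ?f = "\<lambda>y. frozen_count q (ctr q y) h"
        have "Max (?f ` I0) \<in> ?f ` I0" using \<open>finite I0\<close> \<open>I0 \<noteq> {}\<close> by (intro Max_in) auto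
        then obtain x where "x \<in> I0" "?f x = Max (?f ` I0)" by auto
        then show ?thesis using \<open>finite I0\<close> by (intro that[of x]) auto
      qed
      have mx: "frozen_count q (ctr q y) h \<le> frozen_count q (ctr q x) h" if y: "y \<in> Lam M 0" for y
      proof (cases "y \<in> I0")
        case False
        then have 1: "frozen_count q (ctr q y) h \<le> t" using no y by (force simp: E1_def)
        show ?thesis
        proof (cases "t = 0")
          case t: False
          then obtain i where "i \<in> Sp" "t - 1 < frozen_count q (ctr q i) h" using no by (auto simp: E2_def)
          then have "t \<le> frozen_count q (ctr q i) h" "i \<in> I0" using SI by auto
          then show ?thesis using 1 x(2)[of i] by simp
        qed (use 1 in simp)
      qed (rule x(2))
      define Z where "Z i = card (Lam q (ctr q i) - minus_set (Lam (12 * q) (ctr q i)) h - plus_set (Lam (12 * q) (ctr q i)) (sh h))" for i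
      have ZZ: "Z i = frozen_count q (ctr q i) h" if i: "i \<in> Lam M 0" for i
      proof -
        have "Lam (12 * q) (ctr q i) \<subseteq> W"
        proof -
          have "sdist i 0 \<le> int M" using i by (simp add: Lam_def)
          then have "int (2 * q + 1) * sdist i 0 \<le> int (2 * q + 1) * int M" by (intro mult_left_mono) auto
          then have "sdist (ctr q i) 0 \<le> int (2 * q + 1) * int M" using sdist_ctr[of q i 0] by (simp add: ctr_0)
          then show ?thesis unfolding W_def by (intro Lam_mono) (simp add: algebra_simps)
        qed
        then have "plus_set (Lam (12 * q) (ctr q i)) (sh h) = plus_set (Lam (12 * q) (ctr q i)) (\<lambda>v. h v + 1 / real q)"
          using hh by (intro sets_cong(2)) blast
        then show ?thesis by (simp add: Z_def frozen_count_def)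
      qed
      show False
      proof (rule ring_contradiction[OF e q jM pow, where h = h and h' = "sh h" and Z = Z and x = x])
        show "x \<in> Lam (M - 4 * j) 0" using x(1) by (simp add: I0_def)
        show "Z y \<le> Z x" if "y \<in> Lam M 0" for y using mx[OF that] ZZ[OF that] ZZ[of x] x(1) I0M by auto
      qed (use hh r1 r2 in \<open>simp_all only: W_def Z_def\<close>)
    qed
    have evA: "ev (A im)" if "im \<in> Im" for im by (rule local_ev_ev[OF locA[OF that]])
    have evA': "ev (\<lambda>h. A im (sh h))" if "im \<in> Im" for im
      unfolding sh_def by (rule local_ev_ev[OF local_ev_shift[OF locA[OF that]]])
    have ev31: "ev (\<lambda>h. \<exists>im\<in>Im. A im h)" by (rule ev_Bex[OF fIm]) (rule evA)
    have ev32: "ev (\<lambda>h. \<exists>im\<in>Im. A im (sh h))" by (rule ev_Bex[OF fIm]) (rule evA')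
    note ev3 = ev31 ev32
    have s1: "pr (\<lambda>h. \<exists>im\<in>Im. A im h) \<le> 4 * nI * \<delta>"
    proof -
      have "pr (\<lambda>h. \<exists>im\<in>Im. A im h) \<le> (\<Sum>im\<in>Im. pr (A im))" by (rule pr_Bex_le[OF fIm]) (rule evA)
      also have "\<dots> \<le> (\<Sum>im\<in>Im. \<delta>)" by (intro sum_mono pA)
      finally show ?thesis using cIm by simp
    qed
    have s2: "pr (\<lambda>h. \<exists>im\<in>Im. A im (sh h)) \<le> 4 * nI * (R * \<delta> + exp \<kappa> / R)"
    proof -
      have "pr (\<lambda>h. \<exists>im\<in>Im. A im (sh h)) \<le> (\<Sum>im\<in>Im. pr (\<lambda>h. A im (sh h)))"
        by (rule pr_Bex_le[OF fIm]) (rule evA')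
      also have "\<dots> \<le> (\<Sum>im\<in>Im. R * \<delta> + exp \<kappa> / R)" by (intro sum_mono pA')
      finally show ?thesis using cIm by simp
    qed
    have "1 = pr (\<lambda>h. (\<exists>im\<in>Im. A im h) \<or> (\<exists>im\<in>Im. A im (sh h)) \<or> E1 h \<or> E2 h)"
      using all P.prob_space by (simp add: pr_def)
    also have "\<dots> \<le> pr (\<lambda>h. \<exists>im\<in>Im. A im h) + (pr (\<lambda>h. \<exists>im\<in>Im. A im (sh h)) + (pr E1 + pr E2))"
      by (intro order_trans[OF pr_disj_le] add_left_mono ev3 ev_disj evE1 evE2 pr_disj_le)
    also have "\<dots> \<le> 4 * nI * \<delta> + (4 * nI * (R * \<delta> + exp \<kappa> / R) + (1 / 8 + 1 / 8))"
      by (intro add_mono s1 s2 pE1 pE2)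
    also have "\<dots> = 4 * nI * ((R + 1) * \<delta>) + 4 * nI * (exp \<kappa> / R) + 1 / 4" by (simp add: algebra_simps)
    also have "(R + 1) * \<delta> = 1 / (32 * nI)" using R0 by (simp add: \<delta>_def)
    also have "exp \<kappa> / R = 1 / (32 * nI)" by (simp add: R_def)
    also have "4 * nI * (1 / (32 * nI)) = 1 / 8" using nI1 by simp
    finally show False by simp
  qed
  then show ?thesis using \<delta>0 \<delta>1 by (intro exI[of _ L] exI[of _ \<delta>]) (simp add: L_def)
qed

end

section \<open>Straight paths\<close>

text \<open>\<open>p\<close> lies in an ellipse with foci \<open>a\<close> and \<open>b\<close>.
  Minkowski's inequality for the vectors (u, v) and (D - u, v) bounds its half-width.\<close>

lemma collinear_deviation:
  fixes a b p :: "real \<times> real" and D m :: real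
  assumes D: "D = dist a b" "D > 0" and e: "e = (1 / D) *\<^sub>R (b - a)" and s: "dist a p + dist p b \<le> m"
  shows "D\<^sup>2 + 4 * ((p - a) \<bullet> perp e)\<^sup>2 \<le> m\<^sup>2" "norm e = 1"
proof -
  show ne: "norm e = 1" using D by (simp add: e dist_norm norm_minus_commute)
  have nrm: "norm w ^ 2 = (w \<bullet> e)\<^sup>2 + (w \<bullet> perp e)\<^sup>2" for w
  proof -
    obtain x y where w: "w = (x, y)" by (cases w)
    obtain c d where e': "e = (c, d)" by (cases e)
    have "c\<^sup>2 + d\<^sup>2 = 1" using ne by (simp add: e' norm_Pair)
    then have "x\<^sup>2 + y\<^sup>2 = (x * c + y * d)\<^sup>2 + (x * - d + y * c)\<^sup>2" by algebra
    then show ?thesis unfolding w e' by (simp add: norm_Pair inner_pair perp_def)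
  qed
  let ?u = "(p - a) \<bullet> e" and ?v = "(p - a) \<bullet> perp e"
  have be: "(b - a) = D *\<^sub>R e" using D by (simp add: e)
  have ee: "e \<bullet> e = 1" "e \<bullet> perp e = 0" using ne by (simp_all add: norm_eq_1 inner_pair perp_def)
  have 1: "(b - p) \<bullet> e = D - ?u" "(b - p) \<bullet> perp e = - ?v"
  proof -
    have "b - p = D *\<^sub>R e - (p - a)" using be by (simp add: algebra_simps)
    then show "(b - p) \<bullet> e = D - ?u" "(b - p) \<bullet> perp e = - ?v" by (simp_all add: inner_diff_left inner_add_left ee)
  qed
  have d1: "dist a p = sqrt (?u\<^sup>2 + ?v\<^sup>2)"
    using nrm[of "p - a"] by (metis dist_commute dist_norm norm_ge_zero real_sqrt_abs abs_of_nonneg)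
  have d2: "dist p b = sqrt ((D - ?u)\<^sup>2 + ?v\<^sup>2)"
    using nrm[of "b - p"] unfolding 1 by (metis dist_commute dist_norm norm_ge_zero real_sqrt_abs abs_of_nonneg power2_minus)
  have "sqrt ((?u + (D - ?u))\<^sup>2 + (?v + ?v)\<^sup>2) \<le> sqrt (?u\<^sup>2 + ?v\<^sup>2) + sqrt ((D - ?u)\<^sup>2 + ?v\<^sup>2)"
    by (rule real_sqrt_sum_squares_triangle_ineq)
  then have "sqrt (D\<^sup>2 + (?v + ?v)\<^sup>2) \<le> m" using s d1 d2 by simp
  then have "(sqrt (D\<^sup>2 + (?v + ?v)\<^sup>2))\<^sup>2 \<le> m\<^sup>2" by (intro power_mono) auto
  then have "D\<^sup>2 + (?v + ?v)\<^sup>2 \<le> m\<^sup>2" by simp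
  moreover have "(?v + ?v)\<^sup>2 = 4 * ?v\<^sup>2" by (simp add: power2_eq_square)
  ultimately show "D\<^sup>2 + 4 * ?v\<^sup>2 \<le> m\<^sup>2" by simp
qed

text \<open>Keep the piece from the last time behind the rear end to the next time beyond the front
  end. It overshoots by at most one step at either end, hence the \<open>8 * real q + 1\<close> in
  \<open>crosses\<close>.\<close>

lemma crosses_of_path:
  assumes e: "norm e = 1" and S: "\<And>i. i \<le> k \<Longrightarrow> g i \<in> S" and adj: "\<And>i. i < k \<Longrightarrow> adj (g i) (g (Suc i))"
    and v: "\<And>i. i \<le> k \<Longrightarrow> \<bar>(pos (g i) - pos c) \<bullet> perp e\<bar> \<le> 2 * real q"
    and u0: "(pos (g 0) - pos c) \<bullet> e \<le> - 8 * real q" and uk: "8 * real q \<le> (pos (g k) - pos c) \<bullet> e" and q: "q \<ge> 1"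
  shows "crosses e q c S"
proof -
  let ?u = "\<lambda>i. (pos (g i) - pos c) \<bullet> e"
  have step: "\<bar>?u (Suc i) - ?u i\<bar> \<le> 1" if "i < k" for i
  proof -
    have "?u (Suc i) - ?u i = (pos (g (Suc i)) - pos (g i)) \<bullet> e" by (simp add: inner_diff_left)
    moreover have "\<bar>(pos (g (Suc i)) - pos (g i)) \<bullet> e\<bar> \<le> norm (pos (g (Suc i)) - pos (g i)) * norm e" by (rule Cauchy_Schwarz_ineq2)
    moreover have "norm (pos (g (Suc i)) - pos (g i)) = 1" using dst_adj[OF adj[OF that]] by (simp add: dist_norm norm_minus_commute)
    ultimately show ?thesis using e by simp
  qed
  define a where "a = Max {i. i \<le> k \<and> ?u i \<le> - 8 * real q}"
  have fin: "finite {i. i \<le> k \<and> ?u i \<le> - 8 * real q}" by auto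
  have a: "a \<le> k" "?u a \<le> - 8 * real q"
  proof -
    have "0 \<in> {i. i \<le> k \<and> ?u i \<le> - 8 * real q}" using u0 by simp
    then have "a \<in> {i. i \<le> k \<and> ?u i \<le> - 8 * real q}" unfolding a_def using fin by (intro Max_in) blast+
    then show "a \<le> k" "?u a \<le> - 8 * real q" by simp_all
  qed
  have a': "- 8 * real q < ?u i" if "a < i" "i \<le> k" for i
  proof (rule ccontr)
    assume "\<not> ?thesis"
    then have "i \<in> {i. i \<le> k \<and> ?u i \<le> - 8 * real q}" using that by auto
    from Max_ge[OF fin this] that show False unfolding a_def by simp
  qed
  define b where "b = (LEAST i. a \<le> i \<and> 8 * real q \<le> ?u i)"
  have b: "a \<le> b" "8 * real q \<le> ?u b" "b \<le> k"
    using LeastI[of "\<lambda>i. a \<le> i \<and> 8 * real q \<le> ?u i" k] Least_le[of "\<lambda>i. a \<le> i \<and> 8 * real q \<le> ?u i" k] a(1) uk by (auto simp: b_def)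
  have b': "?u i < 8 * real q" if "a \<le> i" "i < b" for i
    using not_less_Least[of i "\<lambda>i. a \<le> i \<and> 8 * real q \<le> ?u i"] that by (auto simp: b_def)
  have ab: "a < b" using a b q by (cases "a = b") auto
  have bd: "\<bar>?u i\<bar> \<le> 8 * real q + 1" if "a \<le> i" "i \<le> b" for i
  proof -
    have lo: "- 8 * real q - 1 \<le> ?u i"
    proof (cases "i = a")
      case True
      have "- 8 * real q < ?u (Suc a)" using a'[of "Suc a"] ab b by simp
      then show ?thesis using step[of a] ab b True by (simp add: abs_le_iff)
    next
      case False then show ?thesis using a'[of i] that b by simp
    qed
    have hi: "?u i \<le> 8 * real q + 1"
    proof (cases "i = b")
      case True
      then obtain b1 where b1: "b = Suc b1" using ab by (cases b) auto
      have "?u b1 < 8 * real q" using b'[of b1] b1 ab by simp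
      then show ?thesis using step[of b1] b1 b True by (simp add: abs_le_iff)
    next
      case False then show ?thesis using b'[of i] that by simp
    qed
    show ?thesis using lo hi by (simp add: abs_le_iff)
  qed
  show ?thesis unfolding crosses_def
  proof (intro exI[of _ "\<lambda>i. g (a + i)"] exI[of _ "b - a"] conjI allI impI)
    show "walk S (\<lambda>i. g (a + i)) (b - a)" using S adj b by (auto simp: walk_def)
  qed (use a b ab v bd in auto)
qed

definition roundS :: "real \<times> real \<Rightarrow> site" where
  "roundS w = (round (fst w), round (snd w))"

lemma roundS_err: "dist (pos (roundS w)) w \<le> 1"
proof -
  have "\<bar>real_of_int (round (fst w)) - fst w\<bar> \<le> 1 / 2" "\<bar>real_of_int (round (snd w)) - snd w\<bar> \<le> 1 / 2"
    by (rule of_int_round_abs_le)+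
  moreover have "dist (pos (roundS w)) w \<le> dist (fst (pos (roundS w))) (fst w) + dist (snd (pos (roundS w))) (snd w)"
    unfolding dist_prod_def by (intro sqrt_sum_squares_le_sum) auto
  ultimately show ?thesis by (simp add: roundS_def pos_def dist_real_def)
qed

text \<open>Every site is tested in the box centred at itself. This gives a stationary random set
  with dependence range \<open>n\<close> that contains the disagreement of any larger box, as long
  as the box around the site fits inside.\<close>

definition loc :: "nat \<Rightarrow> (site \<Rightarrow> real) \<Rightarrow> site set" where
  "loc n h = {v. v \<in> disagree (Lam n v) h}"

lemma self_Lam: "v \<in> Lam n v"
  by (simp add: Lam_def sdist_def)

lemma loc_in_disagree:
  assumes "v \<in> loc n h" "Lam m c \<subseteq> Lam n v" "v \<in> Lam m c"
  shows "v \<in> disagree (Lam m c) h"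
  by (rule disagree_antimono[OF finite_Lam assms(2,3)]) (use assms(1) in \<open>simp add: loc_def\<close>)

lemma loc_mono: "n \<le> m \<Longrightarrow> loc m h \<subseteq> loc n h"
proof
  fix v assume nm: "n \<le> m" and v: "v \<in> loc m h"
  have "Lam n v \<subseteq> Lam m v" by (rule Lam_mono) (use nm in \<open>simp add: sdist_def\<close>)
  from loc_in_disagree[OF v this self_Lam] show "v \<in> loc n h" by (simp add: loc_def)
qed

text \<open>A run with displacement just above 2r all of whose sites lie in the thin ellipse with
  the end points as foci. There is no condition on its number of steps: being straight is a property
  of the shape only.\<close>

definition straight :: "real \<Rightarrow> nat \<Rightarrow> site \<Rightarrow> (site \<Rightarrow> real) \<Rightarrow> bool" where
  "straight \<kappa> r x h \<longleftrightarrow> (\<exists>g k. walk (loc (2 * r) h \<inter> Lam (8 * r) x) g k \<and> g 0 \<in> Lam r x \<and>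
     2 * real r < dst (g 0) (g k) \<and> dst (g 0) (g k) \<le> 2 * real r + 1 \<and>
     (\<forall>i\<le>k. dst (g 0) (g i) + dst (g i) (g k) \<le> (1 + 3 * \<kappa>) * (2 * real r)))"

lemma card_cell_Lam:
  assumes w: "w \<ge> 1"
  shows "finite (cell w ` Lam n x)" "real (card (cell w ` Lam n x)) \<le> (2 * real n / real w + 2)\<^sup>2"
proof -
  let ?A = "{(fst x - int n) div int w..(fst x + int n) div int w}" and ?B = "{(snd x - int n) div int w..(snd x + int n) div int w}"
  have sub: "cell w ` Lam n x \<subseteq> ?A \<times> ?B" using w by (auto simp: Lam_eq cell_def intro!: zdiv_mono1)
  show "finite (cell w ` Lam n x)" by simp
  have c: "real (card {(y - int n) div int w..(y + int n) div int w}) \<le> 2 * real n / real w + 2" for y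
  proof -
    have "real_of_int ((y + int n) div int w) \<le> (real_of_int y + real n) / real w"
      using real_of_int_div4[of "y + int n" "int w"] by simp
    moreover have "(real_of_int y - real n) / real w - 1 \<le> real_of_int ((y - int n) div int w)"
      using real_of_int_div3[of "y - int n" "int w"] by simp
    moreover have "(y - int n) div int w \<le> (y + int n) div int w" using w by (intro zdiv_mono1) auto
    ultimately show ?thesis using w by (simp add: field_simps)
  qed
  have "real (card (cell w ` Lam n x)) \<le> real (card (?A \<times> ?B))"
    using card_mono[OF _ sub] by (simp only: of_nat_le_iff) simp
  also have "\<dots> = real (card ?A) * real (card ?B)" by (simp add: card_cartesian_product)
  also have "\<dots> \<le> (2 * real n / real w + 2) * (2 * real n / real w + 2)" by (intro mult_mono c) auto
  finally show "real (card (cell w ` Lam n x)) \<le> (2 * real n / real w + 2)\<^sup>2" by (simp add: power2_eq_square)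
qed

definition snap :: "nat \<Rightarrow> site \<Rightarrow> site" where
  "snap w a = (int w * fst a, int w * snd a)"

lemma snap_cell:
  assumes "w \<ge> 1" shows "sdist p (snap w (cell w p)) < int w"
proof -
  have 1: "y - int w * (y div int w) = y mod int w" for y by (simp add: minus_mult_div_eq_mod)
  have "\<bar>y - int w * (y div int w)\<bar> < int w" for y unfolding 1 using assms by simp
  then show ?thesis unfolding sdist_def snap_def cell_def fst_conv snd_conv by simp
qed

context gaussian_field
begin

lemma local_ev_loc: "local_ev (Lam n v) (\<lambda>h. v \<in> loc n h)"
  using local_ev_disagree[of "Lam n v" "\<lambda>D. v \<in> D"] by (simp add: loc_def)

lemma local_ev_loc_set:
  "local_ev (Lam (m + n) x) (\<lambda>h. Q (loc n h \<inter> Lam m x))"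
proof -
  have "local_ev (Lam (m + n) x) (\<lambda>h. Q {v \<in> Lam m x. v \<in> loc n h})"
  proof (rule local_ev_combine)
    fix v assume "v \<in> Lam m x"
    then have "Lam n v \<subseteq> Lam (m + n) x" by (intro Lam_mono) (simp add: Lam_def)
    then show "local_ev (Lam (m + n) x) (\<lambda>h. v \<in> loc n h)" by (intro local_ev_mono[OF local_ev_loc]) auto
  qed auto
  moreover have "{v \<in> Lam m x. v \<in> loc n h} = loc n h \<inter> Lam m x" for h by auto
  ultimately show ?thesis by simp
qed

lemma local_ev_straight: "local_ev (Lam (10 * r) x) (straight \<kappa> r x)"
  unfolding straight_def using local_ev_loc_set[of "8 * r" "2 * r" x] by simp

text \<open>The spacing 4Lq leaves room for rounding the centres and for the factor 3/2 between the
  two distances, so that boxes of radius Lq stay disjoint and the tubes independent.\<close>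

lemma tubes_along_line:
  assumes tb: "\<And>q e c. q \<ge> 4 \<Longrightarrow> norm e = 1 \<Longrightarrow> pr (tube e q L c) \<le> 1 - \<delta>" and L: "L \<ge> 30" and q: "q \<ge> 4" and e: "norm e = 1"
    and c: "\<And>i. c i = roundS (a + (real i * (4 * real L * real q)) *\<^sub>R e)"
  shows "ev (\<lambda>h. \<forall>i\<in>{1..I}. tube e q L (c i) h)" "pr (\<lambda>h. \<forall>i\<in>{1..I::nat}. tube e q L (c i) h) \<le> (1 - \<delta>) ^ I"
proof -
  let ?K = "\<lambda>i. Lam (L * q) (c i)"
  have fK: "finite (\<Union>i\<in>{1..I}. ?K i)" by simp
  have "local_ev (\<Union>i\<in>{1..I}. ?K i) (\<lambda>h. \<forall>i\<in>{1..I}. tube e q L (c i) h)"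
  proof (rule local_ev_Ball[OF _ fK])
    fix i assume "i \<in> {1..I}"
    then show "local_ev (\<Union>i\<in>{1..I}. ?K i) (tube e q L (c i))" by (intro local_ev_mono[OF local_ev_tube _ fK]) blast
  qed simp
  then show "ev (\<lambda>h. \<forall>i\<in>{1..I}. tube e q L (c i) h)" by (rule local_ev_ev)
  have dj: "disjoint_family_on ?K {1..I}"
    unfolding disjoint_family_on_def
  proof (intro ballI impI)
    fix i j assume ij: "i \<in> {1..I}" "j \<in> {1..I}" "i \<noteq> j"
    let ?s = "4 * real L * real q"
    have Lq: "120 \<le> real L * real q"
    proof -
      have "30 * 4 \<le> real L * real q" using L q by (intro mult_mono) auto
      then show ?thesis by simp
    qed
    have "dist (a + (real i * ?s) *\<^sub>R e) (a + (real j * ?s) *\<^sub>R e) = \<bar>real i - real j\<bar> * ?s"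
    proof -
      have "(a + (real i * ?s) *\<^sub>R e) - (a + (real j * ?s) *\<^sub>R e) = ((real i - real j) * ?s) *\<^sub>R e"
        by (simp add: algebra_simps)
      then show ?thesis using e Lq by (simp add: dist_norm abs_mult)
    qed
    moreover have "1 \<le> \<bar>real i - real j\<bar>" using ij by linarith
    then have "1 * ?s \<le> \<bar>real i - real j\<bar> * ?s" using Lq by (intro mult_right_mono) auto
    moreover have "dist (a + (real i * ?s) *\<^sub>R e) (a + (real j * ?s) *\<^sub>R e) \<le> 1 + dst (c i) (c j) + 1"
      using roundS_err[of "a + (real i * ?s) *\<^sub>R e"] roundS_err[of "a + (real j * ?s) *\<^sub>R e"]
        dist_triangle[of "a + (real i * ?s) *\<^sub>R e" "a + (real j * ?s) *\<^sub>R e" "pos (c i)"]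
        dist_triangle[of "pos (c i)" "a + (real j * ?s) *\<^sub>R e" "pos (c j)"]
      unfolding c by (simp add: dist_commute)
    ultimately have "4 * (real L * real q) - 2 \<le> dst (c i) (c j)" by simp
    then have "4 * (real L * real q) - 2 \<le> 3 / 2 * real_of_int (sdist (c i) (c j))" using dst_le_sdist[of "c i" "c j"] by linarith
    then have "2 * (real L * real q) < real_of_int (sdist (c i) (c j))" using Lq by linarith
    then have "real_of_int (int (2 * (L * q))) < real_of_int (sdist (c i) (c j))" by simp
    then have far: "int (2 * (L * q)) < sdist (c i) (c j)" by (simp only: of_int_less_iff)
    show "?K i \<inter> ?K j = {}"
    proof (rule ccontr)
      assume "\<not> ?thesis"
      then obtain v where "sdist v (c i) \<le> int (L * q)" "sdist v (c j) \<le> int (L * q)" unfolding Lam_def by blast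
      then show False using far sdist_triangle[of "c i" "c j" v] by (simp add: sdist_sym)
    qed
  qed
  have "pr (\<lambda>h. \<forall>i\<in>{1..I}. tube e q L (c i) h) = (\<Prod>i\<in>{1..I}. pr (tube e q L (c i)))"
    by (rule pr_indep_Ball[OF _ local_ev_tube dj]) simp
  also have "\<dots> \<le> (\<Prod>i\<in>{1..I}. 1 - \<delta>)" using tb[OF q e] by (intro prod_mono) auto
  finally show "pr (\<lambda>h. \<forall>i\<in>{1..I}. tube e q L (c i) h) \<le> (1 - \<delta>) ^ I" by simp
qed

end

definition dirv :: "site \<Rightarrow> site \<Rightarrow> real \<times> real" where
  "dirv y f = (1 / dst y f) *\<^sub>R (pos f - pos y)"

text \<open>The ellipse has half-width of order r times the square root of its relative excess,
  whence excess \<kappa> = 1/s^2 for tubes of width q about 4r/s. The \<open>I\<close> tubes take up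
  at most I * 4L * 5r/s = 5r/6 of the run, so all are crossed. Snapping the end points to a grid of
  mesh \<open>w\<close>, at most \<kappa>r, leaves only boundedly many tube families, uniformly in
  \<open>r\<close>.\<close>

lemma straight_implies_tubes:
  fixes L I r :: nat
  defines "s \<equiv> 24 * L * I"
  defines "w \<equiv> r div s\<^sup>2" and "q \<equiv> nat \<lceil>4 * real r / real s\<rceil>"
  assumes L: "L \<ge> 30" and I: "I \<ge> 1" and r: "r \<ge> 2 * s\<^sup>2"
    and st: "straight (1 / real s ^ 2) r x h"
  shows "\<exists>a\<in>cell w ` Lam (8 * r) x. \<exists>b\<in>cell w ` Lam (8 * r) x. snap w a \<noteq> snap w b \<and>
    (\<forall>i\<in>{1..I}. tube (dirv (snap w a) (snap w b)) q L
      (roundS (pos (snap w a) + (real i * (4 * real L * real q)) *\<^sub>R dirv (snap w a) (snap w b))) h)"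
proof -
  define \<kappa> where "\<kappa> = 1 / real s ^ 2"
  have s720: "720 \<le> s"
  proof -
    have "24 * 30 * 1 \<le> 24 * L * I" using L I by (intro mult_le_mono) auto
    then show ?thesis by (simp add: s_def)
  qed
  have s0: "0 < real s" "1 \<le> real s" using s720 by auto
  have \<kappa>: "0 < \<kappa>" "\<kappa> * real s \<le> 1" "\<kappa> \<le> 1 / 720" "\<kappa> * real s ^ 2 = 1"
  proof -
    show "0 < \<kappa>" "\<kappa> * real s ^ 2 = 1" using s0 by (simp_all add: \<kappa>_def)
    have "\<kappa> * real s = 1 / real s" using s0 by (simp add: \<kappa>_def power2_eq_square)
    then show "\<kappa> * real s \<le> 1" using s0 by simp
    have "\<kappa> \<le> 1 / real s" using s0 by (simp add: \<kappa>_def power2_eq_square field_simps)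
    also have "\<dots> \<le> 1 / 720" using s720 by (intro divide_left_mono) auto
    finally show "\<kappa> \<le> 1 / 720" .
  qed
  have rs: "2 * (real s)\<^sup>2 \<le> real r" using r by (metis of_nat_le_iff of_nat_mult of_nat_numeral of_nat_power)
  have rs1: "real s \<le> real r"
  proof -
    have "real s * 1 \<le> real s * real s" using s0 by (intro mult_left_mono) auto
    then show ?thesis using rs s0 unfolding power2_eq_square by linarith
  qed
  have r0: "0 < real r" using rs1 s0 by linarith
  have w1: "1 \<le> w" unfolding w_def using r s720 by (simp add: less_eq_div_iff_mult_less_eq)
  have wr: "real w \<le> \<kappa> * real r"
  proof -
    have "w * s\<^sup>2 \<le> r" unfolding w_def by (rule div_times_less_eq_dividend)
    then have "real (w * s\<^sup>2) \<le> real r" by (simp only: of_nat_le_iff)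
    then show ?thesis using s0 by (simp add: \<kappa>_def field_simps)
  qed
  have q1: "4 * real r / real s \<le> real q" unfolding q_def using r0 s0 by linarith
  have q2: "real q \<le> 5 * real r / real s"
  proof -
    have "real q \<le> 4 * real r / real s + 1" unfolding q_def using r0 s0 by (simp add: of_nat_nat)
    also have "1 \<le> real r / real s" using rs1 s0 by simp
    finally show ?thesis by (simp add: add_divide_distrib[symmetric])
  qed
  have q4: "4 \<le> real q"
  proof -
    have "1 \<le> real r / real s" using rs1 s0 by simp
    moreover have "4 * real r / real s = 4 * (real r / real s)" by simp
    ultimately show ?thesis using q1 by linarith
  qed
  have \<kappa>r: "\<kappa> * real r \<le> real q"
  proof -
    have "\<kappa> * real r = real r / real s * (1 / real s)" by (simp add: \<kappa>_def power2_eq_square)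
    also have "\<dots> \<le> real r / real s * 1" using s0 r0 by (intro mult_left_mono) auto
    finally have "\<kappa> * real r \<le> real r / real s" by simp
    moreover have "4 * real r / real s = 4 * (real r / real s)" "0 \<le> real r / real s" by simp_all
    ultimately show ?thesis using q1 by linarith
  qed
  from st obtain g k where g: "walk (loc (2 * r) h \<inter> Lam (8 * r) x) g k" "g 0 \<in> Lam r x"
    "2 * real r < dst (g 0) (g k)" "dst (g 0) (g k) \<le> 2 * real r + 1"
    "\<And>i. i \<le> k \<Longrightarrow> dst (g 0) (g i) + dst (g i) (g k) \<le> (1 + 3 * \<kappa>) * (2 * real r)"
    unfolding straight_def \<kappa>_def by blast
  let ?y = "snap w (cell w (g 0))" and ?f = "snap w (cell w (g k))"
  have snap: "dst p (snap w (cell w p)) \<le> 3 / 2 * (\<kappa> * real r)" for p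
  proof -
    have "real_of_int (sdist p (snap w (cell w p))) \<le> real w" using snap_cell[OF w1, of p] by linarith
    then show ?thesis using dst_le_sdist[of p "snap w (cell w p)"] wr by linarith
  qed
  define D where "D = dst ?y ?f"
  have D1: "2 * real r - 3 * (\<kappa> * real r) \<le> D"
    using g(3) snap[of "g 0"] snap[of "g k"] dist_triangle[of "pos (g 0)" "pos (g k)" "pos ?y"]
      dist_triangle[of "pos ?y" "pos (g k)" "pos ?f"] unfolding D_def by (simp add: dist_commute)
  have \<kappa>r2: "\<kappa> * real r \<le> 1 / 720 * real r" using \<kappa> r0 by (intro mult_right_mono) auto
  have D0: "D > 0" using D1 \<kappa>r2 r0 by linarith
  define e where "e = dirv ?y ?f"
  have e_eq: "e = (1 / D) *\<^sub>R (pos ?f - pos ?y)" by (simp add: e_def dirv_def D_def)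
  \<comment> \<open>The excess 6 \<kappa> r of the run plus 3 \<kappa> r for snapping both end
    points.\<close>
  define m where "m = 2 * real r + 9 * (\<kappa> * real r)"
  have sum: "dist (pos ?y) (pos (g i)) + dist (pos (g i)) (pos ?f) \<le> m" if "i \<le> k" for i
    using g(5)[OF that] snap[of "g 0"] snap[of "g k"] dist_triangle[of "pos ?y" "pos (g i)" "pos (g 0)"]
      dist_triangle[of "pos (g i)" "pos ?f" "pos (g k)"] unfolding m_def by (simp add: dist_commute algebra_simps)
  note cd = collinear_deviation[OF D_def D0 e_eq sum]
  have ne: "norm e = 1" by (rule cd(2)[of 0]) simp
  have dev: "\<bar>(pos (g i) - pos ?y) \<bullet> perp e\<bar> \<le> 4 * real r / real s" if "i \<le> k" for i
  proof -
    let ?d = "(pos (g i) - pos ?y) \<bullet> perp e"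
    have "(2 * real r - 3 * (\<kappa> * real r))\<^sup>2 \<le> D\<^sup>2" using D1 \<kappa>r2 r0 by (intro power_mono) auto
    then have "4 * ?d\<^sup>2 \<le> m\<^sup>2 - (2 * real r - 3 * (\<kappa> * real r))\<^sup>2" using cd(1)[OF that] by linarith
    also have "\<dots> = (48 * \<kappa> + 72 * \<kappa>\<^sup>2) * (real r)\<^sup>2" by (simp add: m_def power2_eq_square algebra_simps)
    also have "\<dots> \<le> (64 * \<kappa>) * (real r)\<^sup>2"
    proof (intro mult_right_mono)
      have "\<kappa>\<^sup>2 \<le> \<kappa> * (1 / 720)" unfolding power2_eq_square using \<kappa> by (intro mult_left_mono) auto
      then show "48 * \<kappa> + 72 * \<kappa>\<^sup>2 \<le> 64 * \<kappa>" using \<kappa>(1) by linarith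
    qed simp
    also have "\<dots> = 4 * (4 * real r / real s)\<^sup>2" by (simp add: \<kappa>_def power_divide power_mult_distrib)
    finally have "?d\<^sup>2 \<le> (4 * real r / real s)\<^sup>2" by simp
    then have "\<bar>?d\<bar> \<le> \<bar>4 * real r / real s\<bar>" by (simp only: abs_le_square_iff)
    then show ?thesis by simp
  qed
  have main: "tube e q L (roundS (pos ?y + (real i * (4 * real L * real q)) *\<^sub>R e)) h" if i: "i \<in> {1..I}" for i
  proof -
    define \<sigma> where "\<sigma> = 4 * real L * real q"
    let ?c = "roundS (pos ?y + (real i * \<sigma>) *\<^sub>R e)"
    define er where "er = pos ?c - (pos ?y + (real i * \<sigma>) *\<^sub>R e)"
    have ner: "norm er \<le> 1" unfolding er_def using roundS_err[of "pos ?y + (real i * \<sigma>) *\<^sub>R e"] by (simp add: dist_norm)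
    have np: "norm (perp e) = 1" using perp_pow_norm[of 1 e] ne by simp
    have er1: "\<bar>er \<bullet> e\<bar> \<le> 1" "\<bar>er \<bullet> perp e\<bar> \<le> 1"
      using Cauchy_Schwarz_ineq2[of er e] Cauchy_Schwarz_ineq2[of er "perp e"] ner ne np by simp_all
    have ee: "e \<bullet> e = 1" "e \<bullet> perp e = 0" using ne by (simp_all add: norm_eq_1 inner_pair perp_def)
    have pc: "pos p - pos ?c = (pos p - pos ?y) - (real i * \<sigma>) *\<^sub>R e - er" for p by (simp add: er_def)
    have cu: "(pos p - pos ?c) \<bullet> e = (pos p - pos ?y) \<bullet> e - real i * \<sigma> - er \<bullet> e"
      "(pos p - pos ?c) \<bullet> perp e = (pos p - pos ?y) \<bullet> perp e - er \<bullet> perp e" for p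
      unfolding pc by (simp_all only: inner_diff_left inner_scaleR_left ee mult_1_right mult_zero_right diff_0_right)
    have \<sigma>120: "120 * real q \<le> \<sigma>"
    proof -
      have "4 * 30 * real q \<le> 4 * real L * real q" using L by (intro mult_right_mono) auto
      then show ?thesis by (simp add: \<sigma>_def)
    qed
    have "crosses e q ?c (loc (2 * r) h \<inter> Lam (8 * r) x)"
    proof (rule crosses_of_path[OF ne, where g = g and k = k])
      show "g i \<in> loc (2 * r) h \<inter> Lam (8 * r) x" if "i \<le> k" for i using g(1) that by (simp add: walk_def)
      show "adj (g i) (g (Suc i))" if "i < k" for i using g(1) that by (simp add: walk_def)
      show "\<bar>(pos (g l) - pos ?c) \<bullet> perp e\<bar> \<le> 2 * real q" if "l \<le> k" for l
        unfolding cu using dev[OF that] er1(2) q1 q4 by linarith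
      have "\<bar>(pos (g 0) - pos ?y) \<bullet> e\<bar> \<le> 3 / 2 * (\<kappa> * real r)"
        using Cauchy_Schwarz_ineq2[of "pos (g 0) - pos ?y" e] snap[of "g 0"] ne by (simp add: dist_norm)
      moreover have "1 * \<sigma> \<le> real i * \<sigma>" using i \<sigma>120 q4 by (intro mult_right_mono) auto
      ultimately show "(pos (g 0) - pos ?c) \<bullet> e \<le> - 8 * real q"
        unfolding cu using er1(1) \<sigma>120 \<kappa>r q4 by linarith
      have a1: "\<bar>(pos (g k) - pos ?f) \<bullet> e\<bar> \<le> 3 / 2 * (\<kappa> * real r)"
        using Cauchy_Schwarz_ineq2[of "pos (g k) - pos ?f" e] snap[of "g k"] ne by (simp add: dist_norm)
      have a2: "(pos ?f - pos ?y) \<bullet> e = D"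
      proof -
        have "pos ?f - pos ?y = D *\<^sub>R e" using D0 by (simp add: e_eq)
        then show ?thesis using ee by simp
      qed
      have a3: "(pos (g k) - pos ?y) \<bullet> e = (pos (g k) - pos ?f) \<bullet> e + (pos ?f - pos ?y) \<bullet> e"
        by (simp add: inner_diff_left)
      have a4: "real i * \<sigma> \<le> 5 / 6 * real r"
      proof -
        have "real i * \<sigma> \<le> real I * (4 * real L * (5 * real r / real s))"
          unfolding \<sigma>_def using i q2 by (intro mult_mono) auto
        also have "\<dots> = 5 / 6 * real r * ((24 * real L * real I) / real s)" by (simp add: field_simps)
        also have "(24 * real L * real I) / real s = 1" using L I by (simp add: s_def)
        finally show ?thesis by simp
      qed
      have a5: "real q \<le> 5 / 720 * real r"
      proof -
        have "5 * real r / real s \<le> 5 * real r / 720" using s720 r0 by (intro divide_left_mono) auto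
        then show ?thesis using q2 by simp
      qed
      show "8 * real q \<le> (pos (g k) - pos ?c) \<bullet> e"
        unfolding cu a3 a2 using a1 a4 a5 D1 \<kappa>r2 er1(1) r0 q4 by linarith
      show "q \<ge> 1" using q4 by simp
    qed
    then have "crosses e q ?c (disagree (Lam (L * q) ?c) h)"
    proof (rule crosses_mono[OF _ _ ne])
      fix v assume v: "v \<in> loc (2 * r) h \<inter> Lam (8 * r) x" "dst v ?c \<le> 10 * real q + 1"
      have "real_of_int (sdist v ?c) \<le> real_of_int (11 * int q)" using sdist_le_dst[of v ?c] v(2) q4 by simp
      then have sv: "sdist v ?c \<le> 11 * int q" by (simp only: of_int_le_iff)
      have "11 * q \<le> L * q" using L by simp
      then have "11 * int q \<le> int (L * q)" by (metis of_nat_le_iff of_nat_mult of_nat_numeral)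
      then have vin: "v \<in> Lam (L * q) ?c" using sv by (simp add: Lam_def)
      have "(11 + real L) * real q \<le> 2 * real L * (5 * real r / real s)" using L q2 by (intro mult_mono) auto
      also have "\<dots> \<le> 2 * real r"
      proof -
        have "10 * real L \<le> 2 * real s"
        proof -
          have "24 * real L * 1 \<le> 24 * real L * real I" using I by (intro mult_left_mono) auto
          moreover have "real s = 24 * real L * real I" by (simp add: s_def)
          ultimately show ?thesis using of_nat_0_le_iff[of L, where ?'a = real] by linarith
        qed
        then have "10 * real L * real r \<le> 2 * real s * real r" using r0 by (intro mult_right_mono) auto
        then show ?thesis using s0 by (simp add: field_simps)
      qed
      finally have "real (11 * q + L * q) \<le> real (2 * r)" by (simp add: algebra_simps)
      then have "11 * q + L * q \<le> 2 * r" by (simp only: of_nat_le_iff)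
      then have "int (11 * q + L * q) \<le> int (2 * r)" by (simp only: of_nat_le_iff)
      then have sub: "Lam (L * q) ?c \<subseteq> Lam (2 * r) v" using sv by (intro Lam_mono) (simp add: sdist_sym)
      show "v \<in> disagree (Lam (L * q) ?c) h" by (rule loc_in_disagree[OF _ sub vin]) (use v in simp)
    qed
    then show ?thesis by (simp add: tube_def \<sigma>_def)
  qed
  have in0: "g 0 \<in> Lam (8 * r) x" "g k \<in> Lam (8 * r) x" using g(1) by (auto simp: walk_def)
  have "?y \<noteq> ?f" using D0 by (auto simp: D_def)
  then show ?thesis using in0 main unfolding e_def
    by (intro bexI[of _ "cell w (g 0)"] bexI[of _ "cell w (g k)"] conjI ballI) auto
qed

text \<open>Proved through the sixteenth root of \<open>x\<close>. The exponent 16 is generous: the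
  number of end point pairs grows like I^8, the number of starting cells in
  \<open>tortuous_step\<close> like P^2.\<close>

lemma power_times_geometric:
  fixes x C :: real
  assumes "0 < x" "x < 1" "\<tau> > 0"
  shows "\<exists>I\<ge>N0. C * real I ^ 16 * x ^ I \<le> \<tau>"
proof -
  define y where "y = x powr (1 / 16)"
  have y: "0 < y" "y < 1" using assms powr_less_mono2[of "1 / 16" x 1] by (simp_all add: y_def)
  have yx: "y ^ 16 = x" using assms by (simp add: y_def powr_realpow[symmetric] powr_powr)
  have "(\<lambda>n. of_nat n * y ^ n) \<longlonglongrightarrow> 0" using y by (intro powser_times_n_limit_0) auto
  then have "(\<lambda>n. C * (real n * y ^ n) ^ 16) \<longlonglongrightarrow> C * 0 ^ 16" by (intro tendsto_intros)
  then have "(\<lambda>n. C * (real n * y ^ n) ^ 16) \<longlonglongrightarrow> 0" by simp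
  then have "eventually (\<lambda>n. C * (real n * y ^ n) ^ 16 < \<tau>) sequentially" using assms(3) by (rule order_tendstoD)
  then have "eventually (\<lambda>n. n \<ge> N0 \<and> C * (real n * y ^ n) ^ 16 < \<tau>) sequentially"
    using eventually_ge_at_top[of N0] by eventually_elim auto
  then obtain n where n: "n \<ge> N0" "C * (real n * y ^ n) ^ 16 < \<tau>" by (auto simp: eventually_sequentially)
  have "(real n * y ^ n) ^ 16 = real n ^ 16 * x ^ n"
    by (simp add: power_mult_distrib power_mult[symmetric] mult.commute) (simp add: power_mult yx mult.commute[of n 16])
  then show ?thesis using n by (intro exI[of _ n]) (simp add: mult.assoc)
qed

context gaussian_field
begin

text \<open>The number of pairs of snapped end points is polynomial in \<open>I\<close>, while
  \<open>I\<close> independent tubes are all crossed with probability at most (1 - \<delta>)^I. This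
  amplifies the fixed gain of \<open>tube_bound\<close> to an arbitrarily small probability.\<close>

theorem straight_bound:
  assumes \<tau>: "\<tau> > 0"
  shows "\<exists>\<kappa> r0. 0 < \<kappa> \<and> \<kappa> \<le> 1 / 720 \<and> (\<forall>r\<ge>r0. \<forall>x. pr (straight \<kappa> r x) \<le> \<tau>)"
proof -
  obtain L \<delta> where L: "L \<ge> 30" and \<delta>: "0 < \<delta>" "\<delta> < 1"
    and tb: "\<And>q e c. q \<ge> 4 \<Longrightarrow> norm e = 1 \<Longrightarrow> pr (tube e q L c) \<le> 1 - \<delta>"
    using tube_bound by blast
  obtain I where I: "I \<ge> 1" and small: "(34 ^ 4 * (24 * real L) ^ 8) * real I ^ 16 * (1 - \<delta>) ^ I \<le> \<tau>"
    using power_times_geometric[of "1 - \<delta>" \<tau> 1 "34 ^ 4 * (24 * real L) ^ 8"] \<delta> \<tau> by auto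
  define s where "s = 24 * L * I"
  have s720: "720 \<le> s"
  proof -
    have "24 * 30 * 1 \<le> 24 * L * I" using L I by (intro mult_le_mono) auto
    then show ?thesis by (simp add: s_def)
  qed
  have s1: "1 \<le> real s" using s720 by simp
  have "pr (straight (1 / real s ^ 2) r x) \<le> \<tau>" if r: "r \<ge> 2 * s\<^sup>2" for r x
  proof -
    define w where "w = r div s\<^sup>2"
    define q where "q = nat \<lceil>4 * real r / real s\<rceil>"
    define B where "B = cell w ` Lam (8 * r) x"
    define Pr where "Pr = {ab \<in> B \<times> B. snap w (fst ab) \<noteq> snap w (snd ab)}"
    let ?e = "\<lambda>ab. dirv (snap w (fst ab)) (snap w (snd ab))"
    let ?c = "\<lambda>ab i. roundS (pos (snap w (fst ab)) + (real i * (4 * real L * real q)) *\<^sub>R ?e ab)"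
    have rs: "2 * (real s)\<^sup>2 \<le> real r" using r by (metis of_nat_le_iff of_nat_mult of_nat_numeral of_nat_power)
    have w1: "1 \<le> w" unfolding w_def using r s720 by (simp add: less_eq_div_iff_mult_less_eq)
    have wl: "real r / real s ^ 2 - 1 \<le> real w"
    proof -
      have "r < s\<^sup>2 + w * s\<^sup>2" unfolding w_def using s720 by (intro dividend_less_div_times) simp
      then have "real r < real (s\<^sup>2 + w * s\<^sup>2)" by (simp only: of_nat_less_iff)
      then have "real r < (1 + real w) * real s ^ 2" by (simp add: algebra_simps)
      then show ?thesis using s1 by (simp add: field_simps)
    qed
    have fB: "finite B" and cB: "real (card B) \<le> (2 * real (8 * r) / real w + 2)\<^sup>2"
      unfolding B_def using card_cell_Lam[OF w1, of "8 * r" x] by auto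
    have "2 * real (8 * r) / real w \<le> 32 * (real s)\<^sup>2"
    proof -
      have "1 \<le> real r / (2 * real s ^ 2)" using rs s1 by (simp add: field_simps)
      then have "real r / (2 * real s ^ 2) \<le> real w" using wl by (simp add: field_simps)
      then have "real r \<le> real w * (2 * (real s)\<^sup>2)" using s1 by (simp add: field_simps)
      then show ?thesis using w1 by (simp add: field_simps)
    qed
    moreover have "2 \<le> 2 * (real s)\<^sup>2" using s1 by (simp add: one_le_power)
    ultimately have "2 * real (8 * r) / real w + 2 \<le> 34 * (real s)\<^sup>2" by linarith
    then have "(2 * real (8 * r) / real w + 2)\<^sup>2 \<le> (34 * (real s)\<^sup>2)\<^sup>2" by (intro power_mono) auto
    with cB have cB': "real (card B) \<le> (34 * (real s)\<^sup>2)\<^sup>2" by linarith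
    have fP: "finite Pr" using fB by (simp add: Pr_def)
    have cP: "real (card Pr) \<le> (34 * (real s)\<^sup>2) ^ 4"
    proof -
      have "card Pr \<le> card (B \<times> B)" using fB by (intro card_mono) (auto simp: Pr_def)
      then have "real (card Pr) \<le> real (card B) * real (card B)" by (metis card_cartesian_product of_nat_le_iff of_nat_mult)
      also have "\<dots> \<le> (34 * (real s)\<^sup>2)\<^sup>2 * (34 * (real s)\<^sup>2)\<^sup>2" using cB' by (intro mult_mono) auto
      also have "\<dots> = (34 * (real s)\<^sup>2) ^ 4" by (simp add: power2_eq_square power4_eq_xxxx)
      finally show ?thesis .
    qed
    have q4: "q \<ge> 4"
    proof -
      have "real s * 1 \<le> real s * real s" using s1 by (intro mult_left_mono) auto
      then have "real s \<le> real r" using rs s1 unfolding power2_eq_square by linarith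
      then have "4 \<le> 4 * real r / real s" using s1 by (simp add: field_simps)
      then have "real 4 \<le> real q" unfolding q_def by linarith
      then show ?thesis by (simp only: of_nat_le_iff)
    qed
    have ne: "norm (?e ab) = 1" if "ab \<in> Pr" for ab
    proof -
      have "pos (snap w (fst ab)) \<noteq> pos (snap w (snd ab))" using that by (auto simp: Pr_def pos_def prod_eq_iff)
      then show ?thesis by (simp add: dirv_def dist_norm norm_minus_commute)
    qed
    note tl = tubes_along_line[OF tb L q4 ne refl]
    have "pr (straight (1 / real s ^ 2) r x) \<le> pr (\<lambda>h. \<exists>ab\<in>Pr. \<forall>i\<in>{1..I}. tube (?e ab) q L (?c ab i) h)"
    proof (rule pr_mono)
      show "ev (\<lambda>h. \<exists>ab\<in>Pr. \<forall>i\<in>{1..I}. tube (?e ab) q L (?c ab i) h)"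
        by (rule ev_Bex[OF fP]) (rule tl(1))
      fix h assume "straight (1 / real s ^ 2) r x h"
      from straight_implies_tubes[OF L I, of r x h, folded s_def, folded w_def q_def, OF r this]
      obtain a b where ab: "a \<in> B" "b \<in> B" "snap w a \<noteq> snap w b"
        "\<forall>i\<in>{1..I}. tube (?e (a, b)) q L (?c (a, b) i) h" unfolding B_def fst_conv snd_conv by blast
      then show "\<exists>ab\<in>Pr. \<forall>i\<in>{1..I}. tube (?e ab) q L (?c ab i) h"
        by (intro bexI[of _ "(a, b)"]) (simp_all add: Pr_def)
    qed
    also have "\<dots> \<le> (\<Sum>ab\<in>Pr. pr (\<lambda>h. \<forall>i\<in>{1..I}. tube (?e ab) q L (?c ab i) h))"
      by (rule pr_Bex_le[OF fP]) (rule tl(1))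
    also have "\<dots> \<le> (\<Sum>ab\<in>Pr. (1 - \<delta>) ^ I)" by (intro sum_mono tl(2))
    also have "\<dots> = real (card Pr) * (1 - \<delta>) ^ I" by simp
    also have "\<dots> \<le> (34 * (real s)\<^sup>2) ^ 4 * (1 - \<delta>) ^ I" using cP \<delta> by (intro mult_right_mono) auto
    also have "(34 * (real s)\<^sup>2) ^ 4 = 34 ^ 4 * (24 * real L) ^ 8 * real I ^ 8"
      by (simp add: s_def power_mult_distrib power_mult[symmetric])
    also have "34 ^ 4 * (24 * real L) ^ 8 * real I ^ 8 * (1 - \<delta>) ^ I \<le> (34 ^ 4 * (24 * real L) ^ 8) * real I ^ 16 * (1 - \<delta>) ^ I"
      using I \<delta> by (intro mult_right_mono mult_left_mono power_increasing) auto
    finally show ?thesis using small by linarith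
  qed
  moreover have "1 / real s ^ 2 \<le> 1 / 720"
  proof -
    have "720 * 1 \<le> real s * real s" using s720 s1 by (intro mult_mono) auto
    then show ?thesis by (simp add: power2_eq_square divide_left_mono)
  qed
  ultimately show ?thesis using s1 by (intro exI[of _ "1 / real s ^ 2"] exI[of _ "2 * s\<^sup>2"]) auto
qed

end

section \<open>Lengths of disagreement paths\<close>

text \<open>The confinement to \<open>Lam (3 * n) x\<close> makes the event local; it is no
  restriction, as a walk can be stopped at its first displacement of at least n.\<close>

definition short :: "real \<Rightarrow> nat \<Rightarrow> site \<Rightarrow> (site \<Rightarrow> real) \<Rightarrow> bool" where
  "short K n x h \<longleftrightarrow> (\<exists>g k. walk (loc n h \<inter> Lam (3 * n) x) g k \<and> g 0 \<in> Lam n x \<and>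
     real n \<le> dst (g 0) (g k) \<and> real k < K * real n)"

lemma dst_le_steps:
  assumes "\<And>i. i < k \<Longrightarrow> adj (g i) (g (Suc i))" shows "dst (g 0) (g k) \<le> real k"
  using assms
proof (induction k)
  case (Suc k)
  then have "dst (g 0) (g k) \<le> real k" "dst (g k) (g (Suc k)) = 1" by (auto intro: dst_adj)
  then show ?case using dist_triangle[of "pos (g 0)" "pos (g (Suc k))" "pos (g k)"] by simp
qed simp

lemma loc_translate: "v + x \<in> loc n h \<longleftrightarrow> v \<in> loc n (h \<circ> (\<lambda>p. p + x))"
proof -
  have m: "move 0 v (v + x) = (\<lambda>p. p + x)" by (auto simp: move_def)
  have inj: "inj (\<lambda>p::site. p + x)" by (simp add: inj_def)
  have "Lam n (v + x) = (\<lambda>p. p + x) ` Lam n v" using move_Lam[of 0 v "v + x" n] unfolding m by simp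
  then have "disagree (Lam n (v + x)) h = (\<lambda>p. p + x) ` disagree (Lam n v) (h \<circ> (\<lambda>p. p + x))"
    using sets_iso(3)[OF lattice_iso_add, of x "Lam n v" h] by simp
  then show ?thesis using inj_image_mem_iff[OF inj] by (simp add: loc_def)
qed

lemma Lam_translate: "v + x \<in> Lam n (y + x) \<longleftrightarrow> v \<in> Lam n y"
  by (simp add: Lam_def sdist_def)

lemma short_translate: "short K n x h \<Longrightarrow> short K n 0 (h \<circ> (\<lambda>p. p + x))"
proof -
  assume "short K n x h"
  then obtain g k where g: "walk (loc n h \<inter> Lam (3 * n) x) g k" "g 0 \<in> Lam n x" "real n \<le> dst (g 0) (g k)" "real k < K * real n"
    by (auto simp: short_def)
  let ?g = "\<lambda>i. g i - x"
  have mem: "?g i \<in> loc n (h \<circ> (\<lambda>p. p + x)) \<inter> Lam (3 * n) 0" if "i \<le> k" for i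
    using g(1) that loc_translate[of "?g i" x n h] Lam_translate[of "?g i" x "3 * n" 0] by (simp add: walk_def)
  have w: "walk (loc n (h \<circ> (\<lambda>p. p + x)) \<inter> Lam (3 * n) 0) ?g k"
    using g(1) mem unfolding walk_def by (auto simp: adj_diff)
  have d: "dst (?g 0) (?g k) = dst (g 0) (g k)" by (simp add: pos_diff dist_norm)
  have z: "?g 0 \<in> Lam n 0" using g(2) Lam_translate[of "?g 0" x n 0] by simp
  show ?thesis unfolding short_def
    by (rule exI[of _ ?g], rule exI[of _ k]) (use w z g(3,4) d in simp)
qed

lemma sdist_of_dst: "dst p q \<le> real m \<Longrightarrow> sdist p q \<le> int m"
proof -
  assume "dst p q \<le> real m"
  then have "real_of_int (sdist p q) \<le> real_of_int (int m)" using sdist_le_dst[of p q] by simp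
  then show ?thesis by (simp only: of_int_le_iff)
qed

text \<open>Stopping at the first displacement of at least \<open>l\<close> only removes steps and
  keeps the walk within 2l of its start, so the snapped corner of the starting cell can serve as
  centre.\<close>

lemma short_of_walk:
  assumes l: "1 \<le> l" and w: "walk (loc l h) g k" and d: "real l \<le> dst (g 0) (g k)" and k: "real k < K * real l"
  shows "short K l (snap l (cell l (g 0))) h"
proof -
  let ?P = "\<lambda>j. real l \<le> dst (g 0) (g j)"
  define j where "j = (LEAST j. ?P j)"
  have j: "?P j" "j \<le> k" using LeastI[of ?P, OF d] Least_le[of ?P, OF d] by (simp_all add: j_def)
  have bef: "dst (g 0) (g m) < real l" if "m < j" for m using not_less_Least[of m ?P] that by (simp add: j_def)
  have near: "dst (g 0) (g m) \<le> real (2 * l)" if "m \<le> j" for m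
  proof (cases "m < j")
    case True then show ?thesis using bef[of m] by simp
  next
    case False
    then have m: "m = j" using that by simp
    have "j \<noteq> 0" using j(1) l by (auto intro: gr0I)
    then obtain j1 where j1: "j = Suc j1" by (cases j) auto
    have "adj (g j1) (g j)" using w j1 j(2) by (simp add: walk_def)
    then have "dst (g j1) (g j) = 1" by (rule dst_adj)
    then show ?thesis using bef[of j1] dist_triangle[of "pos (g 0)" "pos (g j)" "pos (g j1)"] l j1 unfolding m by simp
  qed
  let ?x = "snap l (cell l (g 0))"
  have sx: "sdist (g 0) ?x \<le> int l" using snap_cell[OF l, of "g 0"] by simp
  have "g m \<in> Lam (3 * l) ?x" if "m \<le> j" for m
    using sx sdist_triangle[of "g m" ?x "g 0"] sdist_of_dst[OF near[OF that]] by (simp add: Lam_def sdist_sym)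
  then have "walk (loc l h \<inter> Lam (3 * l) ?x) g j" using w j(2) by (simp add: walk_def)
  moreover have "real j < K * real l" using j(2) k by linarith
  ultimately show ?thesis unfolding short_def using sx j(1) by (intro exI[of _ g] exI[of _ j]) (simp add: Lam_def)
qed

lemma no_short_subpath:
  assumes l: "1 \<le> l" "l \<le> n" and w: "walk (loc n h \<inter> Lam (3 * n) 0) g k"
    and good: "\<And>z. z \<in> cell l ` Lam (3 * n) 0 \<Longrightarrow> \<not> short K l (snap l z) h"
    and ij: "i \<le> j" "j \<le> k" "real l \<le> dst (g i) (g j)"
  shows "K * real l \<le> real (j - i)"
proof (rule ccontr)
  assume lt: "\<not> ?thesis"
  let ?g = "\<lambda>m. g (i + m)"
  have "walk (loc l h) ?g (j - i)" using w ij loc_mono[OF l(2), of h] by (auto simp: walk_def)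
  then have "short K l (snap l (cell l (?g 0))) h" by (rule short_of_walk[OF l(1)]) (use ij lt in auto)
  moreover have "g i \<in> Lam (3 * n) 0" using w ij by (auto simp: walk_def)
  ultimately show False using good[of "cell l (g i)"] by auto
qed

text \<open>The first bound chains pieces of scale \<open>l\<close>. For the second, a run that is
  not straight visits a site whose distances to the two ends add up to more than (1 + 3 \<kappa>)
  2r; the legs before and after it are bounded separately, each losing one \<open>l\<close>.\<close>

lemma run_length:
  fixes \<kappa> K :: real
  assumes l: "1 \<le> l" "l \<le> n" and w: "walk (loc n h \<inter> Lam (3 * n) 0) g k"
    and good: "\<And>z. z \<in> cell l ` Lam (3 * n) 0 \<Longrightarrow> \<not> short K l (snap l z) h"
    and K: "K \<ge> 0" and r: "1 \<le> r" "2 * r \<le> n" and ab: "a \<le> b" "b \<le> k" "2 * real r < dst (g a) (g b)"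
  shows "K * real l * (2 * real r - real l) \<le> (real l + 1) * real (b - a)"
    and "\<not> straight \<kappa> r (snap r (cell r (g a))) h \<Longrightarrow>
      K * real l * ((1 + 3 * \<kappa>) * (2 * real r) - 2 * real l) \<le> (real l + 1) * real (b - a)"
proof -
  have Kl: "0 \<le> K * real l" using K by simp
  have ad: "adj (g i) (g (Suc i))" if "i < k" for i using w that by (simp add: walk_def)
  have lb: "K * real l * (dst (g i) (g j) - real l) \<le> (real l + 1) * real (j - i)" if "i \<le> j" "j \<le> k" for i j
    by (rule length_lower_bound[OF _ Kl that(1)])
      (use l ad that no_short_subpath[OF l w good] in auto)
  have "K * real l * (2 * real r - real l) \<le> K * real l * (dst (g a) (g b) - real l)" using ab Kl by (intro mult_left_mono) auto
  also have "\<dots> \<le> (real l + 1) * real (b - a)" using ab by (intro lb)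
  finally show "K * real l * (2 * real r - real l) \<le> (real l + 1) * real (b - a)" .
  assume ns: "\<not> straight \<kappa> r (snap r (cell r (g a))) h"
  define b' where "b' = (LEAST i. a \<le> i \<and> 2 * real r < dst (g a) (g i))"
  have b': "a \<le> b'" "2 * real r < dst (g a) (g b')" "b' \<le> b"
    using LeastI[of "\<lambda>i. a \<le> i \<and> 2 * real r < dst (g a) (g i)" b] Least_le[of "\<lambda>i. a \<le> i \<and> 2 * real r < dst (g a) (g i)" b] ab
    by (auto simp: b'_def)
  have bef: "dst (g a) (g m) \<le> 2 * real r" if "a \<le> m" "m < b'" for m
    using not_less_Least[of m "\<lambda>i. a \<le> i \<and> 2 * real r < dst (g a) (g i)"] that by (auto simp: b'_def)
  have bk: "b' \<le> k" using b' ab by simp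
  have last: "dst (g a) (g b') \<le> 2 * real r + 1"
  proof -
    have "a \<noteq> b'" using b'(2) by auto
    then obtain b1 where b1: "b' = Suc b1" "a \<le> b1" using b'(1) by (cases b') auto
    have "dst (g b1) (g b') = 1" using ad[of b1] b1 bk by (auto intro: dst_adj)
    moreover have "dst (g a) (g b1) \<le> 2 * real r" using bef[of b1] b1 by simp
    ultimately show ?thesis using dist_triangle[of "pos (g a)" "pos (g b')" "pos (g b1)"] by simp
  qed
  have near: "dst (g a) (g m) \<le> real (2 * r + 1)" if "a \<le> m" "m \<le> b'" for m
    using bef[of m] last that by (cases "m = b'") auto
  let ?x = "snap r (cell r (g a))"
  have sx: "sdist (g a) ?x \<le> int r" using snap_cell[OF r(1), of "g a"] by simp
  have "\<exists>i. a \<le> i \<and> i \<le> b' \<and> (1 + 3 * \<kappa>) * (2 * real r) < dst (g a) (g i) + dst (g i) (g b')"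
  proof (rule ccontr)
    assume no: "\<not> ?thesis"
    have "straight \<kappa> r ?x h" unfolding straight_def
    proof (intro exI[of _ "\<lambda>m. g (a + m)"] exI[of _ "b' - a"] conjI allI impI)
      have "g (a + m) \<in> loc (2 * r) h \<inter> Lam (8 * r) ?x" if "m \<le> b' - a" for m
      proof
        have "g (a + m) \<in> loc n h" using w that bk b' by (auto simp: walk_def)
        then show "g (a + m) \<in> loc (2 * r) h" using loc_mono[OF r(2), of h] by blast
        have "sdist (g a) (g (a + m)) \<le> int (2 * r + 1)" using that b'(1) by (intro sdist_of_dst near) auto
        then show "g (a + m) \<in> Lam (8 * r) ?x" using sx sdist_triangle[of "g (a + m)" ?x "g a"] r(1) by (simp add: Lam_def sdist_sym)
      qed
      moreover have "adj (g (a + m)) (g (a + Suc m))" if "m < b' - a" for m using ad that bk by auto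
      ultimately show "walk (loc (2 * r) h \<inter> Lam (8 * r) ?x) (\<lambda>m. g (a + m)) (b' - a)" by (simp add: walk_def)
      show "g (a + 0) \<in> Lam r ?x" using sx by (simp add: Lam_def)
      show "2 * real r < dst (g (a + 0)) (g (a + (b' - a)))" "dst (g (a + 0)) (g (a + (b' - a))) \<le> 2 * real r + 1" using b' last by auto
      fix m assume "m \<le> b' - a"
      then have "a \<le> a + m" "a + m \<le> b'" using b'(1) by auto
      then have "dst (g a) (g (a + m)) + dst (g (a + m)) (g b') \<le> (1 + 3 * \<kappa>) * (2 * real r)" using no by force
      then show "dst (g (a + 0)) (g (a + m)) + dst (g (a + m)) (g (a + (b' - a))) \<le> (1 + 3 * \<kappa>) * (2 * real r)" using b'(1) by simp
    qed
    with ns show False by simp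
  qed
  then obtain i where i: "a \<le> i" "i \<le> b'" "(1 + 3 * \<kappa>) * (2 * real r) < dst (g a) (g i) + dst (g i) (g b')" by blast
  have "K * real l * ((1 + 3 * \<kappa>) * (2 * real r) - 2 * real l) \<le> K * real l * (dst (g a) (g i) - real l + (dst (g i) (g b') - real l))"
    using i Kl by (intro mult_left_mono) auto
  also have "\<dots> \<le> (real l + 1) * real (i - a) + (real l + 1) * real (b' - i)"
    unfolding distrib_left using i bk by (intro add_mono lb) auto
  also have "\<dots> = (real l + 1) * real (b' - a)" using i by (simp add: algebra_simps of_nat_diff)
  also have "\<dots> \<le> (real l + 1) * real (b - a)" using b' by (intro mult_left_mono) auto
  finally show "K * real l * ((1 + 3 * \<kappa>) * (2 * real r) - 2 * real l) \<le> (real l + 1) * real (b - a)" .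
qed

text \<open>Since \<open>\<kappa> * l\<close> is at least 10, the overshoot factor (l + 1) / l is
  absorbed by 1 - \<kappa>/10.\<close>

lemma scale_estimate:
  fixes K l X Y \<kappa> T :: real
  assumes "K * l * X \<le> (l + 1) * T" "10 \<le> \<kappa> * l" "l > 0" "0 \<le> K" "0 \<le> \<kappa>" "Y \<le> (1 - \<kappa> / 10) * X" "0 \<le> X"
  shows "K * Y \<le> T"
proof -
  have "(1 - \<kappa> / 10) * (l + 1) \<le> l"
  proof -
    have "(1 - \<kappa> / 10) * (l + 1) = l + 1 - \<kappa> * l / 10 - \<kappa> / 10" by (simp add: algebra_simps)
    also have "\<dots> \<le> l" using assms by simp
    finally show ?thesis .
  qed
  then have "((1 - \<kappa> / 10) * (l + 1)) * (K * X) \<le> l * (K * X)" using assms by (intro mult_right_mono) auto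
  also have "\<dots> = K * l * X" by simp
  also have "\<dots> \<le> (l + 1) * T" by fact
  finally have "(l + 1) * ((1 - \<kappa> / 10) * (K * X)) \<le> (l + 1) * T" by (simp add: algebra_simps)
  then have "(1 - \<kappa> / 10) * (K * X) \<le> T" using assms by (simp add: mult_le_cancel_left_pos)
  moreover have "K * Y \<le> K * ((1 - \<kappa> / 10) * X)" using assms by (intro mult_left_mono) auto
  ultimately show ?thesis by (simp add: algebra_simps)
qed

lemma sdist_snap: "sdist (snap r z) (snap r z') = int r * sdist z z'"
proof -
  have "\<bar>int r * a - int r * b\<bar> = int r * \<bar>a - b\<bar>" for a b
    by (simp add: abs_mult right_diff_distrib[symmetric])
  then show ?thesis unfolding sdist_def snap_def by (simp add: max_mult_distrib_left)
qed

lemma Lam_snap_disjoint: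
  assumes "r \<ge> 1" "sdist z z' \<ge> 21"
  shows "Lam (10 * r) (snap r z) \<inter> Lam (10 * r) (snap r z') = {}"
proof (rule ccontr)
  assume "\<not> ?thesis"
  then obtain v where "sdist v (snap r z) \<le> int (10 * r)" "sdist v (snap r z') \<le> int (10 * r)" unfolding Lam_def by blast
  then have "sdist (snap r z) (snap r z') \<le> 20 * int r" using sdist_triangle[of "snap r z" "snap r z'" v] by (simp add: sdist_sym)
  moreover have "int r * 21 \<le> int r * sdist z z'" using assms by (intro mult_left_mono) auto
  ultimately show False using assms(1) by (simp add: sdist_snap)
qed

text \<open>Fewer than half of the first \<open>J0\<close> runs are straight. A straight run still
  has relative length 1 - \<kappa>/5, any other at least 1 + 2 \<kappa>, and the mean of these two
  values is 1 + 9\<kappa>/10.\<close>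

lemma long_path:
  fixes \<kappa> K :: real
  assumes l: "1 \<le> l" "l \<le> n" and w: "walk (loc n h \<inter> Lam (3 * n) 0) g k"
    and good: "\<And>z. z \<in> cell l ` Lam (3 * n) 0 \<Longrightarrow> \<not> short K l (snap l z) h"
    and K: "K \<ge> 1" and r: "1 \<le> r" "2 * r \<le> n" and g0: "g 0 \<in> Lam n 0" and disp: "real n \<le> dst (g 0) (g k)"
    and \<kappa>: "0 < \<kappa>" "\<kappa> \<le> 1 / 720" and kl: "10 \<le> \<kappa> * real l" and lr: "10 * real l \<le> \<kappa> * real r"
    and J0: "J0 \<ge> 1" "(J0 + 1) * (2 * r + 1) \<le> n"
    and noF: "\<And>z. z 0 \<in> cell r ` Lam n 0 \<Longrightarrow> (\<forall>j. Suc j < J0 \<longrightarrow> sdist (z j) (z (Suc j)) \<le> 3) \<Longrightarrow> inj_on z {..<J0} \<Longrightarrow>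
       2 * card {j. j < J0 \<and> straight \<kappa> r (snap r (z j)) h} < J0"
  shows "(1 + 9 / 10 * \<kappa>) * (K * (2 * real r)) * real J0 \<le> real k"
proof -
  have ad: "adj (g i) (g (Suc i))" if "i < k" for i using w that by (simp add: walk_def)
  obtain J t where t: "t 0 = 0" "\<And>j. j \<le> J \<Longrightarrow> t j \<le> k" "\<And>j. j < J \<Longrightarrow> t j < t (Suc j)"
    "\<And>j. j < J \<Longrightarrow> 2 * real r < dst (g (t j)) (g (t (Suc j)))"
    "\<And>j. j < J \<Longrightarrow> sdist (cell r (g (t j))) (cell r (g (t (Suc j)))) \<le> 3"
    "inj_on (\<lambda>j. cell r (g (t j))) {..<J}"
    "dst (g 0) (g k) \<le> real (Suc J) * (2 * real r + 1)"
    by (rule cell_chain[OF r(1), of k g, OF ad]) auto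
  have "J0 \<le> J"
  proof -
    have "real ((J0 + 1) * (2 * r + 1)) \<le> real n" using J0(2) by (simp only: of_nat_le_iff)
    also have "\<dots> \<le> real (Suc J) * (2 * real r + 1)" using disp t(7) by linarith
    also have "\<dots> = real (Suc J * (2 * r + 1))" by (simp add: algebra_simps)
    finally have "(J0 + 1) * (2 * r + 1) \<le> Suc J * (2 * r + 1)" by (simp only: of_nat_le_iff)
    then have "J0 + 1 \<le> Suc J" by (simp only: mult_le_cancel2)
    then show ?thesis by simp
  qed
  define E where "E = {j. j < J0 \<and> straight \<kappa> r (snap r (cell r (g (t j)))) h}"
  have cE: "2 * card E < J0"
    unfolding E_def
  proof (rule noF)
    show "cell r (g (t 0)) \<in> cell r ` Lam n 0" using g0 t(1) by simp
    show "\<forall>j. Suc j < J0 \<longrightarrow> sdist (cell r (g (t j))) (cell r (g (t (Suc j)))) \<le> 3" using t(5) \<open>J0 \<le> J\<close> by auto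
    show "inj_on (\<lambda>j. cell r (g (t j))) {..<J0}" using t(6) \<open>J0 \<le> J\<close> by (auto intro: inj_on_subset)
  qed
  define A where "A = K * (2 * real r)"
  have A0: "A \<ge> 0" using K by (simp add: A_def)
  have K0: "0 \<le> K" using K by simp
  have l0: "0 < real l" using l by simp
  have r0: "0 < real r" using r by simp
  have len: "A * (if j \<in> E then 1 - \<kappa> / 5 else 1 + 2 * \<kappa>) \<le> real (t (Suc j) - t j)" if j: "j < J0" for j
  proof -
    have jJ: "j < J" using j \<open>J0 \<le> J\<close> by simp
    have tt: "t j \<le> t (Suc j)" "t (Suc j) \<le> k" using t(2)[of "Suc j"] t(3)[OF jJ] jJ by auto
    have rl1: "K * real l * (2 * real r - real l) \<le> (real l + 1) * real (t (Suc j) - t j)"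
      by (rule run_length(1)[OF l w _ K0 r tt t(4)[OF jJ]]) (rule good)
    have rl2: "\<not> straight \<kappa> r (snap r (cell r (g (t j)))) h \<Longrightarrow>
      K * real l * ((1 + 3 * \<kappa>) * (2 * real r) - 2 * real l) \<le> (real l + 1) * real (t (Suc j) - t j)"
      by (rule run_length(2)[OF l w _ K0 r tt t(4)[OF jJ]]) (rule good)
    have lr': "real l \<le> \<kappa> / 10 * real r" using lr by simp
    have kr: "\<kappa> * real r \<le> 1 / 720 * real r" using \<kappa> r0 by (intro mult_right_mono) auto
    have ksq: "\<kappa> * \<kappa> \<le> \<kappa> * (1 / 720)" using \<kappa> by (intro mult_left_mono) auto
    show ?thesis
    proof (cases "j \<in> E")
      case True
      have "K * ((1 - \<kappa> / 5) * (2 * real r)) \<le> real (t (Suc j) - t j)"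
      proof (rule scale_estimate[OF rl1 kl l0 K0])
        have "(1 - \<kappa> / 5) * (2 * real r) \<le> (1 - \<kappa> / 10) * ((2 - \<kappa> / 10) * real r)"
        proof -
          have "(1 - \<kappa> / 5) * 2 \<le> (1 - \<kappa> / 10) * (2 - \<kappa> / 10)" using \<kappa> by (simp add: algebra_simps)
          then have "(1 - \<kappa> / 5) * 2 * real r \<le> (1 - \<kappa> / 10) * (2 - \<kappa> / 10) * real r" using r0 by (intro mult_right_mono) auto
          then show ?thesis by (simp only: mult.assoc)
        qed
        also have "\<dots> \<le> (1 - \<kappa> / 10) * (2 * real r - real l)"
          using \<kappa> lr' by (intro mult_left_mono) (auto simp: algebra_simps)
        finally show "(1 - \<kappa> / 5) * (2 * real r) \<le> (1 - \<kappa> / 10) * (2 * real r - real l)" .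
        show "0 \<le> 2 * real r - real l" using lr' kr r0 by linarith
      qed (use \<kappa> in auto)
      then show ?thesis using True by (simp add: A_def mult_ac)
    next
      case False
      then have ns: "\<not> straight \<kappa> r (snap r (cell r (g (t j)))) h" using j by (simp add: E_def)
      have "K * ((1 + 2 * \<kappa>) * (2 * real r)) \<le> real (t (Suc j) - t j)"
      proof (rule scale_estimate[OF rl2[OF ns] kl l0 K0])
        have "(1 + 2 * \<kappa>) * (2 * real r) \<le> (1 - \<kappa> / 10) * ((2 + 6 * \<kappa> - \<kappa> / 5) * real r)"
        proof -
          have "(1 + 2 * \<kappa>) * 2 \<le> (1 - \<kappa> / 10) * (2 + 6 * \<kappa> - \<kappa> / 5)"
            using \<kappa> ksq by (simp add: algebra_simps)
          then have "(1 + 2 * \<kappa>) * 2 * real r \<le> (1 - \<kappa> / 10) * (2 + 6 * \<kappa> - \<kappa> / 5) * real r" using r0 by (intro mult_right_mono) auto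
          then show ?thesis by (simp only: mult.assoc)
        qed
        also have "\<dots> \<le> (1 - \<kappa> / 10) * ((1 + 3 * \<kappa>) * (2 * real r) - 2 * real l)"
          using \<kappa> lr' by (intro mult_left_mono) (auto simp: algebra_simps)
        finally show "(1 + 2 * \<kappa>) * (2 * real r) \<le> (1 - \<kappa> / 10) * ((1 + 3 * \<kappa>) * (2 * real r) - 2 * real l)" .
        have "0 \<le> \<kappa> * real r" using \<kappa> r0 by simp
        then show "0 \<le> (1 + 3 * \<kappa>) * (2 * real r) - 2 * real l" using lr' kr r0 by (simp add: algebra_simps)
      qed (use \<kappa> in auto)
      then show ?thesis using False by (simp add: A_def mult_ac)
    qed
  qed
  have EJ: "E \<subseteq> {..<J0}" by (auto simp: E_def)
  have "(1 + 9 / 10 * \<kappa>) * A * real J0 \<le> A * (real J0 * (1 + 2 * \<kappa>) - real (card E) * (11 / 5 * \<kappa>))"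
  proof -
    have "real (card E) \<le> real J0 / 2" using cE by linarith
    then have "real (card E) * (11 / 5 * \<kappa>) \<le> real J0 / 2 * (11 / 5 * \<kappa>)" using \<kappa> by (intro mult_right_mono) auto
    then have "(1 + 9 / 10 * \<kappa>) * real J0 \<le> real J0 * (1 + 2 * \<kappa>) - real (card E) * (11 / 5 * \<kappa>)" by (simp add: algebra_simps)
    then have "A * ((1 + 9 / 10 * \<kappa>) * real J0) \<le> A * (real J0 * (1 + 2 * \<kappa>) - real (card E) * (11 / 5 * \<kappa>))" using A0 by (rule mult_left_mono)
    then show ?thesis by (simp add: mult_ac)
  qed
  also have "\<dots> = (\<Sum>j<J0. A * (if j \<in> E then 1 - \<kappa> / 5 else 1 + 2 * \<kappa>))"
  proof -
    have "(\<Sum>j<J0. (if j \<in> E then 1 - \<kappa> / 5 else 1 + 2 * \<kappa>)) = (\<Sum>j<J0. (1 + 2 * \<kappa>) - (11 / 5 * \<kappa>) * of_bool (j \<in> E))"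
      by (intro sum.cong) auto
    also have "\<dots> = real J0 * (1 + 2 * \<kappa>) - (11 / 5 * \<kappa>) * (\<Sum>j<J0. of_bool (j \<in> E))"
      unfolding sum_subtractf sum_distrib_left by simp
    also have "(\<Sum>j<J0. of_bool (j \<in> E) :: real) = real (card E)"
    proof -
      have "{..<J0} \<inter> E = E" using EJ by blast
      then show ?thesis by simp
    qed
    finally show ?thesis by (simp add: sum_distrib_left[symmetric] mult.commute)
  qed
  also have "\<dots> \<le> (\<Sum>j<J0. real (t (Suc j) - t j))" by (intro sum_mono len) simp
  also have "\<dots> = (\<Sum>j<J0. real (t (Suc j)) - real (t j))"
    using t(3) \<open>J0 \<le> J\<close> by (intro sum.cong) (auto simp: of_nat_diff less_imp_le)
  also have "\<dots> = real (t J0) - real (t 0)" by (rule sum_lessThan_telescope)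
  also have "\<dots> \<le> real k" using t(2)[OF \<open>J0 \<le> J\<close>] by simp
  finally show ?thesis by (simp add: A_def)
qed

context gaussian_field
begin

lemma local_ev_short: "local_ev (Lam (4 * n) x) (short K n x)"
  unfolding short_def using local_ev_loc_set[of "3 * n" n x] by simp

lemma pr_short_le: "pr (short K n x) \<le> pr (short K n 0)"
proof -
  have inj: "inj (\<lambda>p::site. p + x)" by (simp add: inj_def)
  note re = pr_reindex[OF inj local_ev_ev[OF local_ev_short[of n 0 K]]]
  have "pr (short K n x) \<le> pr (\<lambda>h. short K n 0 (h \<circ> (\<lambda>p. p + x)))" by (rule pr_mono[OF re(2)]) (rule short_translate)
  then show ?thesis by (simp add: re(1))
qed

section \<open>Bootstrap of the length constant\<close>

definition tortuous :: "real \<Rightarrow> bool" where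
  "tortuous K \<longleftrightarrow> (\<forall>\<eta>>0. \<exists>n0. \<forall>n\<ge>n0. pr (short K n 0) \<le> \<eta>)"

lemma tortuous_1: "tortuous 1"
  unfolding tortuous_def
proof (intro allI impI exI[of _ 1])
  fix \<eta> :: real and n :: nat assume "\<eta> > 0"
  have "\<not> short 1 n 0 h" for h
  proof
    assume "short 1 n 0 h"
    then obtain g k where g: "walk (loc n h \<inter> Lam (3 * n) 0) g k" "real n \<le> dst (g 0) (g k)" "real k < 1 * real n"
      by (auto simp: short_def)
    have "dst (g 0) (g k) \<le> real k" using g(1) by (intro dst_le_steps) (auto simp: walk_def)
    then show False using g by simp
  qed
  then have "short 1 n 0 = (\<lambda>h. False)" by auto
  then show "pr (short 1 n 0) \<le> \<eta>" using \<open>\<eta> > 0\<close> by (simp add: pr_def)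
qed

text \<open>Three scales l, r, n with fixed ratios: at scale \<open>l\<close> the hypothesis for
  \<open>K\<close> is used in boundedly many cells, at scale \<open>r\<close> a Peierls bound makes
  most runs of a path not straight. \<kappa> comes from \<open>straight_bound\<close> alone and not
  from \<open>K\<close>, so the step can be repeated without its gain shrinking.\<close>

theorem tortuous_step: "\<exists>\<kappa>>0. \<forall>K\<ge>1. tortuous K \<longrightarrow> tortuous ((1 + \<kappa>) * K)"
proof -
  obtain \<tau> :: real where \<tau>: "0 < \<tau>" "\<tau> \<le> 1" "98 * \<tau> powr (1 / (2 * real 21 ^ 2)) \<le> 1 / 2" using peierls_constant by blast
  obtain \<kappa> r0 where \<kappa>: "0 < \<kappa>" "\<kappa> \<le> 1 / 720" and st: "\<And>r x. r \<ge> r0 \<Longrightarrow> pr (straight \<kappa> r x) \<le> \<tau>"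
    using straight_bound[OF \<tau>(1)] by blast
  have "tortuous ((1 + \<kappa> / 8) * K)" if K: "K \<ge> 1" and tK: "tortuous K" for K
    unfolding tortuous_def
  proof (intro allI impI)
    fix \<eta> :: real assume \<eta>: "\<eta> > 0"
    define b where "b = nat \<lceil>10 / \<kappa>\<rceil>"
    have b: "10 / \<kappa> \<le> real b" "1 \<le> b"
    proof -
      show 1: "10 / \<kappa> \<le> real b" unfolding b_def by linarith
      have "0 < 10 / \<kappa>" using \<kappa> by simp
      then show "1 \<le> b" using 1 by linarith
    qed
    \<comment> \<open>1600 = 2 * 100 * 8: at most 100 P^2 starting cells, (1/2)^J0 at most 8
      (1/2)^P, and only half of \<eta> may be spent.\<close>
    obtain P where P: "P \<ge> b + 4" "1600 * real P ^ 16 * (1 / 2) ^ P \<le> \<eta>"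
      using power_times_geometric[of "1 / 2" \<eta> "b + 4" 1600] \<eta> by auto
    have Pk: "10 / \<kappa> \<le> real P" using b P(1) by linarith
    \<comment> \<open>\<open>c0\<^sup>2\<close> bounds the number of cells of side \<open>l\<close>
      in \<open>Lam (3 * n) 0\<close>, whatever \<open>n\<close> is.\<close>
    define c0 where "c0 = 48 * real P * real b + 2"
    have c0: "c0 > 0" unfolding c0_def by (simp add: add_nonneg_pos)
    obtain n1 where n1: "\<And>l. l \<ge> n1 \<Longrightarrow> pr (short K l 0) \<le> \<eta> / (2 * c0\<^sup>2)"
      using tK[unfolded tortuous_def, rule_format, of "\<eta> / (2 * c0\<^sup>2)"] \<eta> c0 by auto
    define N1 where "N1 = n1 + b + r0 + 1"
    have "pr (short ((1 + \<kappa> / 8) * K) n 0) \<le> \<eta>" if n: "n \<ge> 2 * P * (b * N1 + P)" for n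
    proof -
      define r where "r = n div (2 * P)"
      define l where "l = r div b"
      have rge: "b * N1 + P \<le> r" unfolding r_def using n P(1) by (simp add: less_eq_div_iff_mult_less_eq mult.commute)
      have lge: "N1 \<le> l" unfolding l_def using rge b(2) by (simp add: less_eq_div_iff_mult_less_eq mult.commute)
      have rP: "2 * P * r \<le> n" unfolding r_def by (metis mult.commute div_times_less_eq_dividend)
      have nlt: "n < 2 * P * (r + 1)"
        unfolding r_def using dividend_less_div_times[of "2 * P" n] P(1) by (simp add: algebra_simps)
      have lb: "b * l \<le> r" unfolding l_def by (metis mult.commute div_times_less_eq_dividend)
      have rlt: "r < b * (l + 1)"
        unfolding l_def using dividend_less_div_times[of b r] b(2) by (simp add: algebra_simps)
      have l1: "1 \<le> l" "b \<le> l" "n1 \<le> l" using lge by (auto simp: N1_def)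
      have lr: "l \<le> r" using lb b(2) by (metis le_trans mult_le_mono1 nat_mult_1)
      have r1: "1 \<le> r" "r0 \<le> r" "P \<le> r"
      proof -
        show "1 \<le> r" using l1 lr by simp
        show "r0 \<le> r" using lge lr by (simp add: N1_def)
        show "P \<le> r" using rge by simp
      qed
      have r2n: "2 * r \<le> n"
      proof -
        have "2 * 1 * r \<le> 2 * P * r" using P(1) by (intro mult_le_mono) auto
        then show ?thesis using rP by linarith
      qed
      have ln: "l \<le> n" using lr r2n by simp
      have kl: "10 \<le> \<kappa> * real l"
      proof -
        have "10 / \<kappa> \<le> real l" using b(1) l1(2) by linarith
        then show ?thesis using \<kappa> by (simp add: field_simps)
      qed
      have klr: "10 * real l \<le> \<kappa> * real r"
      proof -
        have "10 \<le> \<kappa> * real b" using b(1) \<kappa> by (simp add: field_simps)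
        then have "10 * real l \<le> \<kappa> * real b * real l" by (intro mult_right_mono) auto
        also have "\<dots> = \<kappa> * real (b * l)" by simp
        also have "\<dots> \<le> \<kappa> * real r" using \<kappa> lb by (intro mult_left_mono of_nat_mono) auto
        finally show ?thesis .
      qed
      define J0 where "J0 = n div (2 * r + 1) - 1"
      have Jbig: "P - 2 \<le> n div (2 * r + 1)"
      proof -
        have "(P - 2) * (2 * r + 1) \<le> n"
        proof -
          define p where "p = P - 2"
          have p: "P = p + 2" using P(1) by (simp add: p_def)
          have "p * (2 * r + 1) \<le> 2 * P * r" using r1(3) by (simp add: p algebra_simps)
          then show ?thesis using rP p by simp
        qed
        then show ?thesis by (simp add: less_eq_div_iff_mult_less_eq)
      qed
      have J1: "1 \<le> J0" "P - 3 \<le> J0" using Jbig P(1) b(2) by (simp_all add: J0_def)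
      have J2: "(J0 + 1) * (2 * r + 1) \<le> n"
      proof -
        have "J0 + 1 = n div (2 * r + 1)" using J1 by (simp add: J0_def)
        then show ?thesis by (simp only: div_times_less_eq_dividend)
      qed
      \<comment> \<open>The runs cover the distance n up to a relative loss of \<kappa>/3, due to
        the overshoot of each run, the two missing runs and integer division. The gain survives
        because (1 + 9\<kappa>/10)(1 - \<kappa>/3) is at least 1 + \<kappa>/8.\<close>
      have J3: "real n * (1 - \<kappa> / 3) \<le> 2 * real r * real J0"
      proof -
        have "n < (2 * r + 1) + n div (2 * r + 1) * (2 * r + 1)" by (rule dividend_less_div_times) simp
        moreover have "n div (2 * r + 1) = J0 + 1" using J1 by (simp add: J0_def)
        ultimately have "n < (J0 + 2) * (2 * r + 1)" by (simp add: algebra_simps)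
        then have "real n < real ((J0 + 2) * (2 * r + 1))" by (simp only: of_nat_less_iff)
        then have 1: "real n < (real J0 + 2) * (2 * real r + 1)" by (simp add: algebra_simps)
        have "real ((J0 + 1) * (2 * r + 1)) \<le> real n" using J2 by (simp only: of_nat_le_iff)
        then have "(real J0 + 1) * (2 * real r + 1) \<le> real n" by (simp add: algebra_simps)
        moreover have "real J0 * (2 * real r) \<le> (real J0 + 1) * (2 * real r + 1)" by (intro mult_mono) auto
        ultimately have 2: "real J0 * (2 * real r) \<le> real n" by linarith
        have rl: "10 / \<kappa> \<le> real r" using b(1) l1(2) lr by linarith
        have 3: "real J0 \<le> \<kappa> / 20 * real n"
        proof -
          have "10 \<le> \<kappa> * real r" using rl \<kappa> by (simp add: field_simps)
          then have "10 * real J0 \<le> \<kappa> * real r * real J0" by (intro mult_right_mono) auto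
          also have "\<dots> = \<kappa> / 2 * (real J0 * (2 * real r))" by simp
          also have "\<dots> \<le> \<kappa> / 2 * real n" using 2 \<kappa> by (intro mult_left_mono) auto
          finally show ?thesis by simp
        qed
        have 4: "real r \<le> \<kappa> / 20 * real n"
        proof -
          have "10 \<le> \<kappa> * real P" using Pk \<kappa> by (simp add: field_simps)
          then have "10 * real r \<le> \<kappa> * real P * real r" by (intro mult_right_mono) auto
          also have "\<dots> = \<kappa> / 2 * real (2 * P * r)" by simp
          also have "\<dots> \<le> \<kappa> / 2 * real n" using rP \<kappa> by (intro mult_left_mono of_nat_mono) auto
          finally show ?thesis by simp
        qed
        have "10 \<le> real r"
        proof -
          have "10 / 1 \<le> 10 / \<kappa>" using \<kappa> by (intro divide_left_mono) auto
          then show ?thesis using rl by linarith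
        qed
        then have "real n < real J0 * (2 * real r) + real J0 + 4 * real r + 2" "2 \<le> 1 / 5 * real r" using 1 by (simp_all add: algebra_simps)
        then have "real n \<le> real J0 * (2 * real r) + \<kappa> / 20 * real n + 4 * (\<kappa> / 20 * real n) + 1 / 5 * (\<kappa> / 20 * real n)" using 3 4 by linarith
        moreover have "0 \<le> \<kappa> * real n" using \<kappa> by simp
        ultimately show ?thesis by (simp add: algebra_simps)
      qed
      have nr: "real n \<le> 4 * real P * real r"
      proof -
        have "n \<le> 2 * P * (r + r)" using nlt r1(1) by (meson add_left_mono less_imp_le mult_le_mono2 le_trans)
        then have "real n \<le> real (2 * P * (r + r))" by (simp only: of_nat_le_iff)
        then show ?thesis by (simp add: algebra_simps)
      qed
      have nl: "real n \<le> 8 * real P * real b * real l"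
      proof -
        have "r \<le> b * (l + l)" using rlt l1(1) by (meson add_left_mono less_imp_le mult_le_mono2 le_trans)
        then have "real r \<le> real (b * (l + l))" by (simp only: of_nat_le_iff)
        then have "real r \<le> 2 * real b * real l" by (simp add: algebra_simps)
        then have "4 * real P * real r \<le> 4 * real P * (2 * real b * real l)" by (intro mult_left_mono) auto
        then show ?thesis using nr by simp
      qed
      let ?S = "cell r ` Lam n 0"
      have cS: "real (card ?S) \<le> 100 * real P ^ 2"
      proof -
        have "2 * real n / real r \<le> 8 * real P" using nr r1(1) by (simp add: field_simps)
        moreover have "1 \<le> real P" using P(1) by simp
        ultimately have "2 * real n / real r + 2 \<le> 10 * real P" by linarith
        then have "(2 * real n / real r + 2)\<^sup>2 \<le> (10 * real P)\<^sup>2" by (intro power_mono) auto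
        then show ?thesis using card_cell_Lam(2)[OF r1(1), of n 0] by (simp add: power_mult_distrib)
      qed
      have loc21: "local_ev (Lam (10 * r) (snap r y)) (straight \<kappa> r (snap r y))" for y by (rule local_ev_straight)
      have sep21: "Lam (10 * r) (snap r y) \<inter> Lam (10 * r) (snap r y') = {}" if "sdist y y' \<ge> int 21" for y y'
        using Lam_snap_disjoint[OF r1(1)] that by simp
      have "\<exists>F. ev F \<and> pr F \<le> real (card ?S) * (1 / 2) ^ J0 \<and>
          (\<forall>h z. z 0 \<in> ?S \<longrightarrow> (\<forall>j. Suc j < J0 \<longrightarrow> sdist (z j) (z (Suc j)) \<le> 3) \<longrightarrow> inj_on z {..<J0} \<longrightarrow>
             J0 \<le> 2 * card {j. j < J0 \<and> straight \<kappa> r (snap r (z j)) h} \<longrightarrow> F h)"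
        by (rule peierls[where E = "\<lambda>y. straight \<kappa> r (snap r y)" and k = 21, OF loc21 _ sep21 _ \<tau>])
          (use st r1 J1 card_cell_Lam(1)[OF r1(1)] in auto)
      then obtain F where F: "ev F" "pr F \<le> real (card ?S) * (1 / 2) ^ J0"
        "\<And>h z. z 0 \<in> ?S \<Longrightarrow> (\<forall>j. Suc j < J0 \<longrightarrow> sdist (z j) (z (Suc j)) \<le> 3) \<Longrightarrow> inj_on z {..<J0} \<Longrightarrow>
             J0 \<le> 2 * card {j. j < J0 \<and> straight \<kappa> r (snap r (z j)) h} \<Longrightarrow> F h" by blast
      have pF: "pr F \<le> \<eta> / 2"
      proof -
        have P3: "3 \<le> P" using P(1) by simp
        have "(1 / 2 :: real) ^ J0 \<le> (1 / 2) ^ (P - 3)" using J1 by (intro power_decreasing) auto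
        also have "\<dots> = 8 * (1 / 2) ^ P" using P3 by (simp add: power_diff power_divide)
        finally have "real (card ?S) * (1 / 2) ^ J0 \<le> (100 * real P ^ 2) * (8 * (1 / 2) ^ P)" using cS by (intro mult_mono) auto
        also have "\<dots> \<le> (100 * real P ^ 16) * (8 * (1 / 2) ^ P)"
          using P3 by (intro mult_right_mono mult_left_mono power_increasing) auto
        also have "\<dots> \<le> \<eta> / 2" using P(2) by simp
        finally show ?thesis using F(2) by linarith
      qed
      let ?B = "\<lambda>h. \<exists>z\<in>cell l ` Lam (3 * n) 0. short K l (snap l z) h"
      have fB: "finite (cell l ` Lam (3 * n) 0)" by (rule card_cell_Lam(1)[OF l1(1)])
      have evs: "ev (short K l x)" for x by (rule local_ev_ev[OF local_ev_short])
      have evB: "ev ?B" by (rule ev_Bex[OF fB]) (rule evs)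
      have pB: "pr ?B \<le> \<eta> / 2"
      proof -
        have ps: "pr (short K l x) \<le> \<eta> / (2 * c0\<^sup>2)" for x using pr_short_le[of K l x] n1[OF l1(3)] by linarith
        have "pr ?B \<le> (\<Sum>z\<in>cell l ` Lam (3 * n) 0. pr (short K l (snap l z)))" by (rule pr_Bex_le[OF fB]) (rule evs)
        also have "\<dots> \<le> real (card (cell l ` Lam (3 * n) 0)) * (\<eta> / (2 * c0\<^sup>2))" by (rule sum_bounded_above) (rule ps)
        also have "\<dots> \<le> c0\<^sup>2 * (\<eta> / (2 * c0\<^sup>2))"
        proof (intro mult_right_mono)
          have "2 * real (3 * n) / real l \<le> 48 * real P * real b" using nl l1(1) by (simp add: field_simps)
          then have "(2 * real (3 * n) / real l + 2)\<^sup>2 \<le> c0\<^sup>2" unfolding c0_def by (intro power_mono) auto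
          then show "real (card (cell l ` Lam (3 * n) 0)) \<le> c0\<^sup>2" using card_cell_Lam(2)[OF l1(1), of "3 * n" 0] by linarith
        qed (use \<eta> in auto)
        also have "\<dots> = \<eta> / 2" using c0 by simp
        finally show ?thesis .
      qed
      have main: "?B h \<or> F h" if sh: "short ((1 + \<kappa> / 8) * K) n 0 h" for h
      proof (rule ccontr)
        assume no: "\<not> (?B h \<or> F h)"
        obtain g k where g: "walk (loc n h \<inter> Lam (3 * n) 0) g k" "g 0 \<in> Lam n 0" "real n \<le> dst (g 0) (g k)"
          "real k < (1 + \<kappa> / 8) * K * real n" using sh unfolding short_def by blast
        have "(1 + 9 / 10 * \<kappa>) * (K * (2 * real r)) * real J0 \<le> real k"
          by (rule long_path[OF l1(1) ln g(1) _ K r1(1) r2n g(2,3) \<kappa> kl klr J1(1) J2]) (use no F(3) in force)+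
        moreover have "(1 + \<kappa> / 8) * K * real n \<le> (1 + 9 / 10 * \<kappa>) * (K * (2 * real r)) * real J0"
        proof -
          have kk: "\<kappa> * \<kappa> \<le> \<kappa> * (1 / 720)" using \<kappa> by (intro mult_left_mono) auto
          have "(1 + 9 / 10 * \<kappa>) * (1 - \<kappa> / 3) = 1 + 9 / 10 * \<kappa> - \<kappa> / 3 - 3 / 10 * (\<kappa> * \<kappa>)" by (simp add: field_simps)
          then have "(1 + \<kappa> / 8) \<le> (1 + 9 / 10 * \<kappa>) * (1 - \<kappa> / 3)" using kk \<kappa> by linarith
          then have "(1 + \<kappa> / 8) * (K * real n) \<le> (1 + 9 / 10 * \<kappa>) * (1 - \<kappa> / 3) * (K * real n)" using K by (intro mult_right_mono) auto
          also have "\<dots> = ((1 + 9 / 10 * \<kappa>) * K) * (real n * (1 - \<kappa> / 3))" by simp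
          also have "\<dots> \<le> ((1 + 9 / 10 * \<kappa>) * K) * (2 * real r * real J0)" using J3 K \<kappa> by (intro mult_left_mono) auto
          finally show ?thesis by (simp add: mult_ac)
        qed
        ultimately show False using g(4) by linarith
      qed
      have "pr (short ((1 + \<kappa> / 8) * K) n 0) \<le> pr (\<lambda>h. ?B h \<or> F h)" by (rule pr_mono[OF ev_disj[OF evB F(1)] main])
      also have "\<dots> \<le> pr ?B + pr F" by (rule pr_disj_le[OF evB F(1)])
      finally show ?thesis using pB pF by linarith
    qed
    then show "\<exists>n0. \<forall>n\<ge>n0. pr (short ((1 + \<kappa> / 8) * K) n 0) \<le> \<eta>" by blast
  qed
  then show ?thesis using \<kappa> by (intro exI[of _ "\<kappa> / 8"]) auto
qed

lemma tortuous_unbounded: "\<exists>K\<ge>B. 1 \<le> K \<and> tortuous K"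
proof -
  obtain \<kappa> where \<kappa>: "\<kappa> > 0" "\<And>K. K \<ge> 1 \<Longrightarrow> tortuous K \<Longrightarrow> tortuous ((1 + \<kappa>) * K)" using tortuous_step by blast
  have p: "1 \<le> (1 + \<kappa>) ^ i \<and> tortuous ((1 + \<kappa>) ^ i)" for i
  proof (induction i)
    case 0 then show ?case using tortuous_1 by simp
  next
    case (Suc i)
    then show ?case using \<kappa>(2)[of "(1 + \<kappa>) ^ i"] \<kappa>(1) one_le_power[of "1 + \<kappa>" "Suc i"] by simp
  qed
  obtain i where "B < (1 + \<kappa>) ^ i" using real_arch_pow[of "1 + \<kappa>" B] \<kappa>(1) by auto
  then show ?thesis using p[of i] by (intro exI[of _ "(1 + \<kappa>) ^ i"]) auto
qed

end

section \<open>Decay of the one-point function\<close>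

lemma best_layer:
  assumes fin: "\<And>j. finite (L j)" and inc: "\<And>j. L j \<subseteq> L (Suc j)" and m: "m \<ge> 1"
  shows "\<exists>j<m. real m * real (card (L (Suc j) - L j)) \<le> real (card (L m - L (0::nat)))"
proof (rule ccontr)
  assume no: "\<not> ?thesis"
  have mono: "L i \<subseteq> L j" if "i \<le> j" for i j using that by (rule lift_Suc_mono_le[of L, OF inc])
  have c: "real (card (L (Suc j) - L j)) = real (card (L (Suc j))) - real (card (L j))" for j
    using inc fin card_mono[OF fin inc] by (simp add: card_Diff_subset of_nat_diff)
  have "(\<Sum>j<m. real (card (L (Suc j) - L j))) = real (card (L m)) - real (card (L 0))"
    unfolding c by (rule sum_lessThan_telescope)
  also have "\<dots> = real (card (L m - L 0))"
    using mono[of 0 m] fin card_mono[OF fin mono[of 0 m]] by (simp add: card_Diff_subset of_nat_diff)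
  finally have s: "(\<Sum>j<m. real (card (L (Suc j) - L j))) = real (card (L m - L 0))" .
  have "(\<Sum>j<m. real (card (L m - L 0))) < (\<Sum>j<m. real m * real (card (L (Suc j) - L j)))"
    using no m by (intro sum_strict_mono) (auto simp: not_le lessThan_empty_iff)
  also have "\<dots> = real m * real (card (L m - L 0))" by (simp add: sum_distrib_left[symmetric] s)
  finally show False by simp
qed

lemma card_le_layer:
  assumes "real m * x \<le> y" "m \<ge> 1" shows "x \<le> y / real m"
  using assms by (simp add: field_simps)

lemma ennreal_lincomb:
  "0 \<le> a \<Longrightarrow> 0 \<le> x \<Longrightarrow> 0 \<le> b \<Longrightarrow> 0 \<le> y \<Longrightarrow> ennreal (a * x + b * y) = ennreal a * ennreal x + ennreal b * ennreal y"
  by (simp add: ennreal_mult)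

section \<open>Cuts of the gap between the two ground states around a shifted box\<close>

context
  fixes n :: nat and h :: "site \<Rightarrow> real" and s1 s2 :: real and D M Pl :: "site set"
  assumes n: "n \<ge> 1"
  defines "M \<equiv> minus_set (Lam (30 * n) 0) (shift_on (Lam n 0) s2 h)"
    and "Pl \<equiv> plus_set (Lam (30 * n) 0) (shift_on (Lam n 0) s1 h)"
    and "D \<equiv> Lam (30 * n) 0 - M - Pl"
begin

text \<open>The box \<open>Lam n v\<close> misses the region where the field is shifted. By
  monotonicity in the domain the gap there is local disagreement of the unshifted field, so the cuts
  can be bounded independently of \<open>s1\<close> and \<open>s2\<close>, as
  \<open>disagreement_integral\<close> demands.\<close>

lemma frozen_gap_loc:
  assumes v: "v \<in> D" "v \<notin> Lam (2 * n) 0" "v \<in> Lam (29 * n) 0"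
  shows "v \<in> loc n h"
proof -
  have sub: "Lam n v \<subseteq> Lam (30 * n) 0" using v(3) by (intro Lam_mono) (simp add: Lam_def)
  have out: "u \<notin> Lam n 0" if "u \<in> Lam n v" for u
    using that v(2) sdist_triangle[of v 0 u] by (auto simp: Lam_def sdist_sym)
  have "minus_set (Lam n v) h \<subseteq> M" unfolding M_def
    by (rule minus_set_mono[OF finite_Lam sub]) (use out in \<open>simp add: shift_on_def\<close>)
  moreover have "plus_set (Lam n v) h \<subseteq> Pl" unfolding Pl_def
    by (rule plus_set_mono[OF finite_Lam sub]) (use out in \<open>simp add: shift_on_def\<close>)
  ultimately show ?thesis using v(1) self_Lam[of v n] by (auto simp: loc_def disagree_def D_def)
qed

lemma gap_cut_le:
  assumes Z: "Z \<subseteq> Lam (29 * n) 0" and C: "finite C" "\<And>u v. u \<in> Z \<inter> D \<Longrightarrow> v \<in> D - Z \<Longrightarrow> adj u v \<Longrightarrow> v \<in> C"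
  shows "ecount (Z - M - Pl) (- (M \<union> Pl \<union> Z)) \<le> 4 * real (card C)"
proof (rule ecount_le[OF C(1)])
  fix u v assume u: "u \<in> Z - M - Pl" and v: "v \<in> - (M \<union> Pl \<union> Z)" and a: "adj u v"
  have "sdist v u \<le> 1" using adj_sdist[OF a] by (simp add: sdist_sym)
  then have "v \<in> Lam (30 * n) 0" using u Z sdist_triangle[of v 0 u] n by (auto simp: Lam_def)
  moreover have "u \<in> Lam (30 * n) 0" using u Z by (auto simp: Lam_def)
  ultimately show "v \<in> C" using u v by (intro C(2)[OF _ _ a]) (auto simp: D_def)
qed

text \<open>The \<open>n\<close> disjoint layers between radii 20n and 21n contain one that is no
  worse than average. This cut exists for every field but lacks the factor K.\<close>

lemma cut_far:
  "\<exists>Z. Lam n 0 \<subseteq> Z \<and> Z \<subseteq> Lam (30 * n) 0 \<and>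
    ecount (Z - M - Pl) (- (M \<union> Pl \<union> Z)) \<le> 4 * (real (card (loc n h \<inter> (Lam (21 * n) 0 - Lam (20 * n) 0))) / real n)"
proof -
  define L where "L j = loc n h \<inter> Lam (20 * n + j) 0" for j
  have "\<exists>j<n. real n * real (card (L (Suc j) - L j)) \<le> real (card (L n - L 0))"
  proof (rule best_layer)
    show "finite (L j)" for j by (simp add: L_def)
    show "L j \<subseteq> L (Suc j)" for j by (auto simp: L_def Lam_def)
  qed (rule n)
  then obtain j where j: "j < n" "real n * real (card (L (Suc j) - L j)) \<le> real (card (L n - L 0))" by blast
  have e: "L n - L 0 = loc n h \<inter> (Lam (21 * n) 0 - Lam (20 * n) 0)" by (auto simp: L_def)
  have "ecount (Lam (20 * n + j) 0 - M - Pl) (- (M \<union> Pl \<union> Lam (20 * n + j) 0)) \<le> 4 * real (card (L (Suc j) - L j))"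
  proof (rule gap_cut_le)
    show "Lam (20 * n + j) 0 \<subseteq> Lam (29 * n) 0" using j by (auto simp: Lam_def)
    show "finite (L (Suc j) - L j)" by (simp add: L_def)
    fix u v assume u: "u \<in> Lam (20 * n + j) 0 \<inter> D" and v: "v \<in> D - Lam (20 * n + j) 0" and a: "adj u v"
    have "sdist v u \<le> 1" using adj_sdist[OF a] by (simp add: sdist_sym)
    then have v1: "v \<in> Lam (20 * n + Suc j) 0" using u sdist_triangle[of v 0 u] by (auto simp: Lam_def)
    have "v \<in> loc n h" using v v1 j by (intro frozen_gap_loc) (auto simp: Lam_def)
    then show "v \<in> L (Suc j) - L j" using v v1 by (auto simp: L_def)
  qed
  also have "\<dots> \<le> 4 * (real (card (L n - L 0)) / real n)" using card_le_layer[OF j(2) n] by simp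
  finally show ?thesis unfolding e using j n by (intro exI[of _ "Lam (20 * n + j) 0"]) (auto simp: Lam_def)
qed

text \<open>Layers of graph distance inside the gap set, starting from
  \<open>Lam (10 * n) 0\<close>. A layer that left \<open>Lam (12 * n) 0\<close> would give a walk
  of fewer than K n steps over distance n, which is a \<open>short\<close> event; hence about K n
  layers share one annulus.\<close>

lemma cut_near:
  assumes good: "\<And>z. z \<in> cell n ` Lam (11 * n) 0 \<Longrightarrow> \<not> short K n (snap n z) h"
    and m: "m \<ge> 1" "real m \<le> K * real n"
  shows "\<exists>Z. Lam n 0 \<subseteq> Z \<and> Z \<subseteq> Lam (30 * n) 0 \<and>
    ecount (Z - M - Pl) (- (M \<union> Pl \<union> Z)) \<le> 4 * (real (card (loc n h \<inter> (Lam (12 * n) 0 - Lam (10 * n) 0))) / real m)"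
proof -
  \<comment> \<open>The set grows only through sites of \<open>D\<close>, one graph step at a time,
    so a cut edge ending in \<open>D\<close> always lands in the next layer.\<close>
  define L where "L j = ((\<lambda>Z. Z \<union> {v \<in> D. \<exists>u\<in>Z \<inter> D. adj u v}) ^^ j) (Lam (10 * n) 0)" for j :: nat
  have L0: "L 0 = Lam (10 * n) 0" and LS: "L (Suc j) = L j \<union> {v \<in> D. \<exists>u\<in>L j \<inter> D. adj u v}" for j
    by (simp_all add: L_def)
  have L0L: "L 0 \<subseteq> L j" for j by (induction j) (auto simp: LS)
  have fD: "finite D" by (simp add: D_def)
  have fL: "finite (L j)" for j by (induction j) (use fD in \<open>auto simp: LS L0\<close>)
  have main: "L j \<subseteq> Lam (12 * n) 0 \<and> (\<forall>v\<in>L j - L 0. \<exists>g k. k < j \<and> walk (loc n h) g k \<and> sdist (g 0) 0 \<le> int (10 * n + 1) \<and> g k = v)"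
    if "j \<le> m" for j
    using that
  proof (induction j)
    case 0 then show ?case by (auto simp: L0 Lam_def)
  next
    case (Suc j)
    then have IH: "L j \<subseteq> Lam (12 * n) 0" "\<And>v. v \<in> L j - L 0 \<Longrightarrow> \<exists>g k. k < j \<and> walk (loc n h) g k \<and> sdist (g 0) 0 \<le> int (10 * n + 1) \<and> g k = v"
      by auto
    have new: "v \<in> Lam (12 * n) 0 \<and> (\<exists>g k. k < Suc j \<and> walk (loc n h) g k \<and> sdist (g 0) 0 \<le> int (10 * n + 1) \<and> g k = v)"
      if v: "v \<in> D" "v \<notin> L 0" and u: "u \<in> L j" "u \<in> D" and a: "adj u v" for u v
    proof -
      have vu: "sdist v u \<le> 1" using adj_sdist[OF a] by (simp add: sdist_sym)
      have v13: "sdist v 0 \<le> int (12 * n) + 1" using u(1) IH(1) vu sdist_triangle[of v 0 u] by (auto simp: Lam_def)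
      have vl: "v \<in> loc n h" using v v13 n by (intro frozen_gap_loc) (auto simp: L0 Lam_def)
      have "\<exists>g k. k < Suc j \<and> walk (loc n h) g k \<and> sdist (g 0) 0 \<le> int (10 * n + 1) \<and> g k = v"
      proof (cases "u \<in> L 0")
        case True
        then have "sdist v 0 \<le> int (10 * n + 1)" using vu sdist_triangle[of v 0 u] by (auto simp: L0 Lam_def)
        then show ?thesis using vl by (intro exI[of _ "\<lambda>_. v"] exI[of _ 0]) (simp add: walk_def)
      next
        case False
        then obtain g k where g: "k < j" "walk (loc n h) g k" "sdist (g 0) 0 \<le> int (10 * n + 1)" "g k = u" using IH(2) u(1) by blast
        let ?g = "g(Suc k := v)"
        have "walk (loc n h) ?g (Suc k)" using g(2,4) vl a by (auto simp: walk_def less_Suc_eq le_Suc_eq)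
        then show ?thesis using g by (intro exI[of _ ?g] exI[of _ "Suc k"]) simp
      qed
      then obtain g k where g: "k < Suc j" "walk (loc n h) g k" "sdist (g 0) 0 \<le> int (10 * n + 1)" "g k = v" by blast
      have "v \<in> Lam (12 * n) 0"
      proof (rule ccontr)
        assume "v \<notin> Lam (12 * n) 0"
        then have "int (12 * n) + 1 \<le> sdist v 0" by (simp add: Lam_def)
        then have "int n \<le> sdist (g 0) (g k)" using g(3,4) sdist_triangle[of v 0 "g 0"] by (simp add: sdist_sym)
        then have "real n \<le> real_of_int (sdist (g 0) (g k))" by linarith
        then have d: "real n \<le> dst (g 0) (g k)" using sdist_le_dst[of "g 0" "g k"] by linarith
        have "real k < K * real n" using g(1) Suc.prems m(2) by linarith
        then have "short K n (snap n (cell n (g 0))) h" by (rule short_of_walk[OF n g(2) d])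
        moreover have "g 0 \<in> Lam (11 * n) 0" using g(3) n by (simp add: Lam_def)
        ultimately show False using good by blast
      qed
      then show ?thesis using g by blast
    qed
    show ?case
    proof (intro conjI ballI)
      show "L (Suc j) \<subseteq> Lam (12 * n) 0"
      proof
        fix v assume v: "v \<in> L (Suc j)"
        show "v \<in> Lam (12 * n) 0"
        proof (cases "v \<in> L j")
          case True then show ?thesis using IH(1) by blast
        next
          case False
          then have "v \<notin> L 0" using L0L by blast
          moreover obtain u where "v \<in> D" "u \<in> L j" "u \<in> D" "adj u v" using v False unfolding LS by blast
          ultimately show ?thesis using new by blast
        qed
      qed
      fix v assume v: "v \<in> L (Suc j) - L 0"
      show "\<exists>g k. k < Suc j \<and> walk (loc n h) g k \<and> sdist (g 0) 0 \<le> int (10 * n + 1) \<and> g k = v"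
      proof (cases "v \<in> L j")
        case True
        then have "\<exists>g k. k < j \<and> walk (loc n h) g k \<and> sdist (g 0) 0 \<le> int (10 * n + 1) \<and> g k = v" using IH(2) v by blast
        then show ?thesis using less_SucI by blast
      next
        case False
        then obtain u where "v \<in> D" "u \<in> L j" "u \<in> D" "adj u v" using v unfolding LS by blast
        then show ?thesis using new v by blast
      qed
    qed
  qed
  have "\<exists>j<m. real m * real (card (L (Suc j) - L j)) \<le> real (card (L m - L 0))"
    by (rule best_layer[OF fL _ m(1)]) (auto simp: LS)
  then obtain j where j: "j < m" "real m * real (card (L (Suc j) - L j)) \<le> real (card (L m - L 0))" by blast
  have Lj: "L j \<subseteq> Lam (12 * n) 0" using main[of j] j(1) by simp
  have "ecount (L j - M - Pl) (- (M \<union> Pl \<union> L j)) \<le> 4 * real (card (L (Suc j) - L j))"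
  proof (rule gap_cut_le)
    show "L j \<subseteq> Lam (29 * n) 0" using Lj by (auto simp: Lam_def)
    show "finite (L (Suc j) - L j)" using fL by simp
    show "v \<in> L (Suc j) - L j" if "u \<in> L j \<inter> D" "v \<in> D - L j" "adj u v" for u v using that unfolding LS by blast
  qed
  also have "\<dots> \<le> 4 * (real (card (L m - L 0)) / real m)" using card_le_layer[OF j(2) m(1)] by simp
  also have "\<dots> \<le> 4 * (real (card (loc n h \<inter> (Lam (12 * n) 0 - Lam (10 * n) 0))) / real m)"
  proof -
    have "v \<in> loc n h \<inter> (Lam (12 * n) 0 - Lam (10 * n) 0)" if v: "v \<in> L m - L 0" for v
    proof -
      obtain g k where "walk (loc n h) g k" "g k = v" using main[of m] v by blast
      then have "v \<in> loc n h" by (auto simp: walk_def)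
      then show ?thesis using main[of m] v L0 by blast
    qed
    then have "card (L m - L 0) \<le> card (loc n h \<inter> (Lam (12 * n) 0 - Lam (10 * n) 0))" by (intro card_mono) auto
    then show ?thesis by (intro mult_left_mono divide_right_mono) auto
  qed
  finally show ?thesis using Lj L0L[of j] by (intro exI[of _ "L j"]) (auto simp: L0 Lam_def)
qed

end

context gaussian_field
begin

section \<open>Recursion for the one-point function\<close>

definition marginal :: "nat \<Rightarrow> real" where
  "marginal n = pr (\<lambda>h. 0 \<in> loc n h)"

lemma ev_loc: "ev (\<lambda>h. v \<in> loc n h)"
  by (rule local_ev_ev[OF local_ev_loc])

lemma marginal_nonneg: "0 \<le> marginal n"
  by (simp add: marginal_def)

lemma pr_loc: "pr (\<lambda>h. v \<in> loc n h) = marginal n"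
proof -
  have "inj (\<lambda>p::site. p + v)" by (simp add: inj_def)
  from pr_reindex(1)[OF this ev_loc[of 0 n]] show ?thesis
    using loc_translate[of 0 v n] by (simp add: marginal_def)
qed

lemma sum_indicator_card:
  "finite A \<Longrightarrow> (\<Sum>v\<in>A. indicator {h. P v h} h) = ennreal (real (card {v \<in> A. P v h}))"
proof -
  assume A: "finite A"
  have "(\<Sum>v\<in>A. indicator {h. P v h} h) = (\<Sum>v\<in>A. if P v h then 1 else 0 :: ennreal)"
    by (intro sum.cong) (auto simp: indicator_def)
  also have "\<dots> = (\<Sum>v\<in>{v \<in> A. P v h}. 1)" using A by (rule sum.inter_filter[symmetric])
  finally show ?thesis by (simp add: ennreal_of_nat_eq_real_of_nat)
qed

lemma local_fun_sum_indicator: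
  assumes K: "finite K" and E: "\<And>v. v \<in> A \<Longrightarrow> local_ev K (E v)"
  shows "local_fun K (\<lambda>h. \<Sum>v\<in>A. indicator {h. E v h} h)"
proof (rule local_funI[OF K])
  fix h
  have "indicator {h. E v h} h = (indicator {h. E v h} (restrict h K) :: ennreal)" if "v \<in> A" for v
    by (rule local_fun_cong[OF local_ev_fun[OF E[OF that]]]) simp
  then show "(\<Sum>v\<in>A. indicator {h. E v h} h) = (\<Sum>v\<in>A. indicator {h. E v h} (restrict h K) :: ennreal)"
    by (intro sum.cong) auto
next
  show "(\<lambda>h. \<Sum>v\<in>A. indicator {h. E v h} h :: ennreal) \<in> borel_measurable (\<mu>f K)"
    by (rule borel_measurable_sum) (rule local_fun_meas[OF local_ev_fun[OF E]])
qed

lemma nn_integral_sum_indicator: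
  assumes E: "\<And>v. v \<in> A \<Longrightarrow> ev (E v)"
  shows "(\<integral>\<^sup>+ h. (\<Sum>v\<in>A. indicator {h. E v h} h) \<partial>\<mu>) = ennreal (\<Sum>v\<in>A. pr (E v))"
    and "(\<lambda>h. \<Sum>v\<in>A. indicator {h. E v h} h :: ennreal) \<in> borel_measurable \<mu>"
proof -
  have m: "(indicator {h. E v h} :: _ \<Rightarrow> ennreal) \<in> borel_measurable \<mu>" if "v \<in> A" for v
    using E[OF that] by (simp add: ev_def)
  show "(\<lambda>h. \<Sum>v\<in>A. indicator {h. E v h} h :: ennreal) \<in> borel_measurable \<mu>"
    by (rule borel_measurable_sum) (rule m)
  have "(\<integral>\<^sup>+ h. (\<Sum>v\<in>A. indicator {h. E v h} h) \<partial>\<mu>) = (\<Sum>v\<in>A. \<integral>\<^sup>+ h. indicator {h. E v h} h \<partial>\<mu>)"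
    by (rule nn_integral_sum) (rule m)
  also have "\<dots> = (\<Sum>v\<in>A. ennreal (pr (E v)))" by (intro sum.cong refl nn_integral_indicator_pr E)
  also have "\<dots> = ennreal (\<Sum>v\<in>A. pr (E v))" by (rule sum_ennreal) simp
  finally show "(\<integral>\<^sup>+ h. (\<Sum>v\<in>A. indicator {h. E v h} h) \<partial>\<mu>) = ennreal (\<Sum>v\<in>A. pr (E v))" .
qed

text \<open>Where no cell is short the near cut gains 1/K. Otherwise the far cut is used, and its
  annulus is chosen outside the sites that decide \<open>bad\<close>, so independence supplies a
  factor \<open>pr bad\<close>. The scale 31n appears because \<open>Lam (30 * n) 0\<close> lies
  inside \<open>Lam (31 * n) v\<close> for each \<open>v\<close> in the shifted box.\<close>

lemma marginal_recursion:
  assumes n: "n \<ge> 1" and K: "K \<ge> 1"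
    and bad_def: "\<And>h. bad h \<longleftrightarrow> (\<exists>z\<in>cell n ` Lam (11 * n) 0. short K n (snap n z) h)"
  shows "marginal (31 * n) \<le> 10000 / eps * (1 / K + pr bad) * marginal n"
proof -
  define V where "V = Lam n 0"
  define W where "W = Lam (30 * n) 0"
  define A1 where "A1 = Lam (12 * n) 0 - Lam (10 * n) 0"
  define A2 where "A2 = Lam (21 * n) 0 - Lam (20 * n) 0"
  define m where "m = nat \<lfloor>K * real n\<rfloor>"
  have fin: "finite V" "finite W" "finite A1" "finite A2" by (simp_all add: V_def W_def A1_def A2_def)
  have VW: "V \<subseteq> W" unfolding V_def W_def by (auto simp: Lam_def)
  have V0: "V \<noteq> {}" unfolding V_def using self_Lam by blast
  have n0: "0 < real n" using n by simp
  have Kn: "1 \<le> K * real n" using K n mult_mono[of 1 K 1 "real n"] by simp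
  have m1: "m \<ge> 1" "real m \<le> K * real n" "K * real n / 2 \<le> real m"
  proof -
    have m0: "real m = of_int \<lfloor>K * real n\<rfloor>" "1 \<le> \<lfloor>K * real n\<rfloor>" using Kn by (simp_all add: m_def)
    then show "m \<ge> 1" "real m \<le> K * real n" by linarith+
    have "1 \<le> real m" "K * real n - 1 \<le> real m" using m0 by linarith+
    then show "K * real n / 2 \<le> real m" by linarith
  qed
  have badfun: "bad = (\<lambda>h. \<exists>z\<in>cell n ` Lam (11 * n) 0. short K n (snap n z) h)" by (rule ext) (rule bad_def)
  have fbox: "finite (cell n ` Lam (11 * n) 0)" by simp
  have locbad: "local_ev (Lam (16 * n) 0) bad"
    unfolding badfun
  proof (rule local_ev_Bex[OF fbox])
    fix z assume "z \<in> cell n ` Lam (11 * n) 0"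
    then obtain v where v: "v \<in> Lam (11 * n) 0" "z = cell n v" by blast
    have "sdist (snap n z) 0 \<le> int (12 * n)"
      using v snap_cell[OF n, of v] sdist_triangle[of "snap n z" 0 v] by (simp add: Lam_def sdist_sym)
    then have "Lam (4 * n) (snap n z) \<subseteq> Lam (16 * n) 0" by (intro Lam_mono) simp
    then show "local_ev (Lam (16 * n) 0) (short K n (snap n z))" by (rule local_ev_mono[OF local_ev_short]) simp
  qed simp
  have evbad: "ev bad" by (rule local_ev_ev[OF locbad])
  \<comment> \<open>\<open>bad\<close> is decided within radius 16n, whereas the box of radius n
    around a site of \<open>A2\<close> stays beyond radius 19n.\<close>
  have pbl: "pr (\<lambda>h. bad h \<and> v \<in> loc n h) = pr bad * marginal n" if "v \<in> A2" for v
  proof -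
    have "Lam (16 * n) 0 \<inter> Lam n v = {}"
    proof (rule ccontr)
      assume "\<not> ?thesis"
      then obtain u where "u \<in> Lam (16 * n) 0" "u \<in> Lam n v" by blast
      then show False using that sdist_triangle[of v 0 u] by (auto simp: A2_def Lam_def sdist_sym)
    qed
    from pr_indep[OF locbad local_ev_loc this] show ?thesis by (simp add: pr_loc)
  qed
  have evbl: "ev (\<lambda>h. bad h \<and> v \<in> loc n h)" for v
  proof -
    let ?U = "Lam (16 * n) 0 \<union> Lam n v"
    have "local_ev ?U (\<lambda>h. bad h \<and> v \<in> loc n h)"
      by (intro local_ev_conj local_ev_mono[OF locbad] local_ev_mono[OF local_ev_loc]) auto
    then show ?thesis by (rule local_ev_ev)
  qed
  \<comment> \<open>A bound for the cut that does not involve the shift; the 8 is 4 divided by the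
    1/2 lost in rounding K n down to \<open>m\<close>.\<close>
  define F :: "(site \<Rightarrow> real) \<Rightarrow> real" where
    "F h = 8 / (K * real n) * real (card {v \<in> A1. v \<in> loc n h}) + 4 / real n * real (card {v \<in> A2. bad h \<and> v \<in> loc n h})" for h
  define g :: "(site \<Rightarrow> real) \<Rightarrow> ennreal" where "g h = (\<Sum>v\<in>V. indicator {h. v \<in> disagree W h} h)" for h
  have inner: "(\<integral>\<^sup>+ s. g (shift_on V s h) \<partial>lborel) \<le> ennreal (2 * F h)" for h
  proof -
    have "g (shift_on V s h) = ennreal (real (card (disagree W (shift_on V s h) \<inter> V)))" for s
    proof -
      have "{v \<in> V. v \<in> disagree W (shift_on V s h)} = disagree W (shift_on V s h) \<inter> V" by blast
      then show ?thesis unfolding g_def using sum_indicator_card[OF fin(1), of "\<lambda>v h. v \<in> disagree W h" "shift_on V s h"] by simp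
    qed
    moreover have "(\<integral>\<^sup>+ s. ennreal (real (card (disagree W (shift_on V s h) \<inter> V))) \<partial>lborel) \<le> ennreal (2 * F h)"
    proof (rule disagreement_integral[OF fin(2) VW])
      fix s1 s2 :: real
      show "\<exists>Z. V \<subseteq> Z \<and> Z \<subseteq> W \<and>
        ecount (Z - minus_set W (shift_on V s2 h) - plus_set W (shift_on V s1 h))
          (- (minus_set W (shift_on V s2 h) \<union> plus_set W (shift_on V s1 h) \<union> Z)) \<le> F h"
      proof (cases "bad h")
        case True
        have "{v \<in> A2. bad h \<and> v \<in> loc n h} = loc n h \<inter> A2" using True by blast
        then have "4 * (real (card (loc n h \<inter> A2)) / real n) \<le> F h" using K by (simp add: F_def)
        then show ?thesis using cut_far[OF n, of s2 h s1] unfolding V_def W_def A2_def by (meson order_trans)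
      next
        case False
        have "{v \<in> A1. v \<in> loc n h} = loc n h \<inter> A1" by blast
        then have "8 / (K * real n) * real (card (loc n h \<inter> A1)) \<le> F h" by (simp add: F_def)
        moreover have "4 * (real (card (loc n h \<inter> A1)) / real m) \<le> 8 / (K * real n) * real (card (loc n h \<inter> A1))"
        proof -
          have "4 / real m \<le> 4 / (K * real n / 2)" using m1 Kn by (intro divide_left_mono) auto
          then have "4 / real m * real (card (loc n h \<inter> A1)) \<le> 4 / (K * real n / 2) * real (card (loc n h \<inter> A1))"
            by (intro mult_right_mono) auto
          then show ?thesis by simp
        qed
        ultimately have "4 * (real (card (loc n h \<inter> A1)) / real m) \<le> F h" by linarith
        moreover have "\<not> short K n (snap n z) h" if "z \<in> cell n ` Lam (11 * n) 0" for z using False that unfolding bad_def by blast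
        ultimately show ?thesis using cut_near[OF n _ m1(1,2), of h s2 s1] unfolding V_def W_def A1_def by (meson order_trans)
      qed
    qed
    ultimately show ?thesis by simp
  qed
  have locg: "local_fun W g" unfolding g_def[abs_def] by (rule local_fun_sum_indicator[OF fin(2)]) (rule local_ev_disagree[OF fin(2)])
  have evd: "ev (\<lambda>h. v \<in> disagree W h)" for v by (rule local_ev_ev[OF local_ev_disagree[OF fin(2)]])
  have "real (card V) * marginal (31 * n) = (\<Sum>v\<in>V. marginal (31 * n))" by simp
  also have "\<dots> \<le> (\<Sum>v\<in>V. pr (\<lambda>h. v \<in> disagree W h))"
  proof (rule sum_mono)
    fix v assume v: "v \<in> V"
    have sub: "Lam (30 * n) 0 \<subseteq> Lam (31 * n) v" using v by (intro Lam_mono) (simp add: V_def Lam_def sdist_sym)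
    have "pr (\<lambda>h. v \<in> loc (31 * n) h) \<le> pr (\<lambda>h. v \<in> disagree W h)"
      unfolding W_def by (rule pr_mono[OF evd[unfolded W_def]], erule loc_in_disagree[OF _ sub]) (use v VW in \<open>auto simp: W_def\<close>)
    then show "marginal (31 * n) \<le> pr (\<lambda>h. v \<in> disagree W h)" by (simp add: pr_loc)
  qed
  finally have lower: "ennreal (real (card V) * marginal (31 * n)) \<le> integral\<^sup>N \<mu> g"
    unfolding g_def[abs_def] nn_integral_sum_indicator(1)[of V "\<lambda>v h. v \<in> disagree W h", OF evd] by (rule ennreal_leI)
  let ?c = "eps * sqrt (2 * pi / real (card V))"
  let ?B = "16 / (K * real n) * (real (card A1) * marginal n) + 8 / real n * (real (card A2) * (pr bad * marginal n))"
  have "ennreal (?c * (real (card V) * marginal (31 * n))) = ennreal ?c * ennreal (real (card V) * marginal (31 * n))"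
    using eps_pos by (intro ennreal_mult) (auto simp: marginal_nonneg)
  also have "\<dots> \<le> ennreal ?c * integral\<^sup>N \<mu> g" by (rule mult_left_mono[OF lower]) simp
  also have "\<dots> \<le> (\<integral>\<^sup>+ h. (\<integral>\<^sup>+ s. g (shift_on V s h) \<partial>lborel) \<partial>\<mu>)" by (rule line_average[OF locg VW V0])
  also have "\<dots> \<le> (\<integral>\<^sup>+ h. ennreal (2 * F h) \<partial>\<mu>)" by (intro nn_integral_mono inner)
  also have "\<dots> = (\<integral>\<^sup>+ h. ennreal (16 / (K * real n)) * (\<Sum>v\<in>A1. indicator {h. v \<in> loc n h} h)
      + ennreal (8 / real n) * (\<Sum>v\<in>A2. indicator {h. bad h \<and> v \<in> loc n h} h) \<partial>\<mu>)"
  proof (rule nn_integral_cong)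
    fix h
    have "ennreal (2 * F h) = ennreal (16 / (K * real n) * real (card {v \<in> A1. v \<in> loc n h}) + 8 / real n * real (card {v \<in> A2. bad h \<and> v \<in> loc n h}))"
      by (simp add: F_def algebra_simps)
    also have "\<dots> = ennreal (16 / (K * real n)) * ennreal (real (card {v \<in> A1. v \<in> loc n h})) + ennreal (8 / real n) * ennreal (real (card {v \<in> A2. bad h \<and> v \<in> loc n h}))"
      using K by (intro ennreal_lincomb) auto
    finally show "ennreal (2 * F h) = ennreal (16 / (K * real n)) * (\<Sum>v\<in>A1. indicator {h. v \<in> loc n h} h)
      + ennreal (8 / real n) * (\<Sum>v\<in>A2. indicator {h. bad h \<and> v \<in> loc n h} h)"
      using sum_indicator_card[OF fin(3), of "\<lambda>v h. v \<in> loc n h" h] sum_indicator_card[OF fin(4), of "\<lambda>v h. bad h \<and> v \<in> loc n h" h] by simp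
  qed
  also have "\<dots> = ennreal (16 / (K * real n)) * ennreal (\<Sum>v\<in>A1. pr (\<lambda>h. v \<in> loc n h)) + ennreal (8 / real n) * ennreal (\<Sum>v\<in>A2. pr (\<lambda>h. bad h \<and> v \<in> loc n h))"
  proof -
    note m1 = nn_integral_sum_indicator[of A1 "\<lambda>v h. v \<in> loc n h", OF ev_loc]
    note m2 = nn_integral_sum_indicator[of A2 "\<lambda>v h. bad h \<and> v \<in> loc n h", OF evbl]
    show ?thesis
      by (subst nn_integral_add) (use m1(2) m2(2) in \<open>simp_all add: nn_integral_cmult m1(1) m2(1) borel_measurable_times_ennreal\<close>)
  qed
  also have "\<dots> = ennreal ?B"
  proof -
    have "(\<Sum>v\<in>A1. pr (\<lambda>h. v \<in> loc n h)) = real (card A1) * marginal n" by (simp add: pr_loc)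
    moreover have "(\<Sum>v\<in>A2. pr (\<lambda>h. bad h \<and> v \<in> loc n h)) = real (card A2) * (pr bad * marginal n)" by (simp add: pbl)
    ultimately show ?thesis using K marginal_nonneg[of n] ennreal_lincomb[of "16 / (K * real n)" "real (card A1) * marginal n" "8 / real n" "real (card A2) * (pr bad * marginal n)"] by simp
  qed
  finally have "ennreal (?c * (real (card V) * marginal (31 * n))) \<le> ennreal ?B" .
  moreover have "0 \<le> ?B" using K marginal_nonneg[of n] by simp
  ultimately have main: "?c * (real (card V) * marginal (31 * n)) \<le> ?B" by (simp only: ennreal_le_iff)
  have cV: "real (card V) = (2 * real n + 1)\<^sup>2" by (simp add: V_def card_Lam)
  \<comment> \<open>The critical scaling: volume n^2 times the Gaussian factor 1/n leaves eps * n,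
    which is matched on the right by annulus volume n^2 divided by n layers. Only 1/K and
    \<open>pr bad\<close> remain as gain.\<close>
  have c2: "2 * (eps * real n) \<le> ?c * real (card V)"
  proof -
    have "sqrt (2 * pi / real (card V)) = sqrt (2 * pi) / (2 * real n + 1)" unfolding cV real_sqrt_divide by simp
    then have "?c * real (card V) = eps * (sqrt (2 * pi) * (2 * real n + 1))" unfolding cV by (simp add: power2_eq_square)
    moreover have "1 * (2 * real n) \<le> sqrt (2 * pi) * (2 * real n + 1)"
      using pi_ge_two by (intro mult_mono) (auto simp: real_le_rsqrt)
    ultimately show ?thesis using eps_pos by simp
  qed
  have cA: "real (card A1) \<le> 625 * (real n)\<^sup>2" "real (card A2) \<le> 1849 * (real n)\<^sup>2"
  proof -
    have "card A1 \<le> card (Lam (12 * n) 0)" unfolding A1_def by (intro card_mono) auto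
    also have "\<dots> \<le> (25 * n)\<^sup>2" unfolding card_Lam using n by (intro power_mono) auto
    finally have "real (card A1) \<le> real ((25 * n)\<^sup>2)" by (simp only: of_nat_le_iff)
    then show "real (card A1) \<le> 625 * (real n)\<^sup>2" by (simp add: power_mult_distrib)
    have "card A2 \<le> card (Lam (21 * n) 0)" unfolding A2_def by (intro card_mono) auto
    also have "\<dots> \<le> (43 * n)\<^sup>2" unfolding card_Lam using n by (intro power_mono) auto
    finally have "real (card A2) \<le> real ((43 * n)\<^sup>2)" by (simp only: of_nat_le_iff)
    then show "real (card A2) \<le> 1849 * (real n)\<^sup>2" by (simp add: power_mult_distrib)
  qed
  have "2 * (eps * real n) * marginal (31 * n) \<le> ?c * real (card V) * marginal (31 * n)" by (rule mult_right_mono[OF c2 marginal_nonneg])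
  also have "\<dots> \<le> ?B" using main by (simp only: mult.assoc)
  also have "\<dots> \<le> 16 / (K * real n) * ((625 * (real n)\<^sup>2) * marginal n) + 8 / real n * ((1849 * (real n)\<^sup>2) * (pr bad * marginal n))"
    using K cA marginal_nonneg[of n] by (intro add_mono mult_left_mono mult_right_mono) auto
  also have "\<dots> = real n * marginal n * (10000 * (1 / K) + 14792 * pr bad)"
    using n0 K by (simp add: field_simps power2_eq_square)
  also have "\<dots> \<le> real n * marginal n * (20000 * (1 / K + pr bad))"
  proof (rule mult_left_mono)
    have "0 \<le> 1 / K" using K by simp
    moreover have "10000 * a + 14792 * b \<le> 20000 * (a + b)" if "0 \<le> a" "0 \<le> b" for a b :: real
      using that unfolding distrib_left by (intro add_mono mult_right_mono) auto
    ultimately show "10000 * (1 / K) + 14792 * pr bad \<le> 20000 * (1 / K + pr bad)" using pr_nonneg by blast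
  qed (simp add: marginal_nonneg)
  finally have "real n * (2 * eps * marginal (31 * n)) \<le> real n * (20000 * (1 / K + pr bad) * marginal n)" by (simp add: mult_ac)
  then have "2 * eps * marginal (31 * n) \<le> 20000 * (1 / K + pr bad) * marginal n" using n0 by (simp only: mult_le_cancel_left_pos)
  moreover have "2 * (x * y) = 2 * y * x" "2 * (10000 * (x * y)) = 20000 * x * y" for x y :: real by simp_all
  ultimately have "2 * (marginal (31 * n) * eps) \<le> 2 * (10000 * ((1 / K + pr bad) * marginal n))" by metis
  then have "marginal (31 * n) * eps \<le> 10000 * ((1 / K + pr bad) * marginal n)" by (rule mult_left_le_imp_le) simp
  then have "marginal (31 * n) \<le> 10000 * ((1 / K + pr bad) * marginal n) / eps" by (simp only: pos_le_divide_eq[OF eps_pos])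
  then show ?thesis by (simp only: times_divide_eq_left mult.assoc)
qed

theorem marginal_decay: assumes "\<eta> > 0" shows "\<exists>n0. \<forall>n\<ge>n0. marginal (31 * n) \<le> \<eta> * marginal n"
proof -
  \<comment> \<open>\<open>1 / K\<close> and \<open>pr ?bad\<close> may each be as large as
    \<open>?e\<close>, since 10000 / eps * 2 \<open>?e\<close> = \<eta>; there are at most 24^2 =
    576 cells in \<open>?bad\<close>.\<close>
  let ?e = "\<eta> * eps / 20000"
  have e: "?e > 0" using assms eps_pos by simp
  obtain K where K: "K \<ge> 1 / ?e" "K \<ge> 1" "tortuous K" using tortuous_unbounded by blast
  obtain n0 where n0: "\<And>n. n \<ge> n0 \<Longrightarrow> pr (short K n 0) \<le> ?e / 576"
    using K(3)[unfolded tortuous_def, rule_format, of "?e / 576"] e by auto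
  have "marginal (31 * n) \<le> \<eta> * marginal n" if n: "n \<ge> Suc n0" for n
  proof -
    have n1: "n \<ge> 1" using n by simp
    let ?bad = "\<lambda>h. \<exists>z\<in>cell n ` Lam (11 * n) 0. short K n (snap n z) h"
    have "marginal (31 * n) \<le> 10000 / eps * (1 / K + pr ?bad) * marginal n" by (rule marginal_recursion[OF n1 K(2)]) simp
    also have "\<dots> \<le> \<eta> * marginal n"
    proof (rule mult_right_mono[OF _ marginal_nonneg])
      have ps: "pr (short K n x) \<le> ?e / 576" for x using pr_short_le[of K n x] n0[of n] n by linarith
      have "pr ?bad \<le> (\<Sum>z\<in>cell n ` Lam (11 * n) 0. pr (short K n (snap n z)))"
        by (rule pr_Bex_le) (simp, rule local_ev_ev[OF local_ev_short])
      also have "\<dots> \<le> real (card (cell n ` Lam (11 * n) 0)) * (?e / 576)" by (rule sum_bounded_above) (rule ps)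
      also have "\<dots> \<le> 576 * (?e / 576)"
      proof (rule mult_right_mono)
        have "2 * real (11 * n) / real n + 2 = 24" using n1 by simp
        then show "real (card (cell n ` Lam (11 * n) 0)) \<le> 576" using card_cell_Lam(2)[OF n1, of "11 * n" 0] by simp
      qed (use e in simp)
      finally have "pr ?bad \<le> ?e" by simp
      moreover have "1 / K \<le> ?e" using K(1,2) e by (simp add: field_simps)
      ultimately have "10000 / eps * (1 / K + pr ?bad) \<le> 10000 / eps * (?e + ?e)" using eps_pos by (intro mult_left_mono) auto
      then show "10000 / eps * (1 / K + pr ?bad) \<le> \<eta>" using eps_pos by simp
    qed
    finally show ?thesis .
  qed
  then show ?thesis by blast
qed

end

section \<open>The Hamiltonian and the theorem\<close>

abbreviation minus_spins :: "nat \<Rightarrow> (site \<Rightarrow> real) \<Rightarrow> site set" where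
  "minus_spins N \<sigma> \<equiv> {v \<in> Lambda N. \<sigma> v = -1}"

lemma Lambda_eq: "Lambda N = Lam N 0"
  by (auto simp: Lambda_def Lam_def sdist_def)

lemma finite_Lambda [simp]: "finite (Lambda N)"
  by (simp add: Lambda_eq)

lemma sum_sign_diff:
  fixes f :: "'a \<Rightarrow> real"
  assumes "finite S" "\<And>x. x \<in> S \<Longrightarrow> f x = 1 - 2 * of_bool (P x)"
  shows "sum f S = real (card S) - 2 * real (card {x \<in> S. P x})"
proof -
  have "sum f S = (\<Sum>x\<in>S. 1 - 2 * of_bool (P x))" using assms(2) by (intro sum.cong) auto
  also have "\<dots> = real (card S) - 2 * (\<Sum>x\<in>S. of_bool (P x))" by (simp add: sum_subtractf sum_distrib_left)
  also have "(\<Sum>x\<in>S. of_bool (P x) :: real) = real (card {x \<in> S. P x})"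
    using assms(1) by (simp add: Int_def)
  finally show ?thesis .
qed

text \<open>Each pair of unequal spins lowers the pair sum by 2, each minus spin lowers its boundary
  terms by 2 and its field term by 2 h. As the outside carries plus spins, interior and boundary
  edges enter \<open>per\<close> alike, and the Hamiltonian is twice the energy up to a
  constant.\<close>

lemma hamiltonian_energy:
  assumes \<sigma>: "\<sigma> \<in> configs N"
  shows "H N 1 h \<sigma> = 2 * energy h (minus_spins N \<sigma>)
    - (real (card {e. \<exists>u v. e = {u, v} \<and> u \<in> Lambda N \<and> v \<in> Lambda N \<and> adj u v})
       + real (card {(u, v). u \<in> Lambda N \<and> v \<in> bdry (Lambda N) \<and> adj u v}) + sum h (Lambda N))"
proof -
  let ?\<Lambda> = "Lambda N" and ?A = "minus_spins N \<sigma>"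
  let ?E = "{e. \<exists>u v. e = {u, v} \<and> u \<in> ?\<Lambda> \<and> v \<in> ?\<Lambda> \<and> adj u v}"
  let ?B = "{(u, v). u \<in> ?\<Lambda> \<and> v \<in> bdry ?\<Lambda> \<and> adj u v}"
  let ?I = "{(u, v). adj u v \<and> u \<in> ?A \<and> v \<in> ?\<Lambda> - ?A}" and ?O = "{(u, v). adj u v \<and> u \<in> ?A \<and> v \<notin> ?\<Lambda>}"
  have s: "\<sigma> v = 1 - 2 * of_bool (v \<in> ?A)" if "v \<in> ?\<Lambda>" for v
    using \<sigma> that by (cases "\<sigma> v = -1") (auto simp: configs_def)
  have fE: "finite ?E" by (rule finite_subset[of _ "Pow ?\<Lambda>"]) auto
  have ft: "finite (\<Union>u\<in>?\<Lambda>. (\<lambda>v. (u, v)) ` {v. adj u v})" using finite_nbrs by auto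
  have fB: "finite ?B" and fI: "finite ?I" and fO: "finite ?O" by (rule finite_subset[OF _ ft]; auto)+
  have 1: "(\<Sum>e\<in>?E. \<Prod>u\<in>e. \<sigma> u) = real (card ?E) - 2 * real (card ?I)"
  proof -
    let ?P = "\<lambda>e. \<exists>u v. e = {u, v} \<and> (u, v) \<in> ?I"
    have "(\<Sum>e\<in>?E. \<Prod>u\<in>e. \<sigma> u) = real (card ?E) - 2 * real (card {e \<in> ?E. ?P e})"
    proof (rule sum_sign_diff[OF fE])
      fix e assume "e \<in> ?E"
      then obtain u v where e: "e = {u, v}" "u \<in> ?\<Lambda>" "v \<in> ?\<Lambda>" "adj u v" by blast
      have "u \<noteq> v" using e(4) adj_irrefl by blast
      then have "(\<Prod>u\<in>e. \<sigma> u) = \<sigma> u * \<sigma> v" by (simp add: e(1))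
      moreover have "?P e \<longleftrightarrow> (u \<in> ?A) \<noteq> (v \<in> ?A)"
      proof
        assume "?P e"
        then show "(u \<in> ?A) \<noteq> (v \<in> ?A)" unfolding e(1) doubleton_eq_iff by blast
      next
        assume ne: "(u \<in> ?A) \<noteq> (v \<in> ?A)"
        have "adj v u" using e(4) adj_sym by blast
        show "?P e"
        proof (cases "u \<in> ?A")
          case True
          then have "(u, v) \<in> ?I" using ne e by blast
          then show ?thesis using e(1) by blast
        next
          case False
          then have "(v, u) \<in> ?I" using ne e \<open>adj v u\<close> by blast
          moreover have "e = {v, u}" using e(1) by blast
          ultimately show ?thesis by blast
        qed
      qed
      ultimately show "(\<Prod>u\<in>e. \<sigma> u) = 1 - 2 * of_bool (?P e)" 
        unfolding s[OF e(2)] s[OF e(3)] by (cases "u \<in> ?A"; cases "v \<in> ?A") (simp_all del: mem_Collect_eq)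
    qed
    moreover have "card {e \<in> ?E. ?P e} = card ?I"
    proof -
      have "{e \<in> ?E. ?P e} = (\<lambda>(u, v). {u, v}) ` ?I" by (auto simp: image_iff) blast+
      moreover have "inj_on (\<lambda>(u, v). {u, v}) ?I" by (auto simp: inj_on_def doubleton_eq_iff)
      ultimately show ?thesis by (simp only: card_image)
    qed
    ultimately show ?thesis by simp
  qed
  have 2: "(\<Sum>p\<in>?B. \<sigma> (fst p)) = real (card ?B) - 2 * real (card ?O)"
  proof -
    have "(\<Sum>p\<in>?B. \<sigma> (fst p)) = real (card ?B) - 2 * real (card {p \<in> ?B. fst p \<in> ?A})"
    proof (rule sum_sign_diff[OF fB])
      fix p assume "p \<in> ?B"
      then have "fst p \<in> ?\<Lambda>" by auto
      then show "\<sigma> (fst p) = 1 - 2 * of_bool (fst p \<in> ?A)" by (rule s)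
    qed
    moreover have "{p \<in> ?B. fst p \<in> ?A} = ?O" by (auto simp: bdry_def)
    ultimately show ?thesis by simp
  qed
  have 3: "(\<Sum>u\<in>?\<Lambda>. \<sigma> u * h u) = sum h ?\<Lambda> - 2 * sum h ?A"
  proof -
    have "(\<Sum>u\<in>?\<Lambda>. \<sigma> u * h u) = (\<Sum>u\<in>?\<Lambda>. h u - 2 * (if \<sigma> u = -1 then h u else 0))"
    proof (intro sum.cong refl)
      fix u assume "u \<in> ?\<Lambda>"
      then have "\<sigma> u = 1 \<or> \<sigma> u = -1" using \<sigma> by (simp add: configs_def)
      then show "\<sigma> u * h u = h u - 2 * (if \<sigma> u = -1 then h u else 0)" by auto
    qed
    also have "\<dots> = sum h ?\<Lambda> - 2 * (\<Sum>u\<in>?\<Lambda>. if \<sigma> u = -1 then h u else 0)" by (simp add: sum_subtractf sum_distrib_left)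
    finally show ?thesis by (simp add: sum.inter_filter)
  qed
  have 4: "per ?A = real (card ?I) + real (card ?O)"
  proof -
    have "{(u, v). adj u v \<and> u \<in> ?A \<and> v \<notin> ?A} = ?I \<union> ?O" by auto
    moreover have "card (?I \<union> ?O) = card ?I + card ?O" using fI fO by (intro card_Un_disjoint) auto
    ultimately show ?thesis by (simp add: per_def)
  qed
  show ?thesis unfolding H_def 1 2 3 energy_def 4 by simp
qed

lemma ground_state_plus:
  assumes "is_ground_state N 1 h \<sigma>"
  shows "is_min (Lambda N) h (minus_spins N \<sigma>)"
  unfolding is_min_def
proof (intro conjI allI impI)
  fix A assume A: "A \<subseteq> Lambda N"
  let ?\<tau> = "\<lambda>v. if v \<in> A then -1 else if v \<in> Lambda N then 1 else 0 :: real"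
  have \<tau>: "?\<tau> \<in> configs N" using A by (auto simp: configs_def)
  have eA: "minus_spins N ?\<tau> = A" using A by auto
  have "H N 1 h \<sigma> \<le> H N 1 h ?\<tau>" "\<sigma> \<in> configs N" using assms \<tau> by (auto simp: is_ground_state_def)
  then show "energy h (minus_spins N \<sigma>) \<le> energy h A"
    using hamiltonian_energy[of \<sigma> N h] hamiltonian_energy[OF \<tau>, of h] unfolding eA by linarith
qed auto

lemma hamiltonian_flip: "H N (-1) h \<sigma> = H N 1 (\<lambda>v. - h v) (\<lambda>v. - \<sigma> v)"
proof -
  have "(\<Prod>u\<in>e. - \<sigma> u) = (\<Prod>u\<in>e. \<sigma> u)" if eE: "e \<in> {e. \<exists>u v. e = {u, v} \<and> u \<in> Lambda N \<and> v \<in> Lambda N \<and> adj u v}" for e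
  proof -
    obtain u v where e: "e = {u, v}" "adj u v" using eE by blast
    then have "u \<noteq> v" using adj_irrefl by blast
    then show ?thesis by (simp add: e(1))
  qed
  then show ?thesis unfolding H_def by (simp add: sum_negf cong: sum.cong_simp)
qed

lemma ground_state_minus:
  assumes g: "is_ground_state N (-1) h \<sigma>"
  shows "is_min (Lambda N) (\<lambda>v. - h v) {v \<in> Lambda N. \<sigma> v = 1}"
proof -
  have c: "(\<lambda>v. - \<tau> v) \<in> configs N" if "\<tau> \<in> configs N" for \<tau> using that by (auto simp: configs_def)
  have gs: "is_ground_state N 1 (\<lambda>v. - h v) (\<lambda>v. - \<sigma> v)"
    unfolding is_ground_state_def
  proof (intro conjI ballI)
    show "(\<lambda>v. - \<sigma> v) \<in> configs N" using g c by (auto simp: is_ground_state_def)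
    fix \<tau> assume "\<tau> \<in> configs N"
    then have "H N (-1) h \<sigma> \<le> H N (-1) h (\<lambda>v. - \<tau> v)" using g c by (auto simp: is_ground_state_def)
    then show "H N 1 (\<lambda>v. - h v) (\<lambda>v. - \<sigma> v) \<le> H N 1 (\<lambda>v. - h v) \<tau>" unfolding hamiltonian_flip by simp
  qed
  have "minus_spins N (\<lambda>v. - \<sigma> v) = {v \<in> Lambda N. \<sigma> v = 1}" by simp
  then show ?thesis using ground_state_plus[OF gs] by (simp only:)
qed

context gaussian_field
begin

section \<open>Almost sure uniqueness of the ground states\<close>

lemma local_ev_tie:
  assumes U: "finite U" and A: "A \<subseteq> U" "B \<subseteq> U"
  shows "local_ev U (\<lambda>h. energy (\<lambda>v. s * h v) A = energy (\<lambda>v. s * h v) B)"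
  unfolding local_ev_def
proof (intro conjI allI U)
  have r: "energy (\<lambda>v. s * h v) C = energy (\<lambda>v. s * restrict h U v) C" if "C \<subseteq> U" for h C
    unfolding energy_def using that by (intro arg_cong2[of _ _ _ _ "(+)"] sum.cong) auto
  show "(energy (\<lambda>v. s * h v) A = energy (\<lambda>v. s * h v) B) = (energy (\<lambda>v. s * restrict h U v) A = energy (\<lambda>v. s * restrict h U v) B)" for h
    using r[OF A(1), of h] r[OF A(2), of h] by simp
  have e: "(\<lambda>h. energy (\<lambda>v. s * h v) C) \<in> borel_measurable (\<mu>f U)" if "C \<subseteq> U" for C
  proof -
    have "(\<lambda>h. h v) \<in> borel_measurable (\<mu>f U)" if "v \<in> C" for v
      using measurable_component_singleton[of v U "\<lambda>_. gauss eps"] that \<open>C \<subseteq> U\<close>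
      by (auto simp: measurable_cong_sets[OF refl sets_gauss])
    then show ?thesis unfolding energy_def by (intro borel_measurable_add borel_measurable_const borel_measurable_sum borel_measurable_times)
  qed
  show "{h \<in> space (\<mu>f U). energy (\<lambda>v. s * h v) A = energy (\<lambda>v. s * h v) B} \<in> sets (\<mu>f U)"
    by (rule borel_measurable_eq[OF e[OF A(1)] e[OF A(2)]])
qed

text \<open>Moving the field at \<open>v\<close> alone changes the energy of \<open>A\<close> with
  slope \<open>s\<close> and leaves that of \<open>B\<close> fixed, so each such line contains
  exactly one tie. \<open>line_average\<close> for \<open>{v}\<close> turns length zero on every
  line into probability zero.\<close>

lemma pr_tie:
  assumes U: "finite U" and A: "A \<subseteq> U" "B \<subseteq> U" and v: "v \<in> A" "v \<notin> B" and s: "s \<noteq> 0"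
  shows "pr (\<lambda>h. energy (\<lambda>v. s * h v) A = energy (\<lambda>v. s * h v) B) = 0"
proof -
  let ?E = "\<lambda>h. energy (\<lambda>v. s * h v) A = energy (\<lambda>v. s * h v) B"
  have fA: "finite A" "finite B" using U A finite_subset by auto
  have loc: "local_ev U ?E" by (rule local_ev_tie[OF U A])
  have "ennreal (eps * sqrt (2 * pi / real (card {v}))) * (\<integral>\<^sup>+ h. indicator {h. ?E h} h \<partial>\<mu>)
      \<le> (\<integral>\<^sup>+ h. (\<integral>\<^sup>+ t. indicator {h. ?E h} (shift_on {v} t h) \<partial>lborel) \<partial>\<mu>)"
    by (rule line_average[OF local_ev_fun[OF loc]]) (use v A in auto)
  also have "\<dots> = (\<integral>\<^sup>+ h. 0 \<partial>\<mu>)"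
  proof (rule nn_integral_cong)
    fix h :: "site \<Rightarrow> real"
    have eA: "energy (\<lambda>w. s * shift_on {v} t h w) A = energy (\<lambda>w. s * h w) A + s * t" for t
    proof -
      have "(\<Sum>w\<in>A. s * shift_on {v} t h w) = (\<Sum>w\<in>A. s * h w + (if w = v then s * t else 0))"
        by (intro sum.cong) (auto simp: shift_on_def distrib_left)
      then show ?thesis using v fA by (simp add: energy_def sum.distrib)
    qed
    have eB: "energy (\<lambda>w. s * shift_on {v} t h w) B = energy (\<lambda>w. s * h w) B" for t
    proof -
      have "(\<Sum>w\<in>B. s * shift_on {v} t h w) = (\<Sum>w\<in>B. s * h w)" using v by (intro sum.cong) (auto simp: shift_on_def)
      then show ?thesis by (simp add: energy_def)
    qed
    define t0 where "t0 = (energy (\<lambda>w. s * h w) B - energy (\<lambda>w. s * h w) A) / s"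
    have "(\<integral>\<^sup>+ t. indicator {h. ?E h} (shift_on {v} t h) \<partial>lborel) \<le> (\<integral>\<^sup>+ t. indicator {t0} t \<partial>lborel)"
      using s by (intro nn_integral_mono) (auto simp: indicator_def eA eB t0_def field_simps)
    also have "\<dots> = 0" by simp
    finally show "(\<integral>\<^sup>+ t. indicator {h. ?E h} (shift_on {v} t h) \<partial>lborel) = 0" by simp
  qed
  finally have "ennreal (eps * sqrt (2 * pi)) * ennreal (pr ?E) = 0"
    unfolding nn_integral_indicator_pr[OF local_ev_ev[OF loc]] by simp
  moreover have "eps * sqrt (2 * pi) > 0" using eps_pos by simp
  ultimately have "ennreal (pr ?E) = 0" by (simp add: ennreal_eq_0_iff)
  then show ?thesis using pr_nonneg[of ?E] by (simp add: ennreal_eq_0_iff)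
qed

text \<open>Off the ties, which are null, both ground states are unique and hence described by
  \<open>minus_set\<close> and \<open>plus_set\<close>. These are disjoint, so the spins at the
  origin can only differ with plus for the plus boundary and minus for the minus boundary.\<close>

lemma ground_states_differ_le:
  "pr (\<lambda>h. \<exists>\<sigma>p \<sigma>m. is_ground_state N 1 h \<sigma>p \<and> is_ground_state N (-1) h \<sigma>m \<and> \<sigma>p (0, 0) \<noteq> \<sigma>m (0, 0))
    \<le> pr (\<lambda>h. 0 \<in> disagree (Lam N 0) h)"
proof -
  let ?\<Lambda> = "Lambda N"
  let ?T = "\<lambda>i h. energy (\<lambda>v. fst i * h v) (fst (snd i)) = energy (\<lambda>v. fst i * h v) (snd (snd i))"
  \<comment> \<open>A sign and two sets, the first not contained in the second: this supplies the
    site that \<open>pr_tie\<close> needs. Two different sets violate inclusion in at least one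
    order.\<close>
  let ?I = "{i \<in> {1, -1 :: real} \<times> Pow ?\<Lambda> \<times> Pow ?\<Lambda>. \<not> fst (snd i) \<subseteq> snd (snd i)}"
  have fI: "finite ?I" by simp
  have evT: "ev (?T i)" if "i \<in> ?I" for i
    using that by (intro local_ev_ev[OF local_ev_tie[of ?\<Lambda>]]) (auto simp: mem_Times_iff)
  have pT: "pr (?T i) = 0" if i: "i \<in> ?I" for i
  proof -
    obtain v where "v \<in> fst (snd i)" "v \<notin> snd (snd i)" using i by blast
    then show ?thesis using i by (intro pr_tie[of ?\<Lambda>]) (auto simp: mem_Times_iff)
  qed
  have evt: "ev (\<lambda>h. \<exists>i\<in>?I. ?T i h)" by (rule ev_Bex[OF fI]) (rule evT)
  have evd: "ev (\<lambda>h. 0 \<in> disagree (Lam N 0) h)" by (rule local_ev_ev[OF local_ev_disagree]) simp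
  have unique: "A = B" if nt: "\<not> (\<exists>i\<in>?I. ?T i h)" and s: "s \<in> {1, -1}"
    and A: "is_min ?\<Lambda> (\<lambda>v. s * h v) A" and B: "is_min ?\<Lambda> (\<lambda>v. s * h v) B" for h s A B
  proof -
    have AB: "A \<subseteq> ?\<Lambda>" "B \<subseteq> ?\<Lambda>" using A B is_min_sub by blast+
    have e: "energy (\<lambda>v. s * h v) A = energy (\<lambda>v. s * h v) B"
      using is_minD[OF A AB(2)] is_minD[OF B AB(1)] by simp
    have sub: "C \<subseteq> C'" if C: "C \<subseteq> ?\<Lambda>" "C' \<subseteq> ?\<Lambda>" "energy (\<lambda>v. s * h v) C = energy (\<lambda>v. s * h v) C'" for C C'
    proof (rule ccontr)
      assume "\<not> C \<subseteq> C'"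
      then have i: "(s, C, C') \<in> ?I" using C(1,2) s by simp
      have "?T (s, C, C') h" using C(3) by simp
      then show False by (rule notE[OF nt bexI[OF _ i]])
    qed
    show ?thesis using sub[OF AB e] sub[OF AB(2,1) e[symmetric]] by (rule equalityI)
  qed
  have "0 \<in> disagree (Lam N 0) h \<or> (\<exists>i\<in>?I. ?T i h)"
    if g: "is_ground_state N 1 h \<sigma>p" "is_ground_state N (-1) h \<sigma>m" "\<sigma>p (0, 0) \<noteq> \<sigma>m (0, 0)" for h \<sigma>p \<sigma>m
  proof (rule ccontr)
    assume no: "\<not> ?thesis"
    then have nt: "\<not> (\<exists>i\<in>?I. ?T i h)" by blast
    have m: "minus_set ?\<Lambda> h = minus_spins N \<sigma>p"
      by (rule unique[OF nt, of 1]) (use is_min_minus_set[of ?\<Lambda> h] ground_state_plus[OF g(1)] in simp_all)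
    have p: "plus_set ?\<Lambda> h = {v \<in> ?\<Lambda>. \<sigma>m v = 1}"
      by (rule unique[OF nt, of "-1"]) (use is_min_plus_set[of ?\<Lambda> h] ground_state_minus[OF g(2)] in simp_all)
    have z: "(0, 0) \<in> ?\<Lambda>" by (simp add: Lambda_def)
    have v: "\<sigma>p (0, 0) = 1 \<or> \<sigma>p (0, 0) = -1" "\<sigma>m (0, 0) = 1 \<or> \<sigma>m (0, 0) = -1"
      using g z by (auto simp: is_ground_state_def configs_def)
    have "minus_set ?\<Lambda> h \<inter> plus_set ?\<Lambda> h = {}" by (rule minus_plus_disjoint) simp
    then have "\<sigma>p (0, 0) = 1" "\<sigma>m (0, 0) = -1" using v g(3) z unfolding m p by auto
    then have "(0, 0) \<in> disagree ?\<Lambda> h" using z by (simp add: disagree_def m p)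
    then show False using no by (simp add: Lambda_eq zero_prod_def)
  qed
  then have "pr (\<lambda>h. \<exists>\<sigma>p \<sigma>m. is_ground_state N 1 h \<sigma>p \<and> is_ground_state N (-1) h \<sigma>m \<and> \<sigma>p (0, 0) \<noteq> \<sigma>m (0, 0))
    \<le> pr (\<lambda>h. 0 \<in> disagree (Lam N 0) h \<or> (\<exists>i\<in>?I. ?T i h))"
    by (intro pr_mono ev_disj evd evt) blast
  also have "\<dots> \<le> pr (\<lambda>h. 0 \<in> disagree (Lam N 0) h) + pr (\<lambda>h. \<exists>i\<in>?I. ?T i h)" by (rule pr_disj_le[OF evd evt])
  also have "pr (\<lambda>h. \<exists>i\<in>?I. ?T i h) \<le> (\<Sum>i\<in>?I. pr (?T i))" by (rule pr_Bex_le[OF fI]) (rule evT)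
  also have "\<dots> = 0" by (rule sum.neutral) (use pT in blast)
  finally show ?thesis by simp
qed

text \<open>31^2 = 961 and 1922 = 2 * 961, so each multiplication of the scale by 31 at least halves
  n^2 times the marginal. The square is the number of sites in a block, over which
  \<open>disagree_geometric\<close> takes a union.\<close>

lemma small_scale:
  assumes "\<tau> > 0" shows "\<exists>n\<ge>1. (2 * real n + 1)\<^sup>2 * marginal n \<le> \<tau>"
proof -
  obtain n1 where n1: "\<And>n. n \<ge> n1 \<Longrightarrow> marginal (31 * n) \<le> 1 / 1922 * marginal n" using marginal_decay[of "1 / 1922"] by auto
  define b where "b = Suc n1"
  have bb: "n1 \<le> 31 ^ i * b" "1 \<le> 31 ^ i * b" for i
  proof -
    have "1 * b \<le> 31 ^ i * b" by (intro mult_right_mono) auto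
    then show "n1 \<le> 31 ^ i * b" "1 \<le> 31 ^ i * b" by (simp_all add: b_def)
  qed
  have dec: "marginal (31 ^ i * b) \<le> (1 / 1922) ^ i" for i
  proof (induction i)
    case 0 then show ?case by (simp add: marginal_def)
  next
    case (Suc i)
    have "marginal (31 ^ Suc i * b) \<le> 1 / 1922 * marginal (31 ^ i * b)" using n1[OF bb(1)[of i]] by (simp add: mult.assoc)
    also have "\<dots> \<le> 1 / 1922 * (1 / 1922) ^ i" using Suc by simp
    finally show ?case by simp
  qed
  obtain i where i: "(1 / 2 :: real) ^ i < \<tau> / (9 * (real b)\<^sup>2)"
    using real_arch_pow_inv[of "\<tau> / (9 * (real b)\<^sup>2)" "1 / 2"] assms by (auto simp: b_def)
  let ?n = "31 ^ i * b"
  have "(2 * real ?n + 1)\<^sup>2 * marginal ?n \<le> (3 * real ?n)\<^sup>2 * (1 / 1922) ^ i"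
  proof (intro mult_mono dec power_mono)
    have "real 1 \<le> real ?n" using bb(2)[of i] by (rule of_nat_mono)
    then show "2 * real ?n + 1 \<le> 3 * real ?n" by linarith
  qed (auto simp: marginal_nonneg)
  also have "\<dots> = 9 * (real b)\<^sup>2 * (961 ^ i * (1 / 1922) ^ i)"
  proof -
    have "(31 ^ i)\<^sup>2 = ((31 :: real)\<^sup>2) ^ i" by (simp only: power_mult[symmetric] mult.commute)
    then show ?thesis by (simp add: power_mult_distrib)
  qed
  also have "961 ^ i * (1 / 1922) ^ i = (1 / 2 :: real) ^ i" unfolding power_mult_distrib[symmetric] by simp
  also have "9 * (real b)\<^sup>2 * (1 / 2) ^ i \<le> \<tau>"
  proof -
    have "0 < 9 * (real b)\<^sup>2" by (simp add: b_def)
    then show ?thesis using i by (simp add: pos_less_divide_eq mult.commute)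
  qed
  finally show ?thesis using bb(2)[of i] by blast
qed

text \<open>Disagreement at the origin gives a path to the boundary of the box. Every cell on its
  chain of cells contains local disagreement at the fixed scale \<open>n\<close>, which is rare by
  \<open>small_scale\<close>, so the Peierls bound applies with all cells of the chain bad.\<close>

lemma disagree_geometric:
  "\<exists>n\<ge>1. \<forall>N J. J \<ge> 1 \<longrightarrow> (J + 1) * (2 * n + 1) + n \<le> N \<longrightarrow> pr (\<lambda>h. 0 \<in> disagree (Lam N 0) h) \<le> (1 / 2) ^ J"
proof -
  obtain \<tau> :: real where \<tau>: "0 < \<tau>" "\<tau> \<le> 1" "98 * \<tau> powr (1 / (2 * real 21 ^ 2)) \<le> 1 / 2" using peierls_constant by blast
  obtain n where n: "n \<ge> 1" "(2 * real n + 1)\<^sup>2 * marginal n \<le> \<tau>" using small_scale[OF \<tau>(1)] by blast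
  have "pr (\<lambda>h. 0 \<in> disagree (Lam N 0) h) \<le> (1 / 2) ^ J" if J: "J \<ge> 1" "(J + 1) * (2 * n + 1) + n \<le> N" for N J
  proof -
    let ?E = "\<lambda>z h. loc n h \<inter> Lam n (snap n z) \<noteq> {}"
    have loc: "local_ev (Lam (10 * n) (snap n z)) (?E z)" for z
    proof (rule local_ev_mono)
      show "local_ev (Lam (n + n) (snap n z)) (?E z)" by (rule local_ev_loc_set)
      show "Lam (n + n) (snap n z) \<subseteq> Lam (10 * n) (snap n z)" by (auto simp: Lam_def)
    qed simp
    have pE: "pr (?E z) \<le> \<tau>" for z
    proof -
      have "pr (?E z) = pr (\<lambda>h. \<exists>v\<in>Lam n (snap n z). v \<in> loc n h)" by (rule arg_cong[of _ _ pr]) blast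
      also have "\<dots> \<le> (\<Sum>v\<in>Lam n (snap n z). pr (\<lambda>h. v \<in> loc n h))" by (rule pr_Bex_le[OF finite_Lam]) (rule ev_loc)
      also have "\<dots> = (2 * real n + 1)\<^sup>2 * marginal n" by (simp add: pr_loc card_Lam)
      finally show ?thesis using n(2) by simp
    qed
    have sep: "Lam (10 * n) (snap n y) \<inter> Lam (10 * n) (snap n y') = {}" if "sdist y y' \<ge> int 21" for y y'
      using Lam_snap_disjoint[OF n(1)] that by simp
    have "\<exists>F. ev F \<and> pr F \<le> real (card {cell n 0}) * (1 / 2) ^ J \<and>
      (\<forall>h z. z 0 \<in> {cell n 0} \<longrightarrow> (\<forall>j. Suc j < J \<longrightarrow> sdist (z j) (z (Suc j)) \<le> 3) \<longrightarrow> inj_on z {..<J} \<longrightarrow>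
         J \<le> 2 * card {j. j < J \<and> ?E (z j) h} \<longrightarrow> F h)"
      by (rule peierls[where E = ?E and k = 21, OF loc _ sep pE \<tau>]) (use J in auto)
    then obtain F where F: "ev F" "pr F \<le> (1 / 2) ^ J"
      "\<And>h z. z 0 = cell n 0 \<Longrightarrow> (\<forall>j. Suc j < J \<longrightarrow> sdist (z j) (z (Suc j)) \<le> 3) \<Longrightarrow> inj_on z {..<J} \<Longrightarrow>
         J \<le> 2 * card {j. j < J \<and> ?E (z j) h} \<Longrightarrow> F h" by auto
    have "F h" if d: "0 \<in> disagree (Lam N 0) h" for h
    proof -
      obtain g k v where g: "walk (disagree (Lam N 0) h) g k" "g 0 = 0" "v \<notin> Lam N 0" "adj (g k) v"
        using disagree_reaches_boundary[OF finite_Lam d] by blast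
      have ad: "adj (g i) (g (Suc i))" if "i < k" for i using g(1) that by (simp add: walk_def)
      \<comment> \<open>The path is stopped at distance N - n, so that the box of radius
        \<open>n\<close> around each of its sites stays inside \<open>Lam N 0\<close> and
        disagreement becomes membership in \<open>loc n h\<close>.\<close>
      let ?far = "\<lambda>i. int (N - n) \<le> sdist (g i) 0"
      have farN: "?far k"
        using g(3) adj_sdist[OF g(4)] sdist_triangle[of v 0 "g k"] J(2) n(1) by (auto simp: Lam_def sdist_sym)
      define k' where "k' = (LEAST i. ?far i)"
      have k': "?far k'" "k' \<le> k" using LeastI[of ?far, OF farN] Least_le[of ?far, OF farN] by (simp_all add: k'_def)
      have near: "sdist (g i) 0 \<le> int (N - n)" if "i \<le> k'" for i
      proof (cases i)
        case 0 then show ?thesis using g(2) by (simp add: sdist_def)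
      next
        case (Suc j)
        then have "sdist (g j) 0 < int (N - n)" using not_less_Least[of j ?far] that by (simp add: k'_def)
        moreover have "sdist (g i) (g j) \<le> 1" using adj_sdist[OF ad[of j]] Suc that k'(2) by (simp add: sdist_sym)
        ultimately show ?thesis using sdist_triangle[of "g i" 0 "g j"] by linarith
      qed
      have inloc: "g i \<in> loc n h" if "i \<le> k'" for i
      proof -
        have "Lam n (g i) \<subseteq> Lam N 0" using near[OF that] J(2) by (intro Lam_mono) simp
        moreover have "g i \<in> disagree (Lam N 0) h" using g(1) that k'(2) by (simp add: walk_def)
        ultimately show ?thesis unfolding loc_def using disagree_antimono[OF finite_Lam _ self_Lam] by blast
      qed
      have ad': "adj (g i) (g (Suc i))" if "i < k'" for i using ad that k'(2) by simp
      obtain J' t where t: "t 0 = 0" "\<And>j. j \<le> J' \<Longrightarrow> t j \<le> k'" "\<And>j. j < J' \<Longrightarrow> t j < t (Suc j)"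
        "\<And>j. j < J' \<Longrightarrow> 2 * real n < dst (g (t j)) (g (t (Suc j)))"
        "\<And>j. j < J' \<Longrightarrow> sdist (cell n (g (t j))) (cell n (g (t (Suc j)))) \<le> 3"
        "inj_on (\<lambda>j. cell n (g (t j))) {..<J'}"
        "dst (g 0) (g k') \<le> real (Suc J') * (2 * real n + 1)"
        by (rule cell_chain[OF n(1), of k' g, OF ad']) auto
      have JJ: "J \<le> J'"
      proof -
        have "real ((J + 1) * (2 * n + 1)) \<le> real (N - n)" using J(2) by (intro of_nat_mono) simp
        also have "\<dots> \<le> real_of_int (sdist (g k') 0)" using k'(1) by linarith
        also have "\<dots> \<le> dst (g 0) (g k')" using sdist_le_dst[of "g k'" 0] g(2) by (simp add: dist_commute)
        also have "\<dots> \<le> real (Suc J') * (2 * real n + 1)" by (rule t(7))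
        also have "\<dots> = real (Suc J' * (2 * n + 1))" by (simp add: algebra_simps)
        finally have "(J + 1) * (2 * n + 1) \<le> Suc J' * (2 * n + 1)" by (simp only: of_nat_le_iff)
        then have "J + 1 \<le> Suc J'" by (simp only: mult_le_cancel2)
        then show ?thesis by simp
      qed
      have hit: "?E (cell n (g (t j))) h" if "j < J" for j
      proof -
        have "g (t j) \<in> loc n h" using inloc t(2)[of j] that JJ by simp
        moreover have "g (t j) \<in> Lam n (snap n (cell n (g (t j))))" using snap_cell[OF n(1), of "g (t j)"] by (simp add: Lam_def)
        ultimately show ?thesis by blast
      qed
      show "F h"
      proof (rule F(3)[of "\<lambda>j. cell n (g (t j))"])
        show "cell n (g (t 0)) = cell n 0" using t(1) g(2) by simp
        show "\<forall>j. Suc j < J \<longrightarrow> sdist (cell n (g (t j))) (cell n (g (t (Suc j)))) \<le> 3" using t(5) JJ by auto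
        show "inj_on (\<lambda>j. cell n (g (t j))) {..<J}" using t(6) JJ by (auto intro: inj_on_subset)
        have "{j. j < J \<and> ?E (cell n (g (t j))) h} = {..<J}" using hit by blast
        then show "J \<le> 2 * card {j. j < J \<and> ?E (cell n (g (t j))) h}" by simp
      qed
    qed
    then have "pr (\<lambda>h. 0 \<in> disagree (Lam N 0) h) \<le> pr F" by (intro pr_mono F(1))
    then show ?thesis using F(2) by linarith
  qed
  then show ?thesis using n(1) by blast
qed

lemma disagree_exponential:
  "\<exists>c>0. \<forall>N. pr (\<lambda>h. 0 \<in> disagree (Lam N 0) h) \<le> 1 / c * exp (- c * real N)"
proof -
  obtain n where n: "n \<ge> 1" and geo: "\<And>N J. J \<ge> 1 \<Longrightarrow> (J + 1) * (2 * n + 1) + n \<le> N \<Longrightarrow> pr (\<lambda>h. 0 \<in> disagree (Lam N 0) h) \<le> (1 / 2) ^ J"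
    using disagree_geometric by blast
  \<comment> \<open>\<open>q\<close> is the length that one cell of the chain may cover. For N < 4q
    the claimed bound is at least 16 * 3/4 > 1; beyond that N <= (J + 3) q, and the 3 lost cells
    cost a factor 8, covered by 1/c >= 16.\<close>
  define q where "q = 2 * n + 1"
  define c where "c = 1 / (16 * real q)"
  have q: "q \<ge> 1" "n \<le> q" by (simp_all add: q_def)
  have c: "c > 0" using q by (simp add: c_def)
  have "pr (\<lambda>h. 0 \<in> disagree (Lam N 0) h) \<le> 1 / c * exp (- c * real N)" for N
  proof (cases "N < 4 * q")
    case True
    then have "real N < 4 * real q" by linarith
    then have "c * real N \<le> 1 / 4" using q by (simp add: c_def field_simps)
    then have "3 / 4 \<le> exp (- c * real N)" using exp_ge_add_one_self[of "- c * real N"] by simp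
    moreover have "16 \<le> 1 / c" using q by (simp add: c_def)
    ultimately have "16 * (3 / 4) \<le> 1 / c * exp (- c * real N)" using c by (intro mult_mono) auto
    then show ?thesis using pr_le_1[of "\<lambda>h. 0 \<in> disagree (Lam N 0) h"] by linarith
  next
    case False
    define J where "J = (N - n) div q - 1"
    have "3 * q \<le> N - n" using False q by simp
    then have d3: "3 \<le> (N - n) div q" using q by (simp add: less_eq_div_iff_mult_less_eq)
    then have J1: "J \<ge> 1" "J + 1 = (N - n) div q" by (simp_all add: J_def)
    have "(J + 1) * q \<le> N - n" unfolding J1(2) by (rule div_times_less_eq_dividend)
    then have p: "pr (\<lambda>h. 0 \<in> disagree (Lam N 0) h) \<le> (1 / 2) ^ J" using False q by (intro geo J1(1)) (simp add: q_def)
    have "N - n < q + (N - n) div q * q" using q by (intro dividend_less_div_times) simp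
    then have "N \<le> (J + 3) * q" unfolding J1(2)[symmetric] using q by (simp add: algebra_simps)
    then have "real N \<le> real ((J + 3) * q)" by (simp only: of_nat_le_iff)
    then have J3: "real N / real q \<le> real (J + 3)" using q by (simp add: field_simps)
    have "(1 / 2 :: real) ^ J = 8 * (1 / 2) ^ (J + 3)" by (simp add: power_add power3_eq_cube)
    also have "\<dots> \<le> 8 * exp (- 1 / 2) ^ (J + 3)"
    proof -
      have "exp (- 1 / 2 :: real) = 1 / exp (1 / 2)" by (simp add: exp_minus[of "1 / 2 :: real", simplified] inverse_eq_divide)
      moreover have "1 / 2 \<le> 1 / exp (1 / 2 :: real)" using exp_half_le2 by (intro divide_left_mono) auto
      ultimately have "(1 / 2 :: real) \<le> exp (- 1 / 2)" by (simp only:)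
      then show ?thesis by (intro mult_left_mono power_mono) auto
    qed
    also have "exp (- 1 / 2 :: real) ^ (J + 3) = exp (real (J + 3) * (- 1 / 2))" by (rule exp_of_nat_mult[symmetric])
    also have "8 * exp (real (J + 3) * (- 1 / 2)) \<le> 1 / c * exp (- c * real N)"
    proof (rule mult_mono)
      show "8 \<le> 1 / c" using q by (simp add: c_def)
      have "c * real N \<le> real N / real q / 2" using q by (simp add: c_def field_simps)
      then show "exp (real (J + 3) * (- 1 / 2)) \<le> exp (- c * real N)" using J3 by simp
    qed (use c in auto)
    finally show ?thesis using p by linarith
  qed
  then show ?thesis using c by blast
qed

end

theorem theorem2p1:
  fixes eps :: real
  assumes "eps > 0"
  shows "\<exists>c>0. \<forall>N::nat. N \<ge> 1 \<longrightarrow>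
    measure (field_law eps)
      {h \<in> space (field_law eps). \<exists>\<sigma>p \<sigma>m. is_ground_state N 1 h \<sigma>p \<and>
          is_ground_state N (-1) h \<sigma>m \<and> \<sigma>p (0, 0) \<noteq> \<sigma>m (0, 0)}
    \<le> (1 / c) * exp (- c * real N)"
proof -
  interpret gaussian_field eps by unfold_locales (rule assms)
  obtain c where c: "c > 0" "\<And>N. pr (\<lambda>h. 0 \<in> disagree (Lam N 0) h) \<le> 1 / c * exp (- c * real N)"
    using disagree_exponential by blast
  have "measure (field_law eps)
      {h \<in> space (field_law eps). \<exists>\<sigma>p \<sigma>m. is_ground_state N 1 h \<sigma>p \<and>
          is_ground_state N (-1) h \<sigma>m \<and> \<sigma>p (0, 0) \<noteq> \<sigma>m (0, 0)} \<le> 1 / c * exp (- c * real N)" for N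
    using ground_states_differ_le[of N] c(2)[of N] by (simp add: pr_def)
  then show ?thesis using c(1) by blast
qed

end
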